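(* Let $K$ be a field of characteristic $p\ge 0$, let $n>0$ be an integer such that $n$ is odd if $p=2$, and let $f_1(X),\ldots,f_s(X)\in K[X]$ be non-associate irreducible separable polynomials with respective roots $\omega_1,\ldots,\omega_s$. Assume there exists a PAC extension $M/K$ such that $M(\omega_i)$ has a separable extension of degree $n$ for every $i=1,\ldots,s$. Then there exists a Zariski dense set of $(a_1,\ldots,a_n)\in K^n$ such that for $g(T)=T^n+a_1T^{n-1}+\cdots+a_n$ all $f_i(g(T))$, $i=1,\ldots,s$, are irreducible in $K[T]$.
   Context: A field extension $M/K$ is called a PAC (pseudo algebraically closed) extension if for every absolutely irreducible $M$-variety $V$ of dimension $r\ge 1$ and for every dominating separable $M$-map $\nu\colon V\to\mathbb{A}^r$ there exists $\mathbf{a}\in V(M)$ such that $\nu(\mathbf{a})\in K^r$. The roots $\omega_i$ are taken in an algebraic closure of $M$ (which contains an algebraic closure of $K$). Non-associate means that no two of the $f_i$ with distinct indices differ by a factor in $K^\times$. A separable extension of degree $n$ of a field $E$ means a separable algebraic field extension $E'/E$ with $[E':E]=n$. A set of points of $K^n$ is Zariski dense if for every nonzero polynomial $q\in K[A_1,\ldots,A_n]$ it contains a point $\mathbf{a}$ with $q(\mathbf{a})\neq 0$. *)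

theory Defs
  imports
    "HOL-Algebra.Algebraic_Closure_Type"
    "HOL-Algebra.Generated_Fields"
    "HOL-Library.Poly_Mapping"
begin

section \<open>Polynomials in finitely many variables\<close>

text \<open>
  A polynomial in the variables \<open>X\<^sub>0, X\<^sub>1, \<dots>\<close> is a finitely supported map from monomials
  (exponent vectors) to coefficients. The ring of polynomials in \<open>N\<close> variables is the subring
  of those that only involve \<open>X\<^sub>0, \<dots>, X\<^bsub>N-1\<^esub>\<close>. Accordingly, a point of affine \<open>N\<close>-space is
  a function on \<open>nat\<close> of which only the values at \<open>0, \<dots>, N-1\<close> are ever used.
\<close>

type_synonym 'a mpoly = "(nat \<Rightarrow>\<^sub>0 nat) \<Rightarrow>\<^sub>0 'a"

definition mpoly_ring :: "nat \<Rightarrow> 'a::comm_ring_1 mpoly ring" where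
  "mpoly_ring N = ring_of_type_algebra
     \<lparr>carrier := {p. \<forall>m\<in>Poly_Mapping.keys p. Poly_Mapping.keys m \<subseteq> {..<N}}\<rparr>"

definition mpoly_const :: "'a::comm_ring_1 \<Rightarrow> 'a mpoly" where
  "mpoly_const c = Poly_Mapping.single 0 c"

text \<open>
  Substitution of \<open>x\<close> for the variables, with \<open>h\<close> applied to the coefficients: once with values
  in a type of class \<open>comm_ring_1\<close>, once with values in a ring given by a record.
\<close>

definition mpoly_eval ::
    "('a::comm_ring_1 \<Rightarrow> 'b::comm_ring_1) \<Rightarrow> (nat \<Rightarrow> 'b) \<Rightarrow> 'a mpoly \<Rightarrow> 'b" where
  "mpoly_eval h x p =
     (\<Sum>m\<in>Poly_Mapping.keys p. h (Poly_Mapping.lookup p m) *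
        (\<Prod>i\<in>Poly_Mapping.keys m. x i ^ Poly_Mapping.lookup m i))"

definition mpoly_eval_in ::
    "('f, 'e) ring_scheme \<Rightarrow> ('a::comm_ring_1 \<Rightarrow> 'f) \<Rightarrow> (nat \<Rightarrow> 'f) \<Rightarrow> 'a mpoly \<Rightarrow> 'f" where
  "mpoly_eval_in F h x p =
     (\<Oplus>\<^bsub>F\<^esub>m\<in>Poly_Mapping.keys p. h (Poly_Mapping.lookup p m) \<otimes>\<^bsub>F\<^esub>
        (\<Otimes>\<^bsub>F\<^esub>i\<in>Poly_Mapping.keys m. x i [^]\<^bsub>F\<^esub> Poly_Mapping.lookup m i))"

definition zariski_dense :: "nat \<Rightarrow> (nat \<Rightarrow> 'k::field) set \<Rightarrow> bool" where
  "zariski_dense n S \<longleftrightarrow>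
     (\<forall>q \<in> carrier (mpoly_ring n). q \<noteq> 0 \<longrightarrow> (\<exists>a\<in>S. mpoly_eval id a q \<noteq> 0))"


section \<open>Separable field extensions\<close>

definition separable_poly :: "'k::field poly \<Rightarrow> bool" where
  "separable_poly p \<longleftrightarrow> coprime p (pderiv p)"

text \<open>
  The same notion for the list polynomials of HOL-Algebra (leading coefficient first), relative
  to a subfield \<open>K\<close> of a field \<open>R\<close>.
\<close>

definition formal_deriv :: "('a, 'b) ring_scheme \<Rightarrow> 'a list \<Rightarrow> 'a list" where
  "formal_deriv R p = ring.normalize R
     (map (\<lambda>i. add_pow R (length p - 1 - i) (p ! i)) [0..<length p - 1])"

definition separable_poly_over :: "('a, 'b) ring_scheme \<Rightarrow> 'a set \<Rightarrow> 'a list \<Rightarrow> bool" where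
  "separable_poly_over R K p \<longleftrightarrow> p \<in> carrier (univ_poly R K) \<and>
     (\<forall>d \<in> carrier (univ_poly R K).
        d divides\<^bsub>univ_poly R K\<^esub> p \<longrightarrow> d divides\<^bsub>univ_poly R K\<^esub> formal_deriv R p \<longrightarrow>
        d \<in> Units (univ_poly R K))"

definition algebraic_over :: "('a, 'b) ring_scheme \<Rightarrow> 'a set \<Rightarrow> 'a \<Rightarrow> bool" where
  "algebraic_over R K x \<longleftrightarrow> x \<in> carrier R \<and> ring.algebraic R K x"

text \<open>\<open>ring.Irr R K x\<close> is the minimal polynomial of \<open>x\<close> over \<open>K\<close>.\<close>

definition separable_ext :: "('a, 'b) ring_scheme \<Rightarrow> 'a set \<Rightarrow> 'a set \<Rightarrow> bool" where
  "separable_ext R K E \<longleftrightarrow> subfield K R \<and> subfield E R \<and> K \<subseteq> E \<and>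
     (\<forall>x\<in>E. algebraic_over R K x \<and> separable_poly_over R K (ring.Irr R K x))"

definition separable_ext_of_degree :: "nat \<Rightarrow> ('a, 'b) ring_scheme \<Rightarrow> 'a set \<Rightarrow> 'a set \<Rightarrow> bool" where
  "separable_ext_of_degree n R K E \<longleftrightarrow> separable_ext R K E \<and> ring.dimension R n K E"

text \<open>
  For a field type \<open>'m\<close>, the fixed algebraic closure \<open>'m alg_closure\<close> as a ring record, and in
  it the subfield generated by \<open>'m\<close> and \<open>x\<close>.
\<close>

definition closure_ring :: "'m::field alg_closure ring" where
  "closure_ring = ring_of_type_algebra"

definition adjoin :: "'m::field alg_closure \<Rightarrow> 'm alg_closure set" where
  "adjoin x = generate_field closure_ring (insert x (range to_ac))"


section \<open>Field of fractions of a domain\<close>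

definition frac_class :: "('a, 'b) ring_scheme \<Rightarrow> 'a \<Rightarrow> 'a \<Rightarrow> ('a \<times> 'a) set" where
  "frac_class D a b = {(c, d). c \<in> carrier D \<and> d \<in> carrier D - {\<zero>\<^bsub>D\<^esub>} \<and>
                              a \<otimes>\<^bsub>D\<^esub> d = c \<otimes>\<^bsub>D\<^esub> b}"

definition frac_field :: "('a, 'b) ring_scheme \<Rightarrow> ('a \<times> 'a) set ring" where
  "frac_field D =
     \<lparr>carrier = {frac_class D a b | a b. a \<in> carrier D \<and> b \<in> carrier D - {\<zero>\<^bsub>D\<^esub>}},
      monoid.mult = (\<lambda>U V. \<Union>(a, b)\<in>U. \<Union>(c, d)\<in>V. frac_class D (a \<otimes>\<^bsub>D\<^esub> c) (b \<otimes>\<^bsub>D\<^esub> d)),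
      one = frac_class D \<one>\<^bsub>D\<^esub> \<one>\<^bsub>D\<^esub>,
      ring.zero = frac_class D \<zero>\<^bsub>D\<^esub> \<one>\<^bsub>D\<^esub>,
      add = (\<lambda>U V. \<Union>(a, b)\<in>U. \<Union>(c, d)\<in>V.
               frac_class D (a \<otimes>\<^bsub>D\<^esub> d \<oplus>\<^bsub>D\<^esub> c \<otimes>\<^bsub>D\<^esub> b) (b \<otimes>\<^bsub>D\<^esub> d))\<rparr>"


section \<open>Affine varieties\<close>

text \<open>
  An affine variety \<open>V \<subseteq> A\<^sup>N\<close> over a field \<open>M\<close> is given by its vanishing ideal
  \<open>P\<close> in \<open>M[X\<^sub>0, \<dots>, X\<^bsub>N-1\<^esub>]\<close>. It is absolutely irreducible if it remains a variety over an
  algebraic closure of \<open>M\<close>, that is, if the extension of \<open>P\<close> stays prime.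
\<close>

definition abs_irreducible_variety :: "nat \<Rightarrow> 'm::field mpoly set \<Rightarrow> bool" where
  "abs_irreducible_variety N P \<longleftrightarrow> primeideal P (mpoly_ring N) \<and>
     primeideal (Idl\<^bsub>mpoly_ring N\<^esub> (Poly_Mapping.map to_ac ` P))
       (mpoly_ring N :: 'm alg_closure mpoly ring)"

definition rational_points :: "'m::field mpoly set \<Rightarrow> (nat \<Rightarrow> 'm) set" where
  "rational_points P = {a. \<forall>p\<in>P. mpoly_eval id a p = 0}"

definition coordinate_ring :: "nat \<Rightarrow> 'm::field mpoly set \<Rightarrow> 'm mpoly set ring" where
  "coordinate_ring N P = mpoly_ring N Quot P"

definition function_field ::
    "nat \<Rightarrow> 'm::field mpoly set \<Rightarrow> ('m mpoly set \<times> 'm mpoly set) set ring" where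
  "function_field N P = frac_field (coordinate_ring N P)"

text \<open>The polynomial function on \<open>V\<close> defined by \<open>p\<close>, as an element of the function field.\<close>

definition poly_function ::
    "nat \<Rightarrow> 'm::field mpoly set \<Rightarrow> 'm mpoly \<Rightarrow> ('m mpoly set \<times> 'm mpoly set) set" where
  "poly_function N P p =
     frac_class (coordinate_ring N P) (P +>\<^bsub>mpoly_ring N\<^esub> p) \<one>\<^bsub>coordinate_ring N P\<^esub>"

definition const_function ::
    "nat \<Rightarrow> 'm::field mpoly set \<Rightarrow> 'm \<Rightarrow> ('m mpoly set \<times> 'm mpoly set) set" where
  "const_function N P c = poly_function N P (mpoly_const c)"

text \<open>
  \<open>V\<close> has dimension \<open>r\<close>: its function field has a transcendence basis of \<open>r\<close> elements over \<open>M\<close>.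
\<close>

definition variety_dim :: "nat \<Rightarrow> 'm::field mpoly set \<Rightarrow> nat \<Rightarrow> bool" where
  "variety_dim N P r \<longleftrightarrow>
     (\<exists>y. (\<forall>j<r. y j \<in> carrier (function_field N P)) \<and>
       (\<forall>q \<in> carrier (mpoly_ring r).
          mpoly_eval_in (function_field N P) (const_function N P) y q
            = \<zero>\<^bsub>function_field N P\<^esub> \<longrightarrow> q = 0) \<and>
       (\<forall>x \<in> carrier (function_field N P).
          algebraic_over (function_field N P)
            (generate_field (function_field N P) (range (const_function N P) \<union> y ` {..<r})) x))"

text \<open>
  An \<open>M\<close>-map from \<open>V\<close> to affine \<open>r\<close>-space is given by polynomials \<open>\<nu> 0, \<dots>, \<nu> (r-1)\<close> over \<open>M\<close>.
  It is dominating if its image lies in no proper Zariski closed subset, and separable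
  if the function field of \<open>V\<close> is a separable extension of \<open>M(\<nu>)\<close>.
\<close>

definition dominating :: "'m::field mpoly set \<Rightarrow> nat \<Rightarrow> (nat \<Rightarrow> 'm mpoly) \<Rightarrow> bool" where
  "dominating P r \<nu> \<longleftrightarrow>
     (\<forall>q \<in> carrier (mpoly_ring r). mpoly_eval mpoly_const \<nu> q \<in> P \<longrightarrow> q = 0)"

definition separable_map ::
    "nat \<Rightarrow> 'm::field mpoly set \<Rightarrow> nat \<Rightarrow> (nat \<Rightarrow> 'm mpoly) \<Rightarrow> bool" where
  "separable_map N P r \<nu> \<longleftrightarrow>
     separable_ext (function_field N P)
       (generate_field (function_field N P)
          (range (const_function N P) \<union> (\<lambda>j. poly_function N P (\<nu> j)) ` {..<r}))
       (carrier (function_field N P))"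


section \<open>PAC extensions\<close>

text \<open>
  A field extension \<open>M/K\<close> is given by two field types and an embedding \<open>\<iota>\<close> of \<open>K\<close> into \<open>M\<close>.
  Considering affine varieties and polynomial maps is no restriction: every variety has a
  nonempty affine open subvariety on which a given rational map is defined, and this subvariety
  has the same function field.
\<close>

definition field_extension :: "('k::field \<Rightarrow> 'm::field) \<Rightarrow> bool" where
  "field_extension \<iota> \<longleftrightarrow> \<iota> \<in> ring_hom ring_of_type_algebra ring_of_type_algebra"

definition PAC_extension :: "('k::field \<Rightarrow> 'm::field) \<Rightarrow> bool" where
  "PAC_extension \<iota> \<longleftrightarrow> field_extension \<iota> \<and>
     (\<forall>N P r \<nu>. abs_irreducible_variety N P \<and> r \<ge> 1 \<and> variety_dim N P r \<and>
        (\<forall>j<r. \<nu> j \<in> carrier (mpoly_ring N)) \<and> dominating P r \<nu> \<and> separable_map N P r \<nu> \<longrightarrow>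
        (\<exists>a \<in> rational_points P. \<forall>j<r. mpoly_eval id a (\<nu> j) \<in> range \<iota>))"


section \<open>The polynomial g\<close>

text \<open>\<open>T\<^sup>n + a\<^sub>1 T\<^bsup>n-1\<^esup> + \<dots> + a\<^sub>n\<close>, where \<open>a\<^bsub>j+1\<^esub>\<close> is \<open>a j\<close>.\<close>

definition monic_poly :: "nat \<Rightarrow> (nat \<Rightarrow> 'k::field) \<Rightarrow> 'k poly" where
  "monic_poly n a = Polynomial.monom 1 n + (\<Sum>j<n. Polynomial.monom (a j) (n - 1 - j))"

end

theory Submission
  imports Defs "HOL-Computational_Algebra.Computational_Algebra" "HOL-Combinatorics.Cycles"
begin

text \<open>Let \<open>M'\<close> be the algebraic closure of \<open>M\<close>. A separable extension of degree \<open>n\<close> of \<open>M(\<omega>\<^sub>i)\<close> has the form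
  \<open>M(\<theta>\<^sub>i)\<close> with \<open>\<theta>\<^sub>i\<close> separable over \<open>M\<close> (\<open>sep_ext_primitive\<close>). After a shift by elements of \<open>M\<close> the
  conjugacy classes of the \<open>\<theta>\<^sub>i\<close> are disjoint, so that the product \<open>\<mu>\<close> of their minimal polynomials is
  separable, and there is one polynomial \<open>w\<close> over \<open>M\<close> with \<open>w(\<theta>\<^sub>i) = \<omega>\<^sub>i\<close> for all \<open>i\<close>. It is \<open>n\<close>-to-one on the
  set of roots of \<open>\<mu>\<close> (\<open>common_covering\<close>); here it enters that the \<open>f\<^sub>i\<close> are not associate, so that the
  \<open>\<omega>\<^sub>i\<close> are not conjugate.

  Suppose \<open>a\<close> is in \<open>K\<^sup>n\<close> and \<open>x\<close> generates the algebra \<open>M[T]/(\<mu>)\<close> and satisfies \<open>g(x) = w\<close>, where \<open>g\<close> is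
  the monic polynomial with coefficients \<open>a\<close>. Then \<open>t = x(\<theta>\<^sub>i)\<close> generates \<open>M(\<theta>\<^sub>i)\<close> over \<open>M(\<omega>\<^sub>i)\<close>, and
  \<open>g(t) = \<omega>\<^sub>i\<close>. Thus \<open>1, t, \<dots>, t\<^sup>n\<^sup>-\<^sup>1\<close> are linearly independent over \<open>M(\<omega>\<^sub>i)\<close>, all the more over
  \<open>K(\<omega>\<^sub>i)\<close>. It follows that \<open>t\<close>, a root of \<open>f\<^sub>i(g(T))\<close>, has degree \<open>n deg f\<^sub>i\<close> over \<open>K\<close>, and that this polynomial
  is irreducible (\<open>irreducible_pcompose\<close>).

  Such \<open>a\<close> and \<open>x\<close>, with the additional property \<open>q(a) \<noteq> 0\<close> for a given \<open>q \<noteq> 0\<close>, are found by the PAC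
  property (\<open>prescribed_fibres\<close>). The pairs \<open>(a, x)\<close> with \<open>x\<close> an element of \<open>M'[T]/(\<mu>)\<close> form a variety defined
  over \<open>M\<close>, and the projection to \<open>a\<close> is finite and separable over a dense open set. An element \<open>x\<close> is given by
  its values at the roots \<open>\<theta>\<close> of \<open>\<mu>\<close>, and the conditions say that the values over the fibre of \<open>w\<close> at \<open>c\<close> are the
  \<open>n\<close> distinct roots of \<open>g - c\<close>. So the variety is absolutely irreducible provided that for the generic
  polynomial \<open>g\<close> and finitely many constants \<open>c\<close> the Galois group of \<open>\<Prod>(g - c)\<close> permutes the roots of the
  factors independently and arbitrarily.

  It is enough to obtain all transpositions that exchange two roots of a single factor and fix all other roots.
  They arise when two roots of \<open>g - c\<close> collide (\<open>collision_point\<close>): near \<open>g = (T - b)\<^sup>2 q(T) + c\<close> the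
  two roots close to \<open>b\<close> are exchanged by monodromy, while all other roots of all factors are simple
  (\<open>generic_separable\<close>) and stay fixed. For \<open>n = 2\<close> this fails in characteristic 2, where \<open>n\<close> is assumed
  to be odd. No Galois theory is used: a generic point has a set of reorderings
  that preserve its algebraic relations (\<open>generic_point_swaps\<close>), and a normal form for polynomials in
  the roots (\<open>normal_form_exists\<close>, \<open>vanishing_normal_form\<close>) shows that the obvious relations generate all others.\<close>

section \<open>Subfields of a field type and their simple extensions\<close>

definition polys_over :: "'a::comm_ring_1 set \<Rightarrow> 'a poly set" where
  "polys_over B = {p. \<forall>i. coeff p i \<in> B}"

locale subring_set =
  fixes B :: "'a::comm_ring_1 set"
  assumes zero [simp, intro]: "0 \<in> B"
    and one [simp, intro]: "1 \<in> B"
    and add [intro]: "x \<in> B \<Longrightarrow> y \<in> B \<Longrightarrow> x + y \<in> B"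
    and mult [intro]: "x \<in> B \<Longrightarrow> y \<in> B \<Longrightarrow> x * y \<in> B"
    and uminus [intro]: "x \<in> B \<Longrightarrow> - x \<in> B"
begin

lemma diff [intro]: "x \<in> B \<Longrightarrow> y \<in> B \<Longrightarrow> x - y \<in> B"
  using add[OF _ uminus] by fastforce

lemma sum [intro]: "(\<And>i. i \<in> I \<Longrightarrow> f i \<in> B) \<Longrightarrow> sum f I \<in> B"
  by (induction I rule: infinite_finite_induct) auto

lemma prod [intro]: "(\<And>i. i \<in> I \<Longrightarrow> f i \<in> B) \<Longrightarrow> prod f I \<in> B"
  by (induction I rule: infinite_finite_induct) auto

lemma power [intro]: "x \<in> B \<Longrightarrow> x ^ k \<in> B"
  by (induction k) auto

lemma of_nat [intro]: "of_nat k \<in> B"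
  by (induction k) auto

lemma polys_over_subring: "subring_set (polys_over B)"
  by unfold_locales
     (auto simp: polys_over_def coeff_1 coeff_mult intro!: sum)

lemma pCons_polys_over [intro]: "c \<in> B \<Longrightarrow> p \<in> polys_over B \<Longrightarrow> pCons c p \<in> polys_over B"
  by (auto simp: polys_over_def coeff_pCons split: nat.splits)

lemma pCons_polys_over_iff: "pCons c p \<in> polys_over B \<longleftrightarrow> c \<in> B \<and> p \<in> polys_over B"
proof
  assume *: "pCons c p \<in> polys_over B"
  have "coeff (pCons c p) 0 \<in> B" "\<And>i. coeff (pCons c p) (Suc i) \<in> B"
    using * unfolding polys_over_def by blast+
  then show "c \<in> B \<and> p \<in> polys_over B" by (auto simp: polys_over_def)
qed auto

lemma smult_polys_over [intro]: "c \<in> B \<Longrightarrow> p \<in> polys_over B \<Longrightarrow> smult c p \<in> polys_over B"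
  by (auto simp: polys_over_def)

lemma monom_polys_over [intro]: "c \<in> B \<Longrightarrow> monom c k \<in> polys_over B"
  by (auto simp: polys_over_def)

lemma zero_polys_over [simp, intro]: "0 \<in> polys_over B"
  by (auto simp: polys_over_def)

lemma poly_in [intro]: "p \<in> polys_over B \<Longrightarrow> x \<in> B \<Longrightarrow> poly p x \<in> B"
  by (induction p) (auto simp: pCons_polys_over_iff)

lemma pcompose_polys_over [intro]:
  assumes "p \<in> polys_over B" "q \<in> polys_over B" shows "pcompose p q \<in> polys_over B"
proof -
  interpret P: subring_set "polys_over B" by (rule polys_over_subring)
  show ?thesis using assms by (induction p) (auto simp: pCons_polys_over_iff pcompose_pCons)
qed

lemma synthetic_div_polys_over:
  "p \<in> polys_over B \<Longrightarrow> x \<in> B \<Longrightarrow> synthetic_div p x \<in> polys_over B"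
  by (induction p) (auto simp: pCons_polys_over_iff)

end

lemma polys_over_mono: "B \<subseteq> C \<Longrightarrow> p \<in> polys_over B \<Longrightarrow> p \<in> polys_over C"
  by (auto simp: polys_over_def)

locale subfield_set = subring_set B for B :: "'a::field set" +
  assumes inverse [intro]: "x \<in> B \<Longrightarrow> inverse x \<in> B"
begin

sublocale P: subring_set "polys_over B" by (rule polys_over_subring)

lemma divide [intro]: "x \<in> B \<Longrightarrow> y \<in> B \<Longrightarrow> x / y \<in> B"
  by (auto simp: divide_inverse)

lemma pderiv_polys_over [intro]: "p \<in> polys_over B \<Longrightarrow> pderiv p \<in> polys_over B"
  by (auto simp: polys_over_def coeff_pderiv simp del: of_nat_Suc)

lemma division:
  assumes "p \<in> polys_over B" "q \<in> polys_over B" "q \<noteq> 0"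
  shows "\<exists>a\<in>polys_over B. \<exists>r\<in>polys_over B. p = a * q + r \<and> (r = 0 \<or> degree r < degree q)"
  using assms(1)
proof (induction "degree p" arbitrary: p rule: less_induct)
  case less
  show ?case
  proof (cases "p = 0 \<or> degree p < degree q")
    case True
    then show ?thesis using less.prems by (intro bexI[of _ 0] bexI[of _ p]) auto
  next
    case False
    define c where "c = lead_coeff p / lead_coeff q"
    have c: "c \<in> B" "c \<noteq> 0" using less.prems assms False unfolding c_def polys_over_def by auto
    define t where "t = monom c (degree p - degree q)"
    define p' where "p' = p - t * q"
    have t: "t \<in> polys_over B" using c unfolding t_def by auto
    then have p': "p' \<in> polys_over B" unfolding p'_def using less.prems assms by auto
    have dt: "degree (t * q) = degree p" "lead_coeff (t * q) = lead_coeff p"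
      using False c assms by (auto simp: t_def degree_mult_eq monom_eq_0_iff degree_monom_eq c_def coeff_monom_mult)
    show ?thesis
    proof (cases "p' = 0")
      case True
      then have "p = t * q + 0" by (simp add: p'_def)
      then show ?thesis using t by blast
    next
      case False2: False
      have "degree p' < degree p \<or> degree p = 0"
      proof -
        have "degree p' \<le> degree p" unfolding p'_def using dt degree_diff_le by (metis order_refl)
        moreover have "coeff p' (degree p) = 0" unfolding p'_def using dt by simp
        ultimately show ?thesis using False2 by (metis leading_coeff_0_iff le_neq_implies_less)
      qed
      moreover have "degree p \<noteq> 0"
      proof
        assume 0: "degree p = 0"
        then have "degree p' = 0" unfolding p'_def using dt degree_diff_le by (metis le_zero_eq order_refl)
        moreover have "coeff p' 0 = 0" unfolding p'_def using dt 0 by simp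
        ultimately show False using False2 by (metis leading_coeff_0_iff)
      qed
      ultimately obtain a r where "a \<in> polys_over B" "r \<in> polys_over B" "p' = a * q + r" "r = 0 \<or> degree r < degree q"
        using less.hyps[OF _ p'] by blast
      then have "p = (a + t) * q + r" by (simp add: p'_def algebra_simps)
      then show ?thesis using \<open>a \<in> _\<close> \<open>r \<in> _\<close> \<open>r = 0 \<or> _\<close> t by blast
    qed
  qed
qed

lemma bezout:
  assumes "p \<in> polys_over B" "q \<in> polys_over B" "q \<noteq> 0"
  obtains d a b p' q' where "d \<in> polys_over B" "a \<in> polys_over B" "b \<in> polys_over B"
    "d = a * p + b * q" "d \<noteq> 0" "p' \<in> polys_over B" "p = p' * d" "q' \<in> polys_over B" "q = q' * d"
proof -
  define S where "S = {d. d \<noteq> 0 \<and> (\<exists>a\<in>polys_over B. \<exists>b\<in>polys_over B. d = a * p + b * q)}"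
  have S: "0 * p + 1 * q \<in> S" using assms P.zero P.one unfolding S_def by (simp, metis P.zero P.one add_0 mult_1 mult_zero_left)
  define d where "d = arg_min degree (\<lambda>d. d \<in> S)"
  have dS: "d \<in> S" and dmin: "\<And>e. e \<in> S \<Longrightarrow> degree d \<le> degree e"
    unfolding d_def using arg_min_nat_lemma[of "\<lambda>d. d \<in> S", OF S] by auto
  obtain a b where ab: "a \<in> polys_over B" "b \<in> polys_over B" "d = a * p + b * q" "d \<noteq> 0"
    using dS unfolding S_def by blast
  have dB: "d \<in> polys_over B" using ab assms by auto
  have dvd: "\<exists>e\<in>polys_over B. x * p + y * q = e * d" if xy: "x \<in> polys_over B" "y \<in> polys_over B" for x y
  proof -
    have "x * p + y * q \<in> polys_over B" using that assms by auto
    then obtain e r where er: "e \<in> polys_over B" "r \<in> polys_over B" "x * p + y * q = e * d + r" "r = 0 \<or> degree r < degree d"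
      using division[OF _ dB ab(4)] by blast
    have "r = (x - e * a) * p + (y - e * b) * q" using er(3) ab(3) by (simp add: algebra_simps)
    moreover have "x - e * a \<in> polys_over B" "y - e * b \<in> polys_over B" using that er ab by auto
    ultimately have "r \<noteq> 0 \<Longrightarrow> r \<in> S" unfolding S_def by blast
    then have "r = 0" using er(4) dmin by (meson not_le)
    then show ?thesis using er by auto
  qed
  show ?thesis using dvd[OF P.one P.zero] dvd[OF P.zero P.one] that[OF dB ab(1-4)] by auto
qed

end

definition algebraic_elt :: "'a::field set \<Rightarrow> 'a \<Rightarrow> bool" where
  "algebraic_elt B x \<longleftrightarrow> (\<exists>p\<in>polys_over B. p \<noteq> 0 \<and> poly p x = 0)"

text \<open>Characterised by generating, over \<open>B\<close>, the ideal of polynomials that vanish at \<open>x\<close>.\<close>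

definition min_poly :: "'a::field set \<Rightarrow> 'a \<Rightarrow> 'a poly" where
  "min_poly B x = (SOME m. m \<in> polys_over B \<and> lead_coeff m = 1 \<and> poly m x = 0 \<and>
     (\<forall>p\<in>polys_over B. poly p x = 0 \<longrightarrow> (\<exists>q\<in>polys_over B. p = q * m)))"

text \<open>This is \<open>B[x]\<close>. For algebraic \<open>x\<close> it is the field \<open>B(x)\<close>.\<close>

definition simple_ext :: "'a::field set \<Rightarrow> 'a \<Rightarrow> 'a set" where
  "simple_ext B x = {poly p x | p. p \<in> polys_over B}"

context subfield_set
begin

lemma min_poly:
  assumes "algebraic_elt B x"
  shows min_poly_over: "min_poly B x \<in> polys_over B"
    and min_poly_monic: "lead_coeff (min_poly B x) = 1"
    and min_poly_root: "poly (min_poly B x) x = 0"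
    and min_poly_dvd_ex: "\<And>p. p \<in> polys_over B \<Longrightarrow> poly p x = 0 \<Longrightarrow> \<exists>q\<in>polys_over B. p = q * min_poly B x"
proof -
  define S where "S = {p\<in>polys_over B. p \<noteq> 0 \<and> poly p x = 0}"
  obtain p0 where p0: "p0 \<in> S" using assms by (auto simp: S_def algebraic_elt_def)
  define d where "d = arg_min degree (\<lambda>d. d \<in> S)"
  have dS: "d \<in> S" and dmin: "\<And>e. e \<in> S \<Longrightarrow> degree d \<le> degree e"
    unfolding d_def using arg_min_nat_lemma[of "\<lambda>d. d \<in> S", OF p0] by auto
  define m where "m = smult (inverse (lead_coeff d)) d"
  have d0: "d \<noteq> 0" using dS by (auto simp: S_def)
  have m: "m \<in> polys_over B" "lead_coeff m = 1" "poly m x = 0" "m \<noteq> 0" "degree m = degree d"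
    using dS by (auto simp: S_def m_def polys_over_def)
  have "\<exists>q\<in>polys_over B. p = q * m" if p: "p \<in> polys_over B" "poly p x = 0" for p
  proof -
    obtain q r where qr: "q \<in> polys_over B" "r \<in> polys_over B" "p = q * m + r" "r = 0 \<or> degree r < degree m"
      using division[OF p(1) m(1) m(4)] by blast
    have "poly r x = 0" using qr(3) p(2) m(3) by simp
    then have "r \<noteq> 0 \<Longrightarrow> degree d \<le> degree r" using qr(2) dmin[of r] by (auto simp: S_def)
    then have "r = 0" using qr(4) m(5) by (metis not_le)
    then show ?thesis using qr by auto
  qed
  then have ex: "\<exists>m. m \<in> polys_over B \<and> lead_coeff m = 1 \<and> poly m x = 0 \<and>
     (\<forall>p\<in>polys_over B. poly p x = 0 \<longrightarrow> (\<exists>q\<in>polys_over B. p = q * m))" using m by blast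
  from someI_ex[OF ex]
  show "min_poly B x \<in> polys_over B" "lead_coeff (min_poly B x) = 1" "poly (min_poly B x) x = 0"
    "\<And>p. p \<in> polys_over B \<Longrightarrow> poly p x = 0 \<Longrightarrow> \<exists>q\<in>polys_over B. p = q * min_poly B x"
    unfolding min_poly_def[symmetric] by blast+
qed

lemma min_poly_dvd:
  "algebraic_elt B x \<Longrightarrow> p \<in> polys_over B \<Longrightarrow> poly p x = 0 \<Longrightarrow> min_poly B x dvd p"
  using min_poly_dvd_ex by fastforce

lemma min_poly_degree:
  assumes "algebraic_elt B x" shows "degree (min_poly B x) > 0"
proof (rule ccontr)
  assume "\<not> degree (min_poly B x) > 0"
  then have "min_poly B x = [:1:]" using min_poly_monic[OF assms]
    by (metis degree_eq_zeroE gr0I lead_coeff_pCons(2))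
  then show False using min_poly_root[OF assms] by simp
qed

lemma subset_simple_ext: "B \<subseteq> simple_ext B x"
proof
  fix b assume "b \<in> B"
  then have "[:b:] \<in> polys_over B" by auto
  then show "b \<in> simple_ext B x" unfolding simple_ext_def by force
qed

lemma gen_in_simple_ext: "x \<in> simple_ext B x"
proof -
  have "[:0,1:] \<in> polys_over B" by auto
  then show "x \<in> simple_ext B x" unfolding simple_ext_def by force
qed

lemma simple_ext_inverse:
  assumes x: "algebraic_elt B x" and p: "p \<in> polys_over B"
  shows "inverse (poly p x) \<in> simple_ext B x"
proof (cases "poly p x = 0")
  case True
  then show ?thesis using subset_simple_ext by auto
next
  case False
  define m where "m = min_poly B x"
  note m = min_poly[OF x, folded m_def]
  have m0: "m \<noteq> 0" using m(2) by auto
  obtain d a b p' m' where d: "d \<in> polys_over B" "a \<in> polys_over B" "b \<in> polys_over B"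
    "d = a * p + b * m" "d \<noteq> 0" "p' \<in> polys_over B" "p = p' * d" "m' \<in> polys_over B" "m = m' * d"
    using bezout[OF p m(1) m0] by metis
  have "poly d x \<noteq> 0" using d(7) False by auto
  then have "poly m' x = 0" using d(9) m(3) by auto
  then obtain e where e: "m' = e * m" using m(4)[OF d(8)] by blast
  then have "e * d = 1" using d(9) m0 by auto
  then have "degree d = 0" by (metis is_unit_iff_degree d(5) dvd_triv_right)
  then obtain c where c: "d = [:c:]" by (rule degree_eq_zeroE)
  have cB: "c \<in> B" using d(1) unfolding c by (auto simp: pCons_polys_over_iff)
  have c0: "c \<noteq> 0" using d(5) c by auto
  have "poly a x * poly p x = c" using arg_cong[OF d(4), of "\<lambda>q. poly q x"] c m(3) by simp
  then have "inverse (poly p x) = poly (smult (inverse c) a) x"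
    using False c0 by (metis mult.assoc mult.commute nonzero_eq_divide_eq divide_inverse poly_smult right_inverse mult.right_neutral)
  moreover have "smult (inverse c) a \<in> polys_over B" using smult_polys_over[OF inverse[OF cB] d(2)] .
  ultimately show ?thesis unfolding simple_ext_def by blast
qed

lemma simple_ext_subfield:
  assumes x: "algebraic_elt B x" shows "subfield_set (simple_ext B x)"
proof
  show "0 \<in> simple_ext B x" "1 \<in> simple_ext B x" using subset_simple_ext by auto
  show "inverse y \<in> simple_ext B x" if "y \<in> simple_ext B x" for y
    using that simple_ext_inverse[OF x] by (auto simp: simple_ext_def)
  show "y + z \<in> simple_ext B x" "y * z \<in> simple_ext B x"
    if yz: "y \<in> simple_ext B x" "z \<in> simple_ext B x" for y z
  proof -
    obtain p q where pq: "p \<in> polys_over B" "q \<in> polys_over B" "y = poly p x" "z = poly q x"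
      using yz unfolding simple_ext_def by blast
    have "y + z = poly (p + q) x" "y * z = poly (p * q) x" using pq by auto
    moreover have "p + q \<in> polys_over B" "p * q \<in> polys_over B" using pq by auto
    ultimately show "y + z \<in> simple_ext B x" "y * z \<in> simple_ext B x"
      unfolding simple_ext_def by blast+
  qed
  show "- y \<in> simple_ext B x" if y: "y \<in> simple_ext B x" for y
  proof -
    obtain p where pq: "p \<in> polys_over B" "y = poly p x" using y unfolding simple_ext_def by blast
    have "- y = poly (- p) x" "- p \<in> polys_over B" using pq by auto
    then show ?thesis unfolding simple_ext_def by blast
  qed
qed

lemma simple_ext_minimal:
  assumes "subring_set C" "B \<subseteq> C" "x \<in> C" shows "simple_ext B x \<subseteq> C"
  using subring_set.poly_in[OF assms(1) polys_over_mono[OF assms(2)] assms(3)]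
  by (auto simp: simple_ext_def)

end

lemma algebraic_elt_mono: "B \<subseteq> C \<Longrightarrow> algebraic_elt B x \<Longrightarrow> algebraic_elt C x"
  unfolding algebraic_elt_def using polys_over_mono by blast

section \<open>Separable elements\<close>

lemma monic_degree_1:
  assumes "degree m = 1" "lead_coeff m = 1" shows "m = [:coeff m 0, 1:]"
proof (rule poly_eqI)
  fix i show "coeff m i = coeff [:coeff m 0, 1:] i"
    using assms by (cases "i \<le> 1") (auto simp: coeff_pCons coeff_eq_0 le_Suc_eq split: nat.splits)
qed

lemma degree_prod_mset_linear:
  "degree (\<Prod>x\<in>#A. [:- x, 1 :: 'a::field:]) = size A"
proof (induction A)
  case (add x A)
  have "(\<Prod>x\<in>#A. [:- x, 1 :: 'a:]) \<noteq> 0" by (auto simp: prod_mset_zero_iff)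
  then show ?case using add by (simp add: degree_mult_eq del: mult_pCons_left)
qed auto

locale ac_subfield = subfield_set B for B :: "'a::alg_closed_field set"
begin

text \<open>The norm of \<open>F(x)\<close> lies in the base field. Instead of symmetric functions the proof uses Euclid's
  algorithm for the resultant: \<open>F\<close> may be replaced by its remainder \<open>r\<close> modulo \<open>g = \<Prod>(T - x)\<close>, and
  \<open>\<Prod> r(x)\<close> equals, up to a factor in \<open>B\<close>, the product of the values of \<open>g\<close> at the roots of \<open>r\<close>,
  of which there are fewer.\<close>

lemma prod_roots_in_base:
  fixes A :: "'a multiset"
  assumes "(\<Prod>x\<in>#A. [:-x, 1:]) \<in> polys_over B" "F \<in> polys_over B"
  shows "(\<Prod>x\<in>#A. poly F x) \<in> B"
  using assms
proof (induction "size A" arbitrary: A F rule: less_induct)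
  case less
  define g where "g = (\<Prod>x\<in>#A. [:-x, 1:])"
  have g0: "g \<noteq> 0" by (auto simp: g_def prod_mset_zero_iff)
  have gdeg: "degree g = size A"
    unfolding g_def by (rule degree_prod_mset_linear)
  have groot: "poly g x = 0" if "x \<in># A" for x
    using that by (auto simp: g_def poly_prod_mset prod_mset_zero_iff)
  obtain a r where ar: "a \<in> polys_over B" "r \<in> polys_over B" "F = a * g + r" "r = 0 \<or> degree r < degree g"
    using division[OF less.prems(2) less.prems(1)[folded g_def] g0] by blast
  have Fr: "(\<Prod>x\<in>#A. poly F x) = (\<Prod>x\<in>#A. poly r x)"
    using groot by (intro arg_cong[of _ _ prod_mset] image_mset_cong) (auto simp: ar)
  show ?case
  proof (cases "r = 0")
    case True
    then show ?thesis unfolding Fr by (cases A) auto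
  next
    case False
    then have dr: "degree r < size A" using ar gdeg by auto
    obtain R where R: "size R = degree r" "r = smult (lead_coeff r) (\<Prod>x\<in>#R. [:-x, 1:])"
      using alg_closed_imp_factorization[OF False] by blast
    have lr: "lead_coeff r \<in> B" using ar by (auto simp: polys_over_def)
    have "smult (inverse (lead_coeff r)) r \<in> polys_over B" using lr ar by auto
    moreover have "smult (inverse (lead_coeff r)) r = (\<Prod>x\<in>#R. [:-x, 1:])"
      by (subst R(2)) (use False in simp)
    ultimately have R': "(\<Prod>x\<in>#R. [:-x, 1:]) \<in> polys_over B" by simp
    have IH: "(\<Prod>y\<in>#R. poly g y) \<in> B"
      using less.hyps[OF _ R', of g] less.prems(1) dr R(1) unfolding g_def by auto
    have rp: "poly r x = lead_coeff r * (\<Prod>y\<in>#R. x - y)" for x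
      by (subst R(2)) (simp add: poly_prod_mset image_mset.compositionality o_def)
    have gp: "poly g y = (-1) ^ size A * (\<Prod>x\<in>#A. x - y)" for y
      unfolding g_def by (induction A) (auto simp: algebra_simps)
    have "(\<Prod>x\<in>#A. poly r x) = lead_coeff r ^ size A * (\<Prod>x\<in>#A. \<Prod>y\<in>#R. x - y)"
      unfolding rp by (simp add: prod_mset.distrib)
    also have "(\<Prod>x\<in>#A. \<Prod>y\<in>#R. x - y) = (\<Prod>y\<in>#R. \<Prod>x\<in>#A. x - y)"
      by (induction A) (auto simp: prod_mset.distrib)
    also have "\<dots> = (\<Prod>y\<in>#R. (-1) ^ size A * poly g y)"
    proof -
      have "(-1) ^ size A * ((-1) ^ size A * t) = t" for t :: 'a
        by (simp flip: mult.assoc power_mult_distrib)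
      then show ?thesis unfolding gp by simp
    qed
    also have "\<dots> = ((-1) ^ size A) ^ size R * (\<Prod>y\<in>#R. poly g y)"
      by (simp add: prod_mset.distrib)
    finally have "(\<Prod>x\<in>#A. poly r x) = lead_coeff r ^ size A * (((-1) ^ size A) ^ size R * (\<Prod>y\<in>#R. poly g y))" .
    also have "\<dots> \<in> B" using lr IH by (intro mult power uminus one) auto
    finally show ?thesis unfolding Fr .
  qed
qed

text \<open>Divided differences: \<open>(R(b) - R(b0)) / (b - b0)\<close> again takes values in \<open>B\<close>, and its degree is smaller.\<close>

lemma polys_over_by_values:
  assumes inf: "infinite B" and "finite S" and "\<And>b. b \<in> B - S \<Longrightarrow> poly R b \<in> B"
  shows "R \<in> polys_over B"
  using assms(2,3)
proof (induction "degree R" arbitrary: R S rule: less_induct)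
  case less
  have "infinite (B - S)" using inf less.prems(1) by auto
  then obtain b0 where b0: "b0 \<in> B - S" using infinite_imp_nonempty by blast
  define Q where "Q = synthetic_div R b0"
  have R: "R = [:- b0, 1:] * Q + [:poly R b0:]" unfolding Q_def by (simp only: synthetic_div_correct')
  show ?case
  proof (cases "degree R = 0")
    case True
    then obtain c where "R = [:c:]" by (rule degree_eq_zeroE)
    then show ?thesis using less.prems(2)[OF b0] by auto
  next
    case False
    then have "degree Q < degree R" unfolding Q_def degree_synthetic_div by simp
    moreover have "poly Q b \<in> B" if b: "b \<in> B - insert b0 S" for b
    proof -
      have "poly R b = (b - b0) * poly Q b + poly R b0" by (subst R) (simp add: algebra_simps)
      then have "poly Q b = (poly R b - poly R b0) / (b - b0)" using b by (auto simp: field_simps)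
      also have "\<dots> \<in> B" using b b0 less.prems(2) by (intro divide diff) auto
      finally show ?thesis .
    qed
    ultimately have "Q \<in> polys_over B" using less.hyps less.prems(1) by blast
    then show ?thesis using less.prems(2)[OF b0] b0 by (subst R) (intro P.add P.mult pCons_polys_over uminus, auto)
  qed
qed

end

text \<open>Over an algebraically closed field it suffices to look at roots: none of them is multiple.\<close>

definition sep_poly :: "'a::field poly \<Rightarrow> bool" where
  "sep_poly p \<longleftrightarrow> (\<forall>y. poly p y = 0 \<longrightarrow> poly (pderiv p) y \<noteq> 0)"

definition sep_elt :: "'a::field set \<Rightarrow> 'a \<Rightarrow> bool" where
  "sep_elt B x \<longleftrightarrow> (\<exists>p\<in>polys_over B. poly p x = 0 \<and> sep_poly p)"

lemma sep_poly_nonzero: "sep_poly p \<Longrightarrow> p \<noteq> 0"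
  by (auto simp: sep_poly_def)

lemma sep_poly_dvd: "sep_poly p \<Longrightarrow> q dvd p \<Longrightarrow> sep_poly q"
  by (auto simp: sep_poly_def pderiv_mult elim!: dvdE)

lemma sep_elt_algebraic: "sep_elt B x \<Longrightarrow> algebraic_elt B x"
  unfolding sep_elt_def algebraic_elt_def using sep_poly_nonzero by blast

lemma sep_elt_mono: "B \<subseteq> C \<Longrightarrow> sep_elt B x \<Longrightarrow> sep_elt C x"
  unfolding sep_elt_def using polys_over_mono by blast

lemma sep_poly_card_roots:
  fixes p :: "'a::alg_closed_field poly"
  assumes "sep_poly p" shows "card {x. poly p x = 0} = degree p"
    and "\<exists>A. finite A \<and> card A = degree p \<and> p = smult (lead_coeff p) (\<Prod>x\<in>A. [:-x, 1:])"
proof -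
  have p0: "p \<noteq> 0" using assms by (rule sep_poly_nonzero)
  obtain A where A: "size A = degree p" "p = smult (lead_coeff p) (\<Prod>x\<in>#A. [:-x, 1:])"
    using alg_closed_imp_factorization[OF p0] by blast
  have "count A x \<le> 1" for x
  proof (rule ccontr)
    assume "\<not> count A x \<le> 1"
    then have "{#x, x#} \<subseteq># A" by (simp add: subseteq_mset_def)
    then obtain C where "A = {#x, x#} + C" by (metis subset_mset.le_iff_add)
    then have "p = [:-x,1:] * ([:-x,1:] * smult (lead_coeff p) (\<Prod>x\<in>#C. [:-x, 1:]))"
      by (subst A(2)) (simp del: mult_pCons_left)
    then obtain s where s: "p = [:-x,1:] * ([:-x,1:] * s)" by blast
    have "poly p x = 0" by (subst s) simp
    moreover have "poly (pderiv p) x = 0" by (subst s) (simp add: pderiv_mult del: mult_pCons_left)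
    ultimately show False using assms by (auto simp: sep_poly_def)
  qed
  then have cA: "A = mset_set (set_mset A)"
    by (intro multiset_eqI) (metis count_mset_set(1,3) finite_set_mset le_antisym count_greater_eq_one_iff not_in_iff)
  have roots: "{x. poly p x = 0} = set_mset A"
    by (subst A(2)) (auto simp: poly_prod_mset prod_mset_zero_iff p0)
  have "size A = card (set_mset A)" by (subst cA) simp
  then show "card {x. poly p x = 0} = degree p" using A roots by simp
  have "p = smult (lead_coeff p) (\<Prod>x\<in>set_mset A. [:-x, 1:])"
    using A(2) by (metis cA prod_unfold_prod_mset)
  then show "\<exists>A. finite A \<and> card A = degree p \<and> p = smult (lead_coeff p) (\<Prod>x\<in>A. [:-x, 1:])"
    using \<open>size A = card (set_mset A)\<close> A(1) by (intro exI[of _ "set_mset A"]) auto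
qed

lemma char_power_add:
  fixes x y :: "'a::comm_ring_1"
  assumes p: "prime p" "of_nat p = (0::'a)"
  shows "(x + y) ^ p = x ^ p + y ^ p"
proof -
  have p0: "p > 0" using p prime_gt_0_nat by blast
  have "(x + y) ^ p = (\<Sum>k\<le>p. of_nat (p choose k) * x ^ k * y ^ (p - k))" by (rule binomial_ring)
  also have "\<dots> = (\<Sum>k\<in>{0,p}. of_nat (p choose k) * x ^ k * y ^ (p - k))"
  proof (rule sum.mono_neutral_right)
    show "\<forall>i\<in>{..p} - {0, p}. of_nat (p choose i) * x ^ i * y ^ (p - i) = 0"
    proof
      fix i assume "i \<in> {..p} - {0, p}"
      then have "p dvd (p choose i)" using p p0 by (intro dvd_choose_prime) auto
      then obtain k where "p choose i = p * k" by blast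
      then show "of_nat (p choose i) * x ^ i * y ^ (p - i) = 0" using p by simp
    qed
  qed auto
  also have "\<dots> = x ^ p + y ^ p" using p0 by simp
  finally show ?thesis .
qed

lemma char_power_diff:
  fixes x y :: "'a::comm_ring_1"
  assumes p: "prime p" "of_nat p = (0::'a)"
  shows "(x - y) ^ p = x ^ p - y ^ p"
  using char_power_add[OF p, of "x - y" y] by (simp add: algebra_simps)

context ac_subfield
begin

text \<open>Norms of polynomials reduce to norms of numbers, since by \<open>polys_over_by_values\<close> a polynomial with
  enough values in \<open>B\<close> has its coefficients there.\<close>

lemma norm_in_polys_over:
  assumes inf: "infinite B" and th: "(\<Prod>x\<in>#A. [:-x, 1:]) \<in> polys_over B"
    and F: "\<And>b. b \<in> B \<Longrightarrow> \<exists>f\<in>polys_over B. \<forall>x. poly (F x) b = poly f x"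
  shows "(\<Prod>x\<in>#A. F x) \<in> polys_over B"
proof (rule polys_over_by_values[OF inf, of "{}"])
  fix b assume "b \<in> B - {}"
  then obtain f where f: "f \<in> polys_over B" "\<And>x. poly (F x) b = poly f x" using F by blast
  show "poly (\<Prod>x\<in>#A. F x) b \<in> B"
    using prod_roots_in_base[OF th f(1)] by (simp add: poly_prod_mset f(2) image_mset.compositionality o_def)
qed auto

lemma min_poly_splits:
  assumes "algebraic_elt B x"
  obtains A where "min_poly B x = (\<Prod>x\<in>#A. [:-x, 1:])" "size A = degree (min_poly B x)" "x \<in># A"
proof -
  have "min_poly B x \<noteq> 0" using min_poly_degree[OF assms] by auto
  then obtain A where A: "size A = degree (min_poly B x)" "min_poly B x = smult 1 (\<Prod>x\<in>#A. [:-x, 1:])"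
    using alg_closed_imp_factorization[of "min_poly B x"] min_poly_monic[OF assms] by metis
  have "poly (\<Prod>x\<in>#A. [:-x, 1:]) x = 0" using min_poly_root[OF assms] A(2) by simp
  then have "x \<in># A" by (auto simp: poly_prod_mset prod_mset_zero_iff)
  then show ?thesis using that A by simp
qed

text \<open>A polynomial over \<open>B\<close> with root \<open>w(x)\<close> is the norm of \<open>T - w(x)\<close>.\<close>

lemma algebraic_simple_ext:
  assumes inf: "infinite B" and x: "algebraic_elt B x" and v: "v \<in> simple_ext B x"
  shows "algebraic_elt B v"
proof -
  obtain w where w: "w \<in> polys_over B" "v = poly w x" using v by (auto simp: simple_ext_def)
  obtain A where A: "min_poly B x = (\<Prod>x\<in>#A. [:-x, 1:])" "x \<in># A"
    using min_poly_splits[OF x] by metis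
  define R where "R = (\<Prod>y\<in>#A. [:- poly w y, 1:])"
  have "R \<in> polys_over B" unfolding R_def
  proof (rule norm_in_polys_over[OF inf])
    fix b assume "b \<in> B"
    then show "\<exists>f\<in>polys_over B. \<forall>x. poly [:- poly w x, 1:] b = poly f x"
      using w by (intro bexI[of _ "[:b:] - w"]) auto
  qed (use min_poly_over[OF x] A in simp)
  moreover have "R \<noteq> 0" unfolding R_def by (auto simp: prod_mset_zero_iff)
  moreover have "poly R v = 0" unfolding R_def w(2) using A(2)
    by (auto simp: poly_prod_mset prod_mset_zero_iff)
  ultimately show ?thesis unfolding algebraic_elt_def by blast
qed

lemma algebraic_trans:
  assumes inf: "infinite B" and x: "algebraic_elt B x" and v: "algebraic_elt (simple_ext B x) v"
  shows "algebraic_elt B v"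
proof -
  interpret C: subfield_set "simple_ext B x" by (rule simple_ext_subfield[OF x])
  define m where "m = min_poly (simple_ext B x) v"
  note m = C.min_poly[OF v, folded m_def]
  have "\<exists>c. c \<in> polys_over B \<and> coeff m i = poly c x" for i
    using m(1) by (auto simp: polys_over_def simple_ext_def)
  then obtain c0 where c0: "\<And>i. c0 i \<in> polys_over B" "\<And>i. coeff m i = poly (c0 i) x" by metis
  define c where "c = (\<lambda>i. if i = degree m then 1 else c0 i)"
  have c: "c i \<in> polys_over B" "coeff m i = poly (c i) x" for i
    using c0 m(2) by (auto simp: c_def)
  obtain A where A: "min_poly B x = (\<Prod>x\<in>#A. [:-x, 1:])" "x \<in># A"
    using min_poly_splits[OF x] by metis
  define F where "F = (\<lambda>y. \<Sum>i\<le>degree m. monom (poly (c i) y) i)"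
  define R where "R = (\<Prod>y\<in>#A. F y)"
  have "R \<in> polys_over B" unfolding R_def
  proof (rule norm_in_polys_over[OF inf])
    fix b assume b: "b \<in> B"
    have "poly (F y) b = poly (\<Sum>i\<le>degree m. smult (b ^ i) (c i)) y" for y
      by (simp add: F_def poly_sum poly_monom mult.commute)
    moreover have "(\<Sum>i\<le>degree m. smult (b ^ i) (c i)) \<in> polys_over B"
      using b c by (intro P.sum smult_polys_over power) auto
    ultimately show "\<exists>f\<in>polys_over B. \<forall>y. poly (F y) b = poly f y" by blast
  qed (use min_poly_over[OF x] A in simp)
  moreover have "F y \<noteq> 0" for y
  proof -
    have "coeff (F y) (degree m) = 1" by (simp add: F_def coeff_sum coeff_monom c_def if_distrib cong: if_cong)
    then show ?thesis by auto
  qed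
  then have "R \<noteq> 0" unfolding R_def by (auto simp: prod_mset_zero_iff)
  moreover have "F x = m" by (simp add: F_def c(2)[symmetric] poly_as_sum_of_monoms)
  then have "poly R v = 0" unfolding R_def using A(2) m(3)
    by (force simp: poly_prod_mset prod_mset_zero_iff)
  ultimately show ?thesis unfolding algebraic_elt_def by blast
qed

lemma min_poly_min_degree:
  assumes x: "algebraic_elt B x" and y: "algebraic_elt B y" and "poly (min_poly B x) y = 0"
  shows "min_poly B x = min_poly B y"
proof -
  define m where "m = min_poly B x" define k where "k = min_poly B y"
  note m = min_poly[OF x, folded m_def] and k = min_poly[OF y, folded k_def]
  obtain q where q: "q \<in> polys_over B" "m = q * k" using k(4)[OF m(1)] assms(3) m_def by auto
  have m0: "m \<noteq> 0" using m(2) by auto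
  have "poly q x \<noteq> 0"
  proof
    assume "poly q x = 0"
    then obtain r where "q = r * m" using m(4) q(1) by blast
    then have "r * k = 1" using q(2) m0 by auto
    then show False using min_poly_degree[OF y] unfolding k_def[symmetric]
      by (metis dvd_triv_right is_unit_iff_degree less_irrefl one_dvd dvd_0_left_iff zero_neq_one mult_zero_right)
  qed
  then have "poly k x = 0" using q(2) m(3) by auto
  then obtain r where r: "k = r * m" using m(4) k(1) by blast
  have "m = (q * r) * m" using q r by simp
  then have "q * r = 1" using m0 by auto
  then have "degree q = 0" by (metis dvd_triv_left is_unit_iff_degree zero_neq_one mult_zero_left)
  then obtain c where c: "q = [:c:]" by (rule degree_eq_zeroE)
  then have "lead_coeff m = c * lead_coeff k" using q(2) by simp
  then show ?thesis using m(2) k(2) q(2) c by (simp add: m_def k_def)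
qed

lemma algebraic_of_root:
  assumes "p \<in> polys_over B" "p \<noteq> 0" "poly p y = 0" shows "algebraic_elt B y"
  using assms by (auto simp: algebraic_elt_def)

text \<open>A common root of the minimal polynomial and of its nonzero derivative would have a smaller minimal
  polynomial.\<close>

lemma sep_elt_if_pderiv:
  assumes x: "algebraic_elt B x" and "pderiv (min_poly B x) \<noteq> 0" shows "sep_elt B x"
proof -
  define m where "m = min_poly B x"
  note m = min_poly[OF x, folded m_def]
  have d: "degree m > 0" using min_poly_degree[OF x] m_def by simp
  have "poly (pderiv m) y \<noteq> 0" if y: "poly m y = 0" for y
  proof
    assume y': "poly (pderiv m) y = 0"
    have ya: "algebraic_elt B y" using m(1,2) y by (intro algebraic_of_root) auto
    have "m dvd pderiv m"
      using min_poly_dvd[OF ya pderiv_polys_over[OF m(1)] y'] min_poly_min_degree[OF x ya] y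
      by (simp add: m_def)
    then have "degree m \<le> degree (pderiv m)" using assms(2) dvd_imp_degree_le m_def by blast
    moreover have "degree (pderiv m) \<le> degree m - 1"
      by (intro degree_le) (auto simp: coeff_pderiv coeff_eq_0 simp del: of_nat_Suc)
    ultimately show False using d by simp
  qed
  then show ?thesis unfolding sep_elt_def sep_poly_def using m(1,3) by blast
qed

lemma sep_elt_char_0:
  assumes char: "CHAR('a) = 0" and x: "algebraic_elt B x" shows "sep_elt B x"
proof (rule sep_elt_if_pderiv[OF x])
  define m where "m = min_poly B x"
  have "degree m > 0" "lead_coeff m = 1" using min_poly_degree[OF x] min_poly_monic[OF x] m_def by simp_all
  then have "coeff (pderiv m) (degree m - 1) \<noteq> 0"
    using char by (simp add: coeff_pderiv of_nat_eq_0_iff_char_dvd del: of_nat_Suc)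
  then show "pderiv (min_poly B x) \<noteq> 0" by (auto simp: m_def)
qed

lemma frobenius_inj:
  assumes p: "prime p" "of_nat p = (0::'a)" and "x ^ p = (y::'a) ^ p" shows "x = y"
  using char_power_diff[OF p, of x y] assms(3) by simp

text \<open>Over \<open>C = B(v\<^sup>p)\<close> the element \<open>v\<close> is a root of \<open>T\<^sup>p - v\<^sup>p = (T - v)\<^sup>p\<close>, so that its separable minimal
  polynomial over \<open>C\<close> has degree one. With the converse below this describes separable elements in
  characteristic \<open>p\<close> by \<open>B(v) = B(v\<^sup>p)\<close>, a criterion that passes to towers.\<close>

lemma sep_elt_generated_by_power:
  assumes inf: "infinite B" and v: "sep_elt B v" and p: "prime p" "of_nat p = (0::'a)"
  shows "v \<in> simple_ext B (v ^ p)"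
proof -
  have p0: "p > 0" using p prime_gt_0_nat by blast
  have "v ^ p \<in> simple_ext B v"
    unfolding simple_ext_def using monom_polys_over[OF one, of p] by (auto simp: poly_monom intro: exI[of _ "monom 1 p"])
  then have vp: "algebraic_elt B (v ^ p)" using algebraic_simple_ext inf sep_elt_algebraic v by blast
  interpret C: ac_subfield "simple_ext B (v ^ p)"
    using simple_ext_subfield[OF vp] by (simp add: ac_subfield_def)
  have vC: "sep_elt (simple_ext B (v ^ p)) v" using sep_elt_mono[OF subset_simple_ext v] .
  define m where "m = min_poly (simple_ext B (v ^ p)) v"
  note m = C.min_poly[OF sep_elt_algebraic[OF vC], folded m_def]
  have sm: "sep_poly m" using vC m(4) unfolding sep_elt_def by (metis dvd_triv_right sep_poly_dvd)
  have "monom 1 p - [:v ^ p:] \<in> polys_over (simple_ext B (v ^ p))"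
    using gen_in_simple_ext by (intro C.P.diff C.monom_polys_over C.pCons_polys_over) auto
  moreover have "poly (monom 1 p - [:v ^ p:]) v = 0" by (simp add: poly_monom)
  ultimately obtain q where q: "monom 1 p - [:v ^ p:] = q * m" using m(4) by blast
  have "y = v" if "poly m y = 0" for y
  proof -
    have "poly (monom 1 p - [:v ^ p:]) y = 0" using q that by simp
    then have "y ^ p = v ^ p" by (simp add: poly_monom)
    then show ?thesis using frobenius_inj[OF p] by blast
  qed
  then have "{y. poly m y = 0} = {v}" using m(3) by blast
  then have "degree m = 1" using sep_poly_card_roots(1)[OF sm] by simp
  then have ab: "m = [:coeff m 0, 1:]" using monic_degree_1 m(2) by blast
  define a where "a = coeff m 0"
  have "v = - a" using m(3) by (subst (asm) ab) (simp add: a_def add_eq_0_iff)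
  moreover have "a \<in> simple_ext B (v ^ p)" using m(1) by (simp add: polys_over_def a_def)
  ultimately show ?thesis using C.uminus by simp
qed

text \<open>If \<open>v = r(v\<^sup>p)\<close> then \<open>v\<close> is a root of \<open>T - r(T\<^sup>p)\<close>, whose derivative is 1.\<close>

lemma sep_elt_if_generated_by_power:
  assumes p: "prime p" "of_nat p = (0::'a)" and v: "v \<in> simple_ext B (v ^ p)"
  shows "sep_elt B v"
proof -
  obtain r where r: "r \<in> polys_over B" "v = poly r (v ^ p)"
    using v[unfolded simple_ext_def mem_Collect_eq] by (elim exE conjE) (rule that)
  define f where "f = [:0, 1:] - pcompose r (monom 1 p)"
  have "f \<in> polys_over B" unfolding f_def
    by (rule P.diff, rule pCons_polys_over[OF zero pCons_polys_over[OF one zero_polys_over]],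
        rule pcompose_polys_over[OF r(1) monom_polys_over[OF one]])
  moreover have "poly f v = v - poly r (v ^ p)" unfolding f_def by (simp add: poly_pcompose poly_monom)
  then have "poly f v = 0" using r(2)[symmetric] by simp
  moreover have "pderiv f = 1"
  proof -
    have "pderiv (monom (1::'a) p) = 0" using p(2) by (simp add: pderiv_monom)
    then show ?thesis unfolding f_def by (simp add: pderiv_diff pderiv_pcompose pderiv_pCons)
  qed
  then have "sep_poly f" by (simp add: sep_poly_def)
  ultimately show ?thesis unfolding sep_elt_def by blast
qed

lemma min_poly_sep:
  assumes "sep_elt B x" shows "sep_poly (min_poly B x)"
  using assms min_poly_dvd[OF sep_elt_algebraic[OF assms]] unfolding sep_elt_def
  by (metis sep_poly_dvd)

text \<open>Write \<open>v = w(x)\<close> with \<open>w\<close> of degree below that of the minimal polynomial of \<open>x\<close>. Then \<open>w(y)\<^sup>p = v\<^sup>p\<close>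
  for all conjugates \<open>y\<close> of \<open>x\<close>; as the Frobenius map is injective, \<open>w\<close> takes the value \<open>v\<close> more often
  than its degree allows unless it is constant.\<close>

lemma power_in_base_imp_in_base:
  assumes th: "sep_elt B x" and v: "v \<in> simple_ext B x" "v ^ p \<in> B" and p: "prime p" "of_nat p = (0::'a)"
  shows "v \<in> B"
proof -
  define m where "m = min_poly B x"
  have xa: "algebraic_elt B x" using th by (rule sep_elt_algebraic)
  note m = min_poly[OF xa, folded m_def]
  have sm: "sep_poly m" using min_poly_sep[OF th] m_def by simp
  have m0: "m \<noteq> 0" using m(2) by auto
  obtain w0 where w0: "w0 \<in> polys_over B" "v = poly w0 x" using v by (auto simp: simple_ext_def)
  obtain a w where w: "w \<in> polys_over B" "w0 = a * m + w" "w = 0 \<or> degree w < degree m"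
    using division[OF w0(1) m(1) m0] by blast
  have dw: "degree w < degree m" using w(3) min_poly_degree[OF xa] m_def by auto
  have vw: "v = poly w x" using w0 w(2) m(3) by simp
  have "w ^ p - [:v ^ p:] \<in> polys_over B" using w(1) v(2) by auto
  moreover have "poly (w ^ p - [:v ^ p:]) x = 0" using vw by (simp add: poly_power)
  ultimately obtain q where q: "w ^ p - [:v ^ p:] = q * m" using m(4) by blast
  have "poly (w - [:v:]) y = 0" if "poly m y = 0" for y
  proof -
    have "poly (w ^ p - [:v ^ p:]) y = 0" using q that by simp
    then have "poly w y ^ p = v ^ p" by (simp add: poly_power)
    then show ?thesis using frobenius_inj[OF p] by auto
  qed
  then have sub: "{y. poly m y = 0} \<subseteq> {y. poly (w - [:v:]) y = 0}" by blast
  have "w - [:v:] = 0"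
  proof (rule ccontr)
    assume *: "w - [:v:] \<noteq> 0"
    have "degree m \<le> card {y. poly (w - [:v:]) y = 0}"
      using card_mono[OF poly_roots_finite[OF *] sub] sep_poly_card_roots(1)[OF sm] by simp
    also have "\<dots> \<le> degree (w - [:v:])" by (rule card_poly_roots_bound[OF *])
    also have "\<dots> < degree m"
      using degree_diff_le_max[of w "[:v:]"] dw by simp
    finally show False by simp
  qed
  then have "coeff w 0 = v" by simp
  then show ?thesis using w(1) by (auto simp: polys_over_def)
qed

lemma char_cases:
  obtains "CHAR('a) = 0" | p where "prime p" "of_nat p = (0::'a)"
  using prime_CHAR_semidom[where ?'a = 'a] of_nat_CHAR[where ?'a = 'a] by blast

lemma sep_elt_simple_ext:
  assumes inf: "infinite B" and x: "sep_elt B x" and v: "v \<in> simple_ext B x"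
  shows "sep_elt B v"
proof -
  have va: "algebraic_elt B v" using algebraic_simple_ext[OF inf sep_elt_algebraic[OF x] v] .
  show ?thesis
  proof (cases rule: char_cases)
    case 1
    then show ?thesis using sep_elt_char_0 va by blast
  next
    case (2 p)
    have "v ^ p \<in> simple_ext B v"
      unfolding simple_ext_def using monom_polys_over[OF one, of p] by (auto simp: poly_monom intro: exI[of _ "monom 1 p"])
    then have vp: "algebraic_elt B (v ^ p)" using algebraic_simple_ext inf va by blast
    interpret C: ac_subfield "simple_ext B (v ^ p)"
      using simple_ext_subfield[OF vp] by (simp add: ac_subfield_def)
    have "v \<in> simple_ext (simple_ext B (v ^ p)) x"
      using v polys_over_mono[OF subset_simple_ext] by (fastforce simp: simple_ext_def)
    then have "v \<in> simple_ext B (v ^ p)"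
      using C.power_in_base_imp_in_base[OF sep_elt_mono[OF subset_simple_ext x] _ gen_in_simple_ext 2] by blast
    then show ?thesis by (rule sep_elt_if_generated_by_power[OF 2])
  qed
qed

lemma sep_elt_trans:
  assumes inf: "infinite B" and x: "sep_elt B x" and v: "sep_elt (simple_ext B x) v"
  shows "sep_elt B v"
proof -
  have va: "algebraic_elt B v"
    using algebraic_trans[OF inf sep_elt_algebraic[OF x] sep_elt_algebraic[OF v]] .
  interpret E: ac_subfield "simple_ext B x"
    using simple_ext_subfield[OF sep_elt_algebraic[OF x]] by (simp add: ac_subfield_def)
  have infE: "infinite (simple_ext B x)" using inf subset_simple_ext infinite_super by blast
  show ?thesis
  proof (cases rule: char_cases)
    case 1
    then show ?thesis using sep_elt_char_0 va by blast
  next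
    case (2 p)
    have "v ^ p \<in> simple_ext B v"
      unfolding simple_ext_def using monom_polys_over[OF one, of p] by (auto simp: poly_monom intro: exI[of _ "monom 1 p"])
    then have vp: "algebraic_elt B (v ^ p)" using algebraic_simple_ext inf va by blast
    interpret C: ac_subfield "simple_ext B (v ^ p)"
      using simple_ext_subfield[OF vp] by (simp add: ac_subfield_def)
    have xC: "sep_elt (simple_ext B (v ^ p)) x" using sep_elt_mono[OF subset_simple_ext x] .
    interpret D: ac_subfield "simple_ext (simple_ext B (v ^ p)) x"
      using C.simple_ext_subfield[OF sep_elt_algebraic[OF xC]] by (simp add: ac_subfield_def)
    have "v \<in> simple_ext (simple_ext B x) (v ^ p)"
      by (rule E.sep_elt_generated_by_power[OF infE v 2])
    moreover have "simple_ext B x \<subseteq> simple_ext (simple_ext B (v ^ p)) x"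
      using polys_over_mono[OF subset_simple_ext] by (fastforce simp: simple_ext_def)
    then have "simple_ext (simple_ext B x) (v ^ p) \<subseteq> simple_ext (simple_ext B (v ^ p)) x"
      using E.simple_ext_minimal[OF D.subring_set_axioms] gen_in_simple_ext C.subset_simple_ext by blast
    ultimately have "v \<in> simple_ext B (v ^ p)"
      using C.power_in_base_imp_in_base[OF xC _ gen_in_simple_ext 2] by blast
    then show ?thesis by (rule sep_elt_if_generated_by_power[OF 2])
  qed
qed

lemma sep_elt_two:
  assumes inf: "infinite B" and x: "sep_elt B x" and y: "sep_elt B y"
    and v: "v \<in> simple_ext (simple_ext B x) y"
  shows "sep_elt B v"
proof -
  interpret E: ac_subfield "simple_ext B x"
    using simple_ext_subfield[OF sep_elt_algebraic[OF x]] by (simp add: ac_subfield_def)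
  have infE: "infinite (simple_ext B x)" using inf subset_simple_ext infinite_super by blast
  have "sep_elt (simple_ext B x) v"
    by (rule E.sep_elt_simple_ext[OF infE sep_elt_mono[OF subset_simple_ext y] v])
  then show ?thesis by (rule sep_elt_trans[OF inf x])
qed

lemma sep_elt_base: "b \<in> B \<Longrightarrow> sep_elt B b"
  unfolding sep_elt_def sep_poly_def
  by (intro bexI[of _ "[:-b, 1:]"]) (auto simp: pderiv_pCons)

lemma sep_elts_subfield:
  assumes inf: "infinite B" shows "subfield_set {v. sep_elt B v}"
proof -
  have *: "x + y \<in> simple_ext (simple_ext B x) y \<and> x * y \<in> simple_ext (simple_ext B x) y"
    if "sep_elt B x" "sep_elt B y" for x y
  proof -
    interpret E: ac_subfield "simple_ext B x"
      using simple_ext_subfield[OF sep_elt_algebraic[OF that(1)]] by (simp add: ac_subfield_def)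
    interpret D: ac_subfield "simple_ext (simple_ext B x) y"
      using E.simple_ext_subfield[OF algebraic_elt_mono[OF subset_simple_ext sep_elt_algebraic[OF that(2)]]]
      by (simp add: ac_subfield_def)
    show ?thesis using gen_in_simple_ext E.gen_in_simple_ext E.subset_simple_ext by blast
  qed
  have un: "- x \<in> simple_ext B x \<and> inverse x \<in> simple_ext B x" if "sep_elt B x" for x
  proof -
    interpret E: ac_subfield "simple_ext B x"
      using simple_ext_subfield[OF sep_elt_algebraic[OF that(1)]] by (simp add: ac_subfield_def)
    show ?thesis using gen_in_simple_ext by blast
  qed
  show ?thesis
  proof (unfold_locales, goal_cases)
    case 1 show ?case using sep_elt_base[OF zero] by simp
  next
    case 2 show ?case using sep_elt_base[OF one] by simp
  next
    case (3 x y) then show ?case using * sep_elt_two[OF inf] by blast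
  next
    case (4 x y) then show ?case using * sep_elt_two[OF inf] by blast
  next
    case (5 x) then show ?case using un sep_elt_simple_ext[OF inf] by blast
  next
    case (6 x) then show ?case using un sep_elt_simple_ext[OF inf] by blast
  qed
qed

text \<open>The last conclusion keeps \<open>z\<close> inside every field that contains \<open>B\<close>, \<open>x\<close> and \<open>y\<close>. The usual \<open>z = x + c y\<close>
  works: the minimal polynomials of \<open>y\<close> and, transformed, of \<open>x\<close> have only the root \<open>y\<close> in common.\<close>

lemma primitive_element:
  assumes inf: "infinite B" and x: "sep_elt B x" and y: "sep_elt B y"
  obtains z where "sep_elt B z" "x \<in> simple_ext B z" "y \<in> simple_ext B z"
    "z \<in> simple_ext (simple_ext B x) y"
proof -
  define f where "f = min_poly B x" define g where "g = min_poly B y"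
  note f = min_poly[OF sep_elt_algebraic[OF x], folded f_def]
    and g = min_poly[OF sep_elt_algebraic[OF y], folded g_def]
  have f0: "f \<noteq> 0" "g \<noteq> 0" using f(2) g(2) by auto
  define bad where "bad = (\<lambda>(x', y'). (x' - x) / (y - y')) ` ({x'. poly f x' = 0} \<times> {y'. poly g y' = 0})"
  have "finite bad" unfolding bad_def using f0 poly_roots_finite by blast
  then obtain c where c: "c \<in> B" "c \<notin> bad" using inf by (meson finite_subset subsetI)
  define z where "z = x + c * y"
  interpret E: ac_subfield "simple_ext B x"
    using simple_ext_subfield[OF sep_elt_algebraic[OF x]] by (simp add: ac_subfield_def)
  interpret D: ac_subfield "simple_ext (simple_ext B x) y"
    using E.simple_ext_subfield[OF algebraic_elt_mono[OF subset_simple_ext sep_elt_algebraic[OF y]]]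
    by (simp add: ac_subfield_def)
  have zD: "z \<in> simple_ext (simple_ext B x) y" unfolding z_def
    using c gen_in_simple_ext E.gen_in_simple_ext E.subset_simple_ext subset_simple_ext by blast
  have z: "sep_elt B z" by (rule sep_elt_two[OF inf x y zD])
  interpret Z: ac_subfield "simple_ext B z"
    using simple_ext_subfield[OF sep_elt_algebraic[OF z]] by (simp add: ac_subfield_def)
  define h where "h = pcompose f [:z, -c:]"
  have BZ: "B \<subseteq> simple_ext B z" and zZ: "z \<in> simple_ext B z"
    using subset_simple_ext gen_in_simple_ext by auto
  have "f \<in> polys_over (simple_ext B z)" using polys_over_mono[OF BZ f(1)] .
  then have hZ: "h \<in> polys_over (simple_ext B z)"
    unfolding h_def using c BZ zZ by (intro Z.pcompose_polys_over Z.pCons_polys_over Z.uminus) auto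
  have gZ: "g \<in> polys_over (simple_ext B z)" using polys_over_mono[OF BZ g(1)] .
  have ya: "algebraic_elt (simple_ext B z) y"
    using algebraic_elt_mono[OF BZ sep_elt_algebraic[OF y]] .
  define m where "m = min_poly (simple_ext B z) y"
  note m = Z.min_poly[OF ya, folded m_def]
  have "poly h y = 0" using f(3) by (simp add: h_def poly_pcompose z_def)
  then have mh: "m dvd h" using m(4)[OF hZ] by (metis dvd_triv_right)
  have mg: "m dvd g" using m(4)[OF gZ g(3)] by (metis dvd_triv_right)
  have "y' = y" if "poly m y' = 0" for y'
  proof (rule ccontr)
    assume ne: "y' \<noteq> y"
    have 1: "poly g y' = 0" using mg that by (auto elim: dvdE)
    have "poly h y' = 0" using mh that by (auto elim: dvdE)
    then have 2: "poly f (z - c * y') = 0" by (simp add: h_def poly_pcompose algebra_simps)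
    have "c = ((z - c * y') - x) / (y - y')" using ne by (simp add: z_def field_simps)
    then have "c \<in> bad" unfolding bad_def using 1 2 by (intro image_eqI[of _ _ "(z - c * y', y')"]) auto
    then show False using c by blast
  qed
  then have "{y'. poly m y' = 0} = {y}" using m(3) by blast
  moreover have sm: "sep_poly m" using sep_poly_dvd[OF min_poly_sep[OF y]] mg g_def by simp
  ultimately have "degree m = 1" using sep_poly_card_roots(1)[OF sm] by simp
  then have ab: "m = [:coeff m 0, 1:]" using monic_degree_1 m(2) by blast
  define a where "a = coeff m 0"
  have "y = - a" using m(3) by (subst (asm) ab) (simp add: a_def add_eq_0_iff)
  moreover have "a \<in> simple_ext B z" using m(1) by (simp add: polys_over_def a_def)
  ultimately have yZ: "y \<in> simple_ext B z" using Z.uminus by simp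
  have "x = z - c * y" by (simp add: z_def)
  then have "x \<in> simple_ext B z" using yZ zZ c BZ by auto
  then show ?thesis using that z yZ zD by blast
qed

end

section \<open>Homomorphisms and polynomials in several variables\<close>

text \<open>Homomorphisms between ring types are predicates here, so that evaluations and maps of coefficients can
  be composed without records.\<close>

locale rhom =
  fixes h :: "'a::comm_ring_1 \<Rightarrow> 'b::comm_ring_1"
  assumes hom_add: "h (x + y) = h x + h y"
    and hom_mult: "h (x * y) = h x * h y"
    and hom_one: "h 1 = 1"
begin

lemma hom_zero [simp]: "h 0 = 0"
  using hom_add[of 0 0] by simp

lemma hom_uminus: "h (- x) = - h x"
  using hom_add[of x "- x"] by (simp add: eq_neg_iff_add_eq_0 add.commute)

lemma hom_diff: "h (x - y) = h x - h y"
  using hom_add[of x "- y"] by (simp add: hom_uminus)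

lemma hom_sum: "h (sum f A) = (\<Sum>i\<in>A. h (f i))"
  by (induction A rule: infinite_finite_induct) (auto simp: hom_add)

lemma hom_prod: "h (prod f A) = (\<Prod>i\<in>A. h (f i))"
  by (induction A rule: infinite_finite_induct) (auto simp: hom_mult hom_one)

lemma hom_power: "h (x ^ k) = h x ^ k"
  by (induction k) (auto simp: hom_mult hom_one)

lemma hom_of_nat: "h (of_nat k) = of_nat k"
  by (induction k) (auto simp: hom_add hom_one)

lemma poly_map_poly_hom: "poly (map_poly h p) (h x) = h (poly p x)"
  by (induction p) (auto simp: map_poly_pCons hom_add hom_mult)

end

lemma rhom_comp: "rhom h \<Longrightarrow> rhom g \<Longrightarrow> rhom (g \<circ> h)"
  by (simp add: rhom_def)

lemma rhom_id: "rhom id" by (simp add: rhom_def)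

lemma rhom_eq_0_iff:
  fixes h :: "'a::field \<Rightarrow> 'b::{comm_ring_1,zero_neq_one}"
  assumes "rhom h" shows "h x = 0 \<longleftrightarrow> x = 0"
proof -
  interpret rhom h by fact
  show ?thesis
  proof
    assume "h x = 0"
    show "x = 0"
    proof (rule ccontr)
      assume "x \<noteq> 0"
      then have "h (x * inverse x) = 1" using hom_one by simp
      then show False using \<open>h x = 0\<close> by (simp add: hom_mult)
    qed
  qed simp
qed

lemma rhom_inj:
  fixes h :: "'a::field \<Rightarrow> 'b::{comm_ring_1,zero_neq_one}"
  assumes "rhom h" shows "h x = h y \<longleftrightarrow> x = y"
  using rhom_eq_0_iff[OF assms, of "x - y"] rhom.hom_diff[OF assms, of x y] by auto

lemma rhom_to_ac: "rhom to_ac"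
  by (simp add: rhom_def)

definition polys_in :: "nat set \<Rightarrow> 'a::comm_ring_1 mpoly set" where
  "polys_in V = {p. \<forall>m\<in>Poly_Mapping.keys p. Poly_Mapping.keys m \<subseteq> V}"

definition mpoly_var :: "nat \<Rightarrow> 'a::comm_ring_1 mpoly" where
  "mpoly_var i = Poly_Mapping.single (Poly_Mapping.single i 1) 1"

definition mono_eval :: "(nat \<Rightarrow> 'b::comm_ring_1) \<Rightarrow> (nat \<Rightarrow>\<^sub>0 nat) \<Rightarrow> 'b" where
  "mono_eval x m = (\<Prod>i\<in>Poly_Mapping.keys m. x i ^ Poly_Mapping.lookup m i)"

lemma mono_eval_superset:
  assumes "finite S" "Poly_Mapping.keys m \<subseteq> S"
  shows "mono_eval x m = (\<Prod>i\<in>S. x i ^ Poly_Mapping.lookup m i)"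
  unfolding mono_eval_def using assms
  by (intro prod.mono_neutral_left) (auto simp: in_keys_iff)

lemma mono_eval_add: "mono_eval x (m + m') = mono_eval x m * mono_eval x m'"
proof -
  let ?S = "Poly_Mapping.keys m \<union> Poly_Mapping.keys m'"
  have "mono_eval x (m + m') = (\<Prod>i\<in>?S. x i ^ Poly_Mapping.lookup (m + m') i)"
    using keys_add[of m m'] by (intro mono_eval_superset) auto
  then show ?thesis
    by (simp add: mono_eval_superset[of ?S] lookup_add power_add prod.distrib)
qed

lemma mpoly_eval_alt:
  "mpoly_eval h x p = (\<Sum>m\<in>Poly_Mapping.keys p. h (Poly_Mapping.lookup p m) * mono_eval x m)"
  by (simp add: mpoly_eval_def mono_eval_def)

lemma mpoly_sum_single: "p = (\<Sum>m\<in>Poly_Mapping.keys p. Poly_Mapping.single m (Poly_Mapping.lookup p m))"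
  by (intro poly_mapping_eqI) (auto simp: lookup_sum lookup_single when_def in_keys_iff)

context rhom
begin

lemma mpoly_eval_superset:
  assumes "finite S" "Poly_Mapping.keys p \<subseteq> S"
  shows "mpoly_eval h x p = (\<Sum>m\<in>S. h (Poly_Mapping.lookup p m) * mono_eval x m)"
  unfolding mpoly_eval_alt using assms
  by (intro sum.mono_neutral_left) (auto simp: in_keys_iff)

lemma mpoly_eval_single: "mpoly_eval h x (Poly_Mapping.single m c) = h c * mono_eval x m"
  by (subst mpoly_eval_superset[of "{m}"]) (auto split: if_splits)

lemma mpoly_eval_zero [simp]: "mpoly_eval h x 0 = 0"
  by (simp add: mpoly_eval_alt)

lemma mpoly_eval_add: "mpoly_eval h x (p + q) = mpoly_eval h x p + mpoly_eval h x q"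
proof -
  let ?S = "Poly_Mapping.keys p \<union> Poly_Mapping.keys q"
  have "mpoly_eval h x (p + q) = (\<Sum>m\<in>?S. h (Poly_Mapping.lookup (p + q) m) * mono_eval x m)"
    using keys_add[of p q] by (intro mpoly_eval_superset) auto
  then show ?thesis
    by (simp add: mpoly_eval_superset[of ?S] lookup_add hom_add algebra_simps sum.distrib)
qed

lemma mpoly_eval_sum: "mpoly_eval h x (sum f A) = (\<Sum>i\<in>A. mpoly_eval h x (f i))"
  by (induction A rule: infinite_finite_induct) (auto simp: mpoly_eval_add)

lemma mpoly_eval_mult: "mpoly_eval h x (p * q) = mpoly_eval h x p * mpoly_eval h x q"
proof -
  have "p * q = (\<Sum>m\<in>Poly_Mapping.keys p. \<Sum>m'\<in>Poly_Mapping.keys q.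
      Poly_Mapping.single (m + m') (Poly_Mapping.lookup p m * Poly_Mapping.lookup q m'))"
    by (subst mpoly_sum_single[of p], subst mpoly_sum_single[of q])
       (simp add: sum_product mult_single)
  then have "mpoly_eval h x (p * q) = (\<Sum>m\<in>Poly_Mapping.keys p. \<Sum>m'\<in>Poly_Mapping.keys q.
      (h (Poly_Mapping.lookup p m) * mono_eval x m) * (h (Poly_Mapping.lookup q m') * mono_eval x m'))"
    by (simp add: mpoly_eval_sum mpoly_eval_single mono_eval_add hom_mult mult_ac)
  then show ?thesis by (simp add: mpoly_eval_alt sum_product)
qed

lemma mpoly_eval_const [simp]: "mpoly_eval h x (mpoly_const c) = h c"
  by (simp add: mpoly_const_def mpoly_eval_single mono_eval_def)

lemma mpoly_eval_one [simp]: "mpoly_eval h x 1 = 1"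
  using mpoly_eval_const[of x 1] by (simp add: mpoly_const_def hom_one)

lemma mpoly_eval_var [simp]: "mpoly_eval h x (mpoly_var i) = x i"
  by (simp add: mpoly_var_def mpoly_eval_single mono_eval_def hom_one)

lemma mpoly_eval_rhom: "rhom (mpoly_eval h x)"
  by unfold_locales (auto simp: mpoly_eval_add mpoly_eval_mult)

lemmas mpoly_eval_power = rhom.hom_power[OF mpoly_eval_rhom]
  and mpoly_eval_prod = rhom.hom_prod[OF mpoly_eval_rhom]
  and mpoly_eval_uminus = rhom.hom_uminus[OF mpoly_eval_rhom]
  and mpoly_eval_diff = rhom.hom_diff[OF mpoly_eval_rhom]

end

lemma mpoly_const_rhom: "rhom (mpoly_const :: 'a::comm_ring_1 \<Rightarrow> _)"
  by unfold_locales (auto simp: mpoly_const_def single_add mult_single)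

lemma polys_in_subring: "subring_set (polys_in V :: 'a::comm_ring_1 mpoly set)"
proof
  show "p + q \<in> polys_in V" if "p \<in> polys_in V" "q \<in> polys_in V" for p q :: "'a mpoly"
    using that keys_add[of p q] unfolding polys_in_def by blast
  show "p * q \<in> polys_in V" if pq: "p \<in> polys_in V" "q \<in> polys_in V" for p q :: "'a mpoly"
    unfolding polys_in_def mem_Collect_eq
  proof
    fix m assume "m \<in> Poly_Mapping.keys (p * q)"
    then obtain a b where "m = a + b" "a \<in> Poly_Mapping.keys p" "b \<in> Poly_Mapping.keys q"
      using keys_mult[of p q] by blast
    then show "Poly_Mapping.keys m \<subseteq> V" using pq keys_add[of a b] unfolding polys_in_def by blast
  qed
qed (auto simp: polys_in_def)

lemma mpoly_const_in [simp, intro]: "mpoly_const c \<in> polys_in V"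
  by (auto simp: polys_in_def mpoly_const_def split: if_splits)

lemma mpoly_var_in [simp, intro]: "i \<in> V \<Longrightarrow> mpoly_var i \<in> polys_in V"
  by (auto simp: polys_in_def mpoly_var_def split: if_splits)

lemma polys_in_mono: "V \<subseteq> W \<Longrightarrow> p \<in> polys_in V \<Longrightarrow> p \<in> polys_in W"
  by (auto simp: polys_in_def)

lemma polys_in_UNIV [simp]: "p \<in> polys_in UNIV"
  by (simp add: polys_in_def)

lemma single_mpoly_prod:
  "Poly_Mapping.single m c = mpoly_const c * (\<Prod>i\<in>Poly_Mapping.keys m. mpoly_var i ^ Poly_Mapping.lookup m i)"
proof -
  have pow: "mpoly_var i ^ k = Poly_Mapping.single (Poly_Mapping.single i k) (1::'a)" for i k
    by (induction k) (auto simp: mpoly_var_def mult_single single_add[symmetric])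
  have "(\<Prod>i\<in>A. Poly_Mapping.single (f i) (1::'a)) = Poly_Mapping.single (\<Sum>i\<in>A. f i) 1"
    for f :: "nat \<Rightarrow> nat \<Rightarrow>\<^sub>0 nat" and A
    by (induction A rule: infinite_finite_induct) (auto simp: mult_single)
  moreover have "(\<Sum>i\<in>Poly_Mapping.keys m. Poly_Mapping.single i (Poly_Mapping.lookup m i)) = m"
    by (intro poly_mapping_eqI) (auto simp: lookup_sum lookup_single when_def in_keys_iff)
  ultimately show ?thesis by (simp add: pow mpoly_const_def mult_single)
qed

lemma polys_in_induct [consumes 1, case_names const var add mult]:
  assumes "p \<in> polys_in V"
    and const: "\<And>c. P (mpoly_const c)" and var: "\<And>i. i \<in> V \<Longrightarrow> P (mpoly_var i)"
    and add: "\<And>p q. P p \<Longrightarrow> P q \<Longrightarrow> P (p + q)" and mult: "\<And>p q. P p \<Longrightarrow> P q \<Longrightarrow> P (p * q)"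
  shows "P p"
proof -
  have P0: "P 0" and P1: "P 1" using const[of 0] const[of 1] by (simp_all add: mpoly_const_def)
  have pow: "P q \<Longrightarrow> P (q ^ k)" for q k by (induction k) (auto intro: P1 mult)
  have prod: "(\<And>i. i \<in> A \<Longrightarrow> P (f i)) \<Longrightarrow> P (prod f A)" for f :: "nat \<Rightarrow> _" and A
    by (induction A rule: infinite_finite_induct) (auto intro: P1 mult)
  have sum: "(\<And>i. i \<in> A \<Longrightarrow> P (f i)) \<Longrightarrow> P (sum f A)" for f :: "(nat \<Rightarrow>\<^sub>0 nat) \<Rightarrow> _" and A
    by (induction A rule: infinite_finite_induct) (auto intro: P0 add)
  have "P (\<Sum>m\<in>Poly_Mapping.keys p. Poly_Mapping.single m (Poly_Mapping.lookup p m))"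
  proof (rule sum)
    fix m assume "m \<in> Poly_Mapping.keys p"
    then have "Poly_Mapping.keys m \<subseteq> V" using assms(1) by (auto simp: polys_in_def)
    then show "P (Poly_Mapping.single m (Poly_Mapping.lookup p m))"
      by (subst single_mpoly_prod) (intro mult const prod pow var, auto)
  qed
  then show ?thesis using mpoly_sum_single[of p] by simp
qed

lemma mpoly_induct [case_names const var add mult]:
  assumes "\<And>c. P (mpoly_const c)" "\<And>i. P (mpoly_var i)"
    "\<And>p q. P p \<Longrightarrow> P q \<Longrightarrow> P (p + q)" "\<And>p q. P p \<Longrightarrow> P q \<Longrightarrow> P (p * q)"
  shows "P p"
  using polys_in_induct[of p UNIV P] assms by simp

lemma (in rhom) mpoly_eval_cong:
  assumes "p \<in> polys_in V" "\<And>i. i \<in> V \<Longrightarrow> x i = y i"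
  shows "mpoly_eval h x p = mpoly_eval h y p"
  using assms(1) by (induction rule: polys_in_induct) (auto simp: assms(2) mpoly_eval_add mpoly_eval_mult)

definition mpoly_subst :: "(nat \<Rightarrow> 'a mpoly) \<Rightarrow> 'a::comm_ring_1 mpoly \<Rightarrow> 'a mpoly" where
  "mpoly_subst \<sigma> = mpoly_eval mpoly_const \<sigma>"

lemma mpoly_subst_rhom: "rhom (mpoly_subst \<sigma>)"
  unfolding mpoly_subst_def by (rule rhom.mpoly_eval_rhom[OF mpoly_const_rhom])

lemma mpoly_subst_simps [simp]:
  "mpoly_subst \<sigma> (mpoly_const c) = mpoly_const c" "mpoly_subst \<sigma> (mpoly_var i) = \<sigma> i"
  "mpoly_subst \<sigma> (p + q) = mpoly_subst \<sigma> p + mpoly_subst \<sigma> q"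
  "mpoly_subst \<sigma> (p * q) = mpoly_subst \<sigma> p * mpoly_subst \<sigma> q"
  "mpoly_subst \<sigma> 0 = 0" "mpoly_subst \<sigma> 1 = 1"
  using rhom.hom_add[OF mpoly_subst_rhom] rhom.hom_mult[OF mpoly_subst_rhom]
    rhom.hom_one[OF mpoly_subst_rhom] rhom.hom_zero[OF mpoly_subst_rhom]
  by (auto simp: mpoly_subst_def rhom.mpoly_eval_const[OF mpoly_const_rhom]
      rhom.mpoly_eval_var[OF mpoly_const_rhom])

lemma mpoly_subst_in:
  assumes "p \<in> polys_in V" "\<And>i. i \<in> V \<Longrightarrow> \<sigma> i \<in> polys_in W" shows "mpoly_subst \<sigma> p \<in> polys_in W"
proof -
  interpret subring_set "polys_in W :: 'a mpoly set" by (rule polys_in_subring)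
  show ?thesis using assms(1) by (induction rule: polys_in_induct) (auto simp: assms(2))
qed

lemma mpoly_subst_var [simp]: "mpoly_subst mpoly_var p = p"
  by (induction p rule: mpoly_induct) auto

lemma (in rhom) mpoly_eval_subst:
  "mpoly_eval h x (mpoly_subst \<sigma> p) = mpoly_eval h (\<lambda>i. mpoly_eval h x (\<sigma> i)) p"
  by (induction p rule: mpoly_induct) (auto simp: mpoly_eval_add mpoly_eval_mult)

definition mpoly_rename :: "(nat \<Rightarrow> nat) \<Rightarrow> 'a::comm_ring_1 mpoly \<Rightarrow> 'a mpoly" where
  "mpoly_rename \<pi> = mpoly_subst (\<lambda>i. mpoly_var (\<pi> i))"

lemma (in rhom) mpoly_eval_rename [simp]: "mpoly_eval h x (mpoly_rename \<pi> p) = mpoly_eval h (x \<circ> \<pi>) p"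
  by (simp add: mpoly_rename_def mpoly_eval_subst o_def)

lemma (in rhom) mpoly_map_const [simp]: "Poly_Mapping.map h (mpoly_const c) = mpoly_const (h c)"
  by (intro poly_mapping_eqI) (auto simp: mpoly_const_def Poly_Mapping.map.rep_eq lookup_single when_def)

lemma (in rhom) lookup_map_hom: "Poly_Mapping.lookup (Poly_Mapping.map h p) m = h (Poly_Mapping.lookup p m)"
  by (auto simp: Poly_Mapping.map.rep_eq when_def)

lemma (in rhom) map_mpoly_rhom: "rhom (Poly_Mapping.map h :: 'a mpoly \<Rightarrow> _)"
proof -
  have map: "Poly_Mapping.map h p = mpoly_eval (mpoly_const \<circ> h) mpoly_var p" (is "_ = ?e p") for p :: "'a mpoly"
  proof -
    interpret c: rhom "mpoly_const \<circ> h" using rhom_comp[OF rhom_axioms mpoly_const_rhom] .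
    have "?e p = (\<Sum>m\<in>Poly_Mapping.keys p. Poly_Mapping.single m (h (Poly_Mapping.lookup p m)))"
      by (simp add: mpoly_eval_alt single_mpoly_prod mono_eval_def)
    also have "\<dots> = Poly_Mapping.map h p"
      by (intro poly_mapping_eqI) (auto simp: lookup_sum lookup_single lookup_map_hom when_def in_keys_iff)
    finally show ?thesis by (rule sym)
  qed
  show ?thesis unfolding map[abs_def]
    by (rule rhom.mpoly_eval_rhom[OF rhom_comp[OF rhom_axioms mpoly_const_rhom]])
qed

lemma (in rhom) map_mpoly_var [simp]: "Poly_Mapping.map h (mpoly_var i) = mpoly_var i"
  by (intro poly_mapping_eqI) (auto simp: mpoly_var_def Poly_Mapping.map.rep_eq lookup_single when_def hom_one)

lemma mpoly_eval_map:
  assumes "rhom h" "rhom g"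
  shows "mpoly_eval g x (Poly_Mapping.map h p) = mpoly_eval (g \<circ> h) x p"
proof -
  interpret h: rhom h by fact
  interpret g: rhom g by fact
  define gh where "gh = g \<circ> h"
  have gh: "g (h c) = gh c" for c by (simp add: gh_def)
  interpret gh: rhom gh using rhom_comp[OF assms] by (simp only: gh_def)
  interpret m: rhom "Poly_Mapping.map h :: 'a mpoly \<Rightarrow> _" by (rule h.map_mpoly_rhom)
  show ?thesis unfolding gh_def[symmetric]
    by (induction p rule: mpoly_induct)
       (auto simp: gh g.mpoly_eval_add g.mpoly_eval_mult gh.mpoly_eval_add gh.mpoly_eval_mult m.hom_add m.hom_mult)
qed

lemma map_mpoly_in: "rhom h \<Longrightarrow> p \<in> polys_in V \<Longrightarrow> Poly_Mapping.map h p \<in> polys_in V"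
  by (auto simp: polys_in_def in_keys_iff rhom.lookup_map_hom rhom.hom_zero)

text \<open>A nonzero polynomial over an infinite field does not vanish everywhere: on the curve
  \<open>(y, y\<^sup>B, y\<^bsup>B^2\<^esup>, \<dots>)\<close> distinct monomials with exponents below \<open>B\<close> become distinct powers of \<open>y\<close>.\<close>

lemma digits_unique:
  fixes a b :: "nat \<Rightarrow> nat"
  assumes "\<And>i. i < n \<Longrightarrow> a i < B" "\<And>i. i < n \<Longrightarrow> b i < B"
    and "(\<Sum>i<n. a i * B ^ i) = (\<Sum>i<n. b i * B ^ i)" "i < n"
  shows "a i = b i"
  using assms
proof (induction n arbitrary: i)
  case (Suc n)
  have bound: "(\<Sum>i<n. c i * B ^ i) < B ^ n" if "\<And>i. i < n \<Longrightarrow> c i < B" for c :: "nat \<Rightarrow> nat"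
    using that
  proof (induction n)
    case (Suc n)
    have "(\<Sum>i<Suc n. c i * B ^ i) < B ^ n + c n * B ^ n" using Suc by simp
    also have "\<dots> = (1 + c n) * B ^ n" by (simp add: algebra_simps)
    also have "\<dots> \<le> B * B ^ n" using Suc.prems[of n] by (intro mult_right_mono) auto
    finally show ?case by simp
  qed simp
  have B: "B > 0" using Suc.prems(1)[of n] by simp
  have top: "(\<Sum>i<Suc n. c i * B ^ i) div B ^ n = c n"
       "(\<Sum>i<Suc n. c i * B ^ i) mod B ^ n = (\<Sum>i<n. c i * B ^ i)"
    if "\<And>i. i < Suc n \<Longrightarrow> c i < B" for c :: "nat \<Rightarrow> nat"
    using bound[of c] that B by auto
  have "a n = b n" using top(1)[of a] top(1)[of b] Suc.prems by simp
  moreover have "(\<Sum>i<n. a i * B ^ i) = (\<Sum>i<n. b i * B ^ i)"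
    using top(2)[of a] top(2)[of b] Suc.prems(1,2) Suc.prems(3)[THEN arg_cong, of "\<lambda>t. t mod B ^ n"] by simp
  ultimately show ?case using Suc.IH[of i] Suc.prems by (cases "i = n") auto
qed simp

lemma mpoly_nonvanishing_point:
  fixes p :: "'a::idom mpoly"
  assumes inf: "infinite (UNIV :: 'a set)" and p: "p \<in> polys_in {..<n}" "p \<noteq> 0"
  obtains x where "mpoly_eval id x p \<noteq> 0"
proof -
  interpret rhom "id :: 'a \<Rightarrow> 'a" by (rule rhom_id)
  define D where "D = (\<Union>m\<in>Poly_Mapping.keys p. Poly_Mapping.lookup m ` {..<n})"
  have "finite D" by (simp add: D_def)
  then obtain B where B: "\<And>d. d \<in> D \<Longrightarrow> d < B" by (meson finite_nat_set_iff_bounded)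
  define e where "e = (\<lambda>m::nat \<Rightarrow>\<^sub>0 nat. \<Sum>i<n. Poly_Mapping.lookup m i * B ^ i)"
  have inj: "inj_on e (Poly_Mapping.keys p)"
  proof (rule inj_onI)
    fix m m' assume m: "m \<in> Poly_Mapping.keys p" "m' \<in> Poly_Mapping.keys p" and em: "e m = e m'"
    have "Poly_Mapping.lookup m i = Poly_Mapping.lookup m' i" if "i < n" for i
      by (rule digits_unique[OF _ _ em[unfolded e_def] that]) (use B m in \<open>auto simp: D_def\<close>)
    moreover have "Poly_Mapping.lookup m i = Poly_Mapping.lookup m' i" if "\<not> i < n" for i
    proof -
      have "i \<notin> Poly_Mapping.keys m" "i \<notin> Poly_Mapping.keys m'" using that m p(1) by (auto simp: polys_in_def)
      then show ?thesis by (simp add: in_keys_iff)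
    qed
    ultimately show "m = m'" by (intro poly_mapping_eqI) blast
  qed
  define q where "q = (\<Sum>m\<in>Poly_Mapping.keys p. monom (Poly_Mapping.lookup p m) (e m))"
  obtain m0 where m0: "m0 \<in> Poly_Mapping.keys p" using p(2) by (metis ex_in_conv keys_eq_empty)
  have "coeff q (e m0) = (\<Sum>m\<in>Poly_Mapping.keys p. if m = m0 then Poly_Mapping.lookup p m else 0)"
    unfolding q_def coeff_sum coeff_monom using inj m0 by (intro sum.cong) (auto dest: inj_onD)
  also have "\<dots> = Poly_Mapping.lookup p m0" using m0 by simp
  finally have "q \<noteq> 0" using m0 by (auto simp: in_keys_iff)
  then have "finite {y. poly q y = 0}" by (rule poly_roots_finite)
  then obtain y where y: "poly q y \<noteq> 0" using inf by (metis (mono_tags, lifting) UNIV_eq_I mem_Collect_eq)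
  have "mpoly_eval id (\<lambda>i. y ^ (B ^ i)) p = poly q y"
  proof -
    have "mono_eval (\<lambda>i. y ^ (B ^ i)) m = y ^ e m" if "m \<in> Poly_Mapping.keys p" for m
    proof -
      have "mono_eval (\<lambda>i. y ^ (B ^ i)) m = (\<Prod>i<n. (y ^ (B ^ i)) ^ Poly_Mapping.lookup m i)"
        using that p(1) by (intro mono_eval_superset) (auto simp: polys_in_def)
      also have "\<dots> = y ^ e m" by (simp add: e_def power_sum mult.commute flip: power_mult)
      finally show ?thesis .
    qed
    then show ?thesis by (simp add: mpoly_eval_alt q_def poly_sum poly_monom)
  qed
  then show ?thesis using that[of "\<lambda>i. y ^ (B ^ i)"] y by simp
qed

section \<open>Staircase normal forms\<close>

lemma map_poly_degree_leq: "degree (map_poly f p) \<le> degree p"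
proof -
  have "degree (map_poly f p) \<le> length (map f (coeffs p)) - 1"
    unfolding map_poly_def by (metis degree_eq_length_coeffs coeffs_Poly length_strip_while_le diff_le_mono)
  then show ?thesis by (simp add: degree_eq_length_coeffs)
qed

lemma (in subring_set) monic_division:
  assumes "p \<in> polys_over B" "q \<in> polys_over B" "lead_coeff q = 1" "degree q > 0"
  shows "\<exists>a\<in>polys_over B. \<exists>r\<in>polys_over B. p = a * q + r \<and> degree r < degree q"
  using assms(1)
proof (induction "degree p" arbitrary: p rule: less_induct)
  case less
  interpret P: subring_set "polys_over B" by (rule polys_over_subring)
  show ?case
  proof (cases "degree p < degree q")
    case True
    then show ?thesis using less.prems by (intro bexI[of _ 0] bexI[of _ p]) auto
  next
    case False
    define t where "t = monom (lead_coeff p) (degree p - degree q)"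
    have t: "t \<in> polys_over B" using less.prems unfolding t_def polys_over_def by auto
    define p' where "p' = p - t * q"
    have p': "p' \<in> polys_over B" unfolding p'_def using less.prems assms(2) t by auto
    have "degree (t * q) \<le> degree p"
      using degree_mult_le[of t q] degree_monom_le[of "lead_coeff p" "degree p - degree q"] False
      unfolding t_def by linarith
    then have 1: "degree p' \<le> degree p" unfolding p'_def by (intro degree_diff_le) auto
    have "coeff (t * q) (degree p) = lead_coeff p"
      using False assms(3) by (simp add: t_def coeff_monom_mult)
    then have 2: "coeff p' (degree p) = 0" by (simp add: p'_def)
    have "degree p' < degree p"
    proof (rule ccontr)
      assume "\<not> degree p' < degree p"
      then have "degree p' = degree p" using 1 by simp
      then have "p' = 0" using 2 by (metis leading_coeff_0_iff)
      then show False using \<open>degree p' = degree p\<close> False assms(4) by simp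
    qed
    then obtain a r where "a \<in> polys_over B" "r \<in> polys_over B" "p' = a * q + r" "degree r < degree q"
      using less.hyps[OF _ p'] by blast
    then have "p = (a + t) * q + r" by (simp add: p'_def algebra_simps)
    then show ?thesis using \<open>a \<in> _\<close> \<open>r \<in> _\<close> \<open>degree r < _\<close> t by blast
  qed
qed

definition ideal_set :: "'r::comm_ring_1 set \<Rightarrow> bool" where
  "ideal_set I \<longleftrightarrow> 0 \<in> I \<and> (\<forall>x\<in>I. \<forall>y\<in>I. x + y \<in> I) \<and> (\<forall>x\<in>I. \<forall>c. c * x \<in> I)"

lemma ideal_setD:
  assumes "ideal_set I"
  shows "0 \<in> I" "x \<in> I \<Longrightarrow> y \<in> I \<Longrightarrow> x + y \<in> I" "x \<in> I \<Longrightarrow> c * x \<in> I"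
    "x \<in> I \<Longrightarrow> x * c \<in> I" "x \<in> I \<Longrightarrow> - x \<in> I" "x \<in> I \<Longrightarrow> y \<in> I \<Longrightarrow> x - y \<in> I"
proof -
  have i: "x \<in> I \<Longrightarrow> y \<in> I \<Longrightarrow> x + y \<in> I" "x \<in> I \<Longrightarrow> c * x \<in> I" for x y c
    using assms by (auto simp: ideal_set_def)
  show "0 \<in> I" using assms by (auto simp: ideal_set_def)
  show "x \<in> I \<Longrightarrow> y \<in> I \<Longrightarrow> x + y \<in> I" "x \<in> I \<Longrightarrow> c * x \<in> I" by (fact i)+
  show "x \<in> I \<Longrightarrow> x * c \<in> I" using i(2)[of x c] by (simp add: mult.commute)
  show m: "x \<in> I \<Longrightarrow> - x \<in> I" for x using i(2)[of x "-1"] by simp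
  show "x \<in> I \<Longrightarrow> y \<in> I \<Longrightarrow> x - y \<in> I" using i(1)[of x "- y"] m[of y] by simp
qed

text \<open>The variables with index in \<open>V0\<close> are parameters. Those with index in \<open>R\<close> are divided by \<open>om\<close> into
  blocks of size \<open>n\<close>, and the variables of the block of \<open>v\<close> are meant to be the \<open>n\<close> roots of the monic
  polynomial \<open>G v\<close> of degree \<open>n\<close> over the parameters.\<close>

locale staircase =
  fixes h :: "'k::field \<Rightarrow> 'o::field" and n :: nat and V0 R :: "nat set" and om :: "nat \<Rightarrow> 'c"
    and G :: "nat \<Rightarrow> 'k mpoly poly"
  assumes h: "rhom h" and n: "n > 0" and finR: "finite R" and disj: "V0 \<inter> R = {}"
    and block: "\<And>v. v \<in> R \<Longrightarrow> card {w \<in> R. om w = om v} = n"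
    and G: "\<And>v. v \<in> R \<Longrightarrow> G v \<in> polys_over (polys_in V0)"
      "\<And>v. v \<in> R \<Longrightarrow> lead_coeff (G v) = 1" "\<And>v. v \<in> R \<Longrightarrow> degree (G v) = n"
    and G_block: "\<And>v w. v \<in> R \<Longrightarrow> w \<in> R \<Longrightarrow> om v = om w \<Longrightarrow> G v = G w"
begin

sublocale h: rhom h by (rule h)

text \<open>When \<open>w\<close> runs through the roots of the block of \<open>e\<close> that are already adjoined, \<open>e\<close> is a root of
  \<open>G e\<close> divided by all \<open>T - w\<close>; this is the degree of that quotient.\<close>

definition steps :: "nat list \<Rightarrow> nat \<Rightarrow> nat" where
  "steps es e = n - card {w \<in> set es. om w = om e}"

fun NF :: "nat list \<Rightarrow> 'k mpoly set" where
  "NF [] = polys_in V0"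
| "NF (e # es) = {poly q (mpoly_var e) | q. q \<in> polys_over (NF es) \<and> degree q < steps es e}"

definition block_perms :: "(nat \<Rightarrow> nat) set" where
  "block_perms = {\<pi>. \<pi> permutes R \<and> (\<forall>v\<in>R. om (\<pi> v) = om v)}"

lemma steps_pos:
  assumes "e \<in> R" "set es \<subseteq> R" "e \<notin> set es" shows "steps es e > 0"
proof -
  have "{w \<in> set es. om w = om e} \<subset> {w \<in> R. om w = om e}" using assms by blast
  then have "card {w \<in> set es. om w = om e} < n"
    using psubset_card_mono[OF _ \<open>_ \<subset> _\<close>] finR block[OF assms(1)] by simp
  then show ?thesis by (simp add: steps_def)
qed

lemma NF_in:
  assumes "set es \<subseteq> R" "C \<in> NF es" shows "C \<in> polys_in (V0 \<union> set es)"
  using assms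
proof (induction es arbitrary: C)
  case (Cons e es)
  interpret S: subring_set "polys_in (V0 \<union> set (e # es)) :: 'k mpoly set" by (rule polys_in_subring)
  obtain q where q: "q \<in> polys_over (NF es)" "C = poly q (mpoly_var e)" using Cons.prems by auto
  have "q \<in> polys_over (polys_in (V0 \<union> set (e # es)))"
    using q(1) Cons.IH Cons.prems polys_in_mono[of "V0 \<union> set es" "V0 \<union> set (e # es)"]
    by (fastforce simp: polys_over_def)
  then show ?case unfolding q(2) by (intro S.poly_in) auto
qed auto

lemma const_in_NF:
  assumes "distinct es" "set es \<subseteq> R" "c \<in> polys_in V0" shows "c \<in> NF es"
  using assms
proof (induction es arbitrary: c)
  case (Cons e es)
  have 0: "0 \<in> NF es"
    using Cons.IH[of 0] Cons.prems subring_set.zero[OF polys_in_subring] by auto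
  have "[:c:] \<in> polys_over (NF es)" using Cons 0 by (auto simp: polys_over_def coeff_pCons split: nat.splits)
  moreover have "degree [:c:] < steps es e" using steps_pos Cons.prems by simp
  ultimately show ?case by (auto intro!: exI[of _ "[:c:]"])
qed auto

text \<open>This is the argument behind Cauchy moduli. Dividing \<open>G e\<close> successively by \<open>T - X_b\<close> for the earlier
  roots \<open>b\<close> of the block leaves, modulo \<open>I\<close>, a monic relation for \<open>X_e\<close> of degree \<open>steps es e\<close>. The
  hypothesis \<open>cancel\<close> says that different roots of a block remain different modulo \<open>I\<close>, which is what
  makes the divisions possible.\<close>

lemma normal_form:
  fixes I :: "'k mpoly set"
  assumes I: "ideal_set I"
    and rel: "\<And>v. v \<in> R \<Longrightarrow> poly (G v) (mpoly_var v) \<in> I"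
    and cancel: "\<And>v w p. v \<in> R \<Longrightarrow> w \<in> R \<Longrightarrow> v \<noteq> w \<Longrightarrow> om v = om w \<Longrightarrow>
       (mpoly_var v - mpoly_var w) * p \<in> I \<Longrightarrow> p \<in> I"
    and es: "distinct es" "set es \<subseteq> R"
  shows "subring_set {p. \<exists>C\<in>NF es. p - C \<in> I} \<and> polys_in V0 \<subseteq> {p. \<exists>C\<in>NF es. p - C \<in> I} \<and>
    mpoly_var ` set es \<subseteq> {p. \<exists>C\<in>NF es. p - C \<in> I}"
  using es
proof (induction es)
  case Nil
  interpret S: subring_set "polys_in V0 :: 'k mpoly set" by (rule polys_in_subring)
  note i = ideal_setD[OF I]
  have "subring_set {p. \<exists>C\<in>polys_in V0. p - C \<in> I}"
  proof (unfold_locales, goal_cases)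
    case 1 show ?case using i(1) S.zero by force
  next
    case 2 show ?case using i(1) S.one by force
  next
    case (3 x y)
    then obtain a b where ab: "a \<in> polys_in V0" "b \<in> polys_in V0" "x - a \<in> I" "y - b \<in> I" by blast
    have "(x + y) - (a + b) \<in> I" using i(2)[OF ab(3,4)] by (simp add: algebra_simps)
    then show ?case using ab by blast
  next
    case (4 x y)
    then obtain a b where ab: "a \<in> polys_in V0" "b \<in> polys_in V0" "x - a \<in> I" "y - b \<in> I" by blast
    have "y * (x - a) + a * (y - b) \<in> I" using i ab by blast
    then have "x * y - a * b \<in> I" by (simp add: algebra_simps)
    then show ?case using ab by blast
  next
    case (5 x)
    then obtain a where ab: "a \<in> polys_in V0" "x - a \<in> I" by blast
    have "- x - (- a) \<in> I" using i(5)[OF ab(2)] by (simp add: algebra_simps)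
    then show ?case using ab by blast
  qed
  then show ?case using i(1) by auto (metis diff_self)
next
  case (Cons e es)
  note i = ideal_setD[OF I]
  have eR: "e \<in> R" "e \<notin> set es" "set es \<subseteq> R" using Cons.prems by auto
  define U where "U = {p. \<exists>C\<in>NF es. p - C \<in> I}"
  have IH: "subring_set U" "polys_in V0 \<subseteq> U" "mpoly_var ` set es \<subseteq> U"
    using Cons unfolding U_def by auto
  interpret U: subring_set U by (rule IH)
  interpret UP: subring_set "polys_over U" by (rule U.polys_over_subring)
  define d where "d = steps es e"
  have d0: "d > 0" using steps_pos eR d_def by simp
  define xe where "xe = (mpoly_var e :: 'k mpoly)"

  \<comment> \<open>\<open>r\<close> is \<open>G e\<close> divided by \<open>T - X_b\<close> for all \<open>b\<close> in \<open>bs\<close>\<close>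
  have "\<exists>r\<in>polys_over U. lead_coeff r = 1 \<and> degree r = n - length bs \<and>
      (\<forall>v\<in>R. om v = om e \<longrightarrow> v \<notin> set bs \<longrightarrow> poly r (mpoly_var v) \<in> I)"
    if "distinct bs" "set bs \<subseteq> {w \<in> set es. om w = om e}" "length bs \<le> n" for bs
    using that
  proof (induction bs)
    case Nil
    have "poly (G e) (mpoly_var v) \<in> I" if "v \<in> R" "om v = om e" for v
      using rel[OF that(1)] G_block[OF that(1) eR(1) that(2)] by simp
    then show ?case using G[OF eR(1)] polys_over_mono[OF IH(2)]
      by (intro bexI[of _ "G e"]) auto
  next
    case (Cons b bs)
    then obtain r where r: "r \<in> polys_over U" "lead_coeff r = 1" "degree r = n - length bs"
      "\<And>v. v \<in> R \<Longrightarrow> om v = om e \<Longrightarrow> v \<notin> set bs \<Longrightarrow> poly r (mpoly_var v) \<in> I" by auto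
    define s where "s = synthetic_div r (mpoly_var b)"
    have bU: "mpoly_var b \<in> U" using Cons.prems IH(3) by auto
    have sU: "s \<in> polys_over U" unfolding s_def by (rule U.synthetic_div_polys_over[OF r(1) bU])
    have dr: "degree r > 0" using r(3) Cons.prems by auto
    have ds: "degree s = n - length (b # bs)" unfolding s_def degree_synthetic_div using r(3) by simp
    have rs: "r = [:- mpoly_var b, 1:] * s + [:poly r (mpoly_var b):]"
      unfolding s_def by (simp only: synthetic_div_correct')
    have "degree r = Suc (degree s)" using dr ds r(3) Cons.prems by simp
    then have "lead_coeff r = coeff ([:- mpoly_var b, 1:] * s + [:poly r (mpoly_var b):]) (Suc (degree s))"
      using rs by simp
    also have "\<dots> = lead_coeff s" by (simp add: coeff_eq_0)
    finally have ls: "lead_coeff s = 1" using r(2) by simp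
    have "poly s (mpoly_var v) \<in> I" if v: "v \<in> R" "om v = om e" "v \<notin> set (b # bs)" for v
    proof (rule cancel)
      show "v \<in> R" "b \<in> R" "v \<noteq> b" "om v = om b" using v Cons.prems eR by auto
      have "poly r (mpoly_var v) = (mpoly_var v - mpoly_var b) * poly s (mpoly_var v) + poly r (mpoly_var b)"
        by (subst rs) (simp add: algebra_simps)
      then have "(mpoly_var v - mpoly_var b) * poly s (mpoly_var v) = poly r (mpoly_var v) - poly r (mpoly_var b)"
        by simp
      also have "\<dots> \<in> I" using v Cons.prems eR by (intro i r(4)) auto
      finally show "(mpoly_var v - mpoly_var b) * poly s (mpoly_var v) \<in> I" .
    qed
    then show ?case using sU ls ds by blast
  qed
  note rel_ex = this
  obtain bs where bs: "distinct bs" "set bs = {w \<in> set es. om w = om e}"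
    using finite_distinct_list[of "{w \<in> set es. om w = om e}"] by auto
  have "length bs = card {w \<in> set es. om w = om e}" using distinct_card[OF bs(1)] bs(2) by simp
  then have lbs: "n - length bs = d" "length bs \<le> n" using d0 unfolding d_def steps_def by auto
  obtain r where r: "r \<in> polys_over U" "lead_coeff r = 1" "degree r = d" "poly r xe \<in> I"
    using rel_ex[OF bs(1) _ lbs(2)] bs(2) lbs(1) eR xe_def by auto
  define W where "W = {p. \<exists>q\<in>polys_over U. degree q < d \<and> p - poly q xe \<in> I}"
  have red: "p \<in> W" if q: "q \<in> polys_over U" "p - poly q xe \<in> I" for p q
  proof -
    obtain a b where ab: "a \<in> polys_over U" "b \<in> polys_over U" "q = a * r + b" "degree b < d"
      using U.monic_division[OF q(1) r(1,2)] r(3) d0 by auto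
    have "p - poly q xe + poly a xe * poly r xe \<in> I" using i q r(4) by blast
    then have "p - poly b xe \<in> I" using ab(3) by (simp add: algebra_simps)
    then show ?thesis using ab unfolding W_def by blast
  qed
  have W: "W = {p. \<exists>C\<in>NF (e # es). p - C \<in> I}"
  proof (intro subset_antisym subsetI)
    fix p assume "p \<in> W"
    then obtain q where q: "q \<in> polys_over U" "degree q < d" "p - poly q xe \<in> I" unfolding W_def by blast
    have "\<exists>C. C \<in> NF es \<and> coeff q j - C \<in> I" for j using q(1) by (auto simp: polys_over_def U_def)
    then obtain C where C: "\<And>j. C j \<in> NF es" "\<And>j. coeff q j - C j \<in> I" by metis
    define q' where "q' = (\<Sum>j<d. monom (C j) j)"
    have cq': "coeff q' j = (if j < d then C j else 0)" for j
      by (simp add: q'_def coeff_sum coeff_monom)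
    have "0 \<in> NF es" using const_in_NF Cons.prems subring_set.zero[OF polys_in_subring] by auto
    then have "q' \<in> polys_over (NF es)" using C(1) by (auto simp: polys_over_def cq')
    moreover have "degree q' < d" using d0 by (intro degree_lessI) (auto simp: cq')
    ultimately have "poly q' xe \<in> NF (e # es)" by (auto simp: xe_def d_def)
    moreover have "poly q xe - poly q' xe \<in> I"
    proof -
      have "poly q xe = (\<Sum>j<d. coeff q j * xe ^ j)"
        unfolding poly_altdef using q(2) by (intro sum.mono_neutral_left) (auto simp: coeff_eq_0)
      then have "poly q xe - poly q' xe = (\<Sum>j<d. (coeff q j - C j) * xe ^ j)"
        by (simp add: q'_def poly_sum poly_monom sum_subtractf left_diff_distrib)
      moreover have "sum f A \<in> I" if "\<And>j. j \<in> A \<Longrightarrow> f j \<in> I" for f :: "nat \<Rightarrow> _" and A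
        using that by (induction A rule: infinite_finite_induct) (auto simp: i)
      ultimately show ?thesis using C(2) i(4) by auto
    qed
    from i(2)[OF q(3) this] have "p - poly q' xe \<in> I" by (simp only: diff_add_cancel add_diff_eq)
    ultimately show "p \<in> {p. \<exists>C\<in>NF (e # es). p - C \<in> I}" by blast
  next
    fix p assume "p \<in> {p. \<exists>C\<in>NF (e # es). p - C \<in> I}"
    then obtain q where q: "q \<in> polys_over (NF es)" "degree q < d" "p - poly q xe \<in> I"
      by (auto simp: xe_def d_def)
    have "NF es \<subseteq> U" using i(1) unfolding U_def by force
    then show "p \<in> W" using q polys_over_mono unfolding W_def by blast
  qed
  have UW: "U \<subseteq> W"
  proof
    fix p assume "p \<in> U"
    then show "p \<in> W" using i(1) by (intro red[of "[:p:]"]) auto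
  qed
  have xeW: "xe \<in> W" using i(1) by (intro red[of "[:0,1:]"]) auto
  have "subring_set W"
  proof (unfold_locales, goal_cases)
    case 1 show ?case using UW by auto
  next
    case 2 show ?case using UW by auto
  next
    case (3 x y)
    then obtain a b where ab: "a \<in> polys_over U" "b \<in> polys_over U" "x - poly a xe \<in> I" "y - poly b xe \<in> I"
      unfolding W_def by blast
    have "(x + y) - poly (a + b) xe \<in> I" using i(2)[OF ab(3,4)] by (simp add: algebra_simps)
    then show ?case using ab by (intro red[of "a + b"]) auto
  next
    case (4 x y)
    then obtain a b where ab: "a \<in> polys_over U" "b \<in> polys_over U" "x - poly a xe \<in> I" "y - poly b xe \<in> I"
      unfolding W_def by blast
    have "y * (x - poly a xe) + poly a xe * (y - poly b xe) \<in> I" using i ab by blast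
    then have "x * y - poly (a * b) xe \<in> I" by (simp add: algebra_simps)
    then show ?case using ab by (intro red[of "a * b"]) auto
  next
    case (5 x)
    then obtain a where ab: "a \<in> polys_over U" "x - poly a xe \<in> I" unfolding W_def by blast
    have "- x - poly (- a) xe \<in> I" using i(5)[OF ab(2)] by (simp add: algebra_simps)
    then show ?case using ab by (intro red[of "- a"]) auto
  qed
  then show ?case using W UW IH xeW xe_def by auto
qed

lemma normal_form_exists:
  assumes "ideal_set I"
    and "\<And>v. v \<in> R \<Longrightarrow> poly (G v) (mpoly_var v) \<in> I"
    and "\<And>v w p. v \<in> R \<Longrightarrow> w \<in> R \<Longrightarrow> v \<noteq> w \<Longrightarrow> om v = om w \<Longrightarrow>
       (mpoly_var v - mpoly_var w) * p \<in> I \<Longrightarrow> p \<in> I"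
    and es: "distinct es" "set es = R" and p: "p \<in> polys_in (V0 \<union> R)"
  shows "\<exists>C\<in>NF es. p - C \<in> I"
proof -
  define W where "W = {p. \<exists>C\<in>NF es. p - C \<in> I}"
  have W: "subring_set W" "polys_in V0 \<subseteq> W" "mpoly_var ` R \<subseteq> W"
    using normal_form[OF assms(1-3) es(1)] es(2) unfolding W_def by auto
  interpret W: subring_set W by (rule W)
  have "p \<in> W" using p
    by (induction rule: polys_in_induct) (use W(2,3) in auto)
  then show ?thesis by (simp add: W_def)
qed

definition sep_on_blocks :: "(nat \<Rightarrow> 'o) \<Rightarrow> bool" where
  "sep_on_blocks pt \<longleftrightarrow> (\<forall>v\<in>R. \<forall>w\<in>R. om v = om w \<longrightarrow> pt v = pt w \<longrightarrow> v = w)"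

text \<open>A set of reorderings of the roots that is closed under composition with transpositions inside blocks;
  it will consist of those which preserve the relations satisfied by a point.\<close>

definition swap_closed :: "(nat \<Rightarrow> nat) set \<Rightarrow> bool" where
  "swap_closed Gs \<longleftrightarrow> Gs \<subseteq> block_perms \<and>
     (\<forall>\<pi>\<in>Gs. \<forall>v\<in>R. \<forall>w\<in>R. om v = om w \<longrightarrow> \<pi> \<circ> Transposition.transpose v w \<in> Gs)"

lemma transpose_in_block_perms:
  "v \<in> R \<Longrightarrow> w \<in> R \<Longrightarrow> om v = om w \<Longrightarrow> Transposition.transpose v w \<in> block_perms"
  unfolding block_perms_def by (auto intro: permutes_swap_id simp: Transposition.transpose_def)

lemma block_perms_comp: "\<pi> \<in> block_perms \<Longrightarrow> \<rho> \<in> block_perms \<Longrightarrow> \<pi> \<circ> \<rho> \<in> block_perms"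
  unfolding block_perms_def by (auto intro: permutes_compose simp: permutes_in_image)

lemma block_perms_id: "id \<in> block_perms"
  unfolding block_perms_def by (auto simp: permutes_id)

lemma block_perms_inv: "\<pi> \<in> block_perms \<Longrightarrow> inv_into UNIV \<pi> \<in> block_perms"
  unfolding block_perms_def mem_Collect_eq
  by (metis permutes_inv permutes_in_image permutes_inverses(1))

lemma block_perms_finite: "finite block_perms"
  by (rule finite_subset[OF _ finite_permutations[OF finR]]) (auto simp: block_perms_def)

lemma swap_closed_block_perms: "swap_closed block_perms"
  unfolding swap_closed_def using block_perms_comp transpose_in_block_perms by blast

lemma block_perms_fixes: "\<pi> \<in> block_perms \<Longrightarrow> v \<notin> R \<Longrightarrow> \<pi> v = v"
  unfolding block_perms_def by (auto simp: permutes_not_in)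

lemma const_invariant:
  assumes "\<pi> \<in> block_perms" "c \<in> polys_in V0" shows "mpoly_eval h (pt \<circ> \<pi>) c = mpoly_eval h pt c"
proof (rule h.mpoly_eval_cong[OF assms(2)])
  fix i assume "i \<in> V0"
  then have "\<pi> i = i" using block_perms_fixes[OF assms(1)] disj by blast
  then show "(pt \<circ> \<pi>) i = pt i" by simp
qed

text \<open>The polynomial \<open>q(T) - b\<close>, with coefficients evaluated at \<open>pt \<circ> \<pi>\<close>, vanishes at the value of every root
  of the block that is not used by \<open>es\<close>, because such a root can be swapped into the place of \<open>e\<close> without
  changing the coefficients. There are \<open>steps es e\<close> such roots, more than the degree.\<close>

lemma staircase_step:
  assumes pt: "sep_on_blocks pt" and cl: "swap_closed Gs"
    and e: "e \<in> R" "e \<notin> set es" "set es \<subseteq> R"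
    and q: "q \<in> polys_over (NF es)" "degree q < steps es e"
    and val: "\<And>\<pi>. \<pi> \<in> Gs \<Longrightarrow> mpoly_eval h (pt \<circ> \<pi>) (poly q (mpoly_var e)) = b"
    and \<pi>: "\<pi> \<in> Gs"
  shows "mpoly_eval h (pt \<circ> \<pi>) (coeff q i) = (if i = 0 then b else 0)"
proof -
  define Q where "Q = map_poly (mpoly_eval h (pt \<circ> \<pi>)) q"
  have \<pi>g: "\<pi> \<in> block_perms" using cl \<pi> by (auto simp: swap_closed_def)
  then have per: "\<pi> permutes R" and pom: "\<And>v. v \<in> R \<Longrightarrow> om (\<pi> v) = om v" by (auto simp: block_perms_def)
  define F where "F = {w \<in> R. om w = om e} - \<pi> ` set es"
  have root: "poly (Q - [:b:]) (pt f) = 0" if f: "f \<in> F" for f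
  proof -
    define w where "w = inv_into UNIV \<pi> f"
    have w: "\<pi> w = f" "w \<in> R" "w \<notin> set es" "om w = om e"
    proof -
      show 1: "\<pi> w = f" unfolding w_def using per by (simp add: permutes_inverses)
      show 2: "w \<in> R" using 1 f per by (metis (no_types, lifting) DiffD1 F_def mem_Collect_eq permutes_in_image)
      show "w \<notin> set es" using 1 f by (auto simp: F_def)
      show "om w = om e" using 1 2 f pom by (auto simp: F_def)
    qed
    define \<pi>' where "\<pi>' = \<pi> \<circ> Transposition.transpose e w"
    have \<pi>': "\<pi>' \<in> Gs" unfolding \<pi>'_def using cl \<pi> e w by (auto simp: swap_closed_def)
    have agree: "\<pi>' v = \<pi> v" if "v \<in> V0 \<union> set es" for v
      using that w e disj by (auto simp: \<pi>'_def Transposition.transpose_def)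
    have "\<pi>' e = f" using w by (simp add: \<pi>'_def)
    have same: "mpoly_eval h (pt \<circ> \<pi>') (coeff q j) = mpoly_eval h (pt \<circ> \<pi>) (coeff q j)" for j
      by (rule h.mpoly_eval_cong[of _ "V0 \<union> set es"])
         (use q(1) NF_in[OF e(3)] agree in \<open>auto simp: polys_over_def\<close>)
    have "map_poly (mpoly_eval h (pt \<circ> \<pi>')) q = Q"
      unfolding Q_def by (intro poly_eqI) (simp add: coeff_map_poly same)
    then have "poly Q (pt f) = mpoly_eval h (pt \<circ> \<pi>') (poly q (mpoly_var e))"
      using rhom.poly_map_poly_hom[OF h.mpoly_eval_rhom, of "pt \<circ> \<pi>'" q "mpoly_var e"] \<open>\<pi>' e = f\<close> by simp
    then show ?thesis using val[OF \<pi>'] by simp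
  qed
  have cardF: "card F = steps es e"
  proof -
    have "card F = card {w \<in> R. om w = om e} - card ({w \<in> R. om w = om e} \<inter> \<pi> ` set es)"
      unfolding F_def by (rule card_Diff_subset_Int) simp
    moreover have "{w \<in> R. om w = om e} \<inter> \<pi> ` set es = \<pi> ` {w \<in> set es. om w = om e}"
      using pom e permutes_in_image[OF per] by auto
    moreover have "card (\<pi> ` {w \<in> set es. om w = om e}) = card {w \<in> set es. om w = om e}"
      by (rule card_image) (metis per permutes_inj inj_on_subset subset_UNIV)
    ultimately show ?thesis using block[OF e(1)] by (simp add: steps_def)
  qed
  have "inj_on pt F" using pt by (auto simp: sep_on_blocks_def inj_on_def F_def)
  have degQ: "degree Q < steps es e" using q(2) 
    unfolding Q_def using map_poly_degree_leq[of "mpoly_eval h (pt \<circ> \<pi>)" q] by linarith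
  have "Q - [:b:] = 0"
  proof (rule ccontr)
    assume *: "Q - [:b:] \<noteq> 0"
    have "card (pt ` F) \<le> card {x. poly (Q - [:b:]) x = 0}"
      using root by (intro card_mono poly_roots_finite[OF *]) auto
    also have "\<dots> \<le> degree (Q - [:b:])" by (rule card_poly_roots_bound[OF *])
    also have "\<dots> < steps es e" using degree_diff_le_max[of Q "[:b:]"] degQ by simp
    finally show False using card_image[OF \<open>inj_on pt F\<close>] cardF by simp
  qed
  then have "coeff Q i = coeff [:b:] i" by simp
  then show ?thesis by (simp add: Q_def coeff_map_poly coeff_pCons split: nat.splits)
qed

text \<open>A polynomial whose values do not depend on the order of the roots is one in the parameters: by
  \<open>staircase_step\<close> only the constant term of its normal form survives at each stage.\<close>

lemma orbit_constant_value:
  assumes "distinct es" "set es \<subseteq> R" "C \<in> NF es"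
  obtains c where "c \<in> polys_in V0"
    "\<And>pt b. sep_on_blocks pt \<Longrightarrow> (\<And>\<pi>. \<pi> \<in> block_perms \<Longrightarrow> mpoly_eval h (pt \<circ> \<pi>) C = b) \<Longrightarrow> mpoly_eval h pt c = b"
  using assms
proof (induction es arbitrary: C thesis)
  case Nil
  then show ?case using block_perms_id by (metis NF.simps(1) comp_id)
next
  case (Cons e es)
  obtain q where q: "q \<in> polys_over (NF es)" "degree q < steps es e" "C = poly q (mpoly_var e)"
    using Cons.prems by auto
  obtain c where c: "c \<in> polys_in V0" "\<And>pt b. sep_on_blocks pt \<Longrightarrow>
      (\<And>\<pi>. \<pi> \<in> block_perms \<Longrightarrow> mpoly_eval h (pt \<circ> \<pi>) (coeff q 0) = b) \<Longrightarrow> mpoly_eval h pt c = b"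
  proof (rule Cons.IH)
    show "distinct es" "set es \<subseteq> R" "coeff q 0 \<in> NF es" using Cons.prems q(1) by (auto simp: polys_over_def)
  qed blast
  have e: "e \<in> R" "e \<notin> set es" "set es \<subseteq> R" using Cons.prems by auto
  show ?case
  proof (rule Cons.prems(1)[OF c(1)])
    fix pt b assume *: "sep_on_blocks pt" "\<And>\<pi>. \<pi> \<in> block_perms \<Longrightarrow> mpoly_eval h (pt \<circ> \<pi>) C = b"
    show "mpoly_eval h pt c = b"
    proof (rule c(2)[OF *(1)])
      fix \<pi> assume "\<pi> \<in> block_perms"
      from staircase_step[OF *(1) swap_closed_block_perms e q(1,2) *(2)[unfolded q(3)] this, of 0]
      show "mpoly_eval h (pt \<circ> \<pi>) (coeff q 0) = b" by simp
    qed
  qed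
qed

text \<open>A normal form that vanishes at enough reorderings of one point with independent parameters is zero.
  Hence the normal forms of \<open>normal_form_exists\<close> are unique, and the relations \<open>G v\<close> generate all
  relations of the point.\<close>

lemma vanishing_normal_form:
  assumes "distinct es" "set es \<subseteq> R" "C \<in> NF es"
    and pt: "sep_on_blocks pt" and cl: "swap_closed Gs" "id \<in> Gs"
    and indep: "\<And>c. c \<in> polys_in V0 \<Longrightarrow> mpoly_eval h pt c = 0 \<Longrightarrow> c = 0"
    and val: "\<And>\<pi>. \<pi> \<in> Gs \<Longrightarrow> mpoly_eval h (pt \<circ> \<pi>) C = 0"
  shows "C = 0"
  using assms(1-3) val
proof (induction es arbitrary: C)
  case Nil
  then show ?case using indep[of C] cl(2) by (metis NF.simps(1) comp_id)
next
  case (Cons e es)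
  obtain q where q: "q \<in> polys_over (NF es)" "degree q < steps es e" "C = poly q (mpoly_var e)"
    using Cons.prems by auto
  have "coeff q i = 0" for i
  proof (rule Cons.IH)
    show "distinct es" "set es \<subseteq> R" "coeff q i \<in> NF es" using Cons.prems q(1) by (auto simp: polys_over_def)
    have e: "e \<in> R" "e \<notin> set es" "set es \<subseteq> R" using Cons.prems by auto
    show "mpoly_eval h (pt \<circ> \<pi>) (coeff q i) = 0" if "\<pi> \<in> Gs" for \<pi>
      using staircase_step[OF pt cl(1) e q(1,2) Cons.prems(4)[unfolded q(3)] that, of i] by simp
  qed
  then have "q = 0" by (intro poly_eqI) simp
  then show ?case using q(3) by simp
qed

definition on_variety :: "(nat \<Rightarrow> 'o) \<Rightarrow> bool" where
  "on_variety pt \<longleftrightarrow> sep_on_blocks pt \<and> (\<forall>v\<in>R. mpoly_eval h pt (poly (G v) (mpoly_var v)) = 0)"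

lemma on_variety_perm:
  assumes "on_variety pt" "\<pi> \<in> block_perms" shows "on_variety (pt \<circ> \<pi>)"
proof -
  have per: "\<pi> permutes R" and pom: "\<And>v. v \<in> R \<Longrightarrow> om (\<pi> v) = om v"
    using assms(2) by (auto simp: block_perms_def)
  have "mpoly_eval h (pt \<circ> \<pi>) (poly (G v) (mpoly_var v)) = 0" if v: "v \<in> R" for v
  proof -
    have 1: "mpoly_eval h x (poly (G v) (mpoly_var w)) = poly (map_poly (mpoly_eval h x) (G v)) (x w)" for x w
      using rhom.poly_map_poly_hom[OF h.mpoly_eval_rhom, of x "G v" "mpoly_var w"] by simp
    have 2: "\<pi> v \<in> R" using v per by (simp add: permutes_in_image)
    have 3: "map_poly (mpoly_eval h (pt \<circ> \<pi>)) (G v) = map_poly (mpoly_eval h pt) (G v)"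
      using G(1)[OF v] const_invariant[OF assms(2)]
      by (intro poly_eqI) (simp add: coeff_map_poly polys_over_def del: comp_apply)
    have "mpoly_eval h (pt \<circ> \<pi>) (poly (G v) (mpoly_var v)) = mpoly_eval h pt (poly (G v) (mpoly_var (\<pi> v)))"
      unfolding 1 3 by simp
    moreover have "G v = G (\<pi> v)" by (rule G_block[OF v 2]) (use pom v in simp)
    ultimately show ?thesis using assms(1) 2 by (simp add: on_variety_def)
  qed
  moreover have "sep_on_blocks (pt \<circ> \<pi>)"
    unfolding sep_on_blocks_def
  proof (intro ballI impI)
    fix v w assume "v \<in> R" "w \<in> R" "om v = om w" "(pt \<circ> \<pi>) v = (pt \<circ> \<pi>) w"
    moreover from this have "\<pi> v \<in> R" "\<pi> w \<in> R" using per by (simp_all add: permutes_in_image)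
    ultimately have "\<pi> v = \<pi> w" using assms(1) pom by (auto simp: on_variety_def sep_on_blocks_def)
    then show "v = w" using per by (metis permutes_inverses(2))
  qed
  ultimately show ?thesis by (auto simp: on_variety_def)
qed

text \<open>The theorem on symmetric functions, simultaneously for all blocks.\<close>

lemma symmetric_value:
  assumes p: "p \<in> polys_in (V0 \<union> R)"
  obtains c where "c \<in> polys_in V0" "\<And>pt b. on_variety pt \<Longrightarrow>
    (\<And>\<pi>. \<pi> \<in> block_perms \<Longrightarrow> mpoly_eval h (pt \<circ> \<pi>) p = b) \<Longrightarrow> mpoly_eval h pt c = b"
proof -
  define I where "I = {p. \<forall>pt. on_variety pt \<longrightarrow> mpoly_eval h pt p = 0}"
  have I: "ideal_set I" by (auto simp: ideal_set_def I_def h.mpoly_eval_add h.mpoly_eval_mult)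
  obtain es where es: "distinct es" "set es = R" using finite_distinct_list[OF finR] by blast
  have "\<exists>C\<in>NF es. p - C \<in> I"
  proof (rule normal_form_exists[OF I _ _ es p])
    fix v assume "v \<in> R" then show "poly (G v) (mpoly_var v) \<in> I" by (auto simp: I_def on_variety_def)
  next
    fix v w p assume vw: "v \<in> R" "w \<in> R" "v \<noteq> w" "om v = om w" "(mpoly_var v - mpoly_var w) * p \<in> I"
    have "mpoly_eval h pt p = 0" if pt: "on_variety pt" for pt
    proof -
      have "(pt v - pt w) * mpoly_eval h pt p = 0"
        using vw(5) pt by (auto simp: I_def h.mpoly_eval_mult h.mpoly_eval_diff)
      moreover have "pt v \<noteq> pt w" using pt vw by (auto simp: on_variety_def sep_on_blocks_def)
      ultimately show ?thesis by simp
    qed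
    then show "p \<in> I" by (auto simp: I_def)
  qed
  then obtain C where C: "C \<in> NF es" "p - C \<in> I" by blast
  obtain c where c: "c \<in> polys_in V0" "\<And>pt b. sep_on_blocks pt \<Longrightarrow>
      (\<And>\<pi>. \<pi> \<in> block_perms \<Longrightarrow> mpoly_eval h (pt \<circ> \<pi>) C = b) \<Longrightarrow> mpoly_eval h pt c = b"
    using orbit_constant_value[OF es(1) _ C(1)] es(2) by blast
  show ?thesis
  proof (rule that[OF c(1)])
    fix pt b assume *: "on_variety pt" "\<And>\<pi>. \<pi> \<in> block_perms \<Longrightarrow> mpoly_eval h (pt \<circ> \<pi>) p = b"
    show "mpoly_eval h pt c = b"
    proof (rule c(2))
      show "sep_on_blocks pt" using * by (simp add: on_variety_def)
      fix \<pi> assume \<pi>: "\<pi> \<in> block_perms"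
      have "mpoly_eval h (pt \<circ> \<pi>) (p - C) = 0" using C(2) on_variety_perm[OF *(1) \<pi>] unfolding I_def by blast
      then show "mpoly_eval h (pt \<circ> \<pi>) C = b" using *(2)[OF \<pi>] by (simp add: h.mpoly_eval_diff del: comp_apply)
    qed
  qed
qed

text \<open>A combination \<open>p + l r\<close> with a general constant \<open>l\<close> avoids the zeros of both \<open>p\<close> and \<open>r\<close>.\<close>

lemma avoid_points:
  assumes inf: "infinite (UNIV :: 'k set)" and "finite F"
    and "\<And>x. x \<in> F \<Longrightarrow> \<exists>p\<in>polys_in W. mpoly_eval h pt p = 0 \<and> mpoly_eval h x p \<noteq> 0"
  shows "\<exists>p\<in>polys_in W. mpoly_eval h pt p = 0 \<and> (\<forall>x\<in>F. mpoly_eval h x p \<noteq> 0)"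
  using assms(2,3)
proof (induction F)
  case empty
  show ?case by (intro bexI[of _ 0]) (auto simp: subring_set.zero[OF polys_in_subring])
next
  case (insert x F)
  interpret S: subring_set "polys_in W :: 'k mpoly set" by (rule polys_in_subring)
  obtain p where p: "p \<in> polys_in W" "mpoly_eval h pt p = 0" "\<And>x. x \<in> F \<Longrightarrow> mpoly_eval h x p \<noteq> 0"
    using insert by blast
  obtain r where r: "r \<in> polys_in W" "mpoly_eval h pt r = 0" "mpoly_eval h x r \<noteq> 0" using insert.prems by blast
  define bad where "bad = (\<Union>y\<in>insert x F. {l. mpoly_eval h y p + h l * mpoly_eval h y r = 0})"
  have "finite {l. mpoly_eval h y p + h l * mpoly_eval h y r = 0}" if y: "y \<in> insert x F" for y
  proof (cases "mpoly_eval h y r = 0")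
    case True
    then show ?thesis using p(3) r(3) y by auto
  next
    case False
    have "{l. mpoly_eval h y p + h l * mpoly_eval h y r = 0} \<subseteq> h -` {- mpoly_eval h y p / mpoly_eval h y r}"
      using False by (auto simp: field_simps eq_neg_iff_add_eq_0)
    moreover have "inj h" using rhom_inj[OF h] by (auto simp: inj_on_def)
    ultimately show ?thesis using finite_vimageI finite_subset by (metis finite.emptyI finite.insertI)
  qed
  then have "finite bad" unfolding bad_def using insert.hyps by blast
  then obtain l where l: "l \<notin> bad" using inf by (metis UNIV_eq_I)
  show ?case
    by (rule bexI[of _ "p + mpoly_const l * r"])
       (use l p r in \<open>auto simp: bad_def h.mpoly_eval_add h.mpoly_eval_mult\<close>)
qed

lemma rename_in:
  assumes "\<pi> \<in> block_perms" "p \<in> polys_in (V0 \<union> R)" shows "mpoly_rename \<pi> p \<in> polys_in (V0 \<union> R)"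
  unfolding mpoly_rename_def
proof (rule mpoly_subst_in[OF assms(2)])
  fix i assume "i \<in> V0 \<union> R"
  moreover have "\<pi> permutes R" using assms(1) by (simp add: block_perms_def)
  ultimately have "\<pi> i \<in> V0 \<union> R" using block_perms_fixes[OF assms(1)] disj permutes_in_image[of \<pi> R i] by auto
  then show "mpoly_var (\<pi> i) \<in> polys_in (V0 \<union> R)" by auto
qed

text \<open>Specialisations of the parameters extend to the roots, in at least one ordering. If no ordering worked,
  \<open>avoid_points\<close> would give one relation of \<open>pt\<close> that fails for all of them; the product of its
  reorderings is symmetric, hence a polynomial in the parameters, which must specialise to \<open>0\<close>.\<close>

lemma transport:
  assumes inf: "infinite (UNIV :: 'k set)" and pt: "on_variety pt" "on_variety pt'"
    and base: "\<And>c. c \<in> polys_in V0 \<Longrightarrow> mpoly_eval h pt c = 0 \<Longrightarrow> mpoly_eval h pt' c = 0"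
  shows "\<exists>\<pi>\<in>block_perms. \<forall>p\<in>polys_in (V0 \<union> R). mpoly_eval h pt p = 0 \<longrightarrow> mpoly_eval h (pt' \<circ> \<pi>) p = 0"
proof (rule ccontr)
  assume "\<not> ?thesis"
  then have *: "\<exists>p\<in>polys_in (V0 \<union> R). mpoly_eval h pt p = 0 \<and> mpoly_eval h x p \<noteq> 0"
    if "x \<in> (\<lambda>\<pi>. pt' \<circ> \<pi>) ` block_perms" for x using that by blast
  obtain p where p: "p \<in> polys_in (V0 \<union> R)" "mpoly_eval h pt p = 0"
    "\<And>\<pi>. \<pi> \<in> block_perms \<Longrightarrow> mpoly_eval h (pt' \<circ> \<pi>) p \<noteq> 0"
    using avoid_points[OF inf finite_imageI[OF block_perms_finite] *] by blast
  interpret S: subring_set "polys_in (V0 \<union> R) :: 'k mpoly set" by (rule polys_in_subring)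
  define N where "N = (\<Prod>\<pi>\<in>block_perms. mpoly_rename \<pi> p)"
  have N: "N \<in> polys_in (V0 \<union> R)" unfolding N_def using rename_in p(1) by blast
  have EN: "mpoly_eval h x N = (\<Prod>\<pi>\<in>block_perms. mpoly_eval h (x \<circ> \<pi>) p)" for x
    unfolding N_def by (simp add: h.mpoly_eval_prod)
  have inv: "mpoly_eval h (x \<circ> \<rho>) N = mpoly_eval h x N" if \<rho>: "\<rho> \<in> block_perms" for x \<rho>
    unfolding EN
  proof (rule prod.reindex_bij_witness[of _ "\<lambda>\<pi>. inv_into UNIV \<rho> \<circ> \<pi>" "\<lambda>\<pi>. \<rho> \<circ> \<pi>"])
    have "\<rho> permutes R" using \<rho> by (simp add: block_perms_def)
    then have "\<rho> \<circ> inv_into UNIV \<rho> = id" "inv_into UNIV \<rho> \<circ> \<rho> = id" by (simp_all add: permutes_inv_o)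
    then show "inv_into UNIV \<rho> \<circ> (\<rho> \<circ> \<pi>) = \<pi>" "\<rho> \<circ> (inv_into UNIV \<rho> \<circ> \<pi>) = \<pi>" for \<pi>
      by (simp_all flip: comp_assoc)
    show "\<rho> \<circ> \<pi> \<in> block_perms" "inv_into UNIV \<rho> \<circ> \<pi> \<in> block_perms" if "\<pi> \<in> block_perms" for \<pi>
      using block_perms_comp block_perms_inv \<rho> that by blast+
  qed (simp add: comp_assoc)
  obtain c where c: "c \<in> polys_in V0" "\<And>pt b. on_variety pt \<Longrightarrow>
    (\<And>\<pi>. \<pi> \<in> block_perms \<Longrightarrow> mpoly_eval h (pt \<circ> \<pi>) N = b) \<Longrightarrow> mpoly_eval h pt c = b"
    using symmetric_value[OF N] by blast
  have "mpoly_eval h pt N = 0"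
    unfolding EN using p(2) block_perms_id block_perms_finite by (metis comp_id prod_zero)
  then have "mpoly_eval h pt c = 0" using c(2)[OF pt(1)] inv by metis
  then have "mpoly_eval h pt' c = 0" using base c(1) by blast
  moreover have "mpoly_eval h pt' c = mpoly_eval h pt' N" using c(2)[OF pt(2)] inv by metis
  ultimately show False unfolding EN using p(3) block_perms_finite by simp
qed

lemma transport_iff:
  assumes inf: "infinite (UNIV :: 'k set)" and pt: "on_variety pt" "on_variety pt'"
    and base: "\<And>c. c \<in> polys_in V0 \<Longrightarrow> mpoly_eval h pt c = 0 \<longleftrightarrow> mpoly_eval h pt' c = 0"
  obtains \<pi> where "\<pi> \<in> block_perms"
    "\<And>p. p \<in> polys_in (V0 \<union> R) \<Longrightarrow> mpoly_eval h pt p = 0 \<longleftrightarrow> mpoly_eval h (pt' \<circ> \<pi>) p = 0"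
proof -
  let ?S = "polys_in (V0 \<union> R) :: 'k mpoly set"
  obtain \<pi> where \<pi>: "\<pi> \<in> block_perms" "\<And>p. p \<in> ?S \<Longrightarrow> mpoly_eval h pt p = 0 \<Longrightarrow> mpoly_eval h (pt' \<circ> \<pi>) p = 0"
    using transport[OF inf pt] base by blast
  obtain \<rho> where \<rho>: "\<rho> \<in> block_perms" "\<And>p. p \<in> ?S \<Longrightarrow> mpoly_eval h pt' p = 0 \<Longrightarrow> mpoly_eval h (pt \<circ> \<rho>) p = 0"
    using transport[OF inf pt(2,1)] base by blast
  define \<sigma> where "\<sigma> = \<rho> \<circ> \<pi>"
  have \<sigma>: "\<sigma> \<in> block_perms" unfolding \<sigma>_def using block_perms_comp \<pi>(1) \<rho>(1) by blast
  have 1: "mpoly_eval h (pt \<circ> \<sigma>) p = 0" if p: "p \<in> ?S" "mpoly_eval h (pt' \<circ> \<pi>) p = 0" for p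
  proof -
    have "mpoly_eval h pt' (mpoly_rename \<pi> p) = 0" using p(2) by (simp del: comp_apply)
    then have "mpoly_eval h (pt \<circ> \<rho>) (mpoly_rename \<pi> p) = 0" using \<rho>(2) rename_in[OF \<pi>(1) p(1)] by blast
    then show ?thesis by (simp add: \<sigma>_def comp_assoc del: comp_apply)
  qed
  have iter: "mpoly_eval h (pt \<circ> (\<sigma> ^^ k)) p = 0" if p: "p \<in> ?S" "mpoly_eval h (pt \<circ> \<sigma>) p = 0" "k > 0" for p k
    using p(3,1,2)
  proof (induction k arbitrary: p rule: nat_induct_non_zero)
    case 1
    then show ?case by (simp del: comp_apply)
  next
    case (Suc k)
    have "mpoly_eval h (pt \<circ> (\<sigma> ^^ k)) p = 0" using Suc by blast
    have a: "mpoly_eval h pt (mpoly_rename \<sigma> p) = 0" using Suc.prems by (simp del: comp_apply)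
    have "mpoly_eval h (pt \<circ> \<sigma>) (mpoly_rename \<sigma> p) = 0"
      by (rule 1[OF rename_in[OF \<sigma> Suc.prems(1)] \<pi>(2)[OF rename_in[OF \<sigma> Suc.prems(1)] a]])
    then have "mpoly_eval h (pt \<circ> (\<sigma> ^^ k)) (mpoly_rename \<sigma> p) = 0"
      using Suc.IH rename_in[OF \<sigma> Suc.prems(1)] by blast
    then show ?case by (simp add: comp_assoc funpow_Suc_right del: comp_apply funpow.simps)
  qed
  have "mpoly_eval h pt p = 0" if p: "p \<in> ?S" "mpoly_eval h (pt' \<circ> \<pi>) p = 0" for p
  proof -
    have "\<sigma> permutes R" using \<sigma> by (simp add: block_perms_def)
    then obtain k where "k > 0" "\<sigma> ^^ k = id"
      using finR by (metis permutation_permutes permutation_is_nilpotent)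
    then show ?thesis using iter[OF p(1) 1[OF p]] by (metis comp_id)
  qed
  then show ?thesis using that \<pi> by blast
qed

end

section \<open>Tools for letting two roots collide\<close>

lemma degree_prod_linear:
  "finite A \<Longrightarrow> degree (\<Prod>x\<in>A. [:- f x, 1 :: 'a::field:]) = card A"
  by (subst degree_prod_eq_sum_degree) auto

lemma lead_coeff_prod_linear: "lead_coeff (\<Prod>x\<in>A. [:- f x, 1 :: 'a::field:]) = 1"
  by (simp add: lead_coeff_prod)

lemma rhom_map_poly:
  assumes "rhom h" shows "rhom (map_poly h)"
proof -
  interpret rhom h by fact
  show ?thesis
    by unfold_locales (auto intro!: poly_eqI simp: coeff_map_poly hom_add hom_mult hom_sum coeff_mult hom_one)
qed

lemma map_poly_linear: "rhom h \<Longrightarrow> map_poly h [:a, b:] = [:h a, h b:]"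
  by (simp add: map_poly_pCons rhom.hom_zero)

lemma degree_map_poly_rhom:
  fixes h :: "'a::field \<Rightarrow> 'b::field"
  assumes "rhom h" shows "degree (map_poly h p) = degree p"
  by (rule degree_map_poly) (simp add: rhom_eq_0_iff[OF assms])

lemma map_poly_eq_0_rhom:
  fixes h :: "'a::field \<Rightarrow> 'b::field"
  assumes "rhom h" shows "map_poly h p = 0 \<longleftrightarrow> p = 0"
  using rhom_eq_0_iff[OF assms] by (auto simp: poly_eq_iff coeff_map_poly rhom.hom_zero[OF assms])

lemma pderiv_map_poly:
  fixes h :: "'a::field \<Rightarrow> 'b::field"
  assumes "rhom h" shows "pderiv (map_poly h p) = map_poly h (pderiv p)"
proof -
  interpret rhom h by fact
  show ?thesis by (rule poly_eqI) (simp add: coeff_pderiv coeff_map_poly hom_mult hom_of_nat del: of_nat_Suc)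
qed

text \<open>Algebraically closed fields have no new algebraic elements.\<close>

lemma root_of_closed_in_range:
  fixes j :: "'a::alg_closed_field \<Rightarrow> 'b::field"
  assumes j: "rhom j" and p: "p \<noteq> 0" and root: "poly (map_poly j p) x = 0"
  shows "x \<in> range j"
proof -
  interpret rhom j by fact
  interpret m: rhom "map_poly j" by (rule rhom_map_poly[OF j])
  obtain A where A: "p = smult (lead_coeff p) (\<Prod>x\<in>#A. [:-x, 1:])"
    using alg_closed_imp_factorization[OF p] by blast
  have m1: "map_poly j (smult c q) = smult (j c) (map_poly j q)" for c q
    by (intro poly_eqI) (simp add: coeff_map_poly hom_mult)
  have "map_poly j (\<Prod>x\<in>#A. [:-x, 1:]) = (\<Prod>x\<in>#A. [:- j x, 1:])"
    by (induction A) (simp_all add: m.hom_one m.hom_mult map_poly_linear[OF j] hom_uminus hom_one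
        del: mult_pCons_left)
  then have "poly (\<Prod>x\<in>#A. [:- j x, 1:]) x = 0"
    using root p by (subst (asm) A) (simp add: m1 rhom_eq_0_iff[OF j])
  then show ?thesis by (auto simp: poly_prod_mset prod_mset_zero_iff)
qed

definition transcendental_over :: "('a::field \<Rightarrow> 'b::field) \<Rightarrow> 'b \<Rightarrow> bool" where
  "transcendental_over j b \<longleftrightarrow> (\<forall>p. poly (map_poly j p) b = 0 \<longrightarrow> p = 0)"

text \<open>Suppose \<open>t\<close> is a double root. From \<open>(t - b)\<^sup>2 q(t) = c\<close> and the vanishing derivative one eliminates \<open>b\<close>
  and obtains \<open>4 q(t)\<^sup>3 = c q'(t)\<^sup>2\<close>, a nontrivial equation over the constants. So \<open>t\<close> is a constant,
  and then \<open>b\<close> is algebraic. The elimination is trivial exactly for \<open>q = 1\<close> in characteristic 2, where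
  \<open>(T - b)\<^sup>2 - c\<close> really is a square; this is the source of the parity condition on \<open>n\<close>.\<close>

lemma generic_separable:
  fixes j :: "'a::alg_closed_field \<Rightarrow> 'b::field"
  assumes j: "rhom j" and b: "transcendental_over j b"
    and q: "sep_poly q" "lead_coeff q = 1" and c: "c \<noteq> 0" and two: "degree q > 0 \<or> (2::'a) \<noteq> 0"
  shows "sep_poly ([:-b, 1:] ^ 2 * map_poly j q - [:j c:])"
  unfolding sep_poly_def
proof (intro allI impI notI)
  interpret rhom j by fact
  interpret m: rhom "map_poly j" by (rule rhom_map_poly[OF j])
  let ?f = "[:-b, 1:] ^ 2 * map_poly j q - [:j c:]"
  fix t assume f: "poly ?f t = 0" and f': "poly (pderiv ?f) t = 0"
  define Q where "Q = poly (map_poly j q) t"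
  define Q' where "Q' = poly (map_poly j (pderiv q)) t"
  have jc: "j c \<noteq> 0" using c rhom_eq_0_iff[OF j] by blast
  have 1: "(t - b)^2 * Q = j c" using f by (simp add: Q_def poly_power)
  then have tb: "t \<noteq> b" "Q \<noteq> 0" using jc by auto
  have "poly (pderiv ?f) t = 2 * (t - b) * Q + (t - b)^2 * Q'"
  proof -
    define L where "L = [:-b, 1:]"
    have L: "pderiv L = 1" "poly L t = t - b" by (simp_all add: L_def pderiv_pCons)
    show ?thesis unfolding L_def[symmetric]
      by (simp add: pderiv_diff pderiv_mult power2_eq_square pderiv_map_poly[OF j] Q_def Q'_def L pderiv_pCons algebra_simps)
  qed
  also have "\<dots> = (t - b) * (2 * Q + (t - b) * Q')" by (simp add: power2_eq_square algebra_simps)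
  finally have "2 * Q + (t - b) * Q' = 0" using f' tb by simp
  then have 2: "(t - b) * Q' = - (2 * Q)" by (simp add: eq_neg_iff_add_eq_0 add.commute)
  have "j c * Q'^2 = ((t - b) * Q')^2 * Q" unfolding 1[symmetric] by (simp add: power2_eq_square algebra_simps)
  also have "\<dots> = 4 * Q^3" unfolding 2 by (simp add: power2_eq_square power3_eq_cube)
  finally have 3: "4 * Q^3 - j c * Q'^2 = 0" by simp
  \<comment> \<open>the equation for \<open>t\<close> after the elimination of \<open>b\<close>\<close>
  define r where "r = [:4:] * q^3 - [:c:] * (pderiv q)^2"
  have "poly (map_poly j r) t = 4 * Q^3 - j c * Q'^2"
    unfolding r_def using hom_of_nat[of 4]
    by (simp add: m.hom_diff m.hom_mult m.hom_power map_poly_pCons Q_def Q'_def poly_power del: mult_pCons_left)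
  then have rt: "poly (map_poly j r) t = 0" using 3 by simp
  have "r \<noteq> 0"
  proof
    assume r0: "r = 0"
    show False
    proof (cases "degree q > 0")
      case True
      then obtain v where v: "poly q v = 0" using alg_closed_imp_poly_has_root by blast
      have "poly r v = - c * (poly (pderiv q) v)^2" using v by (simp add: r_def poly_power)
      then have "poly (pderiv q) v = 0" using r0 c by simp
      then show False using q(1) v by (auto simp: sep_poly_def)
    next
      case False
      then have "q = 1" using q(2) by (metis degree_eq_zeroE gr0I lead_coeff_pCons(2) one_pCons)
      then have "r = [:4:]" by (simp add: r_def)
      then have "(2::'a) * 2 = 0" using r0 by simp
      then have "(2::'a) = 0" by (metis mult_eq_0_iff)
      then show False using two False by blast
    qed
  qed
  then obtain u where u: "t = j u" using root_of_closed_in_range[OF j _ rt] by blast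
  have Qu: "Q = j (poly q u)" unfolding Q_def u by (rule poly_map_poly_hom)
  define s where "s = smult (poly q u) ([:-u, 1:]^2) - [:c:]"
  have "poly (map_poly j s) b = (b - t)^2 * Q - j c"
  proof -
    have "smult (poly q u) ([:-u, 1:]^2) = [:poly q u:] * [:-u,1:]^2" by simp
    then show ?thesis unfolding s_def
      by (simp only: m.hom_diff m.hom_mult m.hom_power map_poly_linear[OF j])
         (simp add: map_poly_pCons hom_uminus hom_one Qu u poly_power)
  qed
  also have "\<dots> = 0" using 1 by (simp add: power2_commute)
  finally have "s = 0" using b by (auto simp: transcendental_over_def)
  then have "coeff s 2 = 0" by simp
  then have "poly q u = 0" by (simp add: s_def power2_eq_square numeral_2_eq_2)
  then show False using tb Qu by simp
qed

lemma fps_of_poly_compose: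
  fixes w :: "'a::field fps"
  assumes "w $ 0 = 0"
  shows "fps_of_poly p oo w = poly (map_poly fps_const p) w"
  by (induction p)
     (auto simp: fps_of_poly_pCons map_poly_pCons fps_compose_add_distrib fps_compose_mult_distrib assms mult.commute)

lemma rhom_fps_const: "rhom (fps_const :: 'a::comm_ring_1 \<Rightarrow> _)"
  by (simp add: rhom_def)

text \<open>Hensel's lemma for power series, in the form of the inverse function theorem: the equation
  \<open>p(r) = X q(r)\<close> says that \<open>r\<close> inverts \<open>p / q\<close> near \<open>t\<close>.\<close>

lemma fps_lift_root:
  fixes p q :: "'a::field poly"
  assumes "poly p t = 0" "poly (pderiv p) t \<noteq> 0" "poly q t \<noteq> 0"
  obtains r where "r $ 0 = t" "poly (map_poly fps_const p) r = fps_X * poly (map_poly fps_const q) r"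
proof -
  define P where "P = fps_of_poly (pcompose p [:t, 1:])"
  define Q where "Q = fps_of_poly (pcompose q [:t, 1:])"
  have c0: "coeff (pcompose p' [:t, 1:]) 0 = poly p' t" for p'
    using poly_pcompose[of p' "[:t,1:]" 0] by (simp add: poly_0_coeff_0)
  have c1: "coeff (pcompose p [:t, 1:]) 1 = poly (pderiv p) t"
  proof -
    have "coeff (pcompose p [:t, 1:]) 1 = coeff (pderiv (pcompose p [:t, 1:])) 0" by (simp add: coeff_pderiv)
    also have "pderiv (pcompose p [:t, 1:]) = pcompose (pderiv p) [:t, 1:]"
      by (simp add: pderiv_pcompose pderiv_pCons)
    finally show ?thesis by (simp add: c0)
  qed
  define a where "a = P * inverse Q"
  have Q0: "Q $ 0 \<noteq> 0" unfolding Q_def using assms c0 by simp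
  have a0: "a $ 0 = 0" unfolding a_def P_def using assms c0 by (simp add: fps_mult_nth)
  have a1: "a $ 1 \<noteq> 0" unfolding a_def P_def using assms c0 c1 Q0 by (simp add: fps_mult_nth)
  define w where "w = fps_inv a"
  have w0: "w $ 0 = 0" by (simp add: w_def fps_inv_def)
  have aw: "a oo w = fps_X" unfolding w_def by (rule fps_inv_right[OF a0 a1])
  have "a * Q = P" using Q0 by (simp add: a_def mult.assoc inverse_mult_eq_1)
  then have "(a oo w) * (Q oo w) = P oo w" using fps_compose_mult_distrib[OF w0] by metis
  then have PQ: "P oo w = fps_X * (Q oo w)" using aw by simp
  interpret c: rhom "fps_const :: 'a \<Rightarrow> _" by (rule rhom_fps_const)
  interpret m: rhom "map_poly (fps_const :: 'a \<Rightarrow> _)" by (rule rhom_map_poly[OF rhom_fps_const])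
  have pc: "poly (map_poly fps_const (pcompose p' [:t, 1:])) w = poly (map_poly fps_const p') (fps_const t + w)" for p'
    by (induction p') (auto simp: pcompose_pCons m.hom_add m.hom_mult map_poly_pCons algebra_simps simp del: mult_pCons_left)
  show ?thesis
    by (rule that[of "fps_const t + w"])
       (use PQ in \<open>auto simp: P_def Q_def fps_of_poly_compose[OF w0] pc w0\<close>)
qed

text \<open>The roots of \<open>(T - b)\<^sup>2 = X T\<close> are \<open>b + sqrt (b X) + ...\<close>, which is ramified; comparing the lowest
  terms shows it without square roots.\<close>

lemma no_sqrt_in_fls:
  fixes b :: "'a::field"
  assumes "b \<noteq> 0" shows "(u - fls_const b)^2 \<noteq> fls_X * u"
proof
  assume eq: "(u - fls_const b)^2 = fls_X * u"
  define w where "w = u - fls_const b"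
  have w: "w * w = fls_X * (w + fls_const b)" using eq by (simp add: w_def power2_eq_square)
  have rhs: "fls_nth (fls_X * (w + fls_const b)) k = fls_nth w (k - 1) + (if k = 1 then b else 0)" for k
    by (simp add: fls_X_times_conv_shift)
  have "w \<noteq> 0" using w assms by auto
  show False
  proof (cases "fls_subdegree w > 0")
    case True
    have "fls_nth (w * w) 1 = 0" using True by (intro fls_times_nth_eq0) auto
    moreover have "fls_nth w 0 = 0" using True by simp
    ultimately show False using w rhs[of 1] assms by simp
  next
    case False
    let ?d = "fls_subdegree w"
    have "w * w \<noteq> 0" using \<open>w \<noteq> 0\<close> by simp
    then have "fls_nth (w * w) (fls_subdegree (w * w)) \<noteq> 0" by (rule nth_fls_subdegree_nonzero)
    then have "fls_nth (w * w) (?d + ?d) \<noteq> 0"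
      unfolding fls_subdegree_mult[OF \<open>w \<noteq> 0\<close> \<open>w \<noteq> 0\<close>] .
    moreover have "fls_nth w (?d + ?d - 1) = 0" using False by (intro fls_eq0_below_subdegree) auto
    ultimately show False using w rhs[of "?d + ?d"] False by simp
  qed
qed

text \<open>A ring homomorphism from a subring to the constants, as its graph. The subring is not named, which makes
  it easy to enlarge it step by step.\<close>

definition specialization :: "('k::field \<Rightarrow> 'f::field) \<Rightarrow> ('f \<times> 'k) set \<Rightarrow> bool" where
  "specialization h S \<longleftrightarrow> (\<forall>c. (h c, c) \<in> S) \<and> (\<forall>c. (0, c) \<in> S \<longrightarrow> c = 0) \<and>
     (\<forall>x c y d. (x, c) \<in> S \<longrightarrow> (y, d) \<in> S \<longrightarrow> (x + y, c + d) \<in> S \<and> (x * y, c * d) \<in> S)"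

lemma specialization_mpoly:
  assumes h: "rhom h" and S: "specialization h S" and "p \<in> polys_in V" "\<And>i. i \<in> V \<Longrightarrow> (x i, y i) \<in> S"
  shows "(mpoly_eval h x p, mpoly_eval id y p) \<in> S"
proof -
  interpret h: rhom h by fact
  interpret i: rhom "id :: 'a \<Rightarrow> 'a" by (rule rhom_id)
  have S': "(h c, id c) \<in> S" "(x, c) \<in> S \<Longrightarrow> (y, d) \<in> S \<Longrightarrow> (x + y, c + d) \<in> S"
    "(x, c) \<in> S \<Longrightarrow> (y, d) \<in> S \<Longrightarrow> (x * y, c * d) \<in> S" for x y c d
    using S by (auto simp: specialization_def)
  show ?thesis using assms(3)
  proof (induction rule: polys_in_induct)
    case (const c)
    show ?case unfolding h.mpoly_eval_const i.mpoly_eval_const by (rule S')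
  next
    case (var i)
    then show ?case unfolding h.mpoly_eval_var i.mpoly_eval_var by (rule assms(4))
  next
    case (add p q)
    then show ?case unfolding h.mpoly_eval_add i.mpoly_eval_add by (rule S')
  next
    case (mult p q)
    then show ?case unfolding h.mpoly_eval_mult i.mpoly_eval_mult by (rule S')
  qed
qed

text \<open>A transcendental element may be sent anywhere.\<close>

lemma specialization_extend:
  assumes h: "rhom h" and j: "rhom j" and S: "specialization h S" and b: "transcendental_over j b"
  obtains S' where "specialization (j \<circ> h) S'" "(b, b0) \<in> S'" "\<And>x c. (x, c) \<in> S \<Longrightarrow> (j x, c) \<in> S'"
proof -
  interpret h: rhom h by fact
  interpret j: rhom j by fact
  interpret m: rhom "map_poly j" by (rule rhom_map_poly[OF j])
  have S1: "(h c, c) \<in> S" "(0, c) \<in> S \<Longrightarrow> c = 0" "(x, c) \<in> S \<Longrightarrow> (y, d) \<in> S \<Longrightarrow> (x + y, c + d) \<in> S"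
    "(x, c) \<in> S \<Longrightarrow> (y, d) \<in> S \<Longrightarrow> (x * y, c * d) \<in> S" for x y c d
    using S by (auto simp: specialization_def)
  have S0: "(0, 0) \<in> S" "(1, 1) \<in> S" using S1(1)[of 0] S1(1)[of 1] by (simp_all add: h.hom_one)
  have Ssum: "(\<And>i. i \<in> A \<Longrightarrow> (f i, g i) \<in> S) \<Longrightarrow> (sum f A, sum g A) \<in> S" for f g and A :: "nat set"
    by (induction A rule: infinite_finite_induct) (auto intro: S0 S1)
  define R where "R = {(P, C). \<forall>i. (coeff P i, coeff C i) \<in> S}"
  define S' where "S' = {(poly (map_poly j P) b, poly C b0) | P C. (P, C) \<in> R}"
  have pC: "([:x:], [:c:]) \<in> R" if "(x, c) \<in> S" for x c
    using that S0 by (auto simp: R_def coeff_pCons split: nat.splits)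
  show ?thesis
  proof (rule that[of S'])
    show *: "(j x, c) \<in> S'" if "(x, c) \<in> S" for x c
      unfolding S'_def using pC[OF that]
      by (intro CollectI exI[of _ "[:x:]"] exI[of _ "[:c:]"]) (auto simp: map_poly_pCons)
    have "([:0,1:], [:0,1:]) \<in> R" using S0 by (auto simp: R_def coeff_pCons split: nat.splits)
    then show "(b, b0) \<in> S'" unfolding S'_def
      by (intro CollectI exI[of _ "[:0,1:]"]) (auto simp: map_poly_pCons j.hom_one)
    show "specialization (j \<circ> h) S'"
      unfolding specialization_def
    proof (intro conjI allI impI)
      show "((j \<circ> h) c, c) \<in> S'" for c using *[OF S1(1)] by simp
    next
      fix c assume "(0, c) \<in> S'"
      then obtain P C where PC: "(P, C) \<in> R" "poly (map_poly j P) b = 0" "c = poly C b0"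
        unfolding S'_def by fastforce
      then have "P = 0" using b by (auto simp: transcendental_over_def)
      then have "coeff C i = 0" for i using PC(1) S1(2) by (auto simp: R_def)
      then have "C = 0" by (intro poly_eqI) simp
      then show "c = 0" using PC by simp
    next
      fix x c y d assume "(x, c) \<in> S'" "(y, d) \<in> S'"
      then obtain P C Q D where PC: "(P, C) \<in> R" "x = poly (map_poly j P) b" "c = poly C b0"
        "(Q, D) \<in> R" "y = poly (map_poly j Q) b" "d = poly D b0" unfolding S'_def by blast
      have "(P + Q, C + D) \<in> R" using PC S1 by (auto simp: R_def)
      then show "(x + y, c + d) \<in> S'" unfolding S'_def PC
        by (intro CollectI exI[of _ "P + Q"] exI[of _ "C + D"]) (simp add: m.hom_add)
      have "(P * Q, C * D) \<in> R" using PC S1 by (auto simp: R_def coeff_mult intro!: Ssum)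
      then show "(x * y, c * d) \<in> S'" unfolding S'_def PC
        by (intro CollectI exI[of _ "P * Q"] exI[of _ "C * D"]) (simp add: m.hom_mult)
    qed
  qed
qed

text \<open>An element with nonzero image may be inverted.\<close>

lemma specialization_localize:
  assumes S: "specialization h S" and x: "(x, x0) \<in> S" "x0 \<noteq> 0" and h: "rhom h"
  obtains S' where "specialization h S'" "S \<subseteq> S'" "\<And>u c. (x * u, x0 * c) \<in> S \<Longrightarrow> (u, c) \<in> S'"
proof -
  have S1: "(h c, c) \<in> S" "(0, c) \<in> S \<Longrightarrow> c = 0" "(x, c) \<in> S \<Longrightarrow> (y, d) \<in> S \<Longrightarrow> (x + y, c + d) \<in> S"
    "(x, c) \<in> S \<Longrightarrow> (y, d) \<in> S \<Longrightarrow> (x * y, c * d) \<in> S" for x y c d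
    using S by (auto simp: specialization_def)
  have S0: "(1, 1) \<in> S" using S1(1)[of 1] by (simp add: rhom.hom_one[OF h])
  have pw: "(x ^ k, x0 ^ k) \<in> S" for k by (induction k) (auto intro: S0 S1 x)
  define S' where "S' = {(u, c). \<exists>k. (x ^ k * u, x0 ^ k * c) \<in> S}"
  have sub: "S \<subseteq> S'" unfolding S'_def by (auto intro: exI[of _ 0])
  show ?thesis
  proof (rule that[OF _ sub])
    show "specialization h S'" unfolding specialization_def
    proof (intro conjI allI impI)
      show "(h c, c) \<in> S'" for c using S1(1) sub by blast
    next
      fix c assume "(0, c) \<in> S'"
      then obtain k where "(0, x0 ^ k * c) \<in> S" by (auto simp: S'_def)
      then have "x0 ^ k * c = 0" by (rule S1(2))
      then show "c = 0" using x(2) by simp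
    next
      fix u c v d assume "(u, c) \<in> S'" "(v, d) \<in> S'"
      then obtain k l where kl: "(x ^ k * u, x0 ^ k * c) \<in> S" "(x ^ l * v, x0 ^ l * d) \<in> S"
        by (auto simp: S'_def)
      have "(x ^ l * (x ^ k * u) + x ^ k * (x ^ l * v), x0 ^ l * (x0 ^ k * c) + x0 ^ k * (x0 ^ l * d)) \<in> S"
        by (rule S1(3)[OF S1(4)[OF pw kl(1)] S1(4)[OF pw kl(2)]])
      then have "(x ^ (k + l) * (u + v), x0 ^ (k + l) * (c + d)) \<in> S" by (simp add: power_add algebra_simps)
      then show "(u + v, c + d) \<in> S'" unfolding S'_def by blast
      have "((x ^ k * u) * (x ^ l * v), (x0 ^ k * c) * (x0 ^ l * d)) \<in> S" by (rule S1(4)[OF kl])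
      then have "(x ^ (k + l) * (u * v), x0 ^ (k + l) * (c * d)) \<in> S" by (simp add: power_add mult_ac)
      then show "(u * v, c * d) \<in> S'" unfolding S'_def by blast
    qed
    show "(u, c) \<in> S'" if "(x * u, x0 * c) \<in> S" for u c
      unfolding S'_def mem_Collect_eq case_prod_conv by (rule exI[of _ 1]) (use that in simp)
  qed
qed

section \<open>Swapping two roots\<close>

definition to_fract :: "'a::idom \<Rightarrow> 'a fract" where
  "to_fract x = Fraction_Field.Fract x 1"

lemma rhom_to_fract: "rhom to_fract"
  by (simp add: rhom_def to_fract_def One_fract_def)

lemma to_fract_eq_0_iff [simp]: "to_fract x = 0 \<longleftrightarrow> x = 0"
  by (simp add: to_fract_def Zero_fract_def eq_fract)

lemma to_fract_eq_iff [simp]: "to_fract x = to_fract y \<longleftrightarrow> x = y"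
  by (simp add: to_fract_def eq_fract)

lemma rhom_pconst: "rhom (\<lambda>c::'a::comm_ring_1. [:c:])"
  by (simp add: rhom_def one_pCons)

text \<open>A field that is large enough for a generic point and for a deformation of it: independent elements over
  \<open>'k\<close>, one more transcendental \<open>tvar\<close>, and Laurent series in a deformation parameter, with algebraic
  closures in between.\<close>

type_synonym 'k gen1 = "'k mpoly fract alg_closure"
type_synonym 'k gen2 = "'k gen1 poly fract alg_closure"
type_synonym 'k gen = "'k gen2 fls alg_closure"

definition emb1 :: "'k::field \<Rightarrow> 'k gen1" where "emb1 c = to_ac (to_fract (mpoly_const c))"
definition emb2 :: "'k::field gen1 \<Rightarrow> 'k gen2" where "emb2 c = to_ac (to_fract [:c:])"
definition emb3 :: "'k::field gen2 \<Rightarrow> 'k gen" where "emb3 c = to_ac (fls_const c)"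
definition emb :: "'k::field \<Rightarrow> 'k gen" where "emb c = emb3 (emb2 (emb1 c))"

lemma rhom_fls_const: "rhom (fls_const :: 'a::comm_ring_1 \<Rightarrow> _)"
  by (simp add: rhom_def fls_plus_const)

lemma rhom_emb1: "rhom emb1"
  using rhom_comp[OF rhom_comp[OF mpoly_const_rhom rhom_to_fract] rhom_to_ac]
  by (simp add: emb1_def[abs_def] o_def)

lemma rhom_emb2: "rhom emb2"
  using rhom_comp[OF rhom_comp[OF rhom_pconst rhom_to_fract] rhom_to_ac]
  by (simp add: emb2_def[abs_def] o_def)

lemma rhom_emb3: "rhom emb3"
  using rhom_comp[OF rhom_fls_const rhom_to_ac] by (simp add: emb3_def[abs_def] o_def)

lemma rhom_emb: "rhom emb"
  using rhom_comp[OF rhom_comp[OF rhom_emb1 rhom_emb2] rhom_emb3] by (simp add: emb_def[abs_def] o_def)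

definition tvar :: "'k::field gen2" where "tvar = to_ac (to_fract [:0, 1:])"

lemma tvar_transcendental: "transcendental_over emb2 (tvar :: 'k::field gen2)"
proof -
  have "poly (map_poly emb2 p) tvar = to_ac (to_fract p)" for p :: "'k gen1 poly"
  proof (induction p)
    case (pCons a p)
    have "to_fract (pCons a p) = to_fract [:a:] + to_fract [:0,1:] * to_fract p"
      unfolding rhom.hom_mult[OF rhom_to_fract, symmetric] rhom.hom_add[OF rhom_to_fract, symmetric] by simp
    then show ?case using pCons
      by (simp add: map_poly_pCons rhom.hom_zero[OF rhom_emb2] emb2_def tvar_def)
  qed (simp add: rhom.hom_zero[OF rhom_to_fract])
  then show ?thesis by (simp add: transcendental_over_def)
qed

text \<open>The polynomial \<open>g\<close>, over rings instead of fields.\<close>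

definition gen_monic :: "nat \<Rightarrow> (nat \<Rightarrow> 'a::comm_ring_1) \<Rightarrow> 'a poly" where
  "gen_monic n a = monom 1 n + (\<Sum>j<n. monom (a j) (n - 1 - j))"

lemma coeff_gen_monic:
  "coeff (gen_monic n a) i = (if i = n then 1 else if i < n then a (n - 1 - i) else 0)"
proof -
  have "(\<Sum>j<n. coeff (monom (a j) (n - 1 - j)) i) = (\<Sum>j<n. if j = n - 1 - i \<and> i < n then a j else 0)"
    by (intro sum.cong) auto
  also have "\<dots> = (if i < n then a (n - 1 - i) else 0)" by (auto simp: sum.delta)
  finally show ?thesis by (auto simp: gen_monic_def coeff_sum)
qed

lemma degree_gen_monic: "degree (gen_monic n (a :: nat \<Rightarrow> 'a::{comm_ring_1,zero_neq_one})) = n"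
  by (intro antisym degree_le le_degree) (auto simp: coeff_gen_monic)

lemma gen_monic_coeffs:
  assumes "degree p = n" "lead_coeff p = 1" shows "gen_monic n (\<lambda>j. coeff p (n - 1 - j)) = p"
  using assms by (intro poly_eqI) (auto simp: coeff_gen_monic coeff_eq_0)

lemma gen_monic_cong: "(\<And>j. j < n \<Longrightarrow> a j = b j) \<Longrightarrow> gen_monic n a = gen_monic n b"
  by (simp add: gen_monic_def)

lemma map_poly_gen_monic:
  assumes "rhom h" shows "map_poly h (gen_monic n a) = gen_monic n (\<lambda>j. h (a j))"
  by (intro poly_eqI) (simp add: coeff_map_poly rhom.hom_zero[OF assms] coeff_gen_monic rhom.hom_one[OF assms])

lemma monic_poly_eq: "monic_poly = gen_monic"
  by (intro ext) (simp add: monic_poly_def gen_monic_def)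

lemma sep_poly_prod_linear:
  assumes "finite A" "inj_on f A" shows "sep_poly (\<Prod>x\<in>A. [:- f x, 1 :: 'a::field:])"
  using assms
proof (induction A)
  case (insert x A)
  show ?case unfolding sep_poly_def
  proof (intro allI impI)
    fix y assume y: "poly (\<Prod>x\<in>insert x A. [:- f x, 1:]) y = 0"
    have IH: "sep_poly (\<Prod>x\<in>A. [:- f x, 1 :: 'a:])" using insert by (auto simp: inj_on_def)
    define P where "P = (\<Prod>x\<in>A. [:- f x, 1 :: 'a:])"
    have P: "(\<Prod>x\<in>insert x A. [:- f x, 1:]) = [:- f x, 1:] * P" using insert.hyps by (simp add: P_def)
    define L where "L = [:- f x, 1 :: 'a:]"
    have L: "pderiv L = 1" "poly L y = y - f x" by (simp_all add: L_def pderiv_pCons)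
    have d: "poly (pderiv (L * P)) y = (y - f x) * poly (pderiv P) y + poly P y"
      by (simp add: pderiv_mult L)
    have "y = f x \<or> poly P y = 0" using y unfolding P by auto
    moreover have "poly P (f x) \<noteq> 0"
      using insert by (auto simp: P_def poly_prod inj_on_def)
    moreover have "poly P y = 0 \<Longrightarrow> poly (pderiv P) y \<noteq> 0" using IH by (simp add: sep_poly_def P_def)
    ultimately show "poly (pderiv (\<Prod>x\<in>insert x A. [:- f x, 1:])) y \<noteq> 0"
      unfolding P L_def[symmetric] d by auto
  qed
qed (simp add: sep_poly_def)

lemma mpoly_var_inject:
  assumes "mpoly_var i = (mpoly_var j :: 'a::{comm_ring_1,zero_neq_one} mpoly)" shows "i = j"
proof -
  have k: "Poly_Mapping.keys (mpoly_var l :: 'a mpoly) = {Poly_Mapping.single l 1}" for l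
    by (simp add: mpoly_var_def)
  have "Poly_Mapping.single i (1::nat) = Poly_Mapping.single j 1" using k[of i] k[of j] assms by simp
  then have "Poly_Mapping.keys (Poly_Mapping.single i (1::nat)) = Poly_Mapping.keys (Poly_Mapping.single j (1::nat))"
    by simp
  then show ?thesis by simp
qed

lemma alg_closed_infinite: "infinite (UNIV :: 'a::alg_closed_field set)"
proof
  assume fin: "finite (UNIV :: 'a set)"
  define p where "p = (\<Prod>x\<in>(UNIV :: 'a set). [:- x, 1:]) + 1"
  have "degree (\<Prod>x\<in>(UNIV :: 'a set). [:- x, 1:]) = card (UNIV :: 'a set)"
    using degree_prod_linear[OF fin, of "\<lambda>x. x"] .
  moreover have "card (UNIV :: 'a set) > 0" using fin by (simp add: card_gt_0_iff)
  ultimately have "degree p > 0" unfolding p_def by (subst degree_add_eq_left) auto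
  then obtain x where "poly p x = 0" using alg_closed_imp_poly_has_root by blast
  moreover have "poly p x = 1" unfolding p_def using fin by (auto simp: poly_prod)
  ultimately show False by simp
qed

text \<open>The constants \<open>om v\<close> are values that \<open>g\<close> shall take: the variables below \<open>n\<close> are the coefficients of \<open>g\<close>,
  and the block of \<open>c\<close> consists of the roots of \<open>g - c\<close>.\<close>

locale blocks =
  fixes n :: nat and R :: "nat set" and om :: "nat \<Rightarrow> 'k::alg_closed_field"
  assumes n: "n > 0" and finR: "finite R" and disjR: "{..<n} \<inter> R = {}"
    and block: "\<And>v. v \<in> R \<Longrightarrow> card {w \<in> R. om w = om v} = n"
begin

definition G :: "nat \<Rightarrow> 'k mpoly poly" where
  "G v = gen_monic n mpoly_var - [:mpoly_const (om v):]"

lemma G_props: "G v \<in> polys_over (polys_in {..<n})" "lead_coeff (G v) = 1" "degree (G v) = n"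
proof -
  note S = polys_in_subring[THEN subring_set.diff] polys_in_subring[THEN subring_set.zero]
    polys_in_subring[THEN subring_set.one]
  show "G v \<in> polys_over (polys_in {..<n})"
    by (auto simp: G_def polys_over_def coeff_gen_monic coeff_pCons split: nat.splits intro!: S)
  show d: "degree (G v) = n"
  proof (rule antisym)
    show "degree (G v) \<le> n" unfolding G_def by (intro degree_diff_le) (auto simp: degree_gen_monic)
    show "n \<le> degree (G v)" by (intro le_degree) (use n in \<open>auto simp: G_def coeff_gen_monic coeff_pCons split: nat.splits\<close>)
  qed
  show "lead_coeff (G v) = 1" unfolding d using n by (auto simp: G_def coeff_gen_monic coeff_pCons split: nat.splits)
qed

sublocale st: staircase emb n "{..<n}" R om G
proof (rule staircase.intro)
  show "rhom emb" by (rule rhom_emb)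
qed (use n finR disjR block G_props in \<open>simp_all add: G_def\<close>)

lemma G_eval:
  "mpoly_eval emb pt (poly (G v) (mpoly_var w)) = poly (gen_monic n pt) (pt w) - emb (om v)"
proof -
  interpret e: rhom emb by (rule rhom_emb)
  have "mpoly_eval emb pt (poly (G v) (mpoly_var w)) = poly (map_poly (mpoly_eval emb pt) (G v)) (pt w)"
    using rhom.poly_map_poly_hom[OF e.mpoly_eval_rhom, of pt "G v" "mpoly_var w"] by simp
  also have "map_poly (mpoly_eval emb pt) (G v) = gen_monic n pt - [:emb (om v):]"
    by (simp add: G_def rhom.hom_diff[OF rhom_map_poly[OF e.mpoly_eval_rhom]]
        map_poly_gen_monic[OF e.mpoly_eval_rhom] map_poly_pCons)
  finally show ?thesis by simp
qed

lemma on_variety_iff: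
  "st.on_variety pt \<longleftrightarrow> st.sep_on_blocks pt \<and> (\<forall>v\<in>R. poly (gen_monic n pt) (pt v) = emb (om v))"
  by (simp add: st.on_variety_def G_eval)

text \<open>Over the field of Laurent series in \<open>z\<close> take the polynomial \<open>((T - b)\<^sup>2 - z T) q(T) + om e1\<close>, with \<open>b\<close> and
  the roots of \<open>q\<close> independent. For \<open>z = 0\<close> the two roots \<open>e1\<close>, \<open>e2\<close> collide in \<open>b\<close>. In all other blocks
  the polynomial stays separable at \<open>z = 0\<close> by \<open>generic_separable\<close>, and so the roots are power series in
  \<open>z\<close>, as are the remaining roots of the first block. But \<open>e1\<close> and \<open>e2\<close> lie in a ramified quadratic
  extension and are conjugate: each relation is preserved when they are swapped. The roots of the first
  block are still independent, since \<open>b\<close> and \<open>z\<close> can be chosen to give \<open>e1\<close> and \<open>e2\<close>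
  any two values of which the first is nonzero.\<close>

lemma collision_point:
  assumes two: "n = 2 \<Longrightarrow> (2::'k) \<noteq> 0" and e: "e1 \<in> R" "e2 \<in> R" "e1 \<noteq> e2" "om e1 = om e2"
  obtains pt where "st.on_variety pt"
    "\<And>p. p \<in> polys_in {w \<in> R. om w = om e1} \<Longrightarrow> mpoly_eval emb pt p = 0 \<Longrightarrow> p = 0"
    "\<And>p. mpoly_eval emb pt p = 0 \<Longrightarrow> mpoly_eval emb (pt \<circ> Transposition.transpose e1 e2) p = 0"
proof -
  interpret h1: rhom "emb1 :: 'k \<Rightarrow> _" by (rule rhom_emb1)
  interpret h2: rhom "emb2 :: 'k gen1 \<Rightarrow> _" by (rule rhom_emb2)
  interpret h3: rhom "emb3 :: 'k gen2 \<Rightarrow> _" by (rule rhom_emb3)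
  interpret e: rhom "emb :: 'k \<Rightarrow> _" by (rule rhom_emb)
  interpret m2: rhom "map_poly (emb2 :: 'k gen1 \<Rightarrow> _)" by (rule rhom_map_poly[OF rhom_emb2])
  interpret fc: rhom "fls_const :: 'k gen2 \<Rightarrow> _" by (rule rhom_fls_const)
  interpret mfc: rhom "map_poly (fls_const :: 'k gen2 \<Rightarrow> _)" by (rule rhom_map_poly[OF rhom_fls_const])
  have rfl: "rhom (fps_to_fls :: 'k gen2 fps \<Rightarrow> _)" by (simp add: rhom_def fls_times_fps_to_fls)
  interpret fl: rhom "fps_to_fls :: 'k gen2 fps \<Rightarrow> _" by (rule rfl)
  interpret mac: rhom "map_poly (to_ac :: 'k gen2 fls \<Rightarrow> _)" by (rule rhom_map_poly[OF rhom_to_ac])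
  interpret ac: rhom "to_ac :: 'k gen2 fls \<Rightarrow> _" by (rule rhom_to_ac)
  define blk where "blk = {w \<in> R. om w = om e1}"
  define W where "W = blk - {e1, e2}"
  have eblk: "e1 \<in> blk" "e2 \<in> blk" using e by (auto simp: blk_def)
  have finW: "finite W" "finite blk" using finR by (auto simp: W_def blk_def)
  have cblk: "card blk = n" using block[OF e(1)] by (simp add: blk_def)
  have cW: "card W = n - 2" "n \<ge> 2"
    using card_Diff_subset[of "{e1, e2}" blk] eblk e(3) cblk card_mono[OF finW(2), of "{e1,e2}"] by (auto simp: W_def)
  define v where "v = (\<lambda>w. to_ac (to_fract (mpoly_var w)) :: 'k gen1)"
  have vinj: "inj v"
    by (auto simp: inj_def v_def dest: mpoly_var_inject)
  define q where "q = (\<Prod>w\<in>W. [:- v w, 1:])"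
  have q: "sep_poly q" "lead_coeff q = 1" "degree q = n - 2"
    unfolding q_def using sep_poly_prod_linear[OF finW(1), of v] vinj lead_coeff_prod_linear[of v W]
      degree_prod_linear[OF finW(1), of v] cW by (auto simp: inj_on_def)
  define L2 where "L2 = [:- tvar, 1 :: 'k gen2:] ^ 2"
  define Q2 where "Q2 = map_poly emb2 q"
  have two1: "(2::'k gen1) \<noteq> 0" if "n = 2"
    using two[OF that] h1.hom_of_nat[of 2] rhom_eq_0_iff[OF rhom_emb1, of 2] by auto
  define z where "z = (fls_X :: 'k gen2 fls)"
  define b where "b = fls_const (tvar :: 'k gen2)"
  \<comment> \<open>the two colliding roots, with product \<open>b\<^sup>2\<close> and sum \<open>2 b + z\<close>\<close>
  define Qz where "Qz = [:- b, 1:] ^ 2 - [:0, z:]"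
  define Gam where "Gam = Qz * map_poly fls_const Q2 + [:fls_const (emb2 (emb1 (om e1))):]"
  have tv0: "tvar \<noteq> (0 :: 'k gen2)" by (simp add: tvar_def)
  have Qz_eq: "Qz = [:b^2, - (2 * b + z), 1:]" by (simp add: Qz_def power2_eq_square)
  have degQ2: "degree Q2 = n - 2" "lead_coeff Q2 = 1"
    using q by (simp_all add: Q2_def coeff_map_poly h2.hom_one degree_map_poly_rhom[OF rhom_emb2])
  have degGam: "degree Gam = n" "lead_coeff Gam = 1"
  proof -
    have dQ: "degree (map_poly fls_const Q2) = n - 2" "lead_coeff (map_poly fls_const Q2) = 1"
      using degQ2 by (simp_all add: coeff_map_poly degree_map_poly_rhom[OF rhom_fls_const])
    have "degree (Qz * map_poly fls_const Q2) = degree Qz + (n - 2)"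
      using dQ by (subst degree_mult_eq) (auto simp: Qz_eq)
    moreover have "degree Qz = 2" by (simp add: Qz_eq)
    ultimately have d: "degree (Qz * map_poly fls_const Q2) = n" using cW by simp
    have "lead_coeff (Qz * map_poly fls_const Q2) = lead_coeff Qz * lead_coeff (map_poly fls_const Q2)"
      by (rule lead_coeff_mult)
    also have "lead_coeff Qz = 1" by (simp add: Qz_eq)
    finally have l: "lead_coeff (Qz * map_poly fls_const Q2) = 1" using dQ(2) by simp
    have dl: "degree [:c:] < degree (Qz * map_poly fls_const Q2)" for c :: "'k gen2 fls"
      using d n by simp
    show dG: "degree Gam = n" unfolding Gam_def using degree_add_eq_left[OF dl] d by simp
    have "coeff Gam n = coeff (Qz * map_poly fls_const Q2) n"
      using n by (simp add: Gam_def coeff_pCons split: nat.splits)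
    then show "lead_coeff Gam = 1" using l d dG by simp
  qed
  \<comment> \<open>the roots of the other blocks are power series, by \<open>fps_lift_root\<close>\<close>
  have other: "\<exists>g. inj_on g {w \<in> R. om w = c} \<and> (\<forall>w\<in>{w \<in> R. om w = c}. poly Gam (g w) = fls_const (emb2 (emb1 c)))"
    if c: "c \<in> om ` R" "c \<noteq> om e1" for c
  proof -
    define cc where "cc = emb1 (c - om e1)"
    have cc0: "cc \<noteq> 0" using c rhom_eq_0_iff[OF rhom_emb1, of "c - om e1"] by (simp add: cc_def)
    define f where "f = L2 * Q2 - [:emb2 cc:]"
    have "degree q > 0 \<or> (2 :: 'k gen1) \<noteq> 0" using q(3) two1 cW by (cases "n = 2") auto
    then have sf: "sep_poly f"
      unfolding f_def L2_def Q2_def by (rule generic_separable[OF rhom_emb2 tvar_transcendental q(1,2) cc0])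
    have degf: "degree f = n"
    proof -
      have "degree (L2 * Q2) = n"
      proof -
        have "degree L2 = 2" by (simp add: L2_def power2_eq_square)
        then show ?thesis using degQ2 cW by (subst degree_mult_eq) auto
      qed
      moreover have "f = L2 * Q2 + [:- emb2 cc:]" by (simp add: f_def)
      ultimately show ?thesis using n degree_add_eq_left[of "[:- emb2 cc:]" "L2 * Q2"] by simp
    qed
    have lift: "\<exists>r. fps_nth r 0 = t \<and> poly Gam (fps_to_fls r) = fls_const (emb2 (emb1 c))" if t: "poly f t = 0" for t
    proof -
      have ecc: "emb2 cc \<noteq> 0" using cc0 rhom_eq_0_iff[OF rhom_emb2] by blast
      have 1: "(t - tvar)^2 * poly Q2 t = emb2 cc" using t by (simp add: f_def L2_def poly_power)
      have "t \<noteq> 0"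
      proof
        assume "t = 0"
        then have "tvar^2 * poly Q2 0 = emb2 cc" using 1 by simp
        moreover have "poly Q2 0 = emb2 (poly q 0)" unfolding Q2_def
          using h2.poly_map_poly_hom[of q 0] by simp
        ultimately have "poly (map_poly emb2 ([:0, 0, poly q 0:] - [:cc:])) tvar = 0"
          by (simp add: map_poly_pCons m2.hom_diff power2_eq_square h2.hom_uminus mult_ac)
        then have "[:0, 0, poly q 0:] - [:cc:] = 0" using tvar_transcendental unfolding transcendental_over_def by blast
        then show False using cc0 by simp
      qed
      moreover have "poly Q2 t \<noteq> 0" using 1 ecc by auto
      ultimately have "poly ([:0,1:] * Q2) t \<noteq> 0" by simp
      moreover have "poly (pderiv f) t \<noteq> 0" using sf t by (simp add: sep_poly_def)
      ultimately obtain r where r: "fps_nth r 0 = t"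
        "poly (map_poly fps_const f) r = fps_X * poly (map_poly fps_const ([:0,1:] * Q2)) r"
        using fps_lift_root[OF t] by metis
      have fm: "fps_to_fls (poly (map_poly fps_const p) r) = poly (map_poly fls_const p) (fps_to_fls r)" for p
        by (induction p) (auto simp: map_poly_pCons fl.hom_add fl.hom_mult simp del: fps_to_fls_plus)
      define u where "u = fps_to_fls r"
      have "poly (map_poly fls_const f) u = z * poly (map_poly fls_const ([:0,1:] * Q2)) u"
        using arg_cong[OF r(2), of fps_to_fls] unfolding fl.hom_mult fm u_def z_def by simp
      then have "(u - b)^2 * poly (map_poly fls_const Q2) u - fls_const (emb2 cc) = z * (u * poly (map_poly fls_const Q2) u)"
        by (simp add: f_def L2_def mfc.hom_diff mfc.hom_mult mfc.hom_power map_poly_pCons b_def poly_power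
            fc.hom_uminus del: mult_pCons_left)
      moreover have "poly Gam u = ((u - b)^2 - z * u) * poly (map_poly fls_const Q2) u + fls_const (emb2 (emb1 (om e1)))"
        by (simp add: Gam_def Qz_def poly_power mult.commute)
      ultimately have "poly Gam u = fls_const (emb2 cc) + fls_const (emb2 (emb1 (om e1)))"
        by (simp add: algebra_simps)
      also have "\<dots> = fls_const (emb2 (emb1 c))"
        by (simp add: cc_def h1.hom_diff h2.hom_diff fc.hom_diff)
      finally show ?thesis using r(1) u_def by blast
    qed
    then obtain r where r: "\<And>t. poly f t = 0 \<Longrightarrow> fps_nth (r t) 0 = t"
      "\<And>t. poly f t = 0 \<Longrightarrow> poly Gam (fps_to_fls (r t)) = fls_const (emb2 (emb1 c))" by metis
    obtain w0 where "w0 \<in> R" "om w0 = c" using c by blast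
    then have "card {w \<in> R. om w = c} = card {t. poly f t = 0}"
      using block[of w0] sep_poly_card_roots(1)[OF sf] degf by simp
    moreover have "f \<noteq> 0" using degf n by auto
    ultimately obtain s where s: "bij_betw s {w \<in> R. om w = c} {t. poly f t = 0}"
      using finite_same_card_bij[of "{w \<in> R. om w = c}" "{t. poly f t = 0}"] finR poly_roots_finite by auto
    define g where "g = (\<lambda>w. fps_to_fls (r (s w)))"
    have sr: "poly f (s w) = 0" if "w \<in> {w \<in> R. om w = c}" for w
      using bij_betwE[OF s] that by blast
    have "inj_on g {w \<in> R. om w = c}"
    proof (rule inj_onI)
      fix w w' assume w: "w \<in> {w \<in> R. om w = c}" "w' \<in> {w \<in> R. om w = c}" and "g w = g w'"
      then have "r (s w) = r (s w')" by (simp add: g_def)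
      then have "s w = s w'" using r(1)[OF sr[OF w(1)]] r(1)[OF sr[OF w(2)]] by metis
      then show "w = w'" by (rule inj_onD[OF bij_betw_imp_inj_on[OF s] _ w])
    qed
    moreover have "poly Gam (g w) = fls_const (emb2 (emb1 c))" if "w \<in> {w \<in> R. om w = c}" for w
      using r(2)[OF sr[OF that]] by (simp add: g_def)
    ultimately show ?thesis by blast
  qed
  then have "\<forall>c. \<exists>g. c \<in> om ` R \<longrightarrow> c \<noteq> om e1 \<longrightarrow> inj_on g {w \<in> R. om w = c} \<and>
      (\<forall>w\<in>{w \<in> R. om w = c}. poly Gam (g w) = fls_const (emb2 (emb1 c)))" by blast
  from choice[OF this] obtain g where g0: "\<forall>c. c \<in> om ` R \<longrightarrow> c \<noteq> om e1 \<longrightarrow> inj_on (g c) {w \<in> R. om w = c} \<and>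
      (\<forall>w\<in>{w \<in> R. om w = c}. poly Gam (g c w) = fls_const (emb2 (emb1 c)))" ..
  have g: "\<And>c. c \<in> om ` R \<Longrightarrow> c \<noteq> om e1 \<Longrightarrow> inj_on (g c) {w \<in> R. om w = c}"
    "\<And>c w. c \<in> om ` R \<Longrightarrow> c \<noteq> om e1 \<Longrightarrow> w \<in> {w \<in> R. om w = c} \<Longrightarrow> poly Gam (g c w) = fls_const (emb2 (emb1 c))"
    using g0 by blast+
  \<comment> \<open>the two colliding roots\<close>
  define bb where "bb = to_ac b"
  define zz where "zz = to_ac z"
  have "degree (map_poly to_ac Qz) = 2" by (simp add: degree_map_poly_rhom[OF rhom_to_ac] Qz_eq)
  then obtain x where "poly (map_poly to_ac Qz) x = 0" using alg_closed_imp_poly_has_root by (metis pos2)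
  then have x: "x * x = (2 * bb + zz) * x - bb^2"
    by (simp add: Qz_eq map_poly_pCons bb_def zz_def power2_eq_square algebra_simps add_eq_0_iff)
  define y where "y = 2 * bb + zz - x"
  have xy: "x * y = bb^2" using x by (simp add: y_def algebra_simps)
  have bb0: "bb \<noteq> 0" using tv0 by (simp add: bb_def b_def)
  have x0: "x \<noteq> 0" "y \<noteq> 0" using xy bb0 by auto
  have xr: "x \<notin> range to_ac"
  proof
    assume "x \<in> range to_ac"
    then obtain u where u: "x = to_ac u" by blast
    have "to_ac (u * u) = to_ac ((2 * b + z) * u - b^2)" using x by (simp add: u bb_def zz_def)
    then have "u * u = (2 * b + z) * u - b^2" by (simp only: to_ac_eq_iff)
    then have "(u - fls_const tvar)^2 = fls_X * u"
      by (simp add: b_def z_def power2_eq_square algebra_simps)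
    then show False using no_sqrt_in_fls[OF tv0] by blast
  qed
  have yr: "y \<notin> range to_ac"
  proof
    assume "y \<in> range to_ac"
    then obtain u where "y = to_ac u" by blast
    then have "x = to_ac (2 * b + z - u)" by (simp add: y_def bb_def zz_def algebra_simps)
    then show False using xr by blast
  qed
  have "x \<noteq> y"
  proof
    assume "x = y"
    then have 2: "2 * x = 2 * bb + zz" by (simp add: y_def algebra_simps)
    show False
    proof (cases "(2 :: 'k gen2 fls) = 0")
      case True
      then have "(2 :: 'k gen) = 0" by (metis to_ac_numeral to_ac_0)
      then have "zz = 0" using 2 by simp
      then show False by (simp add: zz_def z_def)
    next
      case False
      then have "(2 :: 'k gen) \<noteq> 0" by (metis to_ac_numeral to_ac_eq_0_iff)
      then have "x = (2 * bb + zz) / 2" using 2 by (metis nonzero_mult_div_cancel_left)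
      also have "\<dots> = to_ac ((2 * b + z) / 2)" by (simp add: bb_def zz_def)
      finally show False using xr by (metis rangeI)
    qed
  qed
  define gv where "gv = (\<lambda>w. if om w = om e1 then fls_const (emb2 (v w)) else g (om w) w)"
  define pt where "pt = (\<lambda>i. if i < n then to_ac (coeff Gam (n - 1 - i)) else if i = e1 then x else if i = e2 then y
      else if i \<in> R then to_ac (gv i) else 0)"
  have Rn: "\<not> w < n" if "w \<in> R" for w using disjR that by auto
  have pt_R: "pt e1 = x" "pt e2 = y" "w \<in> R - {e1, e2} \<Longrightarrow> pt w = to_ac (gv w)" for w
    using Rn e by (auto simp: pt_def)
  have pt_range: "pt w \<in> range to_ac" if "w \<noteq> e1" "w \<noteq> e2" for w
    using that by (auto simp: pt_def)
  have gm: "gen_monic n pt = map_poly to_ac Gam"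
  proof -
    have "gen_monic n pt = gen_monic n (\<lambda>j. to_ac (coeff Gam (n - 1 - j)))"
      by (rule gen_monic_cong) (simp add: pt_def)
    also have "\<dots> = map_poly to_ac (gen_monic n (\<lambda>j. coeff Gam (n - 1 - j)))"
      by (simp add: map_poly_gen_monic[OF rhom_to_ac])
    finally show ?thesis using gen_monic_coeffs[OF degGam] by simp
  qed
  have emb_eq: "emb c = to_ac (fls_const (emb2 (emb1 c)))" for c by (simp add: emb_def emb3_def)
  have Qz_split: "map_poly to_ac Qz = [:- x, 1:] * [:- y, 1:]"
    by (simp add: Qz_eq map_poly_pCons bb_def[symmetric] zz_def[symmetric] xy xy[unfolded mult.commute[of x]])
       (simp add: y_def)
  have rel: "poly (gen_monic n pt) (pt w) = emb (om w)" if w: "w \<in> R" for w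
  proof (cases "om w = om e1")
    case True
    have z0: "poly (map_poly to_ac (Qz * map_poly fls_const Q2)) (pt w) = 0"
    proof (cases "w = e1 \<or> w = e2")
      case True
      then show ?thesis using pt_R(1,2) by (auto simp: mac.hom_mult Qz_split simp del: mult_pCons_left)
    next
      case False
      then have wW: "w \<in> W" using w \<open>om w = om e1\<close> by (auto simp: W_def blk_def)
      then have "poly q (v w) = 0" unfolding q_def using finW by (auto simp: poly_prod)
      then have "poly Q2 (emb2 (v w)) = 0" unfolding Q2_def using h2.poly_map_poly_hom[of q "v w"] by simp
      then have "poly (map_poly fls_const Q2) (fls_const (emb2 (v w))) = 0"
        using fc.poly_map_poly_hom[of Q2 "emb2 (v w)"] by simp
      moreover have "pt w = to_ac (fls_const (emb2 (v w)))" using pt_R False w True by (auto simp: gv_def)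
      ultimately show ?thesis using ac.poly_map_poly_hom[of "Qz * map_poly fls_const Q2" "fls_const (emb2 (v w))"] by simp
    qed
    have "map_poly to_ac Gam = map_poly to_ac (Qz * map_poly fls_const Q2) + [:emb (om e1):]"
      by (simp add: Gam_def mac.hom_add emb_eq map_poly_pCons)
    then show ?thesis using z0 True unfolding gm by simp
  next
    case False
    then have we: "w \<in> R - {e1, e2}" using w e by auto
    have "poly Gam (gv w) = fls_const (emb2 (emb1 (om w)))"
      using g(2)[of "om w" w] False w by (simp add: gv_def)
    then show ?thesis unfolding gm pt_R(3)[OF we] using ac.poly_map_poly_hom[of Gam "gv w"] by (simp add: emb_eq)
  qed
  have sepb: "st.sep_on_blocks pt"
    unfolding st.sep_on_blocks_def
  proof (intro ballI impI)
    fix w w' assume w: "w \<in> R" "w' \<in> R" "om w = om w'" "pt w = pt w'"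
    show "w = w'"
    proof (cases "w \<in> {e1, e2} \<or> w' \<in> {e1, e2}")
      case True
      then show ?thesis using w(4) pt_R(1,2) xr yr \<open>x \<noteq> y\<close> pt_range[of w] pt_range[of w']
        by (metis insertE singletonD)
    next
      case False
      then have "gv w = gv w'" using pt_R(3)[of w] pt_R(3)[of w'] w by auto
      then show ?thesis
      proof (cases "om w = om e1")
        case True
        then have "fls_const (emb2 (v w)) = fls_const (emb2 (v w'))" using \<open>gv w = gv w'\<close> w by (simp add: gv_def)
        then have "emb2 (v w) = emb2 (v w')" using rhom_inj[OF rhom_fls_const] by blast
        then have "v w = v w'" using rhom_inj[OF rhom_emb2] by blast
        then show ?thesis using vinj by (auto dest: injD)
      next
        case False
        then have "g (om w) w = g (om w) w'" using \<open>gv w = gv w'\<close> w by (simp add: gv_def)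
        moreover have inj: "inj_on (g (om w)) {w' \<in> R. om w' = om w}" using g(1)[of "om w"] False w(1) by blast
        ultimately show ?thesis using inj_onD[OF inj] w by simp
      qed
    qed
  qed
  have swap: "mpoly_eval emb (pt \<circ> Transposition.transpose e1 e2) p = 0" if p: "mpoly_eval emb pt p = 0" for p
  proof -
    \<comment> \<open>the graph of the conjugation of the quadratic extension\<close>
    define Cj where "Cj = {(to_ac u + to_ac v * x, to_ac u + to_ac v * y) | u v. True}"
    have CjI: "(to_ac u + to_ac v * x, to_ac u + to_ac v * y) \<in> Cj" for u v unfolding Cj_def by blast
    have Cadd: "(a + a', c + c') \<in> Cj" if "(a, c) \<in> Cj" "(a', c') \<in> Cj" for a a' c c'
    proof -
      obtain u v u' v' where uv: "a = to_ac u + to_ac v * x" "c = to_ac u + to_ac v * y"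
        "a' = to_ac u' + to_ac v' * x" "c' = to_ac u' + to_ac v' * y" using \<open>(a, c) \<in> Cj\<close> \<open>(a', c') \<in> Cj\<close> unfolding Cj_def by blast
      show ?thesis using CjI[of "u + u'" "v + v'"] unfolding uv by (simp add: algebra_simps)
    qed
    have Cmult: "(a * a', c * c') \<in> Cj" if "(a, c) \<in> Cj" "(a', c') \<in> Cj" for a a' c c'
    proof -
      obtain u v u' v' where uv: "a = to_ac u + to_ac v * x" "c = to_ac u + to_ac v * y"
        "a' = to_ac u' + to_ac v' * x" "c' = to_ac u' + to_ac v' * y" using \<open>(a, c) \<in> Cj\<close> \<open>(a', c') \<in> Cj\<close> unfolding Cj_def by blast
      have yy: "y * y = (2 * bb + zz) * y - bb^2" using xy by (simp add: y_def algebra_simps)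
      have "(to_ac u + to_ac v * t) * (to_ac u' + to_ac v' * t) =
        to_ac (u * u' - v * v' * b^2) + to_ac (u * v' + v * u' + v * v' * (2 * b + z)) * t"
        if "t * t = (2 * bb + zz) * t - bb^2" for t
      proof -
        have "(to_ac u + to_ac v * t) * (to_ac u' + to_ac v' * t) =
          to_ac u * to_ac u' + (to_ac u * to_ac v' + to_ac v * to_ac u') * t + to_ac v * to_ac v' * (t * t)"
          by (simp add: algebra_simps)
        then show ?thesis unfolding that bb_def zz_def by (simp add: algebra_simps)
      qed
      from this[OF x] this[OF yy] show ?thesis unfolding uv using CjI by presburger
    qed
    have Cx: "(x, y) \<in> Cj" using CjI[of 0 1] by simp
    have Cy: "(y, x) \<in> Cj" using CjI[of "2 * b + z" "- 1"] by (simp add: y_def bb_def zz_def)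
    have Cc: "(to_ac u, to_ac u) \<in> Cj" for u using CjI[of u 0] by simp
    have Cpt: "(pt i, (pt \<circ> Transposition.transpose e1 e2) i) \<in> Cj" for i
    proof (cases "i = e1 \<or> i = e2")
      case True
      then show ?thesis using Cx Cy pt_R by auto
    next
      case False
      then have "Transposition.transpose e1 e2 i = i" by (simp add: Transposition.transpose_def)
      moreover obtain u where "pt i = to_ac u" using pt_range[of i] False by blast
      ultimately show ?thesis using Cc[of u] by simp
    qed
    have "(mpoly_eval emb pt p, mpoly_eval emb (pt \<circ> Transposition.transpose e1 e2) p) \<in> Cj"
    proof (induction p rule: mpoly_induct)
      case (const c) then show ?case unfolding st.h.mpoly_eval_const by (simp only: emb_eq Cc)
    next
      case (var i) then show ?case unfolding st.h.mpoly_eval_var by (rule Cpt)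
    next
      case (add p q) then show ?case unfolding st.h.mpoly_eval_add by (rule Cadd)
    next
      case (mult p q) then show ?case unfolding st.h.mpoly_eval_mult by (rule Cmult)
    qed
    then obtain u v where uv: "mpoly_eval emb pt p = to_ac u + to_ac v * x"
      "mpoly_eval emb (pt \<circ> Transposition.transpose e1 e2) p = to_ac u + to_ac v * y" unfolding Cj_def by blast
    have "v = 0"
    proof (rule ccontr)
      assume "v \<noteq> 0"
      then have "x = to_ac (- u / v)" using uv(1) p by (simp add: field_simps eq_neg_iff_add_eq_0)
      then show False using xr by blast
    qed
    then show ?thesis using uv p by simp
  qed
  have indep: "p = 0" if p: "p \<in> polys_in blk" "mpoly_eval emb pt p = 0" for p
  proof -
    interpret i: rhom "id :: 'k \<Rightarrow> 'k" by (rule rhom_id)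
    \<comment> \<open>specialise the block to arbitrary values \<open>y0\<close>, where \<open>b\<close> has to become a square root of \<open>y0 e1 * y0 e2\<close>\<close>
    have vanish: "mpoly_eval id y0 p = 0" if y0: "y0 e1 \<noteq> 0" for y0
    proof -
      define S1 where "S1 = {(to_ac (to_fract r), mpoly_eval id y0 r) | r. True}"
      have S1: "specialization emb1 S1"
        unfolding specialization_def
      proof (intro conjI allI impI)
        show "(emb1 c, c) \<in> S1" for c unfolding S1_def emb1_def
          using i.mpoly_eval_const[of y0 c] by (intro CollectI exI[of _ "mpoly_const c"]) simp
      next
        fix c assume "(0, c) \<in> S1"
        then obtain r where r: "to_ac (to_fract r) = 0" "c = mpoly_eval id y0 r" unfolding S1_def by force
        from r(1) have "r = 0" by simp
        then show "c = 0" using r(2) i.mpoly_eval_zero by simp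
      next
        fix a c a' c' assume "(a, c) \<in> S1" "(a', c') \<in> S1"
        then obtain r r' where r: "a = to_ac (to_fract r)" "c = mpoly_eval id y0 r"
          "a' = to_ac (to_fract r')" "c' = mpoly_eval id y0 r'" unfolding S1_def by blast
        show "(a + a', c + c') \<in> S1" unfolding S1_def r
          by (intro CollectI exI[of _ "r + r'"]) (simp add: i.mpoly_eval_add rhom.hom_add[OF rhom_to_fract])
        show "(a * a', c * c') \<in> S1" unfolding S1_def r
          by (intro CollectI exI[of _ "r * r'"]) (simp add: i.mpoly_eval_mult rhom.hom_mult[OF rhom_to_fract])
      qed
      have vS1: "(v w, y0 w) \<in> S1" for w unfolding S1_def v_def
        using i.mpoly_eval_var[of y0 w] by (intro CollectI exI[of _ "mpoly_var w"]) simp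
      obtain b0 where b0: "b0^2 = y0 e1 * y0 e2" using nth_root_exists[of 2] by auto
      obtain S2 where S2: "specialization (emb2 \<circ> emb1) S2" "(tvar, b0) \<in> S2" "\<And>x c. (x, c) \<in> S1 \<Longrightarrow> (emb2 x, c) \<in> S2"
        using specialization_extend[OF rhom_emb1 rhom_emb2 S1 tvar_transcendental] by metis
      have xt: "transcendental_over emb3 x"
        unfolding transcendental_over_def
      proof (intro allI impI)
        fix P assume *: "poly (map_poly emb3 P) x = 0"
        show "P = 0"
        proof (rule ccontr)
          assume "P \<noteq> 0"
          from root_of_closed_in_range[OF rhom_emb3 this *] show False using xr by (auto simp: emb3_def)
        qed
      qed
      obtain S3 where S3: "specialization (emb3 \<circ> (emb2 \<circ> emb1)) S3" "(x, y0 e1) \<in> S3" "\<And>x c. (x, c) \<in> S2 \<Longrightarrow> (emb3 x, c) \<in> S3"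
        using specialization_extend[OF rhom_comp[OF rhom_emb1 rhom_emb2] rhom_emb3 S2(1) xt] by metis
      have e3: "emb3 \<circ> (emb2 \<circ> emb1) = emb" by (intro ext) (simp add: emb_def)
      obtain S4 where S4: "specialization emb S4" "S3 \<subseteq> S4" "\<And>u c. (x * u, y0 e1 * c) \<in> S3 \<Longrightarrow> (u, c) \<in> S4"
        using specialization_localize[OF S3(1)[unfolded e3] S3(2) y0 rhom_emb] by metis
      have "(emb3 tvar, b0) \<in> S3" using S3(3) S2(2) by blast
      then have "(emb3 tvar * emb3 tvar, b0 * b0) \<in> S3" using S3(1) unfolding specialization_def by blast
      then have "(x * y, y0 e1 * y0 e2) \<in> S3" using xy b0 by (simp add: bb_def b_def emb3_def power2_eq_square)
      then have yS: "(y, y0 e2) \<in> S4" using S4(3) by blast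
      have "(pt w, y0 w) \<in> S4" if w: "w \<in> blk" for w
      proof (cases "w = e1 \<or> w = e2")
        case True
        then show ?thesis using yS S3(2) S4(2) pt_R by auto
      next
        case False
        then have "pt w = emb3 (emb2 (v w))" using pt_R(3)[of w] w by (auto simp: blk_def gv_def emb3_def)
        then show ?thesis using S4(2) S3(3)[OF S2(3)[OF vS1]] by auto
      qed
      then have "(mpoly_eval emb pt p, mpoly_eval id y0 p) \<in> S4"
        by (rule specialization_mpoly[OF rhom_emb S4(1) p(1)])
      then show ?thesis using p(2) S4(1) by (auto simp: specialization_def)
    qed
    show "p = 0"
    proof (rule ccontr)
      assume p0: "p \<noteq> 0"
      obtain M where M: "blk \<subseteq> {..<M}" using finW(2) finite_nat_iff_bounded by blast
      have v0: "mpoly_var e1 \<noteq> (0 :: 'k mpoly)"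
        using i.mpoly_eval_var[of "\<lambda>_. 1" e1] i.mpoly_eval_zero[of "\<lambda>_. 1"] by force
      have "mpoly_var e1 * p \<in> polys_in {..<M}"
        using subring_set.mult[OF polys_in_subring] polys_in_mono[OF M p(1)] M eblk by blast
      moreover have "mpoly_var e1 * p \<noteq> 0" using p0 v0 by simp
      ultimately obtain y0 where "mpoly_eval id y0 (mpoly_var e1 * p) \<noteq> 0"
        using mpoly_nonvanishing_point[OF alg_closed_infinite] by blast
      then have "y0 e1 * mpoly_eval id y0 p \<noteq> 0" unfolding i.mpoly_eval_mult i.mpoly_eval_var .
      then show False using vanish[of y0] by auto
    qed
  qed
  show ?thesis
  proof (rule that[of pt])
    show "st.on_variety pt" using sepb rel by (simp add: on_variety_iff)
  qed (use indep swap in \<open>auto simp: blk_def\<close>)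
qed

end

section \<open>The generic point\<close>

lemma mpoly_rename_comp: "mpoly_rename \<rho> (mpoly_rename \<pi> p) = mpoly_rename (\<lambda>i. \<rho> (\<pi> i)) p"
  unfolding mpoly_rename_def by (induction p rule: mpoly_induct) auto

lemma mpoly_rename_ident: "mpoly_rename (\<lambda>i. i) p = p"
  by (simp add: mpoly_rename_def)

lemma multiset_as_family:
  assumes "finite S" "size A = card S" shows "\<exists>f. image_mset f (mset_set S) = A"
  using assms
proof (induction S arbitrary: A)
  case (insert x S)
  then obtain a B where A: "A = add_mset a B" by (metis card_insert_disjoint size_eq_Suc_imp_eq_union union_mset_add_mset_right add.right_neutral)
  then obtain f where f: "image_mset f (mset_set S) = B" using insert by auto
  have "image_mset (f(x := a)) (mset_set S) = image_mset f (mset_set S)"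
    using insert.hyps by (intro image_mset_cong) auto
  then show ?case using insert.hyps f A by (intro exI[of _ "f(x := a)"]) (simp del: fun_upd_apply add: fun_upd_same)
qed auto

lemma monic_split_family:
  fixes p :: "'a::alg_closed_field poly"
  assumes "lead_coeff p = 1" "finite S" "degree p = card S"
  obtains f where "p = (\<Prod>x\<in>S. [:- f x, 1:])"
proof -
  have "p \<noteq> 0" using assms(1) by auto
  then obtain A where A: "size A = degree p" "p = smult (lead_coeff p) (\<Prod>x\<in>#A. [:-x, 1:])"
    using alg_closed_imp_factorization by blast
  obtain f where f: "image_mset f (mset_set S) = A" using multiset_as_family[OF assms(2)] A(1) assms(3) by metis
  have "p = (\<Prod>x\<in>#A. [:-x, 1:])" using A(2) assms(1) by simp
  also have "\<dots> = (\<Prod>x\<in>S. [:- f x, 1:])"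
    unfolding f[symmetric] by (simp add: prod_unfold_prod_mset image_mset.compositionality o_def)
  finally show ?thesis using that by blast
qed

lemma (in staircase) transport_iff_ex:
  assumes "infinite (UNIV :: 'k set)" "on_variety pt" "on_variety pt'"
    and "\<forall>c\<in>polys_in V0. mpoly_eval h pt c = 0 \<longleftrightarrow> mpoly_eval h pt' c = 0"
  shows "\<exists>\<pi>\<in>block_perms. \<forall>p\<in>polys_in (V0 \<union> R). mpoly_eval h pt p = 0 \<longleftrightarrow> mpoly_eval h (pt' \<circ> \<pi>) p = 0"
proof -
  have "mpoly_eval h pt c = 0 \<longleftrightarrow> mpoly_eval h pt' c = 0" if "c \<in> polys_in V0" for c
    using assms(4) that by blast
  from transport_iff[OF assms(1-3) this] show ?thesis by metis
qed

context blocks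
begin

definition block_of :: "'k \<Rightarrow> nat set" where "block_of c = {w \<in> R. om w = c}"

text \<open>Vieta's formulas: in the block of \<open>c\<close> the polynomial \<open>g - c\<close> is the product of the \<open>T - X_v\<close>.\<close>

definition coeff_poly :: "'k \<Rightarrow> nat \<Rightarrow> 'k mpoly" where
  "coeff_poly c l = coeff ((\<Prod>v\<in>block_of c. [:- mpoly_var v, 1:]) + [:mpoly_const c:]) (n - 1 - l)"

lemma finite_block: "finite (block_of c)"
  using finR by (simp add: block_of_def)

lemma coeff_poly_eval:
  assumes "rhom h"
  shows "mpoly_eval h x (coeff_poly c l) = coeff ((\<Prod>v\<in>block_of c. [:- x v, 1:]) + [:h c:]) (n - 1 - l)"
proof -
  interpret h: rhom h by fact
  interpret m: rhom "map_poly (mpoly_eval h x)" by (rule rhom_map_poly[OF h.mpoly_eval_rhom])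
  have "mpoly_eval h x (coeff_poly c l) =
    coeff (map_poly (mpoly_eval h x) ((\<Prod>v\<in>block_of c. [:- mpoly_var v, 1:]) + [:mpoly_const c:])) (n - 1 - l)"
    by (simp add: coeff_poly_def coeff_map_poly)
  also have "map_poly (mpoly_eval h x) ((\<Prod>v\<in>block_of c. [:- mpoly_var v, 1:]) + [:mpoly_const c:]) =
      (\<Prod>v\<in>block_of c. [:- x v, 1:]) + [:h c:]"
    by (simp add: m.hom_add m.hom_prod map_poly_pCons h.mpoly_eval_uminus)
  finally show ?thesis .
qed

lemma coeff_poly_in: "coeff_poly c l \<in> polys_in (block_of c)"
proof -
  interpret S: subring_set "polys_in (block_of c) :: 'k mpoly set" by (rule polys_in_subring)
  interpret P: subring_set "polys_over (polys_in (block_of c)) :: 'k mpoly poly set" by (rule S.polys_over_subring)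
  have "(\<Prod>v\<in>block_of c. [:- mpoly_var v, 1:]) + [:mpoly_const c:] \<in> polys_over (polys_in (block_of c))"
    by (intro P.add P.prod S.pCons_polys_over S.uminus) auto
  then show ?thesis by (simp add: coeff_poly_def polys_over_def)
qed

lemma coeff_poly_root_values:
  assumes pt: "st.on_variety pt" and c: "c \<in> om ` R" and l: "l < n"
  shows "mpoly_eval emb pt (coeff_poly c l) = pt l"
proof -
  obtain v0 where v0: "v0 \<in> R" "om v0 = c" using c by blast
  have card: "card (block_of c) = n" using block[OF v0(1)] v0(2) by (simp add: block_of_def)
  define P where "P = (\<Prod>v\<in>block_of c. [:- pt v, 1:])"
  have P: "degree P = n" "lead_coeff P = 1"
    using degree_prod_linear[OF finite_block, of pt c] lead_coeff_prod_linear[of pt "block_of c"] card by (simp_all add: P_def)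
  have inj: "inj_on pt (block_of c)"
    using pt by (auto simp: st.on_variety_def st.sep_on_blocks_def block_of_def inj_on_def)
  define D where "D = gen_monic n pt - [:emb c:] - P"
  have "D = 0"
  proof (rule ccontr)
    assume D0: "D \<noteq> 0"
    have "coeff D i = 0" if "i \<ge> n" for i
      using that P n by (cases "i = n") (auto simp: D_def coeff_gen_monic coeff_pCons coeff_eq_0 split: nat.splits)
    then have "degree D < n" using n by (intro degree_lessI) auto
    moreover have "pt ` block_of c \<subseteq> {x. poly D x = 0}"
      using pt finite_block by (auto simp: D_def P_def poly_prod on_variety_iff block_of_def)
    then have "n \<le> card {x. poly D x = 0}"
      using card_mono[OF poly_roots_finite[OF D0]] card_image[OF inj] card by metis
    moreover have "card {x. poly D x = 0} \<le> degree D" by (rule card_poly_roots_bound[OF D0])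
    ultimately show False by simp
  qed
  moreover have "P + [:emb c:] = gen_monic n pt - D" unfolding D_def by (simp only: diff_diff_eq2 diff_add_eq) simp
  ultimately have "P + [:emb c:] = gen_monic n pt" by simp
  then show ?thesis using l by (simp add: coeff_poly_eval[OF rhom_emb] P_def coeff_gen_monic)
qed

text \<open>Elimination of the coefficients of \<open>g\<close> in favour of the roots in one block.\<close>

definition to_block :: "'k \<Rightarrow> 'k mpoly \<Rightarrow> 'k mpoly" where
  "to_block c = mpoly_subst (\<lambda>i. if i < n then coeff_poly c i else mpoly_var i)"

lemma to_block_in: "p \<in> polys_in ({..<n} \<union> block_of c) \<Longrightarrow> to_block c p \<in> polys_in (block_of c)"
  unfolding to_block_def by (rule mpoly_subst_in) (auto simp: coeff_poly_in)

lemma to_block_eval: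
  assumes "st.on_variety pt" "c \<in> om ` R"
  shows "mpoly_eval emb pt (to_block c p) = mpoly_eval emb pt p"
proof -
  have "(\<lambda>i. mpoly_eval emb pt (if i < n then coeff_poly c i else mpoly_var i)) = pt"
    using coeff_poly_root_values[OF assms] by (intro ext) auto
  then show ?thesis unfolding to_block_def st.h.mpoly_eval_subst by simp
qed

definition block_indep :: "(nat \<Rightarrow> 'k gen) \<Rightarrow> 'k \<Rightarrow> bool" where
  "block_indep pt c \<longleftrightarrow> (\<forall>p\<in>polys_in (block_of c). mpoly_eval emb pt p = 0 \<longrightarrow> p = 0)"

definition coeff_indep :: "(nat \<Rightarrow> 'k gen) \<Rightarrow> bool" where
  "coeff_indep pt \<longleftrightarrow> (\<forall>p\<in>polys_in {..<n}. mpoly_eval emb pt p = 0 \<longrightarrow> p = 0)"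

text \<open>If the roots of one block are independent, so are the coefficients: any monic polynomial arises by a
  choice of roots.\<close>

lemma block_indep_imp_coeff_indep:
  assumes pt: "st.on_variety pt" and c: "c \<in> om ` R" and ind: "block_indep pt c"
  shows "coeff_indep pt"
  unfolding coeff_indep_def
proof (intro ballI impI)
  fix p assume p: "p \<in> polys_in {..<n}" "mpoly_eval emb pt p = 0"
  interpret i: rhom "id :: 'k \<Rightarrow> 'k" by (rule rhom_id)
  have "to_block c p \<in> polys_in (block_of c)" using to_block_in polys_in_mono[OF _ p(1)] by blast
  then have z: "to_block c p = 0" using ind to_block_eval[OF pt c] p(2) by (auto simp: block_indep_def)
  obtain v0 where v0: "v0 \<in> R" "om v0 = c" using c by blast
  have card: "card (block_of c) = n" using block[OF v0(1)] v0(2) by (simp add: block_of_def)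
  have "mpoly_eval id a p = 0" for a
  proof -
    define P where "P = gen_monic n a - [:c:]"
    have "coeff P n = 1" "\<And>i. i > n \<Longrightarrow> coeff P i = 0"
      using n by (auto simp: P_def coeff_gen_monic coeff_pCons split: nat.splits)
    then have dP: "degree P = n" by (intro antisym degree_le le_degree) auto
    obtain t where t: "P = (\<Prod>v\<in>block_of c. [:- t v, 1:])"
      using monic_split_family[of P "block_of c"] dP \<open>coeff P n = 1\<close> card finite_block by metis
    have "mpoly_eval id t (coeff_poly c l) = a l" if "l < n" for l
      unfolding coeff_poly_eval[OF rhom_id] t[symmetric] P_def using that by (simp add: coeff_gen_monic)
    then have "mpoly_eval id a p = mpoly_eval id (\<lambda>i. mpoly_eval id t (if i < n then coeff_poly c i else mpoly_var i)) p"
      by (intro i.mpoly_eval_cong[OF p(1)]) simp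
    also have "\<dots> = mpoly_eval id t (to_block c p)" unfolding to_block_def i.mpoly_eval_subst ..
    also have "\<dots> = 0" unfolding z by (rule i.mpoly_eval_zero)
    finally show ?thesis .
  qed
  then show "p = 0" using mpoly_nonvanishing_point[OF alg_closed_infinite p(1)] by metis
qed

lemma block_indep_perm:
  assumes "block_indep pt c" "\<pi> \<in> st.block_perms" shows "block_indep (pt \<circ> \<pi>) c"
  unfolding block_indep_def
proof (intro ballI impI)
  fix p assume p: "p \<in> polys_in (block_of c)" "mpoly_eval emb (pt \<circ> \<pi>) p = 0"
  have per: "\<pi> permutes R" "\<And>v. v \<in> R \<Longrightarrow> om (\<pi> v) = om v" using assms(2) by (auto simp: st.block_perms_def)
  have "mpoly_rename \<pi> p \<in> polys_in (block_of c)"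
    unfolding mpoly_rename_def using per
    by (intro mpoly_subst_in[OF p(1)]) (auto simp: block_of_def permutes_in_image)
  moreover have "mpoly_eval emb pt (mpoly_rename \<pi> p) = 0" using p(2) by (simp only: st.h.mpoly_eval_rename)
  ultimately have "mpoly_rename \<pi> p = 0" using assms(1) by (auto simp: block_indep_def)
  then have "mpoly_rename (inv_into UNIV \<pi>) (mpoly_rename \<pi> p) = 0" by (simp add: mpoly_rename_def)
  then show "p = 0" using permutes_inverses(2)[OF per(1)] by (simp add: mpoly_rename_comp mpoly_rename_ident)
qed

text \<open>When the coefficients are eliminated, a relation between them and the independent roots of one block becomes
  an identity, so it survives every reordering.\<close>

lemma block_symmetric:
  assumes pt: "st.on_variety pt" and c: "c \<in> om ` R" and ind: "block_indep pt c"
    and \<pi>: "\<pi> \<in> st.block_perms" and p: "p \<in> polys_in ({..<n} \<union> block_of c)"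
  shows "mpoly_eval emb (pt \<circ> \<pi>) p = 0 \<longleftrightarrow> mpoly_eval emb pt p = 0"
proof -
  have 1: "mpoly_eval emb x p = 0 \<longleftrightarrow> to_block c p = 0" if "st.on_variety x" "block_indep x c" for x
    using to_block_eval[OF that(1) c, of p] to_block_in[OF p] that(2) st.h.mpoly_eval_zero[of x]
    by (auto simp: block_indep_def)
  show ?thesis
    unfolding 1[OF pt ind] 1[OF st.on_variety_perm[OF pt \<pi>] block_indep_perm[OF ind \<pi>]] ..
qed

lemma collision_point_ex:
  assumes "n = 2 \<longrightarrow> (2::'k) \<noteq> 0" "v \<in> R" "w \<in> R" "v \<noteq> w" "om v = om w"
  shows "\<exists>pt. st.on_variety pt \<and> block_indep pt (om v) \<and>
    (\<forall>p. mpoly_eval emb pt p = 0 \<longrightarrow> mpoly_eval emb (pt \<circ> Transposition.transpose v w) p = 0)"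
proof (rule collision_point[of v w], goal_cases)
  case (6 pt)
  show ?case
  proof (intro exI conjI allI impI)
    show "block_indep pt (om v)" unfolding block_indep_def block_of_def using 6(2) by blast
  qed (fact 6)+
qed (use assms in blast)+

text \<open>The Galois group of the generic \<open>\<Prod>(g - c)\<close> over the field of coefficients contains all transpositions
  inside a block. For the point \<open>pt'\<close> of \<open>collision_point\<close> this is known. Since the coefficients are
  independent for both points, \<open>transport\<close> identifies \<open>pt\<close> with a reordering of \<open>pt'\<close>. Reordering the
  block of \<open>v\<close> does not matter by \<open>block_symmetric\<close>, and so a second transport, with that block among the
  parameters, gives a reordering \<open>\<rho>\<close> that fixes the block and therefore commutes with the transposition.\<close>

lemma generic_point_swaps:
  assumes two: "n = 2 \<longrightarrow> (2::'k) \<noteq> 0" and pt: "st.on_variety pt" "coeff_indep pt"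
    and v: "v \<in> R" "w \<in> R" "v \<noteq> w" "om v = om w"
    and p: "p \<in> polys_in ({..<n} \<union> R)" "mpoly_eval emb pt p = 0"
  shows "mpoly_eval emb (pt \<circ> Transposition.transpose v w) p = 0"
proof -
  define c where "c = om v"
  have c: "c \<in> om ` R" using v by (auto simp: c_def)
  obtain pt' where pt': "st.on_variety pt'" "block_indep pt' c"
    "\<forall>p. mpoly_eval emb pt' p = 0 \<longrightarrow> mpoly_eval emb (pt' \<circ> Transposition.transpose v w) p = 0"
    using collision_point_ex[OF two v] unfolding c_def by (elim exE conjE)
  have cpt': "coeff_indep pt'" by (rule block_indep_imp_coeff_indep[OF pt'(1) c pt'(2)])
  have inf: "infinite (UNIV :: 'k set)" by (rule alg_closed_infinite)
  have base: "\<forall>q\<in>polys_in {..<n}. mpoly_eval emb pt q = 0 \<longleftrightarrow> mpoly_eval emb pt' q = 0"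
    using pt(2) cpt' st.h.mpoly_eval_zero unfolding coeff_indep_def by metis
  obtain \<pi> where \<pi>: "\<pi> \<in> st.block_perms" "\<forall>p\<in>polys_in ({..<n} \<union> R).
      mpoly_eval emb pt p = 0 \<longleftrightarrow> mpoly_eval emb (pt' \<circ> \<pi>) p = 0"
    using st.transport_iff_ex[OF inf pt(1) pt'(1) base] by (elim bexE)
  \<comment> \<open>the block of \<open>v\<close> and \<open>w\<close> now counts as parameters\<close>
  define V0' where "V0' = {..<n} \<union> block_of c"
  define R' where "R' = R - block_of c"
  interpret st2: staircase emb n V0' R' om G
  proof (rule staircase.intro)
    show "rhom emb" by (rule rhom_emb)
    show "n > 0" by (rule n)
    show "finite R'" using finR by (simp add: R'_def)
    show "V0' \<inter> R' = {}" using disjR by (auto simp: V0'_def R'_def)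
    show "card {w \<in> R'. om w = om v} = n" if "v \<in> R'" for v
    proof -
      have "{w \<in> R'. om w = om v} = {w \<in> R. om w = om v}" using that by (auto simp: R'_def block_of_def)
      then show ?thesis using block[of v] that by (simp add: R'_def)
    qed
    show "G v \<in> polys_over (polys_in V0')" for v
      using polys_over_mono[OF _ G_props(1)] polys_in_mono[of "{..<n}" V0'] by (auto simp: V0'_def)
    show "G v = G w" if "om v = om w" for v w using that by (simp add: G_def)
    show "lead_coeff (G v) = 1" "degree (G v) = n" for v by (rule G_props)+
  qed
  have R'R: "R' \<subseteq> R" by (auto simp: R'_def)
  have st2v: "st2.on_variety x" if "st.on_variety x" for x
    using that R'R unfolding st2.on_variety_def st.on_variety_def st2.sep_on_blocks_def st.sep_on_blocks_def by blast
  have VR: "V0' \<union> R' = {..<n} \<union> R" by (auto simp: V0'_def R'_def block_of_def)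
  have base2: "mpoly_eval emb pt q = 0 \<longleftrightarrow> mpoly_eval emb pt' q = 0" if q: "q \<in> polys_in V0'" for q
  proof -
    have "V0' \<subseteq> {..<n} \<union> R" using VR by blast
    then have "q \<in> polys_in ({..<n} \<union> R)" using polys_in_mono q by blast
    from bspec[OF \<pi>(2) this] block_symmetric[OF pt'(1) c pt'(2) \<pi>(1) q[unfolded V0'_def]] show ?thesis by simp
  qed
  have base2': "\<forall>q\<in>polys_in V0'. mpoly_eval emb pt q = 0 \<longleftrightarrow> mpoly_eval emb pt' q = 0"
    using base2 by (intro ballI)
  obtain \<rho> where \<rho>: "\<rho> \<in> st2.block_perms" "\<forall>p\<in>polys_in ({..<n} \<union> R).
      mpoly_eval emb pt p = 0 \<longleftrightarrow> mpoly_eval emb (pt' \<circ> \<rho>) p = 0"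
    using st2.transport_iff_ex[OF inf st2v[OF pt(1)] st2v[OF pt'(1)] base2'] unfolding VR by (elim bexE)
  define \<tau> where "\<tau> = Transposition.transpose v w"
  have \<rho>v: "\<rho> v = v" "\<rho> w = w" using st2.block_perms_fixes[OF \<rho>(1)] v by (auto simp: R'_def block_of_def c_def)
  have "\<rho> permutes R'" using \<rho>(1) by (simp add: st2.block_perms_def)
  then have "inj \<rho>" by (rule permutes_inj)
  have "\<tau> (\<rho> i) = \<rho> (\<tau> i)" for i
  proof (cases "i = v \<or> i = w")
    case True
    then show ?thesis using \<rho>v by (elim disjE) (simp_all add: \<tau>_def)
  next
    case False
    then have "\<rho> i \<noteq> v" "\<rho> i \<noteq> w" using \<rho>v inj_eq[OF \<open>inj \<rho>\<close>, of i] by metis+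
    then show ?thesis using False by (simp add: \<tau>_def Transposition.transpose_def)
  qed
  then have comm: "\<tau> \<circ> \<rho> = \<rho> \<circ> \<tau>" by (simp add: fun_eq_iff)
  have "mpoly_eval emb (pt' \<circ> \<rho>) p = 0" using bspec[OF \<rho>(2) p(1)] p(2) by simp
  then have "mpoly_eval emb pt' (mpoly_rename \<rho> p) = 0" by (simp only: st.h.mpoly_eval_rename)
  then have "mpoly_eval emb (pt' \<circ> \<tau>) (mpoly_rename \<rho> p) = 0" unfolding \<tau>_def using pt'(3) by blast
  then have "mpoly_eval emb (pt' \<circ> \<rho>) (mpoly_rename \<tau> p) = 0"
    by (simp only: st.h.mpoly_eval_rename comp_assoc comm)
  moreover have "mpoly_rename \<tau> p \<in> polys_in ({..<n} \<union> R)"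
    unfolding \<tau>_def by (rule st.rename_in[OF st.transpose_in_block_perms[OF v(1,2,4)] p(1)])
  ultimately have "mpoly_eval emb pt (mpoly_rename \<tau> p) = 0" using \<rho>(2) by blast
  then show ?thesis by (simp only: st.h.mpoly_eval_rename \<tau>_def)
qed

text \<open>For \<open>n = 1\<close> there is nothing to collide, and \<open>T + a\<close> with transcendental \<open>a\<close> will do.\<close>

lemma generic_point_exists:
  assumes two: "n = 2 \<longrightarrow> (2::'k) \<noteq> 0" and "R \<noteq> {}"
  obtains pt where "st.on_variety pt" "coeff_indep pt"
proof (cases "n = 1")
  case True
  interpret i: rhom "id :: 'k \<Rightarrow> 'k" by (rule rhom_id)
  define a where "a = (emb3 tvar :: 'k gen)"
  define pt where "pt = (\<lambda>i. if i = 0 then a else emb (om i) - a)"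
  have R0: "0 \<notin> R" using disjR True by auto
  have "w = v" if "v \<in> R" "w \<in> R" "om w = om v" for v w
  proof -
    have "card {w \<in> R. om w = om v} = 1" using block[OF that(1)] True by simp
    then show ?thesis using that by (metis (mono_tags, lifting) card_1_singletonE mem_Collect_eq singletonD)
  qed
  then have "st.sep_on_blocks pt" unfolding st.sep_on_blocks_def by metis
  moreover have "gen_monic n pt = [:a, 1:]" unfolding True by (simp add: gen_monic_def pt_def monom_altdef)
  moreover have "pt v = emb (om v) - a" if "v \<in> R" for v using R0 that by (auto simp: pt_def)
  ultimately have "st.on_variety pt" unfolding on_variety_iff by simp
  moreover have "coeff_indep pt" unfolding coeff_indep_def
  proof (intro ballI impI)
    fix p assume p: "p \<in> polys_in {..<n}" "mpoly_eval emb pt p = 0"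
    have "mpoly_eval id x p = 0" for x
    proof -
      have S1: "specialization emb1 {(emb1 c, c) | c :: 'k. True}"
        unfolding specialization_def
        by (auto simp: rhom.hom_add[OF rhom_emb1] rhom.hom_mult[OF rhom_emb1] rhom_eq_0_iff[OF rhom_emb1] dest: sym)
      obtain S2 where S2: "specialization (emb2 \<circ> emb1) S2" "(tvar, x 0) \<in> S2"
        using specialization_extend[OF rhom_emb1 rhom_emb2 S1 tvar_transcendental] by metis
      define S3 where "S3 = {(emb3 u, c) | u c. (u, c) \<in> S2}"
      have "specialization emb S3" unfolding specialization_def
      proof (intro conjI allI impI)
        show "(emb c, c) \<in> S3" for c using S2(1) unfolding S3_def specialization_def emb_def by force
        show "c = 0" if "(0, c) \<in> S3" for c
        proof -
          obtain u where "emb3 u = 0" "(u, c) \<in> S2" using \<open>(0, c) \<in> S3\<close> unfolding S3_def by auto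
          then show ?thesis using S2(1) rhom_eq_0_iff[OF rhom_emb3] unfolding specialization_def by metis
        qed
        fix y c z d assume "(y, c) \<in> S3" "(z, d) \<in> S3"
        then obtain u u' where u: "y = emb3 u" "(u, c) \<in> S2" "z = emb3 u'" "(u', d) \<in> S2" unfolding S3_def by blast
        have "(u + u', c + d) \<in> S2" "(u * u', c * d) \<in> S2" using S2(1) u unfolding specialization_def by blast+
        then show "(y + z, c + d) \<in> S3" "(y * z, c * d) \<in> S3"
          unfolding S3_def u rhom.hom_add[OF rhom_emb3, symmetric] rhom.hom_mult[OF rhom_emb3, symmetric] by blast+
      qed
      then have "(mpoly_eval emb pt p, mpoly_eval id x p) \<in> S3"
        by (rule specialization_mpoly[OF rhom_emb _ p(1)]) (use S2(2) True in \<open>auto simp: pt_def a_def S3_def\<close>)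
      then show ?thesis using p(2) \<open>specialization emb S3\<close> by (simp add: specialization_def)
    qed
    then show "p = 0" using mpoly_nonvanishing_point[OF alg_closed_infinite p(1)] by metis
  qed
  ultimately show ?thesis using that by blast
next
  case False
  obtain v where v: "v \<in> R" using assms(2) by blast
  have "\<not> {w \<in> R. om w = om v} \<subseteq> {v}"
  proof
    assume "{w \<in> R. om w = om v} \<subseteq> {v}"
    then have "card {w \<in> R. om w = om v} \<le> 1" using card_mono[of "{v}"] by simp
    then show False using block[OF v] n False by simp
  qed
  then obtain w where w: "w \<in> R" "v \<noteq> w" "om v = om w" by (metis (mono_tags, lifting) mem_Collect_eq singleton_iff subsetI)
  obtain pt where pt: "st.on_variety pt" "block_indep pt (om v)"
    using collision_point_ex[OF two v w(1,2,3)] by (elim exE conjE)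
  then show ?thesis using that[OF pt(1)] block_indep_imp_coeff_indep[OF pt(1) _ pt(2)] v by blast
qed

end

section \<open>Fields given by records inside a field type\<close>

text \<open>The definitions of varieties and separability use fields given by records, the theory above subfields
  of a type. An embedding \<open>val\<close> of the record into a field type translates between them.\<close>

locale field_val = field R for R :: "('a, 'b) ring_scheme" (structure) +
  fixes val :: "'a \<Rightarrow> 'o::alg_closed_field"
  assumes val_inj: "inj_on val (carrier R)"
    and val_add: "x \<in> carrier R \<Longrightarrow> y \<in> carrier R \<Longrightarrow> val (x \<oplus> y) = val x + val y"
    and val_mult: "x \<in> carrier R \<Longrightarrow> y \<in> carrier R \<Longrightarrow> val (x \<otimes> y) = val x * val y"
    and val_one: "val \<one> = 1"
begin

lemma val_zero: "val \<zero> = 0"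
proof -
  have "val \<zero> = val \<zero> + val \<zero>" using val_add[of \<zero> \<zero>] by (simp only: zero_closed l_zero)
  then show ?thesis by (metis add_cancel_right_right)
qed

lemma val_eq_0_iff: "x \<in> carrier R \<Longrightarrow> val x = 0 \<longleftrightarrow> x = \<zero>"
  using inj_onD[OF val_inj, of x \<zero>] val_zero by auto

lemma val_uminus: "x \<in> carrier R \<Longrightarrow> val (\<ominus> x) = - val x"
  using val_add[of x "\<ominus> x"] by (simp add: val_zero r_neg eq_neg_iff_add_eq_0 add.commute)

lemma val_pow: "x \<in> carrier R \<Longrightarrow> val (x [^] (k::nat)) = val x ^ k"
  by (induction k) (auto simp: val_one val_mult)

lemma val_inv: "x \<in> carrier R \<Longrightarrow> x \<noteq> \<zero> \<Longrightarrow> val (inv x) = inverse (val x)"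
proof -
  assume x: "x \<in> carrier R" "x \<noteq> \<zero>"
  then have "x \<in> Units R" by (simp add: field_Units)
  then have "val x * val (inv x) = 1" using x val_mult[of x "inv x"] by (simp add: val_one)
  then show ?thesis using inverse_unique by metis
qed

lemma val_add_pow: "x \<in> carrier R \<Longrightarrow> val (add_pow R (k::nat) x) = of_nat k * val x"
  by (induction k) (auto simp: val_zero val_add algebra_simps)

lemma val_subfield:
  assumes K: "subfield K R" shows "ac_subfield (val ` K)"
proof -
  have Kc: "K \<subseteq> carrier R" using K by (rule subfieldE)
  have sr: "subring K R" using K by (rule subfieldE)
  note k = subringE[OF sr]
  show ?thesis
    unfolding ac_subfield_def
  proof (unfold_locales, goal_cases)
    case 1 show ?case using val_zero k(2) by (metis image_eqI)
  next
    case 2 show ?case using val_one k(3) by (metis image_eqI)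
  next
    case (3 x y)
    then obtain a b where ab: "a \<in> K" "b \<in> K" "x = val a" "y = val b" by blast
    then have "a \<in> carrier R" "b \<in> carrier R" using Kc by auto
    from val_add[OF this, symmetric] show ?case unfolding ab(3,4) using k(7)[OF ab(1,2)] by simp
  next
    case (4 x y)
    then obtain a b where ab: "a \<in> K" "b \<in> K" "x = val a" "y = val b" by blast
    then have "a \<in> carrier R" "b \<in> carrier R" using Kc by auto
    from val_mult[OF this, symmetric] show ?case unfolding ab(3,4) using k(6)[OF ab(1,2)] by simp
  next
    case (5 x)
    then obtain a where a: "a \<in> K" "x = val a" by blast
    then have "a \<in> carrier R" using Kc by auto
    from val_uminus[OF this, symmetric] show ?case unfolding a(2) using k(5)[OF a(1)] by simp
  next
    case (6 x)
    then obtain a where a: "a \<in> K" "x = val a" by blast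
    show ?case
    proof (cases "a = \<zero>")
      case True then show ?thesis using a val_zero k(2) by (auto intro: image_eqI)
    next
      case False
      then have "inv a \<in> K" using subfield_m_inv(1)[OF K] a by auto
      then show ?thesis using val_inv[of a] a Kc False by (metis image_eqI subsetD)
    qed
  qed
qed

text \<open>List polynomials have the leading coefficient first.\<close>

definition list_poly :: "'a list \<Rightarrow> 'o poly" where
  "list_poly p = Poly (rev (map val p))"

lemma coeff_list_poly: "i < length p \<Longrightarrow> poly.coeff (list_poly p) i = val (p ! (length p - 1 - i))"
  by (simp add: list_poly_def nth_default_nth rev_nth)

lemma coeff_list_poly_0: "i \<ge> length p \<Longrightarrow> poly.coeff (list_poly p) i = 0"
  by (simp add: list_poly_def nth_default_beyond)

lemma list_poly_Cons: "list_poly (a # p) = Polynomial.monom (val a) (length p) + list_poly p"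
  by (rule poly_eqI) (auto simp: coeff_list_poly coeff_list_poly_0 nth_Cons' not_less Suc_diff_Suc
      coeff_list_poly_0[of p] dest: le_antisym split: if_splits simp: list_poly_def nth_default_append nth_default_nth rev_nth nth_default_beyond)

lemma list_poly_eval:
  "set p \<subseteq> carrier R \<Longrightarrow> x \<in> carrier R \<Longrightarrow> val (eval p x) = poly (list_poly p) (val x)"
proof (induction p)
  case Nil
  then show ?case by (simp add: list_poly_def val_zero)
next
  case (Cons a p)
  then show ?case by (simp add: list_poly_Cons val_add val_mult val_pow poly_monom eval_in_carrier)
qed

lemma list_poly_normalize: "set p \<subseteq> carrier R \<Longrightarrow> list_poly (normalize p) = list_poly p"
  by (induction p) (auto simp: list_poly_Cons val_zero)

lemma univ_poly_set: "p \<in> carrier (univ_poly R K) \<Longrightarrow> set p \<subseteq> K"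
  by (auto simp: univ_poly_def polynomial_def)

lemma list_poly_over: "p \<in> carrier (univ_poly R K) \<Longrightarrow> subfield K R \<Longrightarrow> list_poly p \<in> polys_over (val ` K)"
proof -
  assume p: "p \<in> carrier (univ_poly R K)" and K: "subfield K R"
  interpret B: ac_subfield "val ` K" by (rule val_subfield[OF K])
  show ?thesis unfolding polys_over_def
  proof (intro CollectI allI)
    fix i show "poly.coeff (list_poly p) i \<in> val ` K"
    proof (cases "i < length p")
      case True
      then have "p ! (length p - 1 - i) \<in> set p" by (intro nth_mem) simp
      then show ?thesis using univ_poly_set[OF p] coeff_list_poly[OF True] by auto
    qed (use coeff_list_poly_0 B.zero in simp)
  qed
qed

lemma degree_list_poly:
  assumes "p \<in> carrier (univ_poly R K)" "K \<subseteq> carrier R" "p \<noteq> []"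
  shows "Polynomial.degree (list_poly p) = length p - 1" "Polynomial.lead_coeff (list_poly p) = val (hd p)"
    "list_poly p \<noteq> 0"
proof -
  have "hd p \<in> set p" using assms(3) by simp
  then have "hd p \<in> carrier R" using univ_poly_set[OF assms(1)] assms(2) by blast
  moreover have "hd p \<noteq> \<zero>" using assms by (auto simp: univ_poly_def polynomial_def)
  ultimately have hd: "hd p \<noteq> \<zero>" "hd p \<in> carrier R" by auto
  then have v: "val (hd p) \<noteq> 0" by (simp add: val_eq_0_iff)
  have c: "poly.coeff (list_poly p) (length p - 1) = val (hd p)"
    using assms(3) coeff_list_poly[of "length p - 1" p] by (simp add: hd_conv_nth)
  show d: "Polynomial.degree (list_poly p) = length p - 1"
  proof (rule antisym)
    show "Polynomial.degree (list_poly p) \<le> length p - 1"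
      using assms(3) by (intro degree_le) (auto intro!: coeff_list_poly_0)
    show "length p - 1 \<le> Polynomial.degree (list_poly p)" using c v by (intro le_degree) simp
  qed
  show "Polynomial.lead_coeff (list_poly p) = val (hd p)" unfolding d c ..
  show "list_poly p \<noteq> 0" using c v by auto
qed

lemma list_poly_surj:
  assumes K: "K \<subseteq> carrier R" and P: "P \<in> polys_over (val ` K)"
  obtains p where "p \<in> carrier (univ_poly R K)" "list_poly p = P"
proof (cases "P = 0")
  case True
  then show ?thesis using that[of "[]"] by (simp add: univ_poly_def polynomial_def list_poly_def)
next
  case False
  define f where "f = inv_into K val"
  have cf: "c \<in> val ` K" if mem: "c \<in> set (coeffs P)" for c
  proof -
    obtain i where i: "i < length (coeffs P)" "coeffs P ! i = c" using mem by (auto simp: in_set_conv_nth)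
    have "poly.coeff P i = nth_default 0 (coeffs P) i" by (simp add: nth_default_coeffs_eq)
    also have "\<dots> = c" using nth_default_nth[OF i(1)] i(2) by simp
    finally have "c = poly.coeff P i" ..
    moreover have "poly.coeff P i \<in> val ` K" using P unfolding polys_over_def by blast
    ultimately show ?thesis by simp
  qed
  have f: "f c \<in> K" "val (f c) = c" if "c \<in> set (coeffs P)" for c
    using cf[OF that] by (auto simp: f_def inv_into_into f_inv_into_f)
  define p where "p = map f (rev (coeffs P))"
  have "map val p = rev (coeffs P)" unfolding p_def map_map by (rule map_idI) (use f in simp)
  then have 1: "list_poly p = P" by (simp add: list_poly_def)
  have "hd p = f (Polynomial.lead_coeff P)"
    using False by (simp add: p_def hd_map hd_rev last_coeffs_eq_coeff_degree)
  moreover have "val (f (Polynomial.lead_coeff P)) = Polynomial.lead_coeff P"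
    using f(2)[of "Polynomial.lead_coeff P"] False by (metis coeffs_eq_Nil last_coeffs_eq_coeff_degree last_in_set)
  ultimately have "hd p \<noteq> \<zero>" using False val_zero by (metis leading_coeff_0_iff)
  moreover have "set p \<subseteq> K" using f(1) by (auto simp: p_def)
  ultimately have "p \<in> carrier (univ_poly R K)" by (auto simp: univ_poly_def polynomial_def)
  then show ?thesis using that 1 by blast
qed

lemma formal_deriv_props:
  assumes p: "p \<in> carrier (univ_poly R K)" and K: "subfield K R"
  shows "formal_deriv R p \<in> carrier (univ_poly R K)" "list_poly (formal_deriv R p) = pderiv (list_poly p)"
    "length (formal_deriv R p) \<le> length p - 1"
proof -
  have Kc: "K \<subseteq> carrier R" using K by (rule subfieldE)
  have sr: "subring K R" using K by (rule subfieldE)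
  note k = subringE[OF sr]
  have pK: "set p \<subseteq> K" by (rule univ_poly_set[OF p])
  have ap: "add_pow R (j::nat) x \<in> K" if "x \<in> K" for j x
    using that Kc by (induction j) (auto simp: k)
  define q where "q = map (\<lambda>i. add_pow R (length p - 1 - i) (p ! i)) [0..<length p - 1]"
  have "p ! i \<in> K" if "i < length p - 1" for i using nth_mem[of i p] that pK by auto
  then have qK: "set q \<subseteq> K" using ap by (auto simp: q_def)
  have fd: "formal_deriv R p = normalize q" by (simp add: formal_deriv_def q_def)
  show "formal_deriv R p \<in> carrier (univ_poly R K)"
    unfolding fd using normalize_gives_polynomial[OF qK] by (simp add: univ_poly_def)
  have "length (normalize q) \<le> length q" by (rule normalize_length_le)
  then show "length (formal_deriv R p) \<le> length p - 1" unfolding fd by (simp add: q_def)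
  have "list_poly q = pderiv (list_poly p)"
  proof (rule poly_eqI)
    fix j
    show "poly.coeff (list_poly q) j = poly.coeff (pderiv (list_poly p)) j"
    proof (cases "j < length p - 1")
      case True
      have lq: "length q = length p - 1" by (simp add: q_def)
      have idx: "length q - 1 - j < length p - 1" using True lq by simp
      have mem: "p ! (length q - 1 - j) \<in> carrier R" 
      proof -
        have "length q - 1 - j < length p" using idx by simp
        then have "p ! (length q - 1 - j) \<in> set p" by (rule nth_mem)
        then show ?thesis using pK Kc by blast
      qed
      have "poly.coeff (list_poly q) j = val (q ! (length q - 1 - j))" using True lq coeff_list_poly by simp
      also have "\<dots> = val (add_pow R (length p - 1 - (length q - 1 - j)) (p ! (length q - 1 - j)))"
        using idx by (simp add: q_def)
      also have "\<dots> = of_nat (length p - 1 - (length q - 1 - j)) * val (p ! (length q - 1 - j))"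
        by (rule val_add_pow[OF mem])
      also have "length p - 1 - (length q - 1 - j) = Suc j" using True lq by simp
      also have "length q - 1 - j = length p - 1 - Suc j" using lq by simp
      finally show ?thesis using True by (simp add: coeff_pderiv coeff_list_poly del: of_nat_Suc)
    next
      case False
      then show ?thesis by (simp add: coeff_pderiv coeff_list_poly_0 q_def)
    qed
  qed
  then show "list_poly (formal_deriv R p) = pderiv (list_poly p)"
    unfolding fd using list_poly_normalize[of q] qK Kc by auto
qed

lemma list_poly_root_iff:
  assumes "p \<in> carrier (univ_poly R K)" "K \<subseteq> carrier R" "x \<in> carrier R"
  shows "eval p x = \<zero> \<longleftrightarrow> poly (list_poly p) (val x) = 0"
proof -
  have "set p \<subseteq> carrier R" using univ_poly_set[OF assms(1)] assms(2) by blast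
  then show ?thesis using list_poly_eval[OF _ assms(3)] val_eq_0_iff eval_in_carrier assms(3) by metis
qed

lemma algebraic_iff:
  assumes K: "subfield K R" and x: "x \<in> carrier R"
  shows "algebraic K x \<longleftrightarrow> algebraic_elt (val ` K) (val x)"
proof
  have Kc: "K \<subseteq> carrier R" using K by (rule subfieldE)
  assume "algebraic K x"
  then obtain p where p: "p \<in> carrier (univ_poly R K)" "p \<noteq> []" "eval p x = \<zero>"
    using algebraicE[OF subfieldE(1)[OF K] x] unfolding over_def by blast
  show "algebraic_elt (val ` K) (val x)"
    unfolding algebraic_elt_def using list_poly_over[OF p(1) K] degree_list_poly(3)[OF p(1) Kc p(2)]
      list_poly_root_iff[OF p(1) Kc x] p(3) by blast
next
  have Kc: "K \<subseteq> carrier R" using K by (rule subfieldE)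
  assume "algebraic_elt (val ` K) (val x)"
  then obtain P where P: "P \<in> polys_over (val ` K)" "P \<noteq> 0" "poly P (val x) = 0"
    unfolding algebraic_elt_def by blast
  obtain p where p: "p \<in> carrier (univ_poly R K)" "list_poly p = P" by (rule list_poly_surj[OF Kc P(1)])
  have "p \<noteq> []" using p(2) P(2) by (auto simp: list_poly_def)
  moreover have "eval p x = \<zero>" using list_poly_root_iff[OF p(1) Kc x] p(2) P(3) by simp
  ultimately show "algebraic K x" using algebraicI[OF p(1)] unfolding over_def by blast
qed

lemma Irr_list_poly:
  assumes K: "subfield K R" and x: "x \<in> carrier R" and alg: "algebraic K x"
  shows "list_poly (Irr K x) = min_poly (val ` K) (val x)" "Irr K x \<in> carrier (univ_poly R K)"
    "pirreducible K (Irr K x)" "Irr K x \<noteq> []"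
proof -
  have Kc: "K \<subseteq> carrier R" using K by (rule subfieldE)
  have sr: "subring K R" using K by (rule subfieldE)
  interpret B: ac_subfield "val ` K" by (rule val_subfield[OF K])
  have alg': "(algebraic over K) x" using alg by (simp add: over_def)
  note irr = IrrE[OF K x alg']
  show 1: "Irr K x \<in> carrier (univ_poly R K)" "pirreducible K (Irr K x)" by (fact irr)+
  show 2: "Irr K x \<noteq> []" using pirreducibleE(1)[OF sr irr(1,2)] .
  have ae: "algebraic_elt (val ` K) (val x)" using algebraic_iff[OF K x] alg by blast
  define m0 where "m0 = min_poly (val ` K) (val x)"
  note m0 = B.min_poly[OF ae, folded m0_def]
  obtain p where p: "p \<in> carrier (univ_poly R K)" "list_poly p = m0" by (rule list_poly_surj[OF Kc m0(1)])
  have p0: "p \<noteq> []" using p(2) m0(2) by (auto simp: list_poly_def)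
  have "eval p x = \<zero>" using list_poly_root_iff[OF p(1) Kc x] p(2) m0(3) by simp
  then have "Irr K x pdivides p" using Irr_minimal[OF K x alg' p(1)] by blast
  then have "length (Irr K x) - 1 \<le> length p - 1" using pdivides_imp_degree_le[OF sr irr(1) p(1) p0] by simp
  then have le: "Polynomial.degree (list_poly (Irr K x)) \<le> Polynomial.degree m0"
    using degree_list_poly(1)[OF 1(1) Kc 2] degree_list_poly(1)[OF p(1) Kc p0] p(2) by simp
  have "poly (list_poly (Irr K x)) (val x) = 0" using list_poly_root_iff[OF 1(1) Kc x] irr(4) by simp
  then obtain q where q: "list_poly (Irr K x) = q * m0" using m0(4) list_poly_over[OF 1(1) K] by blast
  have m00: "m0 \<noteq> 0" using m0(2) by auto
  have L0: "list_poly (Irr K x) \<noteq> 0" by (rule degree_list_poly(3)[OF 1(1) Kc 2])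
  then have "q \<noteq> 0" using q by auto
  then have "Polynomial.degree q = 0" using le q m00 by (simp add: degree_mult_eq)
  then obtain c where c: "q = [:c:]" by (rule degree_eq_zeroE)
  have "Polynomial.lead_coeff (list_poly (Irr K x)) = 1"
    using degree_list_poly(2)[OF 1(1) Kc 2] irr(3) val_one by simp
  then have "c = 1" using q c m0(2) by (auto split: if_splits)
  then show "list_poly (Irr K x) = min_poly (val ` K) (val x)" using q c m0_def by simp
qed

text \<open>The minimal polynomial and its derivative are coprime because they have no common root in the algebraically
  closed field.\<close>

lemma separable_over_if_sep_elt:
  assumes K: "subfield K R" and x: "x \<in> carrier R" and sep: "sep_elt (val ` K) (val x)"
  shows "algebraic_over R K x \<and> separable_poly_over R K (Irr K x)"
proof -
  have Kc: "K \<subseteq> carrier R" using K by (rule subfieldE)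
  have sr: "subring K R" using K by (rule subfieldE)
  interpret B: ac_subfield "val ` K" by (rule val_subfield[OF K])
  have alg: "algebraic K x" using algebraic_iff[OF K x] sep_elt_algebraic[OF sep] by blast
  note irr = Irr_list_poly[OF K x alg]
  have dm: "Polynomial.degree (list_poly (Irr K x)) > 0"
    unfolding irr(1) by (rule B.min_poly_degree[OF sep_elt_algebraic[OF sep]])
  have "pderiv (list_poly (Irr K x)) \<noteq> 0"
    unfolding irr(1) using B.min_poly_sep[OF sep] B.min_poly_root[OF sep_elt_algebraic[OF sep]]
    by (auto simp: sep_poly_def)
  then have fd0: "formal_deriv R (Irr K x) \<noteq> []"
    using formal_deriv_props(2)[OF irr(2) K] by (auto simp: list_poly_def)
  interpret UP: domain "univ_poly R K" by (rule univ_poly_is_domain[OF sr])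
  have "d \<in> Units (univ_poly R K)" if d: "d \<in> carrier (univ_poly R K)"
    "d divides\<^bsub>univ_poly R K\<^esub> Irr K x" "d divides\<^bsub>univ_poly R K\<^esub> formal_deriv R (Irr K x)" for d
  proof (rule ccontr)
    assume "d \<notin> Units (univ_poly R K)"
    then have "d \<sim>\<^bsub>univ_poly R K\<^esub> Irr K x"
      using divides_pirreducible_condition[OF irr(3) d(1,2)] by blast
    then have "Irr K x divides\<^bsub>univ_poly R K\<^esub> d" by (simp add: associated_def)
    then have "Irr K x divides\<^bsub>univ_poly R K\<^esub> formal_deriv R (Irr K x)"
      using UP.divides_trans[OF _ d(3)] irr(2) by blast
    then have "Irr K x pdivides formal_deriv R (Irr K x)"
      using pdivides_iff_shell[OF K irr(2) formal_deriv_props(1)[OF irr(2) K]] by blast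
    then have "length (Irr K x) - 1 \<le> length (formal_deriv R (Irr K x)) - 1"
      using pdivides_imp_degree_le[OF sr irr(2) formal_deriv_props(1)[OF irr(2) K] fd0] by simp
    then show False using formal_deriv_props(3)[OF irr(2) K] dm degree_list_poly(1)[OF irr(2) Kc irr(4)] fd0
      by (metis One_nat_def Suc_diff_1 Suc_n_not_le_n diff_le_mono le_trans length_greater_0_conv)
  qed
  then show ?thesis using x alg irr(2) by (auto simp: algebraic_over_def separable_poly_over_def)
qed

text \<open>If the derivative of the minimal polynomial vanished, the minimal polynomial would be a common divisor.\<close>

lemma sep_elt_if_separable_over:
  assumes K: "subfield K R" and x: "algebraic_over R K x" and sep: "separable_poly_over R K (Irr K x)"
  shows "sep_elt (val ` K) (val x)"
proof -
  have sr: "subring K R" using K by (rule subfieldE)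
  interpret B: ac_subfield "val ` K" by (rule val_subfield[OF K])
  interpret UP: domain "univ_poly R K" by (rule univ_poly_is_domain[OF sr])
  have xc: "x \<in> carrier R" and alg: "algebraic K x" using x by (auto simp: algebraic_over_def)
  note irr = Irr_list_poly[OF K xc alg]
  have "formal_deriv R (Irr K x) \<noteq> []"
  proof
    assume fd: "formal_deriv R (Irr K x) = []"
    have "Irr K x divides\<^bsub>univ_poly R K\<^esub> \<zero>\<^bsub>univ_poly R K\<^esub>"
      using irr(2) by (auto simp: factor_def intro!: bexI[of _ "\<zero>\<^bsub>univ_poly R K\<^esub>"])
    then have "Irr K x divides\<^bsub>univ_poly R K\<^esub> formal_deriv R (Irr K x)"
      unfolding fd by (simp add: univ_poly_zero)
    then have "Irr K x \<in> Units (univ_poly R K)"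
      using sep irr(2) UP.divides_refl by (auto simp: separable_poly_over_def)
    then show False using pirreducibleE(2)[OF sr irr(2,3)] by blast
  qed
  then have "pderiv (list_poly (Irr K x)) \<noteq> 0"
    using degree_list_poly(3)[OF formal_deriv_props(1)[OF irr(2) K] subfieldE(3)[OF K]] formal_deriv_props(2)[OF irr(2) K] by simp
  then show ?thesis unfolding irr(1)
    by (intro B.sep_elt_if_pderiv) (use algebraic_iff[OF K xc] alg in blast)
qed

end

section \<open>Function fields and points of PAC extensions\<close>

lemma mpoly_ring_simps:
  "carrier (mpoly_ring N) = polys_in {..<N}" "p \<otimes>\<^bsub>mpoly_ring N\<^esub> q = p * q"
  "p \<oplus>\<^bsub>mpoly_ring N\<^esub> q = p + q" "\<one>\<^bsub>mpoly_ring N\<^esub> = 1" "\<zero>\<^bsub>mpoly_ring N\<^esub> = 0"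
  by (simp_all add: mpoly_ring_def ring_of_type_algebra_def polys_in_def)

lemma cring_mpoly_ring: "cring (mpoly_ring N :: 'a::comm_ring_1 mpoly ring)"
proof -
  interpret S: subring_set "polys_in {..<N} :: 'a mpoly set" by (rule polys_in_subring)
  show ?thesis
  proof (rule cringI)
    show "abelian_group (mpoly_ring N :: 'a mpoly ring)"
    proof (rule abelian_groupI)
      fix p :: "'a mpoly" assume "p \<in> carrier (mpoly_ring N)"
      then show "\<exists>q\<in>carrier (mpoly_ring N). q \<oplus>\<^bsub>mpoly_ring N\<^esub> p = \<zero>\<^bsub>mpoly_ring N\<^esub>"
        by (intro bexI[of _ "- p"]) (auto simp: mpoly_ring_simps)
    qed (auto simp: mpoly_ring_simps algebra_simps)
    show "Group.comm_monoid (mpoly_ring N :: 'a mpoly ring)"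
      by (rule comm_monoidI) (auto simp: mpoly_ring_simps algebra_simps)
  qed (auto simp: mpoly_ring_simps algebra_simps)
qed

lemma mpoly_ring_uminus:
  assumes "p \<in> polys_in {..<N}" shows "\<ominus>\<^bsub>mpoly_ring N\<^esub> p = - p"
proof -
  interpret cring "mpoly_ring N :: 'a mpoly ring" by (rule cring_mpoly_ring)
  have "- p \<in> polys_in {..<N}" using assms subring_set.uminus[OF polys_in_subring] by blast
  then show ?thesis using assms by (intro minus_equality) (auto simp: mpoly_ring_simps)
qed

lemma kernel_primeideal:
  fixes g :: "'a::field \<Rightarrow> 'o::field"
  assumes "rhom g"
  shows "primeideal {p \<in> polys_in {..<N}. mpoly_eval g x p = 0} (mpoly_ring N)"
proof -
  interpret g: rhom g by fact
  interpret R: cring "mpoly_ring N :: 'a mpoly ring" by (rule cring_mpoly_ring)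
  interpret S: subring_set "polys_in {..<N} :: 'a mpoly set" by (rule polys_in_subring)
  show ?thesis
  proof (rule primeidealI)
    show "ideal {p \<in> polys_in {..<N}. mpoly_eval g x p = 0} (mpoly_ring N)"
    proof (rule idealI)
      show "ring (mpoly_ring N :: 'a mpoly ring)" by (rule R.ring_axioms)
      show "subgroup {p \<in> polys_in {..<N}. mpoly_eval g x p = 0} (add_monoid (mpoly_ring N))"
      proof (rule R.add.subgroupI)
        fix p assume "p \<in> {p \<in> polys_in {..<N}. mpoly_eval g x p = 0}"
        then show "\<ominus>\<^bsub>mpoly_ring N\<^esub> p \<in> {p \<in> polys_in {..<N}. mpoly_eval g x p = 0}"
          by (auto simp: mpoly_ring_uminus g.mpoly_eval_uminus)
      qed (auto simp: mpoly_ring_simps g.mpoly_eval_add intro: exI[of _ 0])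
    qed (auto simp: mpoly_ring_simps g.mpoly_eval_mult)
    show "cring (mpoly_ring N :: 'a mpoly ring)" by (rule R.cring_axioms)
    have "1 \<in> carrier (mpoly_ring N :: 'a mpoly ring)" by (simp add: mpoly_ring_simps)
    moreover have "1 \<notin> {p \<in> polys_in {..<N}. mpoly_eval g x p = 0}" by simp
    ultimately show "carrier (mpoly_ring N) \<noteq> {p \<in> polys_in {..<N}. mpoly_eval g x p = 0}" by blast
  qed (auto simp: mpoly_ring_simps g.mpoly_eval_mult)
qed

text \<open>The field of fractions of \<open>D\<close>, built from equivalence classes of pairs, is identified with a subfield of a
  field type in which \<open>D\<close> is embedded.\<close>

locale embedded_domain =
  fixes D :: "('a, 'b) ring_scheme" (structure) and ev :: "'a \<Rightarrow> 'o::alg_closed_field"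
  assumes D_zero: "\<zero> \<in> carrier D" and D_one: "\<one> \<in> carrier D"
    and D_add: "x \<in> carrier D \<Longrightarrow> y \<in> carrier D \<Longrightarrow> x \<oplus> y \<in> carrier D"
    and D_mult: "x \<in> carrier D \<Longrightarrow> y \<in> carrier D \<Longrightarrow> x \<otimes> y \<in> carrier D"
    and D_uminus: "x \<in> carrier D \<Longrightarrow> \<exists>y\<in>carrier D. ev y = - ev x"
    and ev_inj: "inj_on ev (carrier D)"
    and ev_zero: "ev \<zero> = 0" and ev_one: "ev \<one> = 1"
    and ev_add: "x \<in> carrier D \<Longrightarrow> y \<in> carrier D \<Longrightarrow> ev (x \<oplus> y) = ev x + ev y"
    and ev_mult: "x \<in> carrier D \<Longrightarrow> y \<in> carrier D \<Longrightarrow> ev (x \<otimes> y) = ev x * ev y"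
begin

lemma ev_0: "x \<in> carrier D \<Longrightarrow> ev x = 0 \<longleftrightarrow> x = \<zero>"
  using inj_onD[OF ev_inj, of x \<zero>] D_zero ev_zero by auto

definition Fr :: "'o set" where
  "Fr = {ev a / ev b | a b. a \<in> carrier D \<and> b \<in> carrier D - {\<zero>}}"

definition cls :: "'o \<Rightarrow> ('a \<times> 'a) set" where
  "cls u = {(c, d). c \<in> carrier D \<and> d \<in> carrier D - {\<zero>} \<and> ev c = u * ev d}"

lemma frac_class_eq:
  assumes "a \<in> carrier D" "b \<in> carrier D - {\<zero>}" shows "frac_class D a b = cls (ev a / ev b)"
proof -
  have b: "ev b \<noteq> 0" using assms ev_0 by auto
  have "a \<otimes> d = c \<otimes> b \<longleftrightarrow> ev c = ev a / ev b * ev d" if "c \<in> carrier D" "d \<in> carrier D" for c d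
  proof -
    have "a \<otimes> d = c \<otimes> b \<longleftrightarrow> ev (a \<otimes> d) = ev (c \<otimes> b)"
      using that assms by (intro inj_on_eq_iff[OF ev_inj, symmetric] D_mult) auto
    then show ?thesis using that assms b by (auto simp: ev_mult field_simps)
  qed
  then show ?thesis by (auto simp: frac_class_def cls_def)
qed

lemma frE:
  assumes "u \<in> Fr"
  obtains a b where "a \<in> carrier D" "b \<in> carrier D - {\<zero>}" "u = ev a / ev b" "ev b \<noteq> 0" "(a, b) \<in> cls u"
proof -
  obtain a b where ab: "a \<in> carrier D" "b \<in> carrier D - {\<zero>}" "u = ev a / ev b" using assms by (auto simp: Fr_def)
  moreover have "ev b \<noteq> 0" using ab ev_0 by auto
  ultimately show ?thesis using that by (auto simp: cls_def)
qed

lemma cls_nonempty: "u \<in> Fr \<Longrightarrow> cls u \<noteq> {}"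
  by (erule frE) auto

lemma FrI: "a \<in> carrier D \<Longrightarrow> b \<in> carrier D \<Longrightarrow> ev b \<noteq> 0 \<Longrightarrow> ev a / ev b \<in> Fr"
  using ev_0 by (auto simp: Fr_def)

lemma cls_inj: "u \<in> Fr \<Longrightarrow> v \<in> Fr \<Longrightarrow> cls u = cls v \<Longrightarrow> u = v"
proof -
  assume "u \<in> Fr" "v \<in> Fr" "cls u = cls v"
  then obtain a b where "(a, b) \<in> cls u" "(a, b) \<in> cls v" "ev b \<noteq> 0" by (metis frE)
  then show "u = v" by (auto simp: cls_def)
qed

lemma Fr_subfield: "subfield_set Fr"
proof (unfold_locales, goal_cases)
  case 1 show ?case using FrI[OF D_zero D_one] by (simp add: ev_zero ev_one)
next
  case 2 show ?case using FrI[OF D_one D_one] by (simp add: ev_one)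
next
  case (3 x y)
  then obtain a b c d where x: "a \<in> carrier D" "b \<in> carrier D - {\<zero>}" "x = ev a / ev b" "ev b \<noteq> 0"
    and y: "c \<in> carrier D" "d \<in> carrier D - {\<zero>}" "y = ev c / ev d" "ev d \<noteq> 0" by (metis frE)
  have "ev ((a \<otimes> d) \<oplus> (c \<otimes> b)) / ev (b \<otimes> d) \<in> Fr" using x y by (intro FrI D_add D_mult) (auto simp: ev_mult)
  also have "ev ((a \<otimes> d) \<oplus> (c \<otimes> b)) / ev (b \<otimes> d) = x + y"
    using x y by (simp add: ev_add ev_mult D_mult field_simps)
  finally show ?case .
next
  case (4 x y)
  then obtain a b c d where x: "a \<in> carrier D" "b \<in> carrier D - {\<zero>}" "x = ev a / ev b" "ev b \<noteq> 0"
    and y: "c \<in> carrier D" "d \<in> carrier D - {\<zero>}" "y = ev c / ev d" "ev d \<noteq> 0" by (metis frE)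
  have "ev (a \<otimes> c) / ev (b \<otimes> d) \<in> Fr" using x y by (intro FrI D_mult) (auto simp: ev_mult)
  then show ?case using x y by (simp add: ev_mult)
next
  case (5 x)
  then obtain a b where x: "a \<in> carrier D" "b \<in> carrier D - {\<zero>}" "x = ev a / ev b" "ev b \<noteq> 0" by (metis frE)
  obtain a' where "a' \<in> carrier D" "ev a' = - ev a" using D_uminus[OF x(1)] by blast
  then show ?case using FrI[of a' b] x by simp
next
  case (6 x)
  then obtain a b where x: "a \<in> carrier D" "b \<in> carrier D - {\<zero>}" "x = ev a / ev b" "ev b \<noteq> 0" by (metis frE)
  show ?case
  proof (cases "ev a = 0")
    case True
    then show ?thesis using FrI[OF D_zero D_one] x by (simp add: ev_zero ev_one)
  next
    case False
    then show ?thesis using FrI[of b a] x by simp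
  qed
qed

abbreviation FF where "FF \<equiv> frac_field D"

lemma FF_carrier: "carrier FF = cls ` Fr"
proof -
  have c: "carrier FF = {frac_class D a b | a b. a \<in> carrier D \<and> b \<in> carrier D - {\<zero>}}"
    by (simp add: frac_field_def)
  show ?thesis
  proof (intro equalityI subsetI)
    fix x assume "x \<in> carrier FF"
    then obtain a b where ab: "a \<in> carrier D" "b \<in> carrier D - {\<zero>}" "x = frac_class D a b" unfolding c by blast
    then have "x = cls (ev a / ev b)" using frac_class_eq by simp
    moreover have "ev a / ev b \<in> Fr" unfolding Fr_def using ab by blast
    ultimately show "x \<in> cls ` Fr" by blast
  next
    fix x assume "x \<in> cls ` Fr"
    then obtain a b where ab: "a \<in> carrier D" "b \<in> carrier D - {\<zero>}" "x = cls (ev a / ev b)" unfolding Fr_def by blast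
    then have "x = frac_class D a b" using frac_class_eq by simp
    then show "x \<in> carrier FF" unfolding c using ab by blast
  qed
qed

lemma FF_one: "\<one>\<^bsub>FF\<^esub> = cls 1" and FF_zero: "\<zero>\<^bsub>FF\<^esub> = cls 0"
  using frac_class_eq[of \<one> \<one>] frac_class_eq[of \<zero> \<one>] D_one D_zero ev_one ev_zero ev_0[of \<one>]
  by (auto simp: frac_field_def)

lemma FF_mult: "u \<in> Fr \<Longrightarrow> v \<in> Fr \<Longrightarrow> cls u \<otimes>\<^bsub>FF\<^esub> cls v = cls (u * v)"
proof -
  assume uv: "u \<in> Fr" "v \<in> Fr"
  have *: "frac_class D (a \<otimes> c) (b \<otimes> d) = cls (u * v)" if "(a, b) \<in> cls u" "(c, d) \<in> cls v" for a b c d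
  proof -
    have abcd: "a \<in> carrier D" "b \<in> carrier D" "c \<in> carrier D" "d \<in> carrier D" "ev b \<noteq> 0" "ev d \<noteq> 0"
      "ev a = u * ev b" "ev c = v * ev d" using that ev_0 by (auto simp: cls_def)
    then have "b \<otimes> d \<in> carrier D - {\<zero>}" using ev_0[of "b \<otimes> d"] by (auto simp: D_mult ev_mult)
    then show ?thesis using abcd by (subst frac_class_eq) (auto simp: D_mult ev_mult)
  qed
  have ex: "cls u \<noteq> {}" "cls v \<noteq> {}" using cls_nonempty uv by auto
  have "cls u \<otimes>\<^bsub>FF\<^esub> cls v = (\<Union>(a, b)\<in>cls u. \<Union>(c, d)\<in>cls v. frac_class D (a \<otimes> c) (b \<otimes> d))"
    by (simp add: frac_field_def)
  also have "\<dots> = (\<Union>x\<in>cls u. \<Union>y\<in>cls v. cls (u * v))"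
  proof (intro SUP_cong refl)
    fix x assume x: "x \<in> cls u"
    have "(case x of (a, b) \<Rightarrow> \<Union>(c, d)\<in>cls v. frac_class D (a \<otimes> c) (b \<otimes> d)) = (\<Union>y\<in>cls v. cls (u * v))"
    proof (cases x)
      case (Pair a b)
      have "(\<Union>(c, d)\<in>cls v. frac_class D (a \<otimes> c) (b \<otimes> d)) = (\<Union>y\<in>cls v. cls (u * v))"
      proof (intro SUP_cong refl)
        fix y assume y: "y \<in> cls v"
        show "(case y of (c, d) \<Rightarrow> frac_class D (a \<otimes> c) (b \<otimes> d)) = cls (u * v)" using *[of a b "fst y" "snd y"] x y Pair by (cases y) auto
      qed
      then show ?thesis using Pair by simp
    qed
    then show "(case x of (a, b) \<Rightarrow> \<Union>(c, d)\<in>cls v. frac_class D (a \<otimes> c) (b \<otimes> d)) = (\<Union>y\<in>cls v. cls (u * v))" .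
  qed
  also have "\<dots> = cls (u * v)" using ex by simp
  finally show "cls u \<otimes>\<^bsub>FF\<^esub> cls v = cls (u * v)" .
qed

lemma FF_add: "u \<in> Fr \<Longrightarrow> v \<in> Fr \<Longrightarrow> cls u \<oplus>\<^bsub>FF\<^esub> cls v = cls (u + v)"
proof -
  assume uv: "u \<in> Fr" "v \<in> Fr"
  have *: "frac_class D ((a \<otimes> d) \<oplus> (c \<otimes> b)) (b \<otimes> d) = cls (u + v)" if "(a, b) \<in> cls u" "(c, d) \<in> cls v" for a b c d
  proof -
    have abcd: "a \<in> carrier D" "b \<in> carrier D" "c \<in> carrier D" "d \<in> carrier D" "ev b \<noteq> 0" "ev d \<noteq> 0"
      "ev a = u * ev b" "ev c = v * ev d" using that ev_0 by (auto simp: cls_def)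
    then have "b \<otimes> d \<in> carrier D - {\<zero>}" using ev_0[of "b \<otimes> d"] by (auto simp: D_mult ev_mult)
    then have "frac_class D ((a \<otimes> d) \<oplus> (c \<otimes> b)) (b \<otimes> d) = cls (ev ((a \<otimes> d) \<oplus> (c \<otimes> b)) / ev (b \<otimes> d))"
      using abcd by (intro frac_class_eq) (auto simp: D_mult D_add)
    also have "ev ((a \<otimes> d) \<oplus> (c \<otimes> b)) / ev (b \<otimes> d) = u + v"
      using abcd(1-4) abcd(5,6) by (simp add: D_mult ev_add ev_mult abcd(7,8) field_simps)
    finally show ?thesis .
  qed
  have ex: "cls u \<noteq> {}" "cls v \<noteq> {}" using cls_nonempty uv by auto
  have "cls u \<oplus>\<^bsub>FF\<^esub> cls v = (\<Union>(a, b)\<in>cls u. \<Union>(c, d)\<in>cls v. frac_class D ((a \<otimes> d) \<oplus> (c \<otimes> b)) (b \<otimes> d))"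
    by (simp add: frac_field_def)
  also have "\<dots> = (\<Union>x\<in>cls u. \<Union>y\<in>cls v. cls (u + v))"
  proof (intro SUP_cong refl)
    fix x assume x: "x \<in> cls u"
    have "(case x of (a, b) \<Rightarrow> \<Union>(c, d)\<in>cls v. frac_class D ((a \<otimes> d) \<oplus> (c \<otimes> b)) (b \<otimes> d)) = (\<Union>y\<in>cls v. cls (u + v))"
    proof (cases x)
      case (Pair a b)
      have "(\<Union>(c, d)\<in>cls v. frac_class D ((a \<otimes> d) \<oplus> (c \<otimes> b)) (b \<otimes> d)) = (\<Union>y\<in>cls v. cls (u + v))"
      proof (intro SUP_cong refl)
        fix y assume y: "y \<in> cls v"
        show "(case y of (c, d) \<Rightarrow> frac_class D ((a \<otimes> d) \<oplus> (c \<otimes> b)) (b \<otimes> d)) = cls (u + v)" using *[of a b "fst y" "snd y"] x y Pair by (cases y) auto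
      qed
      then show ?thesis using Pair by simp
    qed
    then show "(case x of (a, b) \<Rightarrow> \<Union>(c, d)\<in>cls v. frac_class D ((a \<otimes> d) \<oplus> (c \<otimes> b)) (b \<otimes> d)) = (\<Union>y\<in>cls v. cls (u + v))" .
  qed
  also have "\<dots> = cls (u + v)" using ex by simp
  finally show "cls u \<oplus>\<^bsub>FF\<^esub> cls v = cls (u + v)" .
qed

definition val :: "('a \<times> 'a) set \<Rightarrow> 'o" where "val = inv_into Fr cls"

lemma val_cls: "u \<in> Fr \<Longrightarrow> val (cls u) = u"
  unfolding val_def by (rule inv_into_f_f) (auto simp: inj_on_def intro: cls_inj)

lemma FF_field_val: "field_val FF val"
proof -
  interpret Fr: subfield_set Fr by (rule Fr_subfield)
  note s = FF_carrier FF_one FF_zero FF_mult FF_add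
  have "cring FF"
  proof (rule cringI)
    show "abelian_group FF"
    proof (rule abelian_groupI)
      fix x assume "x \<in> carrier FF"
      then obtain u where u: "u \<in> Fr" "x = cls u" by (auto simp: s)
      then show "\<exists>y\<in>carrier FF. y \<oplus>\<^bsub>FF\<^esub> x = \<zero>\<^bsub>FF\<^esub>"
      proof (intro bexI[of _ "cls (- u)"])
        have "cls (- u) \<oplus>\<^bsub>FF\<^esub> cls u = cls (- u + u)" by (rule FF_add) (use u in auto)
        then show "cls (- u) \<oplus>\<^bsub>FF\<^esub> x = \<zero>\<^bsub>FF\<^esub>" using u by (simp add: FF_zero)
        show "cls (- u) \<in> carrier FF" using u by (auto simp: FF_carrier)
      qed
    qed (auto simp: s Fr.add algebra_simps)
    show "Group.comm_monoid FF"
      by (rule comm_monoidI) (auto simp: s Fr.mult algebra_simps)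
  qed (auto simp: s Fr.add Fr.mult algebra_simps)
  then interpret F: cring FF .
  have "field FF"
  proof (rule F.cring_fieldI2)
    show "\<zero>\<^bsub>FF\<^esub> \<noteq> \<one>\<^bsub>FF\<^esub>" using cls_inj[of 0 1] by (auto simp: s)
    fix x assume "x \<in> carrier FF" "x \<noteq> \<zero>\<^bsub>FF\<^esub>"
    then obtain u where u: "u \<in> Fr" "x = cls u" "u \<noteq> 0" by (auto simp: s)
    then show "\<exists>y\<in>carrier FF. x \<otimes>\<^bsub>FF\<^esub> y = \<one>\<^bsub>FF\<^esub>"
      by (intro bexI[of _ "cls (inverse u)"]) (auto simp: s Fr.inverse)
  qed
  then show ?thesis
    unfolding field_val_def field_val_axioms_def
    by (auto simp: s val_cls inj_on_def Fr.add Fr.mult)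
qed

lemma val_frac_class:
  assumes "a \<in> carrier D" shows "val (frac_class D a \<one>) = ev a" "frac_class D a \<one> \<in> carrier FF"
proof -
  have "\<one> \<in> carrier D - {\<zero>}" using D_one ev_0[of \<one>] ev_one by auto
  then have 1: "frac_class D a \<one> = cls (ev a)" using frac_class_eq[OF assms] by (simp add: ev_one)
  have "ev a \<in> Fr" using FrI[OF assms D_one] by (simp add: ev_one)
  then show "val (frac_class D a \<one>) = ev a" "frac_class D a \<one> \<in> carrier FF"
    unfolding 1 by (auto simp: val_cls FF_carrier)
qed

end

context field_val begin

lemma val_finsum:
  "(\<And>i. i \<in> A \<Longrightarrow> f i \<in> carrier R) \<Longrightarrow> finite A \<Longrightarrow> finsum R f A \<in> carrier R \<and> val (finsum R f A) = (\<Sum>i\<in>A. val (f i))"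
proof (induction A rule: infinite_finite_induct)
  case (insert x A)
  then have "finsum R f (insert x A) = f x \<oplus> finsum R f A" by (intro finsum_insert) auto
  then show ?case using insert by (simp add: val_add)
qed (auto simp: val_zero)

lemma val_finprod:
  "(\<And>i. i \<in> A \<Longrightarrow> f i \<in> carrier R) \<Longrightarrow> finite A \<Longrightarrow> finprod R f A \<in> carrier R \<and> val (finprod R f A) = (\<Prod>i\<in>A. val (f i))"
proof (induction A rule: infinite_finite_induct)
  case (insert x A)
  then have "finprod R f (insert x A) = f x \<otimes> finprod R f A" by (intro finprod_insert) auto
  then show ?case using insert by (simp add: val_mult)
qed (auto simp: val_one)

lemma val_mpoly_eval_in:
  assumes "\<And>c. h c \<in> carrier R" "q \<in> polys_in V" "\<And>i. i \<in> V \<Longrightarrow> x i \<in> carrier R"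
  shows "val (mpoly_eval_in R h x q) = mpoly_eval (\<lambda>c. val (h c)) (\<lambda>i. val (x i)) q"
proof -
  have pr: "(\<Otimes>i\<in>Poly_Mapping.keys m. x i [^] Poly_Mapping.lookup m i) \<in> carrier R \<and>
      val (\<Otimes>i\<in>Poly_Mapping.keys m. x i [^] Poly_Mapping.lookup m i) = (\<Prod>i\<in>Poly_Mapping.keys m. val (x i) ^ Poly_Mapping.lookup m i)"
    if m: "m \<in> Poly_Mapping.keys q" for m
  proof -
    have xc: "x i \<in> carrier R" if "i \<in> Poly_Mapping.keys m" for i using that m assms by (auto simp: polys_in_def)
    have "(\<Prod>i\<in>Poly_Mapping.keys m. val (x i [^] Poly_Mapping.lookup m i)) = (\<Prod>i\<in>Poly_Mapping.keys m. val (x i) ^ Poly_Mapping.lookup m i)"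
      using xc by (intro prod.cong) (auto simp: val_pow)
    then show ?thesis using val_finprod[of "Poly_Mapping.keys m" "\<lambda>i. x i [^] Poly_Mapping.lookup m i"] xc by auto
  qed
  have "val (mpoly_eval_in R h x q) = (\<Sum>m\<in>Poly_Mapping.keys q. val (h (Poly_Mapping.lookup q m) \<otimes>
        (\<Otimes>i\<in>Poly_Mapping.keys m. x i [^] Poly_Mapping.lookup m i)))"
    unfolding mpoly_eval_in_def using pr assms(1) by (intro val_finsum[THEN conjunct2]) auto
  also have "\<dots> = mpoly_eval (\<lambda>c. val (h c)) (\<lambda>i. val (x i)) q"
    unfolding mpoly_eval_def using pr assms(1) by (intro sum.cong) (auto simp: val_mult)
  finally show ?thesis .
qed

end

text \<open>The variety is given by a generic point \<open>gp\<close> in a large field: \<open>P\<close> consists of its relations over \<open>M\<close>,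
  so \<open>P\<close> is prime and the function field is \<open>M(gp)\<close>. If all relations over the algebraic closure follow
  from \<open>P\<close>, then the variety is absolutely irreducible. The map to affine space is given by the first \<open>n\<close>
  coordinates; independence makes it dominating, and it is separable, with \<open>r = n\<close> equal to the dimension,
  when every coordinate is separable over the first \<open>n\<close>.\<close>

lemma PAC_point:
  fixes \<iota> :: "'k::field \<Rightarrow> 'm::field" and g :: "'m alg_closure \<Rightarrow> 'o::alg_closed_field"
  assumes PAC: "PAC_extension \<iota>" and g: "rhom g" and n: "1 \<le> n" "n \<le> N"
    and P_def: "P = {p \<in> polys_in {..<N}. mpoly_eval (\<lambda>c. g (to_ac c)) gp p = 0}"
    and gen: "\<And>p. p \<in> polys_in {..<N} \<Longrightarrow> mpoly_eval g gp p = 0 \<Longrightarrow>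
        p \<in> Idl\<^bsub>mpoly_ring N\<^esub> (Poly_Mapping.map to_ac ` P)"
    and indep: "\<And>q. q \<in> polys_in {..<n} \<Longrightarrow> mpoly_eval (\<lambda>c. g (to_ac c)) gp q = 0 \<Longrightarrow> q = 0"
    and sep: "\<And>B i. ac_subfield B \<Longrightarrow> range (\<lambda>c. g (to_ac c)) \<subseteq> B \<Longrightarrow> gp ` {..<n} \<subseteq> B \<Longrightarrow> infinite B \<Longrightarrow>
        i < N \<Longrightarrow> sep_elt B (gp i)"
  shows "\<exists>a\<in>rational_points P. \<forall>j<n. a j \<in> range \<iota>"
proof -
  define ga where "ga = (\<lambda>c. g (to_ac c))"
  have ga: "rhom ga" using rhom_comp[OF rhom_to_ac g] by (simp add: ga_def o_def)
  interpret g: rhom g by (rule g)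
  interpret ga: rhom ga by (rule ga)
  interpret R: cring "mpoly_ring N :: 'm mpoly ring" by (rule cring_mpoly_ring)
  interpret Rc: cring "mpoly_ring N :: 'm alg_closure mpoly ring" by (rule cring_mpoly_ring)
  interpret S: subring_set "polys_in {..<N} :: 'm mpoly set" by (rule polys_in_subring)
  have P: "P = {p \<in> polys_in {..<N}. mpoly_eval ga gp p = 0}" by (simp add: P_def ga_def)
  have prime: "primeideal P (mpoly_ring N)" unfolding P by (rule kernel_primeideal[OF ga])
  interpret P: primeideal P "mpoly_ring N" by (rule prime)
  define Pc where "Pc = {p \<in> polys_in {..<N}. mpoly_eval g gp p = 0}"
  have primec: "primeideal Pc (mpoly_ring N)" unfolding Pc_def by (rule kernel_primeideal[OF g])
  have mapP: "Poly_Mapping.map to_ac ` P \<subseteq> Pc"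
  proof
    fix p assume "p \<in> Poly_Mapping.map to_ac ` P"
    then obtain q where q: "q \<in> P" "p = Poly_Mapping.map to_ac q" by blast
    have "mpoly_eval g gp p = mpoly_eval (g \<circ> to_ac) gp q" unfolding q(2) by (rule mpoly_eval_map[OF rhom_to_ac g])
    also have "g \<circ> to_ac = ga" by (auto simp: ga_def)
    finally show "p \<in> Pc" using q map_mpoly_in[OF rhom_to_ac] by (auto simp: P Pc_def)
  qed
  have Idl: "Idl\<^bsub>mpoly_ring N\<^esub> (Poly_Mapping.map to_ac ` P) = Pc"
  proof
    show "Idl\<^bsub>mpoly_ring N\<^esub> (Poly_Mapping.map to_ac ` P) \<subseteq> Pc"
      by (rule Rc.genideal_minimal[OF primeideal.axioms(1)[OF primec] mapP])
    show "Pc \<subseteq> Idl\<^bsub>mpoly_ring N\<^esub> (Poly_Mapping.map to_ac ` P)" using gen by (auto simp: Pc_def)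
  qed
  have abs: "abs_irreducible_variety N P"
    unfolding abs_irreducible_variety_def Idl using prime primec by blast
  define D where "D = coordinate_ring N P"
  define cs where "cs = (\<lambda>p. P +>\<^bsub>mpoly_ring N\<^esub> p)"
  have cs: "cs p = (\<lambda>r. r + p) ` P" for p by (auto simp: cs_def a_r_coset_def' mpoly_ring_simps)
  define ev where "ev = (\<lambda>Z. mpoly_eval ga gp (SOME p. p \<in> Z))"
  have ev: "ev (cs p) = mpoly_eval ga gp p" if "p \<in> polys_in {..<N}" for p
  proof -
    have "0 + p \<in> cs p" unfolding cs using P by (intro imageI) auto
    then have "(SOME q. q \<in> cs p) \<in> cs p" by (rule someI)
    then obtain r where r: "r \<in> P" "(SOME q. q \<in> cs p) = r + p" unfolding cs by blast
    then show ?thesis unfolding ev_def r(2) by (simp add: ga.mpoly_eval_add P)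
  qed
  have Dcar: "carrier D = cs ` polys_in {..<N}"
    by (auto simp: D_def coordinate_ring_def FactRing_def A_RCOSETS_def' cs_def mpoly_ring_simps)
  have Dmult: "cs p \<otimes>\<^bsub>D\<^esub> cs q = cs (p * q)" if "p \<in> polys_in {..<N}" "q \<in> polys_in {..<N}" for p q
    using P.rcoset_mult_add[of p q] that by (simp add: D_def coordinate_ring_def FactRing_def cs_def mpoly_ring_simps)
  have Dadd: "cs p \<oplus>\<^bsub>D\<^esub> cs q = cs (p + q)" if "p \<in> polys_in {..<N}" "q \<in> polys_in {..<N}" for p q
    using P.a_rcos_sum[of p q] that by (simp add: D_def coordinate_ring_def FactRing_def cs_def mpoly_ring_simps)
  have Done: "\<one>\<^bsub>D\<^esub> = cs 1" by (simp add: D_def coordinate_ring_def FactRing_def cs_def mpoly_ring_simps)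
  have Dzero: "\<zero>\<^bsub>D\<^esub> = cs 0" unfolding cs by (simp add: D_def coordinate_ring_def FactRing_def)
  have csinj: "cs p = cs q" if pq: "p \<in> polys_in {..<N}" "q \<in> polys_in {..<N}" "mpoly_eval ga gp p = mpoly_eval ga gp q" for p q
  proof -
    have "cs p \<subseteq> cs q" if pq: "p \<in> polys_in {..<N}" "q \<in> polys_in {..<N}" "mpoly_eval ga gp p = mpoly_eval ga gp q" for p q
    proof
      fix x assume "x \<in> cs p"
      then obtain r where r: "r \<in> P" "x = r + p" unfolding cs by blast
      have "r + (p - q) \<in> P" using r pq by (auto simp: P ga.mpoly_eval_add ga.mpoly_eval_diff)
      moreover have "x = (r + (p - q)) + q" using r by simp
      ultimately show "x \<in> cs q" unfolding cs by blast
    qed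
    then show ?thesis using pq by (metis subset_antisym)
  qed
  interpret E: embedded_domain D ev
  proof (unfold_locales, goal_cases)
    case 1 show ?case unfolding Dzero Dcar by (intro imageI) simp
  next
    case 2 show ?case unfolding Done Dcar by (intro imageI) simp
  next
    case (3 x y) then show ?case unfolding Dcar by (auto simp: Dadd)
  next
    case (4 x y) then show ?case unfolding Dcar by (auto simp: Dmult)
  next
    case (5 x)
    then obtain p where p: "p \<in> polys_in {..<N}" "x = cs p" unfolding Dcar by blast
    then have "ev (cs (- p)) = - ev x" by (simp add: ev S.uminus ga.mpoly_eval_uminus)
    then show ?case using p Dcar by blast
  next
    case 6
    show ?case
    proof (rule inj_onI)
      fix x y assume "x \<in> carrier D" "y \<in> carrier D" and e: "ev x = ev y"
      then obtain p q where pq: "p \<in> polys_in {..<N}" "q \<in> polys_in {..<N}" "x = cs p" "y = cs q"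
        unfolding Dcar by blast
      show "x = y" unfolding pq(3,4) by (rule csinj[OF pq(1,2)]) (use e pq ev in simp)
    qed
  next
    case 7 show ?case unfolding Dzero by (simp add: ev)
  next
    case 8 show ?case unfolding Done by (simp add: ev)
  next
    case (9 x y) then show ?case unfolding Dcar by (auto simp: Dadd ev S.add ga.mpoly_eval_add)
  next
    case (10 x y) then show ?case unfolding Dcar by (auto simp: Dmult ev S.mult ga.mpoly_eval_mult)
  qed
  define FF where "FF = function_field N P"
  have FF: "FF = frac_field D" by (simp add: FF_def function_field_def D_def)
  interpret F: field_val FF E.val unfolding FF by (rule E.FF_field_val)
  have pf: "poly_function N P p \<in> carrier FF" "E.val (poly_function N P p) = mpoly_eval ga gp p"
    if p: "p \<in> polys_in {..<N}" for p
  proof -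
    have c: "cs p \<in> carrier D" unfolding Dcar using p by blast
    have 1: "poly_function N P p = frac_class D (cs p) \<one>\<^bsub>D\<^esub>" by (simp add: poly_function_def D_def cs_def)
    show "poly_function N P p \<in> carrier FF" "E.val (poly_function N P p) = mpoly_eval ga gp p"
      unfolding 1 FF using E.val_frac_class[OF c] ev[OF p] by simp_all
  qed
  have cf: "const_function N P c \<in> carrier FF" "E.val (const_function N P c) = ga c" for c
    unfolding const_function_def using pf[of "mpoly_const c"] by simp_all
  have vN: "mpoly_var j \<in> (polys_in {..<N} :: 'm mpoly set)" if "j < n" for j using that n by simp
  define y where "y = (\<lambda>j. poly_function N P (mpoly_var j))"
  have y: "y j \<in> carrier FF" "E.val (y j) = gp j" if "j < n" for j
    using pf[OF vN[OF that]] by (simp_all add: y_def)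
  define Sg where "Sg = range (const_function N P) \<union> y ` {..<n}"
  have SgF: "Sg \<subseteq> carrier FF" using cf y by (auto simp: Sg_def)
  define K where "K = generate_field FF Sg"
  have K: "subfield K FF" unfolding K_def by (rule F.generate_field_is_subfield[OF SgF])
  have SgK: "Sg \<subseteq> K" unfolding K_def by (auto intro: generate_field.incl)
  define B where "B = E.val ` K"
  interpret B: ac_subfield B unfolding B_def by (rule F.val_subfield[OF K])
  have gaB: "ga c \<in> B" for c
  proof -
    have "const_function N P c \<in> K" using SgK by (auto simp: Sg_def)
    then show ?thesis unfolding B_def using cf(2)[of c] by (metis image_eqI)
  qed
  have gpB: "gp j \<in> B" if "j < n" for j
  proof -
    have "y j \<in> K" using SgK that by (auto simp: Sg_def)
    then show ?thesis unfolding B_def using y(2)[OF that] by (metis image_eqI)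
  qed
  have "inj (\<lambda>i. gp 0 ^ i)"
  proof (rule injI)
    fix i j assume eq: "gp 0 ^ i = gp 0 ^ j"
    interpret Sn: subring_set "polys_in {..<n} :: 'm mpoly set" by (rule polys_in_subring)
    have "mpoly_eval ga gp (mpoly_var 0 ^ i - mpoly_var 0 ^ j) = 0"
      using eq by (simp add: ga.mpoly_eval_diff ga.mpoly_eval_power)
    moreover have "mpoly_var 0 ^ i - mpoly_var 0 ^ j \<in> (polys_in {..<n} :: 'm mpoly set)"
      using n by (intro Sn.diff Sn.power mpoly_var_in) auto
    ultimately have "mpoly_var 0 ^ i - mpoly_var 0 ^ j = (0 :: 'm mpoly)" by (intro indep[folded ga_def])
    then have pe: "mpoly_var 0 ^ i = (mpoly_var 0 ^ j :: 'm mpoly)" by simp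
    have pow: "mpoly_var 0 ^ k = Poly_Mapping.single (Poly_Mapping.single 0 k) (1::'m)" for k
      by (induction k) (auto simp: mpoly_var_def mult_single single_add[symmetric])
    have "Poly_Mapping.keys (Poly_Mapping.single (Poly_Mapping.single (0::nat) i) (1::'m)) =
      Poly_Mapping.keys (Poly_Mapping.single (Poly_Mapping.single (0::nat) j) (1::'m))" using pe unfolding pow by simp
    then have "Poly_Mapping.single (0::nat) i = Poly_Mapping.single 0 j" by simp
    then show "i = j" by (metis lookup_single_eq)
  qed
  moreover have "range (\<lambda>i. gp 0 ^ i) \<subseteq> B" using gpB[of 0] n by auto
  ultimately have infB: "infinite B" using finite_imageD finite_subset infinite_UNIV_nat by blast
  interpret Sep: subfield_set "{v. sep_elt B v}" by (rule B.sep_elts_subfield[OF infB])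
  have sepgp: "sep_elt B (gp i)" if "i < N" for i
    by (rule sep[OF B.ac_subfield_axioms _ _ infB that]) (use gaB gpB in \<open>auto simp: ga_def\<close>)
  have sepp: "sep_elt B (mpoly_eval ga gp p)" if "p \<in> polys_in {..<N}" for p
    using that
  proof (induction rule: polys_in_induct)
    case (const c) then show ?case using B.sep_elt_base[OF gaB] by simp
  next
    case (var i) then show ?case using sepgp by simp
  next
    case (add p q) then show ?case using Sep.add by (simp add: ga.mpoly_eval_add)
  next
    case (mult p q) then show ?case using Sep.mult by (simp add: ga.mpoly_eval_mult)
  qed
  have allsep: "algebraic_over FF K x \<and> separable_poly_over FF K (ring.Irr FF K x)" if x: "x \<in> carrier FF" for x
  proof (rule F.separable_over_if_sep_elt[OF K x])
    have "x \<in> E.cls ` E.Fr" using x unfolding FF E.FF_carrier .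
    then obtain u where u: "u \<in> E.Fr" "x = E.cls u" by blast
    then obtain a b where ab: "a \<in> carrier D" "b \<in> carrier D" "u = ev a / ev b" using E.frE by (metis DiffD1)
    then have "sep_elt B (ev a)" "sep_elt B (ev b)" using sepp ev unfolding Dcar by auto
    then have "sep_elt B u" using Sep.divide ab(3) by simp
    then show "sep_elt (E.val ` K) (E.val x)" using E.val_cls[OF u(1)] u(2) B_def by simp
  qed
  have dim: "variety_dim N P n"
    unfolding variety_dim_def FF_def[symmetric]
  proof (intro exI[of _ y] conjI allI impI ballI)
    show "y j \<in> carrier FF" if "j < n" for j using y that by blast
    show "q = 0" if q: "q \<in> carrier (mpoly_ring n)" "mpoly_eval_in FF (const_function N P) y q = \<zero>\<^bsub>FF\<^esub>" for q
    proof -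
      have qn: "q \<in> polys_in {..<n}" using q(1) by (simp add: mpoly_ring_simps)
      have "E.val (mpoly_eval_in FF (const_function N P) y q) = mpoly_eval (\<lambda>c. E.val (const_function N P c)) (\<lambda>i. E.val (y i)) q"
        by (rule F.val_mpoly_eval_in[OF _ qn]) (use cf y in auto)
      also have "\<dots> = mpoly_eval ga (\<lambda>i. E.val (y i)) q" by (simp only: cf(2))
      also have "\<dots> = mpoly_eval ga gp q" by (rule ga.mpoly_eval_cong[OF qn]) (use y in auto)
      finally have "mpoly_eval ga gp q = 0" using q(2) F.val_zero by simp
      then show ?thesis using indep[OF qn] by (simp add: ga_def)
    qed
    show "algebraic_over FF (generate_field FF (range (const_function N P) \<union> y ` {..<n})) x" if "x \<in> carrier FF" for x
      using allsep[OF that] by (simp add: K_def Sg_def)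
  qed
  have sepmap: "separable_map N P n mpoly_var"
    unfolding separable_map_def separable_ext_def FF_def[symmetric]
    unfolding y_def[symmetric] Sg_def[symmetric] K_def[symmetric]
    using K F.carrier_is_subfield subfieldE(3)[OF K] allsep by blast
  have dom: "dominating P n mpoly_var" unfolding dominating_def
  proof (intro ballI impI)
    fix q :: "'m mpoly" assume q: "q \<in> carrier (mpoly_ring n)" "mpoly_eval mpoly_const mpoly_var q \<in> P"
    have "mpoly_eval mpoly_const mpoly_var q = q" using mpoly_subst_var[of q] by (simp add: mpoly_subst_def)
    then show "q = 0" using q indep[of q] by (auto simp: P_def mpoly_ring_simps)
  qed
  have "\<exists>a\<in>rational_points P. \<forall>j<n. mpoly_eval id a (mpoly_var j) \<in> range \<iota>"
    using PAC[unfolded PAC_extension_def, THEN conjunct2, rule_format, of N P n "\<lambda>j. mpoly_var j"] abs n(1) dim vN dom sepmap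
    unfolding mpoly_ring_simps(1) by blast
  then show ?thesis unfolding rhom.mpoly_eval_var[OF rhom_id] .
qed

section \<open>Lagrange interpolation\<close>

text \<open>The Lagrange basis polynomial at the node \<open>a e\<close>; the nodes are \<open>a 0, \<dots>, a (N-1)\<close>.\<close>

definition lbase :: "nat \<Rightarrow> (nat \<Rightarrow> 'a::field) \<Rightarrow> nat \<Rightarrow> 'a poly" where
  "lbase N a e = (\<Prod>f\<in>{..<N} - {e}. smult (inverse (a e - a f)) [:- a f, 1:])"

definition lagr :: "nat \<Rightarrow> (nat \<Rightarrow> 'a::field) \<Rightarrow> (nat \<Rightarrow> 'a) \<Rightarrow> 'a poly" where
  "lagr N a b = (\<Sum>e<N. smult (b e) (lbase N a e))"

lemma degree_prod_le_card:
  assumes "finite A" "\<And>x. x \<in> A \<Longrightarrow> degree (f x) \<le> 1" shows "degree (\<Prod>x\<in>A. f x :: 'a::comm_semiring_1 poly) \<le> card A"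
  using assms
proof (induction A)
  case (insert x A)
  have "degree (f x * (\<Prod>x\<in>A. f x)) \<le> degree (f x) + degree (\<Prod>x\<in>A. f x)" by (rule degree_mult_le)
  also have "\<dots> \<le> 1 + card A" using insert by (intro add_mono) auto
  finally show ?case using insert by simp
qed auto

lemma lbase_coeff: "e < N \<Longrightarrow> i \<ge> N \<Longrightarrow> coeff (lbase N a e) i = 0"
proof -
  assume e: "e < N" "i \<ge> N"
  have "degree (lbase N a e) \<le> card ({..<N} - {e})"
    unfolding lbase_def by (intro degree_prod_le_card) (auto intro: order_trans[OF degree_smult_le])
  then show ?thesis using e by (intro coeff_eq_0) simp
qed

lemma lagr_coeff: "i \<ge> N \<Longrightarrow> coeff (lagr N a b) i = 0"
  by (simp add: lagr_def coeff_sum lbase_coeff)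

lemma lbase_poly:
  assumes "inj_on a {..<N}" "e < N" "f < N" shows "poly (lbase N a e) (a f) = (if e = f then 1 else 0)"
proof (cases "e = f")
  case True
  have "(\<Prod>x\<in>{..<N} - {e}. poly (smult (inverse (a e - a x)) [:- a x, 1:]) (a e)) = 1"
  proof (rule prod.neutral, rule ballI)
    fix x assume x: "x \<in> {..<N} - {e}"
    then have "a e \<noteq> a x" using assms by (auto dest: inj_onD)
    moreover have "poly (smult (inverse (a e - a x)) [:- a x, 1:]) (a e) = inverse (a e - a x) * (a e - a x)" by (simp add: algebra_simps)
    ultimately show "poly (smult (inverse (a e - a x)) [:- a x, 1:]) (a e) = 1" by simp
  qed
  then show ?thesis using True by (simp add: lbase_def poly_prod)
next
  case False
  have "(\<Prod>x\<in>{..<N} - {e}. poly (smult (inverse (a e - a x)) [:- a x, 1:]) (a f)) = 0"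
    by (rule prod_zero) (use False assms(3) in \<open>auto intro!: bexI[of _ f]\<close>)
  then show ?thesis using False by (simp add: lbase_def poly_prod)
qed

lemma lagr_poly:
  assumes "inj_on a {..<N}" "e < N" shows "poly (lagr N a b) (a e) = b e"
proof -
  have "poly (lagr N a b) (a e) = (\<Sum>f<N. if f = e then b f else 0)"
    unfolding lagr_def poly_sum poly_smult using assms by (intro sum.cong) (auto simp: lbase_poly)
  then show ?thesis using assms(2) by simp
qed

lemma poly_eq_by_nodes:
  fixes p q :: "'a::idom poly"
  assumes "inj_on a {..<N}" "\<And>i. i \<ge> N \<Longrightarrow> coeff p i = 0" "\<And>i. i \<ge> N \<Longrightarrow> coeff q i = 0"
    and "\<And>e. e < N \<Longrightarrow> poly p (a e) = poly q (a e)"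
  shows "p = q"
proof (rule ccontr)
  assume "p \<noteq> q"
  then have d: "p - q \<noteq> 0" by simp
  have "a ` {..<N} \<subseteq> {x. poly (p - q) x = 0}" using assms(4) by auto
  then have "card (a ` {..<N}) \<le> card {x. poly (p - q) x = 0}" by (intro card_mono poly_roots_finite[OF d])
  then have "N \<le> card {x. poly (p - q) x = 0}" using card_image[OF assms(1)] by simp
  also have "\<dots> \<le> degree (p - q)" by (rule card_poly_roots_bound[OF d])
  finally have "coeff (p - q) (degree (p - q)) = 0" using assms(2,3) by simp
  then show False using d leading_coeff_0_iff by blast
qed

lemma (in subfield_set) lagr_over:
  assumes "\<And>e. e < N \<Longrightarrow> a e \<in> B" "\<And>e. e < N \<Longrightarrow> b e \<in> B" shows "lagr N a b \<in> polys_over B"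
  unfolding lagr_def lbase_def using assms
  by (intro P.sum smult_polys_over P.prod pCons_polys_over zero_polys_over uminus inverse diff one) auto

lemma rhom_poly_map: "rhom f \<Longrightarrow> rhom (\<lambda>S. poly (map_poly f S) y)"
  unfolding rhom_def[of "\<lambda>S. poly (map_poly f S) y"]
  by (simp add: rhom.hom_add[OF rhom_map_poly] rhom.hom_mult[OF rhom_map_poly] rhom.hom_one[OF rhom_map_poly])

section \<open>The variety of generators with prescribed fibres\<close>

text \<open>A polynomial \<open>S\<close> in a variable \<open>T\<close> with coefficients in a ring of polynomials is regarded as a family of
  equations; here one such family is substituted into another.\<close>

lemma poly_in_fibre_family:
  fixes f :: "'m::field mpoly \<Rightarrow> 'c::comm_ring_1"
  assumes f: "rhom f"
  shows "poly (map_poly f (poly (map_poly (\<lambda>c. [:c:]) S) T)) y = poly (map_poly f S) (poly (map_poly f T) y)"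
proof -
  interpret H: rhom "\<lambda>S. poly (map_poly f S) y" by (rule rhom_poly_map[OF f])
  have 0: "f 0 = 0" by (rule rhom.hom_zero[OF f])
  show ?thesis
    by (induction S)
       (auto simp: map_poly_pCons 0 H.hom_add H.hom_mult H.hom_zero)
qed

text \<open>Let \<open>A = M[T]/(\<mu>)\<close>, a separable algebra whose homomorphisms into the algebraic closure correspond to the
  set \<open>Th\<close> of roots. The pairs \<open>(a, x)\<close> with \<open>Q(a) \<noteq> 0\<close>, \<open>x\<close> a generator of \<open>A\<close> (witnessed by
  \<open>z(x) = T\<close>) and \<open>g(x) = w\<close> form an affine variety over \<open>M\<close>. Over the algebraic closure \<open>x\<close> is given
  by its values \<open>t_e\<close> at the roots \<open>th e\<close>, and the variety becomes that of the coefficients of \<open>g\<close> together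
  with the roots of all \<open>g - W(\<theta>)\<close>, one root for each \<open>\<theta>\<close>. As the fibres of \<open>W\<close> have \<open>n\<close> elements,
  these are all the roots in some order; this is the situation of \<open>blocks\<close>. Full symmetry of the generic
  point makes the variety irreducible, and \<open>PAC_point\<close> yields a point with \<open>a\<close> in \<open>K\<close>.\<close>

lemma prescribed_fibres:
  fixes \<iota> :: "'k::field \<Rightarrow> 'm::field" and \<mu> w :: "'m poly" and Th :: "'m alg_closure set" and Q :: "'k mpoly"
  assumes PAC: "PAC_extension \<iota>" and n: "n > 0" and two: "n = 2 \<longrightarrow> (2::'m) \<noteq> 0"
    and Th: "finite Th" "Th \<noteq> {}" and mu: "map_poly to_ac \<mu> = (\<Prod>\<theta>\<in>Th. [:- \<theta>, 1:])"
    and fib: "\<And>\<theta>. \<theta> \<in> Th \<Longrightarrow> card {\<theta>' \<in> Th. poly (map_poly to_ac w) \<theta>' = poly (map_poly to_ac w) \<theta>} = n"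
    and Q: "Q \<in> polys_in {..<n}" "Q \<noteq> 0"
  shows "\<exists>a xp zp. mpoly_eval id a Q \<noteq> 0 \<and>
    (\<forall>\<theta>\<in>Th. poly (gen_monic n (\<lambda>j. to_ac (\<iota> (a j)))) (poly (map_poly to_ac xp) \<theta>) = poly (map_poly to_ac w) \<theta> \<and>
      poly (map_poly to_ac zp) (poly (map_poly to_ac xp) \<theta>) = \<theta>)"
proof -
  define N where "N = card Th"
  have N0: "N > 0" using Th by (simp add: N_def card_gt_0_iff)
  obtain th where th0: "bij_betw th {0..<N} Th" using ex_bij_betw_nat_finite[OF Th(1)] N_def by blast
  then have th: "bij_betw th {..<N} Th" by (simp add: atLeast0LessThan)
  have thT: "th e \<in> Th" if "e < N" for e using bij_betwE[OF th] that by blast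
  have thinj: "inj_on th {..<N}" using th by (rule bij_betw_imp_inj_on)
  have thsurj: "\<exists>e<N. \<theta> = th e" if "\<theta> \<in> Th" for \<theta> using bij_betw_imp_surj_on[OF th] that by (metis imageE lessThan_iff)
  define W where "W = (\<lambda>\<theta>. poly (map_poly to_ac w) \<theta>)"
  define R where "R = {n..<n + N}"
  define om where "om = (\<lambda>v. W (th (v - n)))"
  interpret blocks n R om
  proof
    show "n > 0" by (rule n)
    show "finite R" by (simp add: R_def)
    show "{..<n} \<inter> R = {}" by (auto simp: R_def)
    fix v assume v: "v \<in> R"
    then have ev: "v - n < N" by (auto simp: R_def)
    have "bij_betw (\<lambda>u. th (u - n)) {u \<in> R. om u = om v} {\<theta>' \<in> Th. W \<theta>' = W (th (v - n))}"
    proof (rule bij_betw_imageI)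
      show "inj_on (\<lambda>u. th (u - n)) {u \<in> R. om u = om v}"
      proof (rule inj_onI)
        fix x y assume xy: "x \<in> {u \<in> R. om u = om v}" "y \<in> {u \<in> R. om u = om v}" "th (x - n) = th (y - n)"
        then have "x - n = y - n" using inj_onD[OF thinj xy(3)] by (auto simp: R_def)
        then show "x = y" using xy by (auto simp: R_def)
      qed
      show "(\<lambda>u. th (u - n)) ` {u \<in> R. om u = om v} = {\<theta>' \<in> Th. W \<theta>' = W (th (v - n))}"
      proof (intro equalityI subsetI)
        fix \<theta> assume "\<theta> \<in> {\<theta>' \<in> Th. W \<theta>' = W (th (v - n))}"
        then obtain e where "e < N" "\<theta> = th e" "W (th e) = W (th (v - n))" using thsurj by blast
        then show "\<theta> \<in> (\<lambda>u. th (u - n)) ` {u \<in> R. om u = om v}"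
          by (intro image_eqI[of _ _ "n + e"]) (auto simp: R_def om_def)
      qed (auto simp: R_def om_def intro: thT)
    qed
    then show "card {u \<in> R. om u = om v} = n" using fib[OF thT[OF ev]] by (simp add: bij_betw_same_card W_def)
  qed
  have RN: "R \<noteq> {}" using N0 by (auto simp: R_def)
  have VR: "{..<n} \<union> R = {..<n + N}" by (auto simp: R_def)
  have two': "n = 2 \<longrightarrow> (2::'m alg_closure) \<noteq> 0" using two by (metis to_ac_numeral to_ac_eq_0_iff)
  obtain pt where pt: "st.on_variety pt" "coeff_indep pt"
    using generic_point_exists[OF two' RN] by blast
  interpret e: rhom "emb :: 'm alg_closure \<Rightarrow> _" by (rule rhom_emb)
  define t where "t = (\<lambda>e. pt (n + e))"
  have trel: "poly (gen_monic n pt) (t e) = emb (W (th e))" if "e < N" for e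
    using pt(1) that unfolding on_variety_iff by (auto simp: t_def om_def R_def)
  have tinj: "inj_on t {..<N}"
  proof (rule inj_onI)
    fix x y assume xy: "x \<in> {..<N}" "y \<in> {..<N}" "t x = t y"
    then have "emb (W (th x)) = emb (W (th y))" using trel[of x] trel[of y] by simp
    then have "W (th x) = W (th y)" using rhom_inj[OF rhom_emb] by blast
    then have "om (n + x) = om (n + y)" by (simp add: om_def)
    moreover have "\<forall>v\<in>R. \<forall>w\<in>R. om v = om w \<longrightarrow> pt v = pt w \<longrightarrow> v = w"
      using pt(1) unfolding on_variety_iff st.sep_on_blocks_def by blast
    moreover have "n + x \<in> R" "n + y \<in> R" "pt (n + x) = pt (n + y)" using xy by (auto simp: R_def t_def)
    ultimately have "n + x = n + y" by blast
    then show "x = y" by simp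
  qed
  have einj: "inj_on (\<lambda>e. emb (th e)) {..<N}"
    using thinj rhom_inj[OF rhom_emb] by (auto simp: inj_on_def)
  define xg where "xg = lagr N (\<lambda>e. emb (th e)) t"
  define zg where "zg = lagr N t (\<lambda>e. emb (th e))"
  define Qm where "Qm = Poly_Mapping.map \<iota> Q"
  define Qh where "Qh = Poly_Mapping.map to_ac Qm"
  have \<iota>: "rhom \<iota>"
    using PAC unfolding PAC_extension_def field_extension_def ring_hom_def by (simp add: ring_of_type_algebra_def rhom_def)
  have Qm: "Qm \<in> polys_in {..<n}" unfolding Qm_def by (rule map_mpoly_in[OF \<iota> Q(1)])
  have Qh: "Qh \<in> polys_in {..<n}" unfolding Qh_def by (rule map_mpoly_in[OF rhom_to_ac Qm])
  have Qh0: "Qh \<noteq> 0"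
  proof
    assume "Qh = 0"
    then have "Poly_Mapping.lookup Qh m = 0" for m by simp
    then have "Poly_Mapping.lookup Q m = 0" for m
      using rhom_eq_0_iff[OF \<iota>] by (simp add: Qh_def Qm_def rhom.lookup_map_hom[OF rhom_to_ac] rhom.lookup_map_hom[OF \<iota>])
    then show False using Q(2) by (metis poly_mapping_eqI lookup_zero)
  qed
  define q0 where "q0 = mpoly_eval emb pt Qh"
  have q0: "q0 \<noteq> 0" using pt(2) Qh Qh0 by (auto simp: coeff_indep_def q0_def)
  \<comment> \<open>coordinates: the coefficients of \<open>g\<close>, those of \<open>x\<close> and of \<open>z\<close>, and the inverse of \<open>Q(a)\<close>\<close>
  define NN where "NN = n + 2 * N + 1"
  have NNi: "i < NN \<longleftrightarrow> i \<le> n + 2 * N" for i by (auto simp: NN_def)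
  define gp where "gp = (\<lambda>i. if i < n then pt i else if i < n + N then coeff xg (i - n)
      else if i < n + 2 * N then coeff zg (i - n - N) else inverse q0)"
  define ga where "ga = (\<lambda>c::'m. emb (to_ac c))"
  have ga: "rhom ga" using rhom_comp[OF rhom_to_ac rhom_emb] by (simp add: ga_def o_def)
  interpret ga: rhom ga by (rule ga)
  define P where "P = {p \<in> polys_in {..<NN}. mpoly_eval ga gp p = 0}"
  interpret S: subring_set "polys_in {..<NN} :: 'm alg_closure mpoly set" by (rule polys_in_subring)
  interpret Sm: subring_set "polys_in {..<NN} :: 'm mpoly set" by (rule polys_in_subring)
  interpret SmP: subring_set "polys_over (polys_in {..<NN}) :: 'm mpoly poly set" by (rule Sm.polys_over_subring)
  interpret Rc: cring "mpoly_ring NN :: 'm alg_closure mpoly ring" by (rule cring_mpoly_ring)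
  define mac where "mac = (Poly_Mapping.map to_ac :: 'm mpoly \<Rightarrow> 'm alg_closure mpoly)"
  have mac: "rhom mac" unfolding mac_def by (rule rhom.map_mpoly_rhom[OF rhom_to_ac])
  interpret mac: rhom mac by (rule mac)
  define I where "I = Idl\<^bsub>mpoly_ring NN\<^esub> (mac ` P)"
  have emac: "mpoly_eval emb gp (mac p) = mpoly_eval ga gp p" for p
    unfolding mac_def using mpoly_eval_map[OF rhom_to_ac rhom_emb, of gp p] by (simp add: ga_def[abs_def] o_def)
  have macP: "mac ` P \<subseteq> carrier (mpoly_ring NN)"
    unfolding mpoly_ring_simps mac_def P_def using map_mpoly_in[OF rhom_to_ac] by blast
  have Iideal: "ideal I (mpoly_ring NN)" unfolding I_def by (rule Rc.genideal_ideal[OF macP])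
  interpret I: ideal I "mpoly_ring NN :: 'm alg_closure mpoly ring" by (rule Iideal)
  have Icar: "I \<subseteq> polys_in {..<NN}" using I.a_subset by (simp add: mpoly_ring_simps)
  have I0: "0 \<in> I" using I.zero_closed by (simp add: mpoly_ring_simps)
  have Iadd: "x + y \<in> I" if "x \<in> I" "y \<in> I" for x y using I.a_closed[OF that] by (simp add: mpoly_ring_simps)
  have Imult: "c * x \<in> I" if "x \<in> I" "c \<in> polys_in {..<NN}" for x c
    using I.I_l_closed[of x c] that by (simp add: mpoly_ring_simps)
  have Iminus: "- x \<in> I" if "x \<in> I" for x using Imult[OF that, of "-1"] by auto
  have Idiff: "x - y \<in> I" if "x \<in> I" "y \<in> I" for x y using Iadd[OF that(1) Iminus[OF that(2)]] by simp
  have Isum: "(\<And>i. i \<in> A \<Longrightarrow> f i \<in> I) \<Longrightarrow> sum f A \<in> I" for f and A :: "nat set"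
    by (induction A rule: infinite_finite_induct) (auto intro: I0 Iadd)
  have PI: "mac p \<in> I" if "p \<in> P" for p unfolding I_def using Rc.genideal_self[OF macP] that by blast
  have Ivan: "mpoly_eval emb gp p = 0" if "p \<in> I" for p
  proof -
    have "I \<subseteq> {p \<in> polys_in {..<NN}. mpoly_eval emb gp p = 0}"
      unfolding I_def
      by (rule Rc.genideal_minimal[OF primeideal.axioms(1)[OF kernel_primeideal[OF rhom_emb]]])
         (use macP emac in \<open>auto simp: P_def mpoly_ring_simps\<close>)
    then show ?thesis using that by blast
  qed
  \<comment> \<open>a family of equations over \<open>M\<close> that holds at all roots of \<open>\<mu>\<close> is a consequence of \<open>P\<close>: reduce it
    modulo \<open>\<mu>\<close>, and interpolation shows that the coefficients of the remainder belong to \<open>P\<close>\<close>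
  define mum where "mum = map_poly mpoly_const \<mu>"
  have degmu: "degree \<mu> = N" "lead_coeff \<mu> = 1"
  proof -
    have d: "degree (map_poly to_ac \<mu>) = N" "lead_coeff (map_poly to_ac \<mu>) = 1"
      unfolding mu using degree_prod_linear[OF Th(1), of "\<lambda>x. x"] lead_coeff_prod_linear[of "\<lambda>x. x" Th] by (simp_all add: N_def)
    then show "degree \<mu> = N" by (simp add: degree_map_poly_rhom[OF rhom_to_ac])
    then have "to_ac (lead_coeff \<mu>) = to_ac 1" using d by (simp add: coeff_map_poly degree_map_poly_rhom[OF rhom_to_ac])
    then show "lead_coeff \<mu> = 1" by (simp only: to_ac_eq_iff)
  qed
  have const0: "mpoly_const c = 0 \<longleftrightarrow> c = 0" for c :: 'm
    using rhom_eq_0_iff[OF mpoly_const_rhom, of c] by simp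
  have degmum: "degree mum = N" "lead_coeff mum = 1"
  proof -
    show d: "degree mum = N" unfolding mum_def using degmu(1) by (subst degree_map_poly) (auto simp: const0)
    show "lead_coeff mum = 1" unfolding d using degmu
      by (simp add: mum_def coeff_map_poly const0 rhom.hom_one[OF mpoly_const_rhom])
  qed
  have mumP: "mum \<in> polys_over (polys_in {..<NN})"
    by (auto simp: mum_def polys_over_def coeff_map_poly const0)
  have muroot: "poly (map_poly to_ac \<mu>) \<theta> = 0" if "\<theta> \<in> Th" for \<theta>
    unfolding mu poly_prod using that Th(1) by (intro prod_zero) auto
  have fam: "poly (map_poly mac S) (mpoly_const \<theta>) \<in> I \<and>
       (\<forall>a\<in>rational_points P. poly (map_poly (\<lambda>p. to_ac (mpoly_eval id a p)) S) \<theta> = 0)"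
    if S: "S \<in> polys_over (polys_in {..<NN})" and van: "\<And>\<theta>. \<theta> \<in> Th \<Longrightarrow> poly (map_poly (mpoly_eval ga gp) S) (emb \<theta>) = 0"
      and \<theta>: "\<theta> \<in> Th" for S \<theta>
  proof -
    obtain A r where Ar: "A \<in> polys_over (polys_in {..<NN})" "r \<in> polys_over (polys_in {..<NN})" "S = A * mum + r" "degree r < N"
      using Sm.monic_division[OF S mumP degmum(2)] degmum(1) N0 by auto
    have red: "poly (map_poly f S) y = poly (map_poly f r) y"
      if f: "rhom f" and y: "poly (map_poly (\<lambda>c. f (mpoly_const c)) \<mu>) y = 0" for f :: "'m mpoly \<Rightarrow> 'd::comm_ring_1" and y
    proof -
      interpret H: rhom "\<lambda>S. poly (map_poly f S) y" by (rule rhom_poly_map[OF f])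
      have "map_poly f mum = map_poly (\<lambda>c. f (mpoly_const c)) \<mu>"
        unfolding mum_def by (intro poly_eqI) (simp add: coeff_map_poly const0 rhom.hom_zero[OF f] rhom.hom_zero[OF mpoly_const_rhom])
      then have "poly (map_poly f mum) y = 0" using y by simp
      then show ?thesis unfolding Ar(3) H.hom_add H.hom_mult by simp
    qed
    define r' where "r' = map_poly (mpoly_eval ga gp) r"
    have "poly r' (emb \<theta>') = 0" if "\<theta>' \<in> Th" for \<theta>'
    proof -
      have "poly (map_poly (\<lambda>c. mpoly_eval ga gp (mpoly_const c)) \<mu>) (emb \<theta>') = 0"
      proof -
        have "map_poly (\<lambda>c. mpoly_eval ga gp (mpoly_const c)) \<mu> = map_poly emb (map_poly to_ac \<mu>)"
          unfolding ga.mpoly_eval_const by (intro poly_eqI) (subst coeff_map_poly, rule ga.hom_zero, simp add: coeff_map_poly ga_def)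
        then show ?thesis using st.h.poly_map_poly_hom[of "map_poly to_ac \<mu>" \<theta>'] muroot[OF that] by simp
      qed
      then show ?thesis unfolding r'_def using red[OF ga.mpoly_eval_rhom] van[OF that] by metis
    qed
    then have rn: "r' = 0"
      using Ar(4) map_poly_degree_leq[of "mpoly_eval ga gp" r]
      by (intro poly_eq_by_nodes[OF einj]) (auto simp: r'_def thT intro!: coeff_eq_0)
    have rP: "coeff r i \<in> P" for i
    proof -
      have "coeff r' i = 0" using rn by simp
      then show ?thesis using Ar(2) by (auto simp: P_def r'_def coeff_map_poly polys_over_def)
    qed
    have "poly (map_poly mac S) (mpoly_const \<theta>) = poly (map_poly mac r) (mpoly_const \<theta>)"
    proof (rule red[OF mac])
      have "map_poly (\<lambda>c. mac (mpoly_const c)) \<mu> = map_poly mpoly_const (map_poly to_ac \<mu>)"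
        by (intro poly_eqI) (simp add: coeff_map_poly mac_def rhom.mpoly_map_const[OF rhom_to_ac]
            rhom.hom_zero[OF mpoly_const_rhom] rhom.hom_zero[OF rhom_to_ac] const0)
      then show "poly (map_poly (\<lambda>c. mac (mpoly_const c)) \<mu>) (mpoly_const \<theta>) = 0"
        using rhom.poly_map_poly_hom[OF mpoly_const_rhom, of "map_poly to_ac \<mu>" \<theta>] muroot[OF \<theta>]
        by (simp add: rhom.hom_zero[OF mpoly_const_rhom])
    qed
    also have "\<dots> = (\<Sum>i\<le>degree (map_poly mac r). mac (coeff r i) * mpoly_const \<theta> ^ i)"
      by (simp add: poly_altdef coeff_map_poly)
    also have "\<dots> \<in> I"
    proof (rule Isum)
      fix i have "mpoly_const \<theta> ^ i * mac (coeff r i) \<in> I" by (rule Imult[OF PI[OF rP]]) auto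
      then show "mac (coeff r i) * mpoly_const \<theta> ^ i \<in> I" by (simp add: mult.commute)
    qed
    finally have 1: "poly (map_poly mac S) (mpoly_const \<theta>) \<in> I" .
    have 2: "poly (map_poly (\<lambda>p. to_ac (mpoly_eval id a p)) S) \<theta> = 0" if a: "a \<in> rational_points P" for a
    proof -
      have ra: "rhom (\<lambda>p. to_ac (mpoly_eval id a p))"
        using rhom_comp[OF rhom.mpoly_eval_rhom[OF rhom_id, of a] rhom_to_ac] by (simp add: o_def)
      have "poly (map_poly (\<lambda>p. to_ac (mpoly_eval id a p)) S) \<theta> = poly (map_poly (\<lambda>p. to_ac (mpoly_eval id a p)) r) \<theta>"
      proof (rule red[OF ra])
        show "poly (map_poly (\<lambda>c. to_ac (mpoly_eval id a (mpoly_const c))) \<mu>) \<theta> = 0"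
          unfolding rhom.mpoly_eval_const[OF rhom_id] using muroot[OF \<theta>] by simp
      qed
      also have "map_poly (\<lambda>p. to_ac (mpoly_eval id a p)) r = 0"
      proof (rule poly_eqI)
        fix i
        have "mpoly_eval id a (coeff r i) = 0" using a rP by (auto simp: rational_points_def)
        then show "coeff (map_poly (\<lambda>p. to_ac (mpoly_eval id a p)) r) i = coeff 0 i"
          by (subst coeff_map_poly) (simp_all only: rhom.hom_zero[OF ra] to_ac_0 coeff_0)
      qed
      finally show ?thesis unfolding poly_0 .
    qed
    show ?thesis using 1 2 by blast
  qed
  define XS where "XS = (\<Sum>l<N. monom (mpoly_var (n + l) :: 'm mpoly) l)"
  define ZS where "ZS = (\<Sum>l<N. monom (mpoly_var (n + N + l) :: 'm mpoly) l)"
  \<comment> \<open>the equations \<open>g(x) = w\<close> and \<open>z(x) = T\<close>\<close>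
  define S1 where "S1 = poly (map_poly (\<lambda>c. [:c:]) (gen_monic n (mpoly_var :: nat \<Rightarrow> 'm mpoly))) XS - map_poly mpoly_const w"
  define S2 where "S2 = poly (map_poly (\<lambda>c. [:c:]) ZS) XS - [:0, 1:]"
  have cXS: "coeff XS i = (if i < N then mpoly_var (n + i) else 0)" for i by (simp add: XS_def coeff_sum)
  have cZS: "coeff ZS i = (if i < N then mpoly_var (n + N + i) else 0)" for i by (simp add: ZS_def coeff_sum)
  have XSP: "XS \<in> polys_over (polys_in {..<NN})" by (auto simp: polys_over_def cXS NNi)
  have liftP: "poly (map_poly (\<lambda>c. [:c:]) p) XS \<in> polys_over (polys_in {..<NN})"
    if "p \<in> polys_over (polys_in {..<NN})" for p :: "'m mpoly poly"
    using that
    by (induction p) (auto simp: map_poly_pCons Sm.pCons_polys_over_iff intro!: SmP.add SmP.mult XSP Sm.pCons_polys_over)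
  have S1P: "S1 \<in> polys_over (polys_in {..<NN})" unfolding S1_def
    by (intro SmP.diff liftP) (auto simp: polys_over_def coeff_gen_monic coeff_map_poly const0 NNi)
  have S2P: "S2 \<in> polys_over (polys_in {..<NN})" unfolding S2_def
    by (intro SmP.diff liftP Sm.pCons_polys_over Sm.zero Sm.one Sm.zero_polys_over) (auto simp: polys_over_def cZS NNi)
  have ev1: "poly (map_poly f S1) y = poly (gen_monic n (\<lambda>j. f (mpoly_var j))) (poly (map_poly f XS) y) - poly (map_poly (\<lambda>c. f (mpoly_const c)) w) y"
    if f: "rhom f" for f :: "'m mpoly \<Rightarrow> 'd::comm_ring_1" and y
  proof -
    interpret H: rhom "\<lambda>S. poly (map_poly f S) y" by (rule rhom_poly_map[OF f])
    have "map_poly f (map_poly mpoly_const w) = map_poly (\<lambda>c. f (mpoly_const c)) w"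
      by (intro poly_eqI) (simp add: coeff_map_poly const0 rhom.hom_zero[OF f] rhom.hom_zero[OF mpoly_const_rhom])
    then show ?thesis unfolding S1_def H.hom_diff poly_in_fibre_family[OF f] map_poly_gen_monic[OF f] by simp
  qed
  have ev2: "poly (map_poly f S2) y = poly (map_poly f ZS) (poly (map_poly f XS) y) - y"
    if f: "rhom f" for f :: "'m mpoly \<Rightarrow> 'd::comm_ring_1" and y
  proof -
    interpret H: rhom "\<lambda>S. poly (map_poly f S) y" by (rule rhom_poly_map[OF f])
    show ?thesis unfolding S2_def H.hom_diff poly_in_fibre_family[OF f]
      by (simp add: map_poly_pCons rhom.hom_zero[OF f] rhom.hom_one[OF f])
  qed
  have evX: "map_poly (mpoly_eval ga gp) XS = xg" "map_poly (mpoly_eval ga gp) ZS = zg"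
    by (intro poly_eqI; auto simp: coeff_map_poly cXS cZS gp_def xg_def zg_def lagr_coeff)+
  have xgp: "poly xg (emb (th e)) = t e" "poly zg (t e) = emb (th e)" if "e < N" for e
    unfolding xg_def zg_def using lagr_poly[OF einj that] lagr_poly[OF tinj that] by auto
  have gm: "gen_monic n (\<lambda>j. gp j) = gen_monic n pt" by (rule gen_monic_cong) (simp add: gp_def)
  have van1: "poly (map_poly (mpoly_eval ga gp) S1) (emb \<theta>) = 0" if "\<theta> \<in> Th" for \<theta>
  proof -
    from thsurj[OF \<open>\<theta> \<in> Th\<close>] obtain e where e: "e < N" "\<theta> = th e" by blast
    have "map_poly (\<lambda>c. mpoly_eval ga gp (mpoly_const c)) w = map_poly emb (map_poly to_ac w)"
      unfolding ga.mpoly_eval_const by (intro poly_eqI) (subst coeff_map_poly, rule ga.hom_zero, simp add: coeff_map_poly ga_def)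
    then have "poly (map_poly (\<lambda>c. mpoly_eval ga gp (mpoly_const c)) w) (emb \<theta>) = emb (W \<theta>)"
      using st.h.poly_map_poly_hom[of "map_poly to_ac w" \<theta>] by (simp add: W_def)
    then show ?thesis unfolding ev1[OF ga.mpoly_eval_rhom] evX ga.mpoly_eval_var gm
      using xgp(1)[OF e(1)] trel[OF e(1)] e(2) by simp
  qed
  have van2: "poly (map_poly (mpoly_eval ga gp) S2) (emb \<theta>) = 0" if "\<theta> \<in> Th" for \<theta>
  proof -
    from thsurj[OF \<open>\<theta> \<in> Th\<close>] obtain e where e: "e < N" "\<theta> = th e" by blast
    show ?thesis unfolding ev2[OF ga.mpoly_eval_rhom] evX using xgp[OF e(1)] e(2) by simp
  qed
  define pY where "pY = Qm * mpoly_var (n + 2 * N) - 1"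
  have pYP: "pY \<in> P"
  proof -
    have 1: "pY \<in> polys_in {..<NN}" unfolding pY_def
      using polys_in_mono[OF _ Qm, of "{..<NN}"] by (intro Sm.diff Sm.mult Sm.one mpoly_var_in) (auto simp: NN_def)
    have "mpoly_eval ga gp Qm = mpoly_eval emb gp Qh" unfolding Qh_def using emac[of Qm] by (simp add: mac_def)
    also have "\<dots> = q0" unfolding q0_def by (rule st.h.mpoly_eval_cong[OF Qh]) (simp add: gp_def)
    finally have "mpoly_eval ga gp pY = 0"
      unfolding pY_def using q0 by (simp add: ga.mpoly_eval_diff ga.mpoly_eval_mult gp_def)
    then show ?thesis using 1 by (simp add: P_def)
  qed
  have mvar: "mac (mpoly_var i) = mpoly_var i" for i unfolding mac_def by (rule rhom.map_mpoly_var[OF rhom_to_ac])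
  have mconst: "mac (mpoly_const c) = mpoly_const (to_ac c)" for c unfolding mac_def by (rule rhom.mpoly_map_const[OF rhom_to_ac])
  interpret mc: rhom "mpoly_const :: 'm alg_closure \<Rightarrow> _" by (rule mpoly_const_rhom)
  interpret EV: rhom "mpoly_eval emb gp" by (rule st.h.mpoly_eval_rhom)
  define XM where "XM = map_poly mac XS"
  define ZM where "ZM = map_poly mac ZS"
  have cXM: "coeff XM i = (if i < N then mpoly_var (n + i) else 0)" for i by (simp add: XM_def coeff_map_poly cXS mvar)
  have cZM: "coeff ZM i = (if i < N then mpoly_var (n + N + i) else 0)" for i by (simp add: ZM_def coeff_map_poly cZS mvar)
  have XMP: "XM \<in> polys_over (polys_in {..<NN})" by (auto simp: polys_over_def cXM NNi)
  have ZMP: "ZM \<in> polys_over (polys_in {..<NN})" by (auto simp: polys_over_def cZM NNi)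
  \<comment> \<open>the value of \<open>x\<close> at the root \<open>th e\<close>, as a polynomial in the coordinates\<close>
  define Tp where "Tp = (\<lambda>e. poly XM (mpoly_const (th e)))"
  have TpP: "Tp e \<in> polys_in {..<NN}" for e unfolding Tp_def by (rule S.poly_in[OF XMP]) simp
  have EVT: "mpoly_eval emb gp (Tp e) = t e" if "e < N" for e
  proof -
    have "map_poly (mpoly_eval emb gp) XM = xg"
      by (intro poly_eqI) (auto simp: coeff_map_poly cXM gp_def xg_def lagr_coeff)
    then show ?thesis unfolding Tp_def EV.poly_map_poly_hom[symmetric] using xgp(1)[OF that] by simp
  qed
  have Trel: "poly (gen_monic n mpoly_var) (Tp e) - mpoly_const (W (th e)) \<in> I" if "e < N" for e
  proof -
    have "map_poly (\<lambda>c. mac (mpoly_const c)) w = map_poly mpoly_const (map_poly to_ac w)"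
      unfolding mconst by (intro poly_eqI) (simp add: coeff_map_poly)
    then have "poly (map_poly (\<lambda>c. mac (mpoly_const c)) w) (mpoly_const (th e)) = mpoly_const (W (th e))"
      unfolding W_def mc.poly_map_poly_hom[symmetric] by simp
    then show ?thesis using fam[OF S1P van1 thT[OF that]] unfolding ev1[OF mac] mvar Tp_def XM_def by simp
  qed
  have Zrel: "poly ZM (Tp e) - mpoly_const (th e) \<in> I" if "e < N" for e
    using fam[OF S2P van2 thT[OF that]] unfolding ev2[OF mac] Tp_def XM_def ZM_def by simp
  \<comment> \<open>different values are units modulo \<open>I\<close>, because \<open>z\<close> maps them to different constants\<close>
  define canc where "canc = (\<lambda>d. \<forall>q\<in>polys_in {..<NN}. d * q \<in> I \<longrightarrow> q \<in> I)"
  have Tcanc: "canc (Tp e - Tp e')" if e: "e < N" "e' < N" "e \<noteq> e'" for e e'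
    unfolding canc_def
  proof (intro ballI impI)
    fix q assume q: "q \<in> polys_in {..<NN}" "(Tp e - Tp e') * q \<in> I"
    define U where "U = poly (synthetic_div ZM (Tp e')) (Tp e)"
    have U: "U \<in> polys_in {..<NN}" unfolding U_def by (intro S.poly_in S.synthetic_div_polys_over ZMP TpP)
    have "poly ([:- Tp e', 1:] * synthetic_div ZM (Tp e') + [:poly ZM (Tp e'):]) (Tp e) = poly ZM (Tp e)"
      by (simp only: synthetic_div_correct')
    then have ZU: "poly ZM (Tp e) = (Tp e - Tp e') * U + poly ZM (Tp e')"
      unfolding poly_add poly_mult U_def by simp
    define d where "d = th e - th e'"
    have d0: "d \<noteq> 0" using inj_onD[OF thinj, of e e'] e by (auto simp: d_def)
    have "U * ((Tp e - Tp e') * q) - q * (poly ZM (Tp e) - mpoly_const (th e)) + q * (poly ZM (Tp e') - mpoly_const (th e')) \<in> I"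
      by (intro Iadd Idiff Imult q U Zrel e)
    also have "U * ((Tp e - Tp e') * q) - q * (poly ZM (Tp e) - mpoly_const (th e)) + q * (poly ZM (Tp e') - mpoly_const (th e'))
        = mpoly_const d * q"
      unfolding ZU d_def mc.hom_diff by (simp add: algebra_simps)
    finally have "mpoly_const (inverse d) * (mpoly_const d * q) \<in> I" by (rule Imult) simp
    also have "mpoly_const (inverse d) * (mpoly_const d * q) = q"
      unfolding mult.assoc[symmetric] mc.hom_mult[symmetric] using d0 by (simp add: mc.hom_one)
    finally show "q \<in> I" .
  qed
  have canc1: "canc 1" by (simp add: canc_def)
  have canc_mult: "canc (d * d')" if "canc d" "canc d'" "d' \<in> polys_in {..<NN}" for d d'
    using that unfolding canc_def mult.assoc by (metis S.mult)
  have canc_prod: "canc (prod f A)" if "finite A" "\<And>x. x \<in> A \<Longrightarrow> canc (f x)" "\<And>x. x \<in> A \<Longrightarrow> f x \<in> polys_in {..<NN}"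
    for f and A :: "nat set"
    using that
  proof (induction A)
    case (insert x A)
    have "canc (f x * prod f A)" using insert by (intro canc_mult S.prod) auto
    then show ?case using insert by simp
  qed (simp add: canc1)
  \<comment> \<open>from the coordinates of \<open>blocks\<close> to those of the variety\<close>
  define \<sigma> where "\<sigma> = (\<lambda>i. if i < n then mpoly_var i else if i < n + N then Tp (i - n) else 0)"
  define sub where "sub = mpoly_subst \<sigma>"
  interpret sub: rhom sub unfolding sub_def by (rule mpoly_subst_rhom)
  have subvar: "sub (mpoly_var i) = mpoly_var i" if "i < n" for i using that by (simp add: sub_def \<sigma>_def)
  have subT: "sub (mpoly_var (n + e)) = Tp e" if "e < N" for e using that by (simp add: sub_def \<sigma>_def)
  have subconst: "sub (mpoly_const c) = mpoly_const c" for c by (simp add: sub_def)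
  have subP: "sub p \<in> polys_in {..<NN}" for p
    unfolding sub_def by (rule mpoly_subst_in[of _ UNIV]) (auto simp: \<sigma>_def TpP NNi)
  have subid: "sub p = p" if "p \<in> polys_in {..<n}" for p
    using that by (induction rule: polys_in_induct) (auto simp: subvar subconst sub.hom_add sub.hom_mult)
  have EVsub: "mpoly_eval emb gp (sub p) = mpoly_eval emb pt p" if p: "p \<in> polys_in ({..<n} \<union> R)" for p
    unfolding sub_def st.h.mpoly_eval_subst
  proof (rule st.h.mpoly_eval_cong[OF p])
    fix i assume "i \<in> {..<n} \<union> R"
    then show "mpoly_eval emb gp (\<sigma> i) = pt i"
      using EVT[of "i - n"] by (auto simp: \<sigma>_def R_def t_def gp_def)
  qed
  interpret V: subring_set "polys_in ({..<n} \<union> R) :: 'm alg_closure mpoly set" by (rule polys_in_subring)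
  interpret VP: subring_set "polys_over (polys_in ({..<n} \<union> R)) :: 'm alg_closure mpoly poly set" by (rule V.polys_over_subring)
  \<comment> \<open>relations between the generic roots \<open>t e\<close> and the coefficients of \<open>g\<close> follow from \<open>g(t_e) = W(\<theta>_e)\<close>:
    a normal form that vanishes at the generic point is zero\<close>
  have rels: "sub p \<in> I" if p: "p \<in> polys_in ({..<n} \<union> R)" "mpoly_eval emb pt p = 0" for p
  proof -
    define I' where "I' = {p. sub p \<in> I}"
    have I': "ideal_set I'" by (auto simp: ideal_set_def I'_def sub.hom_add sub.hom_mult I0 Iadd Imult subP)
    obtain es where es: "distinct es" "set es = R" using finite_distinct_list[OF finR] by blast
    have "poly (G v) (mpoly_var v) \<in> I'" if v: "v \<in> R" for v
    proof -
      obtain e where e: "v = n + e" "e < N" using v by (auto simp: R_def le_iff_add)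
      interpret ms: rhom "map_poly sub" by (rule rhom_map_poly[OF sub.rhom_axioms])
      have "map_poly sub (gen_monic n mpoly_var) = gen_monic n mpoly_var"
        unfolding map_poly_gen_monic[OF sub.rhom_axioms] by (rule gen_monic_cong) (rule subvar)
      then have "map_poly sub (G v) = gen_monic n mpoly_var - [:mpoly_const (om v):]"
        unfolding G_def ms.hom_diff by (simp add: map_poly_pCons subconst)
      then have "sub (poly (G v) (mpoly_var v)) = poly (gen_monic n mpoly_var) (Tp e) - mpoly_const (W (th e))"
        unfolding sub.poly_map_poly_hom[symmetric] using subT[OF e(2)] e(1) by (simp add: om_def)
      then show ?thesis unfolding I'_def using Trel[OF e(2)] by simp
    qed
    moreover have "p \<in> I'" if v: "v \<in> R" "w \<in> R" "v \<noteq> w" and q: "(mpoly_var v - mpoly_var w) * p \<in> I'" for v w p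
    proof -
      obtain e e' where e: "v = n + e" "e < N" "w = n + e'" "e' < N" using v by (auto simp: R_def le_iff_add)
      then have "canc (Tp e - Tp e')" using v by (intro Tcanc) auto
      moreover have "(Tp e - Tp e') * sub p \<in> I"
        using q e(2,4) unfolding I'_def e(1,3) by (simp add: sub.hom_mult sub.hom_diff subT)
      ultimately show ?thesis unfolding I'_def canc_def using subP by blast
    qed
    ultimately obtain C where C: "C \<in> st.NF es" "p - C \<in> I'"
      using st.normal_form_exists[OF I' _ _ es p(1)] by blast
    have CV: "C \<in> polys_in ({..<n} \<union> R)" using st.NF_in[OF _ C(1)] es(2) by simp
    have "mpoly_eval emb gp (sub (p - C)) = 0" using C(2) by (intro Ivan) (simp add: I'_def)
    then have C0: "mpoly_eval emb pt C = 0" unfolding EVsub[OF V.diff[OF p(1) CV]] using p(2) by (simp add: st.h.mpoly_eval_diff)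
    define Gs where "Gs = {\<pi> \<in> st.block_perms. \<forall>p\<in>polys_in ({..<n} \<union> R). mpoly_eval emb pt p = 0 \<longrightarrow> mpoly_eval emb (pt \<circ> \<pi>) p = 0}"
    have "st.swap_closed Gs"
      unfolding st.swap_closed_def
    proof (intro conjI ballI impI)
      show "Gs \<subseteq> st.block_perms" by (auto simp: Gs_def)
      fix \<pi> v w assume \<pi>: "\<pi> \<in> Gs" and v: "v \<in> R" "w \<in> R" "om v = om w"
      let ?\<tau> = "Transposition.transpose v w"
      have \<tau>: "?\<tau> \<in> st.block_perms" by (rule st.transpose_in_block_perms[OF v])
      have "mpoly_eval emb (pt \<circ> (\<pi> \<circ> ?\<tau>)) p = 0" if q: "p \<in> polys_in ({..<n} \<union> R)" "mpoly_eval emb pt p = 0" for p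
      proof -
        have "mpoly_eval emb (pt \<circ> ?\<tau>) p = 0"
        proof (cases "v = w")
          case False
          then show ?thesis using generic_point_swaps[OF two' pt v(1,2) False v(3) q] by simp
        qed (use q in simp)
        then have "mpoly_eval emb pt (mpoly_rename ?\<tau> p) = 0" by (simp only: st.h.mpoly_eval_rename)
        then have "mpoly_eval emb (pt \<circ> \<pi>) (mpoly_rename ?\<tau> p) = 0"
          using \<pi> st.rename_in[OF \<tau> q(1)] by (auto simp: Gs_def simp del: st.h.mpoly_eval_rename)
        then show ?thesis by (simp only: st.h.mpoly_eval_rename comp_assoc)
      qed
      moreover have "\<pi> \<circ> ?\<tau> \<in> st.block_perms" using \<pi> \<tau> by (intro st.block_perms_comp) (auto simp: Gs_def)
      ultimately show "\<pi> \<circ> ?\<tau> \<in> Gs" by (simp add: Gs_def)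
    qed
    moreover have "id \<in> Gs" using st.block_perms_id by (simp add: Gs_def)
    moreover have "st.sep_on_blocks pt" using pt(1) by (simp add: st.on_variety_def)
    ultimately have "C = 0"
      using st.vanishing_normal_form[OF es(1) _ C(1), of pt Gs] es(2) pt(2) CV C0
      unfolding coeff_indep_def Gs_def by blast
    then show ?thesis using C(2) by (simp add: I'_def)
  qed
  \<comment> \<open>every polynomial in the coordinates becomes one in the values of \<open>x\<close> and the coefficients of \<open>g\<close> after
    multiplication with an element that can be cancelled modulo \<open>I\<close>; this reduces \<open>gen\<close> to \<open>rels\<close>\<close>
  define good where "good = (\<lambda>p. p \<in> polys_in {..<NN} \<and> (\<exists>d p'. d \<in> polys_in ({..<n} \<union> R) \<and> p' \<in> polys_in ({..<n} \<union> R) \<and> canc (sub d) \<and> sub d * p - sub p' \<in> I))"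
  have goodI: "good p" if "p \<in> polys_in {..<NN}" "d \<in> polys_in ({..<n} \<union> R)" "p' \<in> polys_in ({..<n} \<union> R)" "canc (sub d)" "sub d * p - sub p' \<in> I"
    for p d p' using that unfolding good_def by blast
  have good_add: "good (p + q)" and good_mult: "good (p * q)" if "good p" "good q" for p q
  proof -
    obtain d p' where p: "p \<in> polys_in {..<NN}" "d \<in> polys_in ({..<n} \<union> R)" "p' \<in> polys_in ({..<n} \<union> R)" "canc (sub d)" "sub d * p - sub p' \<in> I"
      using \<open>good p\<close> unfolding good_def by blast
    obtain f q' where q: "q \<in> polys_in {..<NN}" "f \<in> polys_in ({..<n} \<union> R)" "q' \<in> polys_in ({..<n} \<union> R)" "canc (sub f)" "sub f * q - sub q' \<in> I"
      using \<open>good q\<close> unfolding good_def by blast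
    have cc: "canc (sub (d * f))" unfolding sub.hom_mult by (rule canc_mult[OF p(4) q(4) subP])
    have "sub f * (sub d * p - sub p') + sub d * (sub f * q - sub q') \<in> I" by (intro Iadd Imult p q subP)
    then have "sub (d * f) * (p + q) - sub (f * p' + d * q') \<in> I"
      by (simp add: sub.hom_mult sub.hom_add algebra_simps)
    then show "good (p + q)" using p q by (intro goodI[of _ "d * f" "f * p' + d * q'"] cc S.add V.add V.mult) auto
    have "(sub f * q) * (sub d * p - sub p') + sub p' * (sub f * q - sub q') \<in> I" by (intro Iadd Imult S.mult p q subP)
    then have "sub (d * f) * (p * q) - sub (p' * q') \<in> I"
      by (simp add: sub.hom_mult algebra_simps)
    then show "good (p * q)" using p q by (intro goodI[of _ "d * f" "p' * q'"] cc S.mult V.mult) auto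
  qed
  have nR: "n + e \<in> R" if "e < N" for e using that by (simp add: R_def)
  \<comment> \<open>\<open>x\<close> is the polynomial that interpolates its values\<close>
  have good_x: "good (mpoly_var (n + l))" if l: "l < N" for l
  proof -
    define p' where "p' = (\<Sum>e<N. mpoly_var (n + e) * mpoly_const (coeff (lbase N th e) l))"
    have "XM = (\<Sum>e<N. smult (Tp e) (map_poly mpoly_const (lbase N th e)))"
    proof (rule poly_eq_by_nodes)
      show "inj_on (\<lambda>e. mpoly_const (th e)) {..<N}"
        using thinj rhom_inj[OF mpoly_const_rhom] by (auto simp: inj_on_def)
      fix f assume f: "f < N"
      have "poly (map_poly mpoly_const (lbase N th e)) (mpoly_const (th f)) = (if e = f then 1 else 0)" if "e < N" for e
        unfolding mc.poly_map_poly_hom lbase_poly[OF thinj that f] by (simp add: mc.hom_one)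
      then have "(\<Sum>e<N. Tp e * poly (map_poly mpoly_const (lbase N th e)) (mpoly_const (th f))) = (\<Sum>e<N. if e = f then Tp e else 0)"
        by (intro sum.cong) auto
      then show "poly XM (mpoly_const (th f)) = poly (\<Sum>e<N. smult (Tp e) (map_poly mpoly_const (lbase N th e))) (mpoly_const (th f))"
        using f by (simp add: poly_sum Tp_def)
    qed (simp_all add: cXM coeff_sum coeff_map_poly lbase_coeff)
    then have "coeff XM l = (\<Sum>e<N. Tp e * mpoly_const (coeff (lbase N th e) l))"
      by (simp add: coeff_sum coeff_map_poly)
    then have "sub p' = mpoly_var (n + l)" using l by (simp add: p'_def sub.hom_sum sub.hom_mult subT subconst cXM)
    moreover have "p' \<in> polys_in ({..<n} \<union> R)" unfolding p'_def by (intro V.sum V.mult) (auto simp: nR)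
    ultimately show ?thesis using l by (intro goodI[of _ 1 p']) (auto simp: canc1 I0 NNi sub.hom_one)
  qed
  \<comment> \<open>likewise for \<open>z\<close>, with nodes \<open>Tp e\<close>; the denominators are cleared by \<open>\<Prod>e<N. D Tp e\<close>\<close>
  have good_z: "good (mpoly_var (n + N + l))" if l: "l < N" for l
  proof -
    define D where "D = (\<lambda>y e. \<Prod>f\<in>{..<N} - {e}. y e - y f :: 'm alg_closure mpoly)"
    define c where "c = (\<lambda>y e. \<Prod>f\<in>{..<N} - {e}. D y f)"
    define L where "L = (\<lambda>y e. \<Prod>f\<in>{..<N} - {e}. [:- y f, 1 :: 'm alg_closure mpoly:])"
    define v where "v = (\<lambda>e. mpoly_var (n + e) :: 'm alg_closure mpoly)"
    have sv: "sub (v e) = Tp e" if "e < N" for e using subT[OF that] by (simp add: v_def)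
    have sD: "sub (D v e) = D Tp e" if "e < N" for e unfolding D_def sub.hom_prod using that by (intro prod.cong) (auto simp: sub.hom_diff sv)
    have sc: "sub (c v e) = c Tp e" if "e < N" for e unfolding c_def sub.hom_prod by (intro prod.cong) (auto simp: sD)
    have sL: "sub (coeff (L v e) l) = coeff (L Tp e) l" if "e < N" for e
    proof -
      interpret ms: rhom "map_poly sub" by (rule rhom_map_poly[OF sub.rhom_axioms])
      have "map_poly sub (L v e) = L Tp e" unfolding L_def ms.hom_prod
        by (intro prod.cong) (auto simp: map_poly_pCons sub.hom_uminus sub.hom_one sv)
      then show ?thesis by (metis coeff_map_poly sub.hom_zero)
    qed
    have TI: "inj_on Tp {..<N}"
    proof (rule inj_onI)
      fix x y assume xy: "x \<in> {..<N}" "y \<in> {..<N}" "Tp x = Tp y"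
      then have "t x = t y" using EVT[of x] EVT[of y] by simp
      then show "x = y" using inj_onD[OF tinj] xy by blast
    qed
    have Tne: "Tp x \<noteq> Tp y" if "x < N" "y < N" "x \<noteq> y" for x y using inj_onD[OF TI] that by blast
    have degL: "coeff (L Tp e) i = 0" if "e < N" "i \<ge> N" for e i
    proof -
      have "degree (L Tp e) \<le> card ({..<N} - {e})" unfolding L_def by (intro degree_prod_le_card) auto
      then show ?thesis using that by (intro coeff_eq_0) simp
    qed
    have key: "smult (\<Prod>e<N. D Tp e) ZM = (\<Sum>e<N. smult (poly ZM (Tp e) * c Tp e) (L Tp e))"
    proof (rule poly_eq_by_nodes[OF TI])
      fix f assume f: "f < N"
      have "poly (L Tp e) (Tp f) = (if e = f then D Tp f else 0)" if "e < N" for e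
        unfolding L_def D_def poly_prod using f that by (auto intro!: prod.cong prod_zero bexI[of _ f])
      then have "poly (\<Sum>e<N. smult (poly ZM (Tp e) * c Tp e) (L Tp e)) (Tp f) = (\<Sum>e<N. if e = f then poly ZM (Tp e) * c Tp e * D Tp f else 0)"
        unfolding poly_sum poly_smult by (intro sum.cong) auto
      also have "\<dots> = poly ZM (Tp f) * (D Tp f * c Tp f)" using f by (simp add: mult_ac)
      also have "D Tp f * c Tp f = (\<Prod>e<N. D Tp e)" unfolding c_def using f by (subst prod.remove[of "{..<N}" f]) auto
      finally show "poly (smult (\<Prod>e<N. D Tp e) ZM) (Tp f) = poly (\<Sum>e<N. smult (poly ZM (Tp e) * c Tp e) (L Tp e)) (Tp f)"
        by (simp add: mult.commute)
    qed (simp_all add: cZM coeff_sum degL)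
    have "coeff (smult (\<Prod>e<N. D Tp e) ZM) l = coeff (\<Sum>e<N. smult (poly ZM (Tp e) * c Tp e) (L Tp e)) l" by (simp only: key)
    then have k: "(\<Prod>e<N. D Tp e) * mpoly_var (n + N + l) = (\<Sum>e<N. poly ZM (Tp e) * (c Tp e * coeff (L Tp e) l))"
      using l by (simp only: coeff_smult coeff_sum cZM if_True mult.assoc)
    define p' where "p' = (\<Sum>e<N. mpoly_const (th e) * (c v e * coeff (L v e) l))"
    define d where "d = (\<Prod>e<N. D v e)"
    have vP: "v e \<in> polys_in ({..<n} \<union> R)" if "e < N" for e using that by (auto simp: v_def nR)
    have DP: "D v e \<in> polys_in ({..<n} \<union> R)" if "e < N" for e unfolding D_def using that by (intro V.prod V.diff vP) auto
    have cP: "c v e \<in> polys_in ({..<n} \<union> R)" if "e < N" for e unfolding c_def by (intro V.prod DP) auto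
    have LP: "L v e \<in> polys_over (polys_in ({..<n} \<union> R))" if "e < N" for e
      unfolding L_def by (intro VP.prod V.pCons_polys_over V.uminus V.one V.zero_polys_over vP) auto
    have "p' \<in> polys_in ({..<n} \<union> R)"
      unfolding p'_def using LP by (intro V.sum V.mult cP) (auto simp: polys_over_def)
    moreover have "d \<in> polys_in ({..<n} \<union> R)" unfolding d_def by (intro V.prod DP) auto
    moreover have sd: "sub d = (\<Prod>e<N. D Tp e)" unfolding d_def by (simp add: sub.hom_prod sD)
    have DPT: "D Tp e \<in> polys_in {..<NN}" for e unfolding D_def by (intro S.prod S.diff TpP)
    have "canc (sub d)" unfolding sd D_def
      by (intro canc_prod S.prod S.diff TpP Tcanc) auto
    moreover have "sub d * mpoly_var (n + N + l) - sub p' \<in> I"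
    proof -
      have "sub p' = (\<Sum>e<N. mpoly_const (th e) * (c Tp e * coeff (L Tp e) l))"
        unfolding p'_def by (simp add: sub.hom_sum sub.hom_mult subconst sc sL)
      then have "sub d * mpoly_var (n + N + l) - sub p' = (\<Sum>e<N. (c Tp e * coeff (L Tp e) l) * (poly ZM (Tp e) - mpoly_const (th e)))"
        unfolding sd k by (simp add: sum_subtractf[symmetric] algebra_simps)
      also have "\<dots> \<in> I"
      proof (intro Isum Imult Zrel)
        fix e assume "e \<in> {..<N}"
        then have "c Tp e * coeff (L Tp e) l = sub (c v e * coeff (L v e) l)" by (simp add: sub.hom_mult sc sL)
        then show "c Tp e * coeff (L Tp e) l \<in> polys_in {..<NN}" using subP by simp
      qed simp
      finally show ?thesis .
    qed
    ultimately show ?thesis using l by (intro goodI[of _ d p']) (auto simp: NNi)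
  qed
  have good_y: "good (mpoly_var (n + 2 * N))"
  proof -
    let ?Y = "mpoly_var (n + 2 * N) :: 'm alg_closure mpoly"
    have Y: "?Y \<in> polys_in {..<NN}" by (auto simp: NNi)
    have QP: "Qh \<in> polys_in ({..<n} \<union> R)" using polys_in_mono[OF _ Qh] by blast
    have r: "Qh * ?Y - 1 \<in> I"
    proof -
      have "mac pY = Qh * ?Y - 1" unfolding pY_def mac.hom_diff mac.hom_mult mac.hom_one mvar by (simp add: Qh_def mac_def)
      then show ?thesis using PI[OF pYP] by simp
    qed
    have "q \<in> I" if q: "q \<in> polys_in {..<NN}" "Qh * q \<in> I" for q
    proof -
      have "?Y * (Qh * q) - q * (Qh * ?Y - 1) \<in> I" by (intro Idiff Imult q r Y)
      then show ?thesis by (simp add: algebra_simps)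
    qed
    then have "canc (sub Qh)" unfolding subid[OF Qh] canc_def by blast
    then show ?thesis using QP r Y by (intro goodI[of _ Qh 1]) (auto simp: subid[OF Qh] sub.hom_one)
  qed
  have good_all: "good p" if "p \<in> polys_in {..<NN}" for p using that
  proof (induction rule: polys_in_induct)
    case (const c) show ?case by (rule goodI[of _ 1 "mpoly_const c"]) (auto simp: canc1 I0 subconst sub.hom_one)
  next
    case (var i)
    then consider "i < n" | l where "l < N" "i = n + l" | l where "l < N" "i = n + N + l" | "i = n + 2 * N"
      unfolding lessThan_iff NNi by (metis add.assoc add_less_cancel_left le_neq_implies_less linorder_not_less mult_2 nat_le_iff_add)
    then show ?case
    proof cases
      case 1 then show ?thesis
        by (intro goodI[of _ 1 "mpoly_var i"]) (auto simp: canc1 I0 subvar sub.hom_one NNi)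
    qed (use good_x good_z good_y in auto)
  next
    case (add p q) then show ?case by (intro good_add)
  next
    case (mult p q) then show ?case by (intro good_mult)
  qed
  have gen: "p \<in> I" if p: "p \<in> polys_in {..<NN}" "mpoly_eval emb gp p = 0" for p
  proof -
    obtain d p' where d: "p' \<in> polys_in ({..<n} \<union> R)" "canc (sub d)" "sub d * p - sub p' \<in> I"
      using good_all[OF p(1)] unfolding good_def by blast
    have "mpoly_eval emb pt p' = 0" using Ivan[OF d(3)] p(2)
      unfolding EVsub[OF d(1), symmetric] st.h.mpoly_eval_diff st.h.mpoly_eval_mult by simp
    then have "(sub d * p - sub p') + sub p' \<in> I" by (intro Iadd d rels)
    then have "sub d * p \<in> I" by simp
    then show ?thesis using d(2) p(1) unfolding canc_def by blast
  qed
  have indep: "q = 0" if q: "q \<in> polys_in {..<n}" "mpoly_eval ga gp q = 0" for q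
  proof -
    have mq: "mac q \<in> polys_in {..<n}" unfolding mac_def by (rule map_mpoly_in[OF rhom_to_ac q(1)])
    have "mpoly_eval emb pt (mac q) = mpoly_eval emb gp (mac q)" by (rule st.h.mpoly_eval_cong[OF mq]) (simp add: gp_def)
    then have "mac q = 0" using pt(2) mq q(2) unfolding emac coeff_indep_def by auto
    then have "to_ac (Poly_Mapping.lookup q m) = 0" for m
      unfolding mac_def by (metis rhom.lookup_map_hom[OF rhom_to_ac] lookup_zero)
    then show ?thesis by (intro poly_mapping_eqI) simp
  qed
  \<comment> \<open>two separable steps: adjoin the roots of \<open>\<mu>\<close>, then those of \<open>g - W(\<theta>)\<close>\<close>
  have sep: "sep_elt B (gp i)"
    if B: "ac_subfield B" "range ga \<subseteq> B" "gp ` {..<n} \<subseteq> B" "infinite B" for B i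
  proof -
    interpret B: ac_subfield B by (rule B(1))
    interpret SB: subfield_set "{v. sep_elt B v}" by (rule B.sep_elts_subfield[OF B(4)])
    have ptB: "pt j \<in> B" if "j < n" for j
    proof -
      have "gp j \<in> B" using B(3) that by blast
      then show ?thesis using that by (simp add: gp_def)
    qed
    have gaB: "ga c \<in> B" for c using B(2) by blast
    have sth: "sep_elt B (emb (th e))" if e: "e < N" for e
    proof -
      interpret me: rhom "map_poly (emb :: 'm alg_closure \<Rightarrow> _)" by (rule rhom_map_poly[OF rhom_emb])
      have "map_poly ga \<mu> = map_poly emb (map_poly to_ac \<mu>)"
        by (intro poly_eqI) (subst coeff_map_poly, rule ga.hom_zero, simp add: coeff_map_poly ga_def)
      also have "\<dots> = (\<Prod>\<theta>\<in>Th. [:- emb \<theta>, 1:])"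
        unfolding mu me.hom_prod by (simp add: map_poly_pCons st.h.hom_uminus st.h.hom_one)
      finally have eq: "map_poly ga \<mu> = (\<Prod>\<theta>\<in>Th. [:- emb \<theta>, 1:])" .
      have "sep_poly (map_poly ga \<mu>)" unfolding eq
        by (rule sep_poly_prod_linear[OF Th(1)]) (use rhom_inj[OF rhom_emb] in \<open>auto simp: inj_on_def\<close>)
      moreover have "poly (map_poly ga \<mu>) (emb (th e)) = 0"
        unfolding eq poly_prod using Th(1) thT[OF e] by (intro prod_zero) auto
      moreover have "map_poly ga \<mu> \<in> polys_over B" by (auto simp: polys_over_def coeff_map_poly gaB)
      ultimately show ?thesis unfolding sep_elt_def by blast
    qed
    have st: "sep_elt B (t e)" if e: "e < N" for e
    proof -
      define E where "E = simple_ext B (emb (th e))"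
      interpret E: subfield_set E unfolding E_def by (rule B.simple_ext_subfield[OF sep_elt_algebraic[OF sth[OF e]]])
      have BE: "B \<subseteq> E" "emb (th e) \<in> E" unfolding E_def using B.subset_simple_ext B.gen_in_simple_ext by blast+
      define cc where "cc = om (n + e)"
      have "map_poly ga w = map_poly emb (map_poly to_ac w)"
        by (intro poly_eqI) (subst coeff_map_poly, rule ga.hom_zero, simp add: coeff_map_poly ga_def)
      then have "emb cc = poly (map_poly ga w) (emb (th e))"
        unfolding cc_def om_def W_def by (simp add: st.h.poly_map_poly_hom)
      moreover have "map_poly ga w \<in> polys_over E" using gaB BE(1) by (auto simp: polys_over_def coeff_map_poly)
      ultimately have ccE: "emb cc \<in> E" using E.poly_in BE(2) by simp
      define Pr where "Pr = (\<Prod>v\<in>block_of cc. [:- pt v, 1:])"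
      define F where "F = Pr + [:emb cc:]"
      have "card (block_of cc) = n" unfolding cc_def block_of_def using block[OF nR[OF e]] .
      then have dP: "degree Pr = n" "lead_coeff Pr = 1"
        unfolding Pr_def using degree_prod_linear[OF finite_block, of pt cc] lead_coeff_prod_linear[of pt "block_of cc"] by simp_all
      then have dF: "degree F = n" unfolding F_def using n by (subst degree_add_eq_left) simp_all
      have lF: "lead_coeff F = 1" unfolding dF using dP n by (simp add: F_def coeff_pCons split: nat.splits)
      have "gen_monic n pt = gen_monic n (\<lambda>j. coeff F (n - 1 - j))"
      proof (rule gen_monic_cong)
        fix j assume "j < n"
        then show "pt j = coeff F (n - 1 - j)"
          using coeff_poly_root_values[OF pt(1), of cc j] nR[OF e] coeff_poly_eval[OF rhom_emb, of pt cc j]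
          by (auto simp: cc_def F_def Pr_def)
      qed
      also have "\<dots> = F" by (rule gen_monic_coeffs[OF dF lF])
      finally have "Pr = gen_monic n pt - [:emb cc:]" by (simp add: F_def)
      moreover have "gen_monic n pt \<in> polys_over E"
        using ptB BE(1) E.zero E.one by (auto simp: polys_over_def coeff_gen_monic)
      ultimately have "Pr \<in> polys_over E" using ccE by (simp add: E.P.diff E.pCons_polys_over)
      moreover have "poly Pr (t e) = 0"
        unfolding Pr_def poly_prod t_def using finite_block nR[OF e] by (intro prod_zero) (auto simp: block_of_def cc_def)
      moreover have "sep_poly Pr" unfolding Pr_def
        by (rule sep_poly_prod_linear[OF finite_block])
           (use pt(1) in \<open>auto simp: st.on_variety_def st.sep_on_blocks_def block_of_def inj_on_def\<close>)
      ultimately have "sep_elt E (t e)" unfolding sep_elt_def by blast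
      then show ?thesis unfolding E_def by (rule B.sep_elt_trans[OF B(4) sth[OF e]])
    qed
    have "xg \<in> polys_over {v. sep_elt B v}" "zg \<in> polys_over {v. sep_elt B v}"
      unfolding xg_def zg_def by (rule SB.lagr_over; use sth st in simp)+
    moreover have "q0 \<in> B"
    proof -
      have "mpoly_eval ga pt p \<in> B" if "p \<in> polys_in {..<n}" for p using that
        by (induction rule: polys_in_induct) (auto simp: gaB ptB ga.mpoly_eval_add ga.mpoly_eval_mult)
      moreover have "q0 = mpoly_eval ga pt Qm"
        unfolding q0_def Qh_def mpoly_eval_map[OF rhom_to_ac rhom_emb] by (simp add: ga_def o_def)
      ultimately show ?thesis using Qm by simp
    qed
    ultimately show ?thesis
      using ptB B.sep_elt_base SB.inverse[of q0] by (auto simp: gp_def polys_over_def)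
  qed
  have "\<exists>a\<in>rational_points P. \<forall>j<n. a j \<in> range \<iota>"
  proof (rule PAC_point[OF PAC rhom_emb])
    show "1 \<le> n" "n \<le> NN" using n by (auto simp: NN_def)
    show "P = {p \<in> polys_in {..<NN}. mpoly_eval (\<lambda>c. emb (to_ac c)) gp p = 0}" by (simp add: P_def ga_def)
    show "p \<in> Idl\<^bsub>mpoly_ring NN\<^esub> (Poly_Mapping.map to_ac ` P)" if "p \<in> polys_in {..<NN}" "mpoly_eval emb gp p = 0" for p
      using gen[OF that] by (simp only: I_def mac_def)
    show "q = 0" if "q \<in> polys_in {..<n}" "mpoly_eval (\<lambda>c. emb (to_ac c)) gp q = 0" for q
      by (rule indep[OF that(1)]) (use that(2) in \<open>simp add: ga_def\<close>)
    show "sep_elt B (gp i)" if "ac_subfield B" "range (\<lambda>c. emb (to_ac c)) \<subseteq> B" "gp ` {..<n} \<subseteq> B" "infinite B" "i < NN" for B i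
      by (rule sep) (use that in \<open>simp_all add: ga_def\<close>)
  qed
  then obtain a' where a': "a' \<in> rational_points P" "\<And>j. j < n \<Longrightarrow> a' j \<in> range \<iota>" by blast
  define a where "a = (\<lambda>j. inv_into UNIV \<iota> (a' j))"
  have a: "\<iota> (a j) = a' j" if "j < n" for j using a'(2)[OF that] unfolding a_def by (rule f_inv_into_f)
  define fa where "fa = (\<lambda>p. to_ac (mpoly_eval id a' p))"
  have fa: "rhom fa" using rhom_comp[OF rhom.mpoly_eval_rhom[OF rhom_id, of a'] rhom_to_ac] by (simp add: fa_def o_def)
  have favar: "fa (mpoly_var i) = to_ac (a' i)" "fa (mpoly_const c) = to_ac c" for i c
    unfolding fa_def rhom.mpoly_eval_var[OF rhom_id] rhom.mpoly_eval_const[OF rhom_id] by simp_all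
  define xp where "xp = (\<Sum>l<N. monom (a' (n + l)) l)"
  define zp where "zp = (\<Sum>l<N. monom (a' (n + N + l)) l)"
  have xpz: "map_poly fa XS = map_poly to_ac xp" "map_poly fa ZS = map_poly to_ac zp"
    by (intro poly_eqI; auto simp: coeff_map_poly cXS cZS rhom.hom_zero[OF fa] favar xp_def zp_def coeff_sum)+
  have gma: "gen_monic n (\<lambda>j. to_ac (a' j)) = gen_monic n (\<lambda>j. to_ac (\<iota> (a j)))"
    by (rule gen_monic_cong) (simp add: a)
  have main: "poly (gen_monic n (\<lambda>j. to_ac (\<iota> (a j)))) (poly (map_poly to_ac xp) \<theta>) = poly (map_poly to_ac w) \<theta> \<and>
      poly (map_poly to_ac zp) (poly (map_poly to_ac xp) \<theta>) = \<theta>" if \<theta>: "\<theta> \<in> Th" for \<theta>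
  proof -
    have "poly (map_poly fa S1) \<theta> = 0" "poly (map_poly fa S2) \<theta> = 0"
      using fam[OF S1P van1 \<theta>] fam[OF S2P van2 \<theta>] a'(1) by (auto simp: fa_def)
    then show ?thesis unfolding ev1[OF fa] ev2[OF fa] xpz favar gma by simp
  qed
  have "mpoly_eval id a Q \<noteq> 0"
  proof
    assume 0: "mpoly_eval id a Q = 0"
    interpret i: rhom "id :: 'm \<Rightarrow> 'm" by (rule rhom_id)
    interpret ik: rhom "id :: 'k \<Rightarrow> 'k" by (rule rhom_id)
    interpret io: rhom \<iota> by (rule \<iota>)
    have "mpoly_eval \<iota> (\<lambda>j. \<iota> (a j)) Q = \<iota> (mpoly_eval id a Q)"
    proof (induction Q rule: mpoly_induct)
      case (const c) show ?case unfolding io.mpoly_eval_const ik.mpoly_eval_const by simp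
    next
      case (var j) show ?case unfolding io.mpoly_eval_var ik.mpoly_eval_var ..
    next
      case (add p q) then show ?case unfolding io.mpoly_eval_add ik.mpoly_eval_add io.hom_add by (simp only:)
    next
      case (mult p q) then show ?case unfolding io.mpoly_eval_mult ik.mpoly_eval_mult io.hom_mult by (simp only:)
    qed
    moreover have "mpoly_eval \<iota> a' Q = mpoly_eval \<iota> (\<lambda>j. \<iota> (a j)) Q"
      by (rule io.mpoly_eval_cong[OF Q(1)]) (simp add: a)
    moreover have "mpoly_eval id a' Qm = mpoly_eval (id \<circ> \<iota>) a' Q" unfolding Qm_def by (rule mpoly_eval_map[OF \<iota> rhom_id])
    ultimately have "mpoly_eval id a' Qm = 0" using 0 by simp
    moreover have "mpoly_eval id a' pY = 0" using a'(1) pYP by (auto simp: rational_points_def)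
    ultimately show False unfolding pY_def i.mpoly_eval_diff i.mpoly_eval_mult i.mpoly_eval_one by simp
  qed
  then show ?thesis using main by blast
qed

section \<open>Subfields of the algebraic closure\<close>

lemma closure_ring_simps [simp]:
  "carrier closure_ring = UNIV" "x \<oplus>\<^bsub>closure_ring\<^esub> y = x + y" "x \<otimes>\<^bsub>closure_ring\<^esub> y = x * y"
  "\<one>\<^bsub>closure_ring\<^esub> = 1" "\<zero>\<^bsub>closure_ring\<^esub> = 0"
  by (simp_all add: closure_ring_def ring_of_type_algebra_def)

text \<open>For subfields of the algebraic closure the translation between records and types is the identity.\<close>

lemma closure_field_val: "field_val (closure_ring :: 'm::field alg_closure ring) id"
proof -
  interpret field "closure_ring :: 'm alg_closure ring" unfolding closure_ring_def by (rule field_from_type_algebra)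
  show "field_val (closure_ring :: 'm alg_closure ring) id" by unfold_locales auto
qed

lemma subfield_closure_iff: "subfield K (closure_ring :: 'm::field alg_closure ring) \<longleftrightarrow> subfield_set K"
proof
  interpret clf: field_val "closure_ring :: 'm alg_closure ring" "id :: 'm alg_closure \<Rightarrow> 'm alg_closure" by (rule closure_field_val)
  assume "subfield K (closure_ring :: 'm alg_closure ring)"
  from clf.val_subfield[OF this] show "subfield_set K" by (simp add: ac_subfield_def)
next
  interpret clf: field_val "closure_ring :: 'm alg_closure ring" "id :: 'm alg_closure \<Rightarrow> 'm alg_closure" by (rule closure_field_val)
  assume "subfield_set K"
  then interpret subfield_set K .
  have m: "\<ominus>\<^bsub>closure_ring\<^esub> x = - x" for x :: "'m alg_closure" using clf.val_uminus[of x] by simp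
  have i: "inv\<^bsub>closure_ring\<^esub> x = inverse x" if "x \<noteq> 0" for x :: "'m alg_closure" using clf.val_inv[of x] that by simp
  show "subfield K (closure_ring :: 'm alg_closure ring)"
    by (intro clf.subfieldI' clf.subringI) (auto simp: m i)
qed

lemma range_to_ac_subfield: "ac_subfield (range (to_ac :: 'm::field \<Rightarrow> 'm alg_closure))"
  unfolding ac_subfield_def
proof (unfold_locales, goal_cases)
  case 1 show ?case by (metis rangeI to_ac_0)
next
  case 2 show ?case by (metis rangeI to_ac_1)
next
  case (3 x y) then show ?case by (auto simp flip: to_ac_add)
next
  case (4 x y) then show ?case by (auto simp flip: to_ac_mult)
next
  case (5 x)
  then obtain a where "x = to_ac a" by auto
  then have "- x = to_ac (- a)" by (simp only: rhom.hom_uminus[OF rhom_to_ac])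
  then show ?case by (rule range_eqI)
next
  case (6 x)
  then obtain a where "x = to_ac a" by auto
  then have "inverse x = to_ac (inverse a)" by (simp only: to_ac_inverse)
  then show ?case by (rule range_eqI)
qed

lemma polys_over_range_to_ac:
  assumes "P \<in> polys_over (range to_ac)" obtains p where "map_poly to_ac p = P"
proof -
  have "map_poly to_ac (map_poly (inv_into UNIV to_ac) P) = P"
  proof (rule poly_eqI)
    fix i
    have 0: "inv_into UNIV to_ac (0::'a alg_closure) = 0"
      by (metis inv_into_f_f injI to_ac_0 to_ac_eq_iff rangeI UNIV_I)
    have "coeff P i \<in> range to_ac" using assms by (auto simp: polys_over_def)
    then show "coeff (map_poly to_ac (map_poly (inv_into UNIV to_ac) P)) i = coeff P i"
      by (simp add: coeff_map_poly 0 f_inv_into_f)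
  qed
  then show thesis by (rule that)
qed

lemma alg_closure_algebraic_elt: "algebraic_elt (range to_ac) (x :: 'm::field alg_closure)"
proof -
  obtain p where p: "p \<noteq> 0" "poly (map_poly to_ac p) x = 0" by (rule alg_closure_algebraic)
  have "map_poly to_ac p \<in> polys_over (range to_ac)" by (auto simp: polys_over_def coeff_map_poly)
  moreover have "map_poly to_ac p \<noteq> 0" using p(1) map_poly_eq_0_rhom[OF rhom_to_ac] by blast
  ultimately show ?thesis using p(2) unfolding algebraic_elt_def by blast
qed

lemma adjoin_eq: "adjoin x = simple_ext (range to_ac) (x :: 'm::field alg_closure)"
proof
  interpret clf: field_val "closure_ring :: 'm alg_closure ring" "id :: 'm alg_closure \<Rightarrow> 'm alg_closure" by (rule closure_field_val)
  interpret M: ac_subfield "range (to_ac :: 'm \<Rightarrow> 'm alg_closure)" by (rule range_to_ac_subfield)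
  have S: "subfield (simple_ext (range to_ac) x) closure_ring"
    unfolding subfield_closure_iff by (rule M.simple_ext_subfield[OF alg_closure_algebraic_elt])
  show "adjoin x \<subseteq> simple_ext (range to_ac) x"
    unfolding adjoin_def by (rule clf.generate_field_min_subfield1[OF _ S]) (use M.subset_simple_ext M.gen_in_simple_ext in auto)
  have "field (closure_ring\<lparr>carrier := adjoin x\<rparr>)"
    unfolding adjoin_def by (rule clf.generate_field_is_field) simp
  then have "subfield (adjoin x) closure_ring" by (intro clf.subfield_iff(1)) auto
  then interpret A: subfield_set "adjoin x" unfolding subfield_closure_iff .
  have "insert x (range to_ac) \<subseteq> adjoin x" unfolding adjoin_def by (auto intro: generate_field.incl)
  then show "simple_ext (range to_ac) x \<subseteq> adjoin x"
    by (intro M.simple_ext_minimal[OF A.subring_set_axioms]) auto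
qed

lemma simple_extension_eq:
  assumes "subfield_set (F :: 'm::field alg_closure set)" shows "ring.simple_extension closure_ring F x = simple_ext F x"
proof -
  interpret clf: field_val "closure_ring :: 'm alg_closure ring" "id :: 'm alg_closure \<Rightarrow> 'm alg_closure" by (rule closure_field_val)
  interpret F: subfield_set F by fact
  have F: "subfield F closure_ring" unfolding subfield_closure_iff by fact
  have ev: "clf.eval p x = poly (clf.list_poly p) x" for p using clf.list_poly_eval[of p x] by simp
  show ?thesis
    unfolding clf.simple_extension_as_eval_img[of F x, simplified] simple_ext_def ev
  proof (intro equalityI subsetI)
    fix y assume "y \<in> (\<lambda>p. poly (clf.list_poly p) x) ` carrier (univ_poly closure_ring F)"
    then show "y \<in> {poly p x |p. p \<in> polys_over F}" using clf.list_poly_over[OF _ F] by auto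
  next
    fix y assume "y \<in> {poly p x |p. p \<in> polys_over F}"
    then obtain P where P: "P \<in> polys_over (id ` F)" "y = poly P x" by auto
    obtain p where "p \<in> carrier (univ_poly closure_ring F)" "clf.list_poly p = P"
      by (rule clf.list_poly_surj[OF _ P(1)]) simp_all
    then show "y \<in> (\<lambda>p. poly (clf.list_poly p) x) ` carrier (univ_poly closure_ring F)"
      using P(2) by (intro image_eqI[of _ _ p]) simp_all
  qed
qed

lemma dimension_min_poly:
  assumes F: "subfield_set F" and x: "algebraic_elt F (x :: 'm::field alg_closure)"
  shows "ring.dimension closure_ring (Polynomial.degree (min_poly F x)) F (simple_ext F x)"
proof -
  interpret clf: field_val "closure_ring :: 'm alg_closure ring" "id :: 'm alg_closure \<Rightarrow> 'm alg_closure" by (rule closure_field_val)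
  have F': "subfield F closure_ring" unfolding subfield_closure_iff by fact
  have a: "clf.algebraic F x" using clf.algebraic_iff[OF F', of x] x by simp
  note I = clf.Irr_list_poly[OF F' _ a, simplified]
  have "Polynomial.degree (min_poly F x) = length (clf.Irr F x) - 1"
    using clf.degree_list_poly(1)[OF I(2) _ I(4)] I(1) by simp
  moreover have "(clf.algebraic over F) x" using a by (simp add: over_def)
  ultimately show ?thesis using clf.dimension_simple_extension[OF F', of x] simple_extension_eq[OF F] by simp
qed

lemma Span_in_subring:
  assumes "subring_set (C :: 'm::field alg_closure set)" "F \<subseteq> C" "set Us \<subseteq> C" shows "ring.Span closure_ring F Us \<subseteq> C"
proof -
  interpret clf: field_val "closure_ring :: 'm alg_closure ring" "id :: 'm alg_closure \<Rightarrow> 'm alg_closure" by (rule closure_field_val)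
  interpret subring_set C by fact
  show ?thesis using assms(3)
  proof (induction Us)
    case (Cons u Us)
    show ?case
    proof
      fix y assume "y \<in> clf.Span F (u # Us)"
      then obtain k v where "k \<in> F" "v \<in> clf.Span F Us" "y = k * u + v"
        by (auto simp: clf.line_extension_mem_iff)
      then show "y \<in> C" using Cons assms(2) by auto
    qed
  qed simp
qed

text \<open>A basis of \<open>E\<close> is adjoined one element at a time with \<open>primitive_element\<close>. As \<open>\<theta>\<close> stays inside \<open>E\<close>, in the
  end \<open>E = M(\<theta>)\<close>, and comparing dimensions over \<open>M(\<omega>)\<close> gives the degree.\<close>

lemma sep_ext_primitive:
  fixes \<omega> :: "'m::field alg_closure"
  assumes inf: "infinite (range (to_ac :: 'm \<Rightarrow> 'm alg_closure))" and om: "sep_elt (range to_ac) \<omega>"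
    and E: "separable_ext_of_degree n closure_ring (adjoin \<omega>) E"
  obtains \<theta> w where "sep_elt (range to_ac) \<theta>" "w \<in> polys_over (range to_ac)" "poly w \<theta> = \<omega>"
    "Polynomial.degree (min_poly (simple_ext (range to_ac) \<omega>) \<theta>) = n"
proof -
  interpret clf: field_val "closure_ring :: 'm alg_closure ring" "id :: 'm alg_closure \<Rightarrow> 'm alg_closure" by (rule closure_field_val)
  let ?M = "range (to_ac :: 'm \<Rightarrow> 'm alg_closure)"
  interpret M: ac_subfield ?M by (rule range_to_ac_subfield)
  define F where "F = simple_ext ?M \<omega>"
  have Fs: "subfield_set F" unfolding F_def by (rule M.simple_ext_subfield[OF alg_closure_algebraic_elt])
  have MF: "?M \<subseteq> F" "\<omega> \<in> F" unfolding F_def using M.subset_simple_ext M.gen_in_simple_ext by auto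
  have E': "subfield F closure_ring" "subfield E closure_ring" "F \<subseteq> E"
    "\<And>x. x \<in> E \<Longrightarrow> algebraic_over closure_ring F x \<and> separable_poly_over closure_ring F (clf.Irr F x)"
    "clf.dimension n F E"
    using E unfolding separable_ext_of_degree_def separable_ext_def adjoin_eq F_def by auto
  interpret E: subfield_set E using E'(2) unfolding subfield_closure_iff .
  have sepE: "sep_elt ?M x" if "x \<in> E" for x
  proof -
    have "sep_elt F x" using clf.sep_elt_if_separable_over[OF E'(1), of x] E'(4)[OF that] by simp
    then show ?thesis unfolding F_def by (rule M.sep_elt_trans[OF inf om])
  qed
  obtain Us where Us: "clf.Span F Us = E" "set Us \<subseteq> E"
    using clf.exists_base[OF E'(1) E'(5)] clf.Span_base_incl[OF E'(1)] by fastforce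
  have "\<exists>\<theta>\<in>E. set xs \<subseteq> simple_ext ?M \<theta>" if "set xs \<subseteq> E" for xs using that
  proof (induction xs)
    case Nil then show ?case using E.zero by auto
  next
    case (Cons u xs)
    then obtain \<theta> where \<theta>: "\<theta> \<in> E" "set xs \<subseteq> simple_ext ?M \<theta>" by auto
    have u: "u \<in> E" using Cons.prems by simp
    obtain z where z: "\<theta> \<in> simple_ext ?M z" "u \<in> simple_ext ?M z" "z \<in> simple_ext (simple_ext ?M \<theta>) u"
      using M.primitive_element[OF inf sepE[OF \<theta>(1)] sepE[OF u]] by metis
    interpret Z: subfield_set "simple_ext ?M z" by (rule M.simple_ext_subfield[OF alg_closure_algebraic_elt])
    interpret T: subfield_set "simple_ext ?M \<theta>" by (rule M.simple_ext_subfield[OF alg_closure_algebraic_elt])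
    have "simple_ext ?M \<theta> \<subseteq> simple_ext ?M z"
      by (rule M.simple_ext_minimal[OF Z.subring_set_axioms M.subset_simple_ext z(1)])
    moreover have "simple_ext ?M \<theta> \<subseteq> E"
      by (rule M.simple_ext_minimal[OF E.subring_set_axioms _ \<theta>(1)]) (use MF(1) E'(3) in blast)
    then have "simple_ext (simple_ext ?M \<theta>) u \<subseteq> E"
      by (rule T.simple_ext_minimal[OF E.subring_set_axioms _ u])
    ultimately show ?case using z \<theta>(2) by (intro bexI[of _ z]) auto
  qed
  from this[of "\<omega> # Us"] obtain \<theta> where \<theta>: "\<theta> \<in> E" "set (\<omega> # Us) \<subseteq> simple_ext ?M \<theta>"
    using Us(2) MF(2) E'(3) by auto
  interpret T: subfield_set "simple_ext ?M \<theta>" by (rule M.simple_ext_subfield[OF alg_closure_algebraic_elt])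
  interpret F: subfield_set F by (rule Fs)
  have FT: "F \<subseteq> simple_ext ?M \<theta>"
    unfolding F_def by (rule M.simple_ext_minimal[OF T.subring_set_axioms M.subset_simple_ext]) (use \<theta>(2) in simp)
  have 1: "E \<subseteq> simple_ext ?M \<theta>"
    unfolding Us(1)[symmetric] by (rule Span_in_subring[OF T.subring_set_axioms FT]) (use \<theta>(2) in simp)
  have a: "algebraic_elt F \<theta>" using algebraic_elt_mono[OF MF(1) alg_closure_algebraic_elt] .
  interpret FTh: subfield_set "simple_ext F \<theta>" by (rule F.simple_ext_subfield[OF a])
  have 2: "simple_ext ?M \<theta> \<subseteq> simple_ext F \<theta>"
    by (rule M.simple_ext_minimal[OF FTh.subring_set_axioms]) (use MF(1) F.subset_simple_ext F.gen_in_simple_ext in blast)+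
  have 3: "simple_ext F \<theta> \<subseteq> E" by (rule F.simple_ext_minimal[OF E.subring_set_axioms E'(3) \<theta>(1)])
  have "E = simple_ext F \<theta>" using 1 2 3 by blast
  then have "n = Polynomial.degree (min_poly F \<theta>)"
    using clf.dimension_is_inj[OF E'(1) E'(5)] dimension_min_poly[OF Fs a] by simp
  moreover obtain w where "w \<in> polys_over ?M" "poly w \<theta> = \<omega>"
    using \<theta>(2) unfolding simple_ext_def by auto
  ultimately show thesis using that[of \<theta> w] sepE[OF \<theta>(1)] unfolding F_def by simp
qed

section \<open>Generating a separable algebra over several residue fields\<close>

context ac_subfield
begin

text \<open>Elements of \<open>B(\<omega>)\<close> are replaced by polynomials in a second variable that stands for \<open>\<omega>\<close>.\<close>

lemma lift_poly_over_simple_ext: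
  assumes "p \<in> polys_over (simple_ext B \<omega>)"
  obtains P where "P \<in> polys_over (polys_over B)" "map_poly (\<lambda>c. poly c \<omega>) P = p" "lead_coeff p = 1 \<Longrightarrow> lead_coeff P = 1" "degree P = degree p"
proof -
  have "\<exists>q. q \<in> polys_over B \<and> poly q \<omega> = c \<and> (c = 0 \<longrightarrow> q = 0) \<and> (c = 1 \<longrightarrow> q = 1)" if "c \<in> simple_ext B \<omega>" for c
  proof -
    obtain q where "q \<in> polys_over B" "poly q \<omega> = c" using \<open>c \<in> _\<close> unfolding simple_ext_def by blast
    then show ?thesis
      by (intro exI[of _ "if c = 0 then 0 else if c = 1 then 1 else q"]) auto
  qed
  then obtain l where l: "\<And>c. c \<in> simple_ext B \<omega> \<Longrightarrow> l c \<in> polys_over B \<and> poly (l c) \<omega> = c \<and> (c = 0 \<longrightarrow> l c = 0) \<and> (c = 1 \<longrightarrow> l c = 1)"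
    by metis
  have co: "coeff p i \<in> simple_ext B \<omega>" for i using assms by (auto simp: polys_over_def)
  have in01: "0 \<in> simple_ext B \<omega>" using subset_simple_ext zero by blast
  then have l0: "l 0 = 0" using l by blast
  have cP: "coeff (map_poly l p) i = l (coeff p i)" for i by (simp add: coeff_map_poly l0)
  have d: "degree (map_poly l p) = degree p"
  proof (cases "p = 0")
    case False
    have "l (lead_coeff p) \<noteq> 0" using l[OF co, of "degree p"] False by auto
    then show ?thesis by (intro antisym map_poly_degree_leq le_degree) (simp add: cP)
  qed simp
  show thesis
  proof (rule that)
    show "map_poly l p \<in> polys_over (polys_over B)" using l[OF co] by (auto simp: polys_over_def cP)
    show "map_poly (\<lambda>c. poly c \<omega>) (map_poly l p) = p" using l[OF co] by (intro poly_eqI) (simp add: coeff_map_poly cP)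
    show "lead_coeff (map_poly l p) = 1" if "lead_coeff p = 1" using l[OF co, of "degree p"] that d by (simp add: cP)
  qed (rule d)
qed

text \<open>Each coefficient is a polynomial over \<open>B\<close> with root \<open>\<omega>\<close>, hence has all conjugates of \<open>\<omega>\<close> as roots. This
  replaces the isomorphism between \<open>B(\<omega>)\<close> and \<open>B(\<omega>')\<close>.\<close>

lemma transfer_to_conjugate:
  assumes om: "algebraic_elt B \<omega>" "poly (min_poly B \<omega>) \<omega>' = 0"
    and P: "P \<in> polys_over (polys_over B)" and 0: "map_poly (\<lambda>c. poly c \<omega>) P = 0"
  shows "map_poly (\<lambda>c. poly c \<omega>') P = 0"
proof (rule poly_eqI)
  fix i
  have "poly (coeff P i) \<omega> = 0" using arg_cong[OF 0, of "\<lambda>p. coeff p i"] by (simp add: coeff_map_poly)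
  then have "min_poly B \<omega> dvd coeff P i" using P by (intro min_poly_dvd[OF om(1)]) (auto simp: polys_over_def)
  then have "poly (coeff P i) \<omega>' = 0" using om(2) by (auto elim!: dvdE)
  then show "coeff (map_poly (\<lambda>c. poly c \<omega>') P) i = coeff 0 i" by (simp add: coeff_map_poly)
qed

text \<open>Over \<open>\<omega> = w(\<theta>)\<close> the fibre consists of the roots of the minimal polynomial \<open>h\<close> of \<open>\<theta>\<close> over \<open>B(\<omega>)\<close>. Writing
  \<open>h = H(\<omega>, T)\<close>, the fibre over a conjugate \<open>\<omega>'\<close> consists of the roots of \<open>H(\<omega>', T)\<close>, which is again
  separable of degree \<open>n\<close>.\<close>

lemma fibre_card:
  assumes th: "sep_elt B \<theta>" and w: "w \<in> polys_over B" and om: "algebraic_elt B (poly w \<theta>)"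
    and n: "degree (min_poly (simple_ext B (poly w \<theta>)) \<theta>) = n" and \<theta>1: "poly (min_poly B \<theta>) \<theta>1 = 0"
  shows "card {\<theta>'. poly (min_poly B \<theta>) \<theta>' = 0 \<and> poly w \<theta>' = poly w \<theta>1} = n"
proof -
  define \<omega> \<omega>' where "\<omega> = poly w \<theta>" and "\<omega>' = poly w \<theta>1"
  define m where "m = min_poly B \<theta>"
  have tha: "algebraic_elt B \<theta>" by (rule sep_elt_algebraic[OF th])
  note m = min_poly[OF tha, folded m_def]
  have oma: "algebraic_elt B \<omega>" using om by (simp add: \<omega>_def)
  define F where "F = simple_ext B \<omega>"
  interpret F: subfield_set F unfolding F_def by (rule simple_ext_subfield[OF oma])
  have BF: "B \<subseteq> F" "\<omega> \<in> F" unfolding F_def using subset_simple_ext gen_in_simple_ext by auto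
  have thF: "algebraic_elt F \<theta>" by (rule algebraic_elt_mono[OF BF(1) tha])
  define h where "h = min_poly F \<theta>"
  note h = F.min_poly[OF thF, folded h_def]
  have conj: "poly (min_poly B \<omega>) \<omega>' = 0"
  proof -
    have "m dvd pcompose (min_poly B \<omega>) w"
      unfolding m_def by (rule min_poly_dvd[OF tha])
        (use w min_poly[OF oma] in \<open>auto simp: poly_pcompose \<omega>_def[symmetric]\<close>)
    then have "poly (pcompose (min_poly B \<omega>) w) \<theta>1 = 0" using \<theta>1 by (auto simp: m_def elim!: dvdE)
    then show ?thesis by (simp add: poly_pcompose \<omega>'_def)
  qed
  obtain a where a: "a \<in> polys_over F" "m = a * h" using h(4)[of m] polys_over_mono[OF BF(1) m(1)] m(3) by blast
  obtain b where b: "b \<in> polys_over F" "w - [:\<omega>:] = b * h"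
    using h(4)[of "w - [:\<omega>:]"] polys_over_mono[OF BF(1) w] BF(2) by (auto simp: \<omega>_def intro!: F.P.diff)
  obtain H where H: "H \<in> polys_over (polys_over B)" "map_poly (\<lambda>c. poly c \<omega>) H = h" "lead_coeff h = 1 \<Longrightarrow> lead_coeff H = 1" "degree H = degree h"
    using lift_poly_over_simple_ext[OF h(1)[unfolded F_def]] by metis
  obtain A where A: "A \<in> polys_over (polys_over B)" "map_poly (\<lambda>c. poly c \<omega>) A = a"
    using lift_poly_over_simple_ext[OF a(1)[unfolded F_def]] by metis
  obtain C where C: "C \<in> polys_over (polys_over B)" "map_poly (\<lambda>c. poly c \<omega>) C = b"
    using lift_poly_over_simple_ext[OF b(1)[unfolded F_def]] by metis
  define ev where "ev = (\<lambda>y. map_poly (\<lambda>c. poly c (y::'a)))"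
  have rp: "rhom (\<lambda>c. poly c y)" for y :: 'a by (simp add: rhom_def)
  interpret ev: rhom "ev y" for y unfolding ev_def by (rule rhom_map_poly[OF rp])
  have evc: "ev y (map_poly (\<lambda>c. [:c:]) p) = p" for y p unfolding ev_def by (intro poly_eqI) (simp add: coeff_map_poly)
  interpret PP: subring_set "polys_over (polys_over B)" by (rule P.polys_over_subring)
  have cP: "map_poly (\<lambda>c. [:c:]) p \<in> polys_over (polys_over B)" if "p \<in> polys_over B" for p
    using that by (auto simp: polys_over_def coeff_map_poly coeff_pCons split: nat.splits)
  define h' where "h' = ev \<omega>' H"
  have evs: "ev \<omega> A = a" "ev \<omega> H = h" "ev \<omega> C = b" using A(2) H(2) C(2) by (simp_all add: ev_def)
  have tr: "ev \<omega>' P = 0" if "P \<in> polys_over (polys_over B)" "ev \<omega> P = 0" for P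
    using transfer_to_conjugate[OF oma conj that(1)] that(2) by (simp add: ev_def)
  have "ev \<omega>' (map_poly (\<lambda>c. [:c:]) m - A * H) = 0"
    by (rule tr, intro PP.diff PP.mult cP m A H) (simp add: ev.hom_diff ev.hom_mult evc evs a(2))
  then have mh: "m = ev \<omega>' A * h'" by (simp add: ev.hom_diff ev.hom_mult evc h'_def)
  have X1: "[:[:0,1:]:] \<in> polys_over (polys_over B)" by (intro P.pCons_polys_over pCons_polys_over) auto
  have evX: "ev y [:[:0,1:]:] = [:y:]" for y by (simp add: ev_def map_poly_pCons)
  have "ev \<omega>' (map_poly (\<lambda>c. [:c:]) w - [:[:0,1:]:] - C * H) = 0"
    by (rule tr, intro PP.diff PP.mult cP w C H X1) (simp add: ev.hom_diff ev.hom_mult evc evX evs b(2))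
  then have wh: "w - [:\<omega>':] = ev \<omega>' C * h'" by (simp add: ev.hom_diff ev.hom_mult evc evX h'_def)
  \<comment> \<open>\<open>H(w(T), T)\<close> vanishes at \<open>\<theta>\<close>, hence at all its conjugates\<close>
  define K where "K = poly (map_poly (\<lambda>c. pcompose c w) H) [:0, 1:]"
  have Kev: "poly K y = poly (ev (poly w y) H) y" for y
  proof -
    interpret py: rhom "\<lambda>p. poly p y" by (rule rp)
    have "poly K y = poly (map_poly (\<lambda>p. poly p y) (map_poly (\<lambda>c. pcompose c w) H)) y"
      unfolding K_def using py.poly_map_poly_hom[of "map_poly (\<lambda>c. pcompose c w) H" "[:0,1:]"] by simp
    also have "map_poly (\<lambda>p. poly p y) (map_poly (\<lambda>c. pcompose c w) H) = ev (poly w y) H"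
      unfolding ev_def by (intro poly_eqI) (simp add: coeff_map_poly poly_pcompose)
    finally show ?thesis .
  qed
  have KB: "K \<in> polys_over B"
  proof -
    have "map_poly (\<lambda>c. pcompose c w) H \<in> polys_over (polys_over B)"
      using H(1) w by (auto simp: polys_over_def[of "polys_over B"] coeff_map_poly)
    then show ?thesis unfolding K_def by (intro P.poly_in pCons_polys_over) auto
  qed
  have "poly K \<theta> = 0" unfolding Kev using H(2) h(3) by (simp add: ev_def \<omega>_def)
  then have "m dvd K" unfolding m_def by (intro min_poly_dvd[OF tha KB])
  then have Kv: "poly K y = 0" if "poly m y = 0" for y using that by (auto elim!: dvdE)
  have eq: "{\<theta>'. poly m \<theta>' = 0 \<and> poly w \<theta>' = \<omega>'} = {y. poly h' y = 0}"
  proof (intro equalityI subsetI)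
    fix y assume y: "y \<in> {\<theta>'. poly m \<theta>' = 0 \<and> poly w \<theta>' = \<omega>'}"
    then show "y \<in> {y. poly h' y = 0}" using Kv[of y] Kev[of y] by (simp add: h'_def)
  next
    fix y assume y: "y \<in> {y. poly h' y = 0}"
    have "poly (w - [:\<omega>':]) y = 0" unfolding wh using y by simp
    then show "y \<in> {\<theta>'. poly m \<theta>' = 0 \<and> poly w \<theta>' = \<omega>'}" using y mh by simp
  qed
  have "sep_poly m" unfolding m_def by (rule min_poly_sep[OF th])
  moreover have "h' dvd m" by (subst mh) (rule dvd_triv_right)
  ultimately have "sep_poly h'" by (rule sep_poly_dvd)
  then have "card {y. poly h' y = 0} = degree h'" by (rule sep_poly_card_roots)
  moreover have "degree h' = degree h"
  proof -
    have "coeff h' (degree H) = 1" using H(3)[OF h(2)] by (simp add: h'_def ev_def coeff_map_poly)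
    then have "degree H \<le> degree h'" by (intro le_degree) simp
    moreover have "degree h' \<le> degree H" unfolding h'_def ev_def by (rule map_poly_degree_leq)
    ultimately show ?thesis using H(4) by simp
  qed
  ultimately have "card {\<theta>'. poly m \<theta>' = 0 \<and> poly w \<theta>' = \<omega>'} = n" using eq n by (simp add: h_def F_def \<omega>_def)
  then show ?thesis by (simp add: m_def \<omega>'_def)
qed

text \<open>A conjugacy class over \<open>B\<close>, given by a representative \<open>\<theta>\<close> and its separable polynomial, which
  a polynomial \<open>w\<close> maps \<open>n\<close>-to-one onto the class of \<open>\<omega>\<close>.\<close>

definition covering_class :: "nat \<Rightarrow> 'a \<Rightarrow> 'a poly \<Rightarrow> 'a poly \<Rightarrow> 'a \<Rightarrow> bool" where
  "covering_class n \<omega> \<mu> w \<theta> \<longleftrightarrow> \<mu> \<in> polys_over B \<and> sep_poly \<mu> \<and> lead_coeff \<mu> = 1 \<and> w \<in> polys_over B \<and>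
     poly \<mu> \<theta> = 0 \<and> poly w \<theta> = \<omega> \<and>
     (\<forall>r\<in>polys_over B. poly r \<theta> = 0 \<longrightarrow> (\<forall>\<theta>'. poly \<mu> \<theta>' = 0 \<longrightarrow> poly r \<theta>' = 0)) \<and>
     (\<forall>\<theta>1. poly \<mu> \<theta>1 = 0 \<longrightarrow> card {\<theta>'. poly \<mu> \<theta>' = 0 \<and> poly w \<theta>' = poly w \<theta>1} = n)"

lemma covering_class_min_poly:
  assumes th: "sep_elt B \<theta>" and w: "w \<in> polys_over B" and om: "algebraic_elt B (poly w \<theta>)"
    and n: "degree (min_poly (simple_ext B (poly w \<theta>)) \<theta>) = n"
  shows "covering_class n (poly w \<theta>) (min_poly B \<theta>) w \<theta>"
proof -
  have tha: "algebraic_elt B \<theta>" by (rule sep_elt_algebraic[OF th])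
  have "poly r \<theta>' = 0" if "r \<in> polys_over B" "poly r \<theta> = 0" "poly (min_poly B \<theta>) \<theta>' = 0" for r \<theta>'
    using min_poly_dvd[OF tha that(1,2)] that(3) by (auto elim!: dvdE)
  then show ?thesis
    unfolding covering_class_def using min_poly[OF tha] min_poly_sep[OF th] w fibre_card[OF assms] by blast
qed

lemma covering_class_shift:
  assumes cc: "covering_class n \<omega> \<mu> w \<theta>" and c: "c \<in> B"
  shows "covering_class n \<omega> (pcompose \<mu> [:- c, 1:]) (pcompose w [:- c, 1:]) (\<theta> + c)"
proof -
  have sB: "[:- c, 1:] \<in> polys_over B" "[:c, 1:] \<in> polys_over B" using c by auto
  have mu: "\<mu> \<in> polys_over B" "sep_poly \<mu>" "lead_coeff \<mu> = 1" "w \<in> polys_over B" "poly \<mu> \<theta> = 0" "poly w \<theta> = \<omega>"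
    and r: "\<And>r \<theta>'. r \<in> polys_over B \<Longrightarrow> poly r \<theta> = 0 \<Longrightarrow> poly \<mu> \<theta>' = 0 \<Longrightarrow> poly r \<theta>' = 0"
    and card: "\<And>\<theta>1. poly \<mu> \<theta>1 = 0 \<Longrightarrow> card {\<theta>'. poly \<mu> \<theta>' = 0 \<and> poly w \<theta>' = poly w \<theta>1} = n"
    using cc unfolding covering_class_def by blast+
  have ev: "poly (pcompose p [:- c, 1:]) y = poly p (y - c)" for p y by (simp add: poly_pcompose)
  have "sep_poly (pcompose \<mu> [:- c, 1:])"
    using mu(2) unfolding sep_poly_def by (simp add: pderiv_pcompose ev pderiv_pCons)
  moreover have "lead_coeff (pcompose \<mu> [:- c, 1:]) = 1" using mu(3) by (subst lead_coeff_comp) auto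
  moreover have "poly q \<theta>' = 0" if q: "q \<in> polys_over B" "poly q (\<theta> + c) = 0" "poly \<mu> (\<theta>' - c) = 0" for q \<theta>'
    using r[of "pcompose q [:c, 1:]" "\<theta>' - c"] q sB pcompose_polys_over by (simp add: poly_pcompose add.commute)
  moreover have "card {\<theta>'. poly \<mu> (\<theta>' - c) = 0 \<and> poly w (\<theta>' - c) = poly w (\<theta>1 - c)} = n" if "poly \<mu> (\<theta>1 - c) = 0" for \<theta>1
  proof -
    have "{\<theta>'. poly \<mu> (\<theta>' - c) = 0 \<and> poly w (\<theta>' - c) = poly w (\<theta>1 - c)} =
      (\<lambda>y. y + c) ` {\<theta>'. poly \<mu> \<theta>' = 0 \<and> poly w \<theta>' = poly w (\<theta>1 - c)}"
      by (auto intro!: image_eqI[of _ _ "_ - c"])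
    then show ?thesis using card[OF that] by (simp add: card_image)
  qed
  ultimately show ?thesis unfolding covering_class_def ev
    using mu sB pcompose_polys_over by (auto simp: ev)
qed

text \<open>Shifting by elements of the base field makes finitely many such classes disjoint.\<close>

lemma disjoint_covering_classes:
  fixes s :: nat
  assumes inf: "infinite B" and ex: "\<And>i. i < s \<Longrightarrow> \<exists>\<mu> w \<theta>. covering_class n (\<omega> i) \<mu> w \<theta>"
  shows "\<exists>\<mu> w \<theta>. (\<forall>i<s. covering_class n (\<omega> i) (\<mu> i) (w i) (\<theta> i)) \<and>
    (\<forall>i<s. \<forall>j<s. i \<noteq> j \<longrightarrow> (\<forall>y. poly (\<mu> i) y = 0 \<longrightarrow> poly (\<mu> j) y \<noteq> 0))"
  using ex
proof (induction s)
  case (Suc s)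
  from Suc.IH obtain \<mu> w \<theta> where IH: "\<And>i. i < s \<Longrightarrow> covering_class n (\<omega> i) (\<mu> i) (w i) (\<theta> i)"
    "\<And>i j y. i < s \<Longrightarrow> j < s \<Longrightarrow> i \<noteq> j \<Longrightarrow> poly (\<mu> i) y = 0 \<Longrightarrow> poly (\<mu> j) y \<noteq> 0"
    using Suc.prems by (metis less_SucI)
  obtain m v t where mv: "covering_class n (\<omega> s) m v t" using Suc.prems[of s] by blast
  have nz: "\<mu> i \<noteq> 0" if "i < s" for i using IH(1)[OF that] by (auto simp: covering_class_def)
  have mnz: "m \<noteq> 0" using mv by (auto simp: covering_class_def)
  define Y where "Y = (\<Union>i<s. {y. poly (\<mu> i) y = 0})"
  define Z where "Z = {y. poly m y = 0}"
  have "finite ((\<lambda>(y, z). y - z) ` (Y \<times> Z))"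
    unfolding Y_def Z_def using nz mnz by (intro finite_imageI finite_cartesian_product finite_UN_I) (auto simp: poly_roots_finite)
  then obtain c where c: "c \<in> B" "c \<notin> (\<lambda>(y, z). y - z) ` (Y \<times> Z)"
    using inf by (meson finite_subset subsetI)
  have ev: "poly (pcompose p [:- c, 1:]) y = poly p (y - c)" for p y by (simp add: poly_pcompose)
  have dis: "poly m (y - c) \<noteq> 0" if "i < s" "poly (\<mu> i) y = 0" for i y
  proof
    assume "poly m (y - c) = 0"
    then have "c = (\<lambda>(y, z). y - z) (y, y - c)" "(y, y - c) \<in> Y \<times> Z" using that by (auto simp: Y_def Z_def)
    then show False using c(2) by blast
  qed
  have "(\<forall>i<Suc s. covering_class n (\<omega> i) ((\<mu>(s := pcompose m [:- c, 1:])) i) ((w(s := pcompose v [:- c, 1:])) i) ((\<theta>(s := t + c)) i)) \<and>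
    (\<forall>i<Suc s. \<forall>j<Suc s. i \<noteq> j \<longrightarrow> (\<forall>y. poly ((\<mu>(s := pcompose m [:- c, 1:])) i) y = 0 \<longrightarrow> poly ((\<mu>(s := pcompose m [:- c, 1:])) j) y \<noteq> 0))"
    using IH covering_class_shift[OF mv c(1)] dis by (auto simp: less_Suc_eq ev)
  then show ?case by blast
qed simp

text \<open>Elements \<open>e i\<close> that are 1 on the \<open>i\<close>-th class and 0 on the others come from Bezout's identity. The values
  of \<open>w\<close> on different classes differ because \<open>\<omega> i\<close> and \<open>\<omega> j\<close> are not conjugate over \<open>B\<close>.\<close>

lemma common_covering:
  fixes s :: nat
  assumes inf: "infinite B" and ex: "\<And>i. i < s \<Longrightarrow> \<exists>\<mu> w \<theta>. covering_class n (\<omega> i) \<mu> w \<theta>"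
    and sep: "\<And>i j. i < s \<Longrightarrow> j < s \<Longrightarrow> i \<noteq> j \<Longrightarrow> \<exists>F\<in>polys_over B. poly F (\<omega> i) = 0 \<and> (\<exists>G\<in>polys_over B. poly G (\<omega> j) = 0 \<and> (\<forall>y. poly F y = 0 \<longrightarrow> poly G y \<noteq> 0))"
  obtains Th w \<theta> where "finite Th" "(\<Prod>t\<in>Th. [:- t, 1:]) \<in> polys_over B" "w \<in> polys_over B"
    "\<And>t. t \<in> Th \<Longrightarrow> card {t' \<in> Th. poly w t' = poly w t} = n"
    "\<And>i. i < s \<Longrightarrow> \<theta> i \<in> Th \<and> poly w (\<theta> i) = \<omega> i"
    "\<And>i r t. i < s \<Longrightarrow> r \<in> polys_over B \<Longrightarrow> poly r (\<theta> i) = 0 \<Longrightarrow> t \<in> Th \<Longrightarrow> poly w t = \<omega> i \<Longrightarrow> poly r t = 0"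
proof -
  obtain \<mu> w \<theta> where cc: "\<And>i. i < s \<Longrightarrow> covering_class n (\<omega> i) (\<mu> i) (w i) (\<theta> i)"
    and dis: "\<And>i j y. i < s \<Longrightarrow> j < s \<Longrightarrow> i \<noteq> j \<Longrightarrow> poly (\<mu> i) y = 0 \<Longrightarrow> poly (\<mu> j) y \<noteq> 0"
    using disjoint_covering_classes[OF inf, of s n \<omega>] ex by metis
  have mu: "\<mu> i \<in> polys_over B" "sep_poly (\<mu> i)" "lead_coeff (\<mu> i) = 1" "w i \<in> polys_over B" "poly (\<mu> i) (\<theta> i) = 0" "poly (w i) (\<theta> i) = \<omega> i"
    and rr: "\<And>r \<theta>'. r \<in> polys_over B \<Longrightarrow> poly r (\<theta> i) = 0 \<Longrightarrow> poly (\<mu> i) \<theta>' = 0 \<Longrightarrow> poly r \<theta>' = 0"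
    and card: "\<And>\<theta>1. poly (\<mu> i) \<theta>1 = 0 \<Longrightarrow> card {\<theta>'. poly (\<mu> i) \<theta>' = 0 \<and> poly (w i) \<theta>' = poly (w i) \<theta>1} = n" if "i < s" for i
    using cc[OF that] unfolding covering_class_def by blast+
  define Z where "Z = (\<lambda>i. {y. poly (\<mu> i) y = 0})"
  define Th where "Th = (\<Union>i<s. Z i)"
  have nz: "\<mu> i \<noteq> 0" if "i < s" for i using mu(3)[OF that] by auto
  have finZ: "finite (Z i)" if "i < s" for i unfolding Z_def by (rule poly_roots_finite[OF nz[OF that]])
  have fin: "finite Th" unfolding Th_def using finZ by auto
  have muZ: "\<mu> i = (\<Prod>t\<in>Z i. [:- t, 1:])" if i: "i < s" for i
  proof -
    obtain A where A: "finite A" "\<mu> i = smult 1 (\<Prod>x\<in>A. [:-x, 1:])" using sep_poly_card_roots(2)[OF mu(2)[OF i]] mu(3)[OF i] by metis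
    have "Z i = A" unfolding Z_def A(2) using A(1) by (auto simp: poly_prod)
    then show ?thesis using A(2) by simp
  qed
  have prod: "(\<Prod>t\<in>Th. [:- t, 1:]) = (\<Prod>i<s. \<mu> i)"
  proof -
    have "(\<Prod>t\<in>Th. [:- t, 1:]) = (\<Prod>i<s. \<Prod>t\<in>Z i. [:- t, 1:])"
      unfolding Th_def by (rule prod.UNION_disjoint) (use finZ dis in \<open>auto simp: Z_def\<close>)
    then show ?thesis using muZ by simp
  qed
  have "\<exists>e\<in>polys_over B. (\<forall>y\<in>Z i. poly e y = 1) \<and> (\<forall>j<s. j \<noteq> i \<longrightarrow> (\<forall>y\<in>Z j. poly e y = 0))" if i: "i < s" for i
  proof -
    define q where "q = (\<Prod>j\<in>{..<s} - {i}. \<mu> j)"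
    have qB: "q \<in> polys_over B" unfolding q_def by (intro P.prod) (use mu(1) in auto)
    have q0: "q \<noteq> 0" unfolding q_def using nz by simp
    obtain d a b p' q' where d: "d \<in> polys_over B" "a \<in> polys_over B" "b \<in> polys_over B"
      "d = a * \<mu> i + b * q" "d \<noteq> 0" "\<mu> i = p' * d" "q = q' * d" using bezout[OF mu(1)[OF i] qB q0] by metis
    have "poly d y \<noteq> 0" for y
    proof
      assume y: "poly d y = 0"
      then have "poly (\<mu> i) y = 0" "poly q y = 0" using d(6,7) by simp_all
      then show False using dis[OF i] unfolding q_def poly_prod by auto
    qed
    then have "degree d = 0" using alg_closed_imp_poly_has_root[of d] by blast
    then obtain k where k: "d = [:k:]" by (metis degree_eq_zeroE)
    have k0: "k \<noteq> 0" using d(5) k by auto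
    have kB: "k \<in> B" using d(1) k by (auto simp: polys_over_def split: nat.splits dest!: spec[of _ 0])
    define e where "e = smult (inverse k) (b * q)"
    have "e \<in> polys_over B" unfolding e_def by (intro smult_polys_over inverse kB P.mult d qB)
    moreover have "poly e y = 1" if "y \<in> Z i" for y
    proof -
      have "poly d y = poly (a * \<mu> i + b * q) y" by (simp only: d(4)[symmetric])
      then have "poly (b * q) y = k" using that k by (simp add: Z_def)
      then show ?thesis using k0 by (simp add: e_def)
    qed
    moreover have "poly e y = 0" if "j < s" "j \<noteq> i" "y \<in> Z j" for j y
    proof -
      have "poly q y = 0" unfolding q_def poly_prod using that by (intro prod_zero) (auto simp: Z_def)
      then show ?thesis by (simp add: e_def)
    qed
    ultimately show ?thesis by blast
  qed
  then obtain e where e: "\<And>i. i < s \<Longrightarrow> e i \<in> polys_over B" "\<And>i y. i < s \<Longrightarrow> y \<in> Z i \<Longrightarrow> poly (e i) y = 1"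
    "\<And>i j y. i < s \<Longrightarrow> j < s \<Longrightarrow> j \<noteq> i \<Longrightarrow> y \<in> Z j \<Longrightarrow> poly (e i) y = 0" by metis
  define W where "W = (\<Sum>i<s. w i * e i)"
  have WB: "W \<in> polys_over B" unfolding W_def by (intro P.sum P.mult) (use mu(4) e(1) in auto)
  have WZ: "poly W y = poly (w j) y" if "j < s" "y \<in> Z j" for j y
  proof -
    have "poly W y = (\<Sum>i<s. if i = j then poly (w j) y else 0)"
      unfolding W_def poly_sum poly_mult using that e(2,3) by (intro sum.cong) auto
    then show ?thesis using that by simp
  qed
  \<comment> \<open>the values of \<open>W\<close> on different classes are not conjugate\<close>
  have Wdis: "poly W y \<noteq> poly W z" if ij: "i < s" "j < s" "i \<noteq> j" and yz: "y \<in> Z i" "z \<in> Z j" for i j y z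
  proof -
    have v: "poly F (poly W y) = 0" if F: "F \<in> polys_over B" "poly F (\<omega> i) = 0" and i: "i < s" "y \<in> Z i" for F i y
    proof -
      have "poly (pcompose F (w i)) y = 0"
        using rr[OF i(1), of "pcompose F (w i)" y] F i mu(4,6)[OF i(1)] pcompose_polys_over by (auto simp: Z_def poly_pcompose)
      then show ?thesis using WZ[OF i] by (simp add: poly_pcompose)
    qed
    obtain F G where FG: "F \<in> polys_over B" "poly F (\<omega> i) = 0" "G \<in> polys_over B" "poly G (\<omega> j) = 0" "\<And>y. poly F y = 0 \<Longrightarrow> poly G y \<noteq> 0"
      using sep[OF ij] by blast
    show ?thesis using v[OF FG(1,2) ij(1) yz(1)] v[OF FG(3,4) ij(2) yz(2)] FG(5) by metis
  qed
  have Zfib: "{t' \<in> Th. poly W t' = poly W t} = {t'. poly (\<mu> i) t' = 0 \<and> poly (w i) t' = poly (w i) t}" if t: "i < s" "t \<in> Z i" for i t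
  proof (intro equalityI subsetI)
    fix y assume y: "y \<in> {t' \<in> Th. poly W t' = poly W t}"
    then obtain j where j: "j < s" "y \<in> Z j" unfolding Th_def by blast
    have "j = i" using Wdis[OF j(1) t(1) _ j(2) t(2)] y by auto
    then show "y \<in> {t'. poly (\<mu> i) t' = 0 \<and> poly (w i) t' = poly (w i) t}"
      using y j WZ[OF t] WZ[OF j] by (auto simp: Z_def)
  next
    fix y assume y: "y \<in> {t'. poly (\<mu> i) t' = 0 \<and> poly (w i) t' = poly (w i) t}"
    then have "y \<in> Z i" by (simp add: Z_def)
    then show "y \<in> {t' \<in> Th. poly W t' = poly W t}" using y t WZ[OF t] WZ[OF t(1), of y] by (auto simp: Th_def)
  qed
  have thZ: "\<theta> i \<in> Z i" if "i < s" for i using mu(5)[OF that] by (simp add: Z_def)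
  have Wth: "poly W (\<theta> i) = \<omega> i" if "i < s" for i using WZ[OF that thZ[OF that]] mu(6)[OF that] by simp
  show thesis
  proof (rule that[of Th W \<theta>])
    show "finite Th" by (rule fin)
    show "(\<Prod>t\<in>Th. [:- t, 1:]) \<in> polys_over B" unfolding prod by (intro P.prod) (use mu(1) in auto)
    show "W \<in> polys_over B" by (rule WB)
    show "card {t' \<in> Th. poly W t' = poly W t} = n" if t: "t \<in> Th" for t
    proof -
      obtain i where i: "i < s" "t \<in> Z i" using t by (auto simp: Th_def)
      then show ?thesis using Zfib[OF i] card[OF i(1), of t] by (simp add: Z_def)
    qed
    show "\<theta> i \<in> Th \<and> poly W (\<theta> i) = \<omega> i" if "i < s" for i using thZ Wth that by (auto simp: Th_def)
    show "poly r t = 0" if i: "i < s" "r \<in> polys_over B" "poly r (\<theta> i) = 0" "t \<in> Th" "poly W t = \<omega> i" for i r t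
    proof -
      have "t \<in> {t' \<in> Th. poly W t' = poly W (\<theta> i)}" using i Wth by simp
      then have "poly (\<mu> i) t = 0" unfolding Zfib[OF i(1) thZ[OF i(1)]] by simp
      then show ?thesis by (rule rr[OF i(1,2,3)])
    qed
  qed
qed

end

section \<open>Irreducibility of compositions\<close>

text \<open>Each polynomial is a combination of \<open>1, T, \<dots>, T\<^sup>n\<^sup>-\<^sup>1\<close> with coefficients in \<open>K[g]\<close>, and the degrees
  \<open>n deg (r l) + l\<close> of the terms are distinct, so nothing cancels.\<close>

lemma g_adic_expansion:
  fixes g :: "'k::field poly"
  assumes g: "degree g = n" "n > 0"
  shows "\<exists>r. u = (\<Sum>l<n. pcompose (r l) g * monom 1 l) \<and> (\<forall>l<n. r l \<noteq> 0 \<longrightarrow> n * degree (r l) + l \<le> degree u)"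
proof (induction "degree u" arbitrary: u rule: less_induct)
  case less
  have small: "(\<Sum>l<n. [:coeff b l:] * monom 1 l) = b" if "degree b < n" for b :: "'k poly"
  proof (rule poly_eqI)
    fix i
    have "coeff (\<Sum>l<n. [:coeff b l:] * monom 1 l) i = (\<Sum>l<n. if l = i then coeff b i else 0)"
      unfolding coeff_sum by (intro sum.cong) auto
    also have "\<dots> = coeff b i" using that by (auto simp: coeff_eq_0)
    finally show "coeff (\<Sum>l<n. [:coeff b l:] * monom 1 l) i = coeff b i" .
  qed
  show ?case
  proof (cases "degree u < n")
    case True
    show ?thesis
      by (rule exI[of _ "\<lambda>l. [:coeff u l:]"]) (use small[OF True] in \<open>auto simp: le_degree\<close>)
  next
    case False
    define a b where "a = u div g" and "b = u mod g"
    have u: "u = a * g + b" by (simp add: a_def b_def)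
    have g0: "g \<noteq> 0" using g by auto
    have b: "degree b < n"
      using degree_mod_less[OF g0, of u] g by (auto simp: b_def)
    have a0: "a \<noteq> 0" using u b False by auto
    have "degree (a * g) = degree a + n" using a0 g0 g by (simp add: degree_mult_eq)
    then have du: "degree u = degree a + n" using b unfolding u by (subst degree_add_eq_left) auto
    then obtain r' where r': "a = (\<Sum>l<n. pcompose (r' l) g * monom 1 l)" "\<And>l. l < n \<Longrightarrow> r' l \<noteq> 0 \<Longrightarrow> n * degree (r' l) + l \<le> degree a"
      using less[of a] g(2) by fastforce
    define r where "r = (\<lambda>l. pCons (coeff b l) (r' l))"
    have "(\<Sum>l<n. pcompose (r l) g * monom 1 l) = (\<Sum>l<n. [:coeff b l:] * monom 1 l) + (\<Sum>l<n. pcompose (r' l) g * monom 1 l) * g"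
      unfolding r_def pcompose_pCons sum_distrib_right sum.distrib[symmetric] by (intro sum.cong) (auto simp only: algebra_simps)
    also have "\<dots> = u" unfolding small[OF b] r'(1)[symmetric] using u by simp
    finally have "u = (\<Sum>l<n. pcompose (r l) g * monom 1 l)" ..
    moreover have "n * degree (r l) + l \<le> degree u" if l: "l < n" "r l \<noteq> 0" for l
    proof (cases "r' l = 0")
      case True
      then show ?thesis using l False by (simp add: r_def)
    next
      case False
      then show ?thesis using r'(2)[OF l(1) False] du by (simp add: r_def)
    qed
    ultimately show ?thesis by blast
  qed
qed

lemma UNIV_subfield: "subfield_set (UNIV :: 'k::field set)"
  by unfold_locales auto

text \<open>Otherwise Bezout's identity would give \<open>0 = 1\<close> at the common root.\<close>

lemma irreducible_dvd_if_common_root: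
  assumes h: "rhom (h :: 'k::field \<Rightarrow> 'o::field)" and f: "Factorial_Ring.irreducible f"
    and y: "poly (map_poly h f) y = 0" "poly (map_poly h r) y = 0"
  shows "f dvd r"
proof -
  interpret h: rhom h by (rule h)
  interpret H: rhom "\<lambda>p. poly (map_poly h p) y" by (rule rhom_poly_map[OF h])
  interpret U: subfield_set "UNIV :: 'k set" by (rule UNIV_subfield)
  have f0: "f \<noteq> 0" using f by auto
  have allP: "p \<in> polys_over UNIV" for p :: "'k poly" by (simp add: polys_over_def)
  obtain d a b p' q' where d: "d = a * r + b * f" "d \<noteq> 0" "r = p' * d" "f = q' * d"
    using U.bezout[OF allP[of r] allP[of f] f0] by metis
  have "poly (map_poly h d) y = 0" unfolding d(1) H.hom_add H.hom_mult using y by simp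
  moreover have "poly (map_poly h d) y \<noteq> 0" if "d dvd 1"
  proof -
    have "degree d = 0" using is_unit_iff_degree[OF d(2)] that by simp
    then obtain c where c: "d = [:c:]" by (rule degree_eq_zeroE)
    have "c \<noteq> 0" using d(2) c by simp
    then show ?thesis using rhom_eq_0_iff[OF h, of c] c by (simp add: map_poly_pCons)
  qed
  ultimately have "q' dvd 1" using f d(4) unfolding Factorial_Ring.irreducible_def by blast
  then have "q' * d dvd d" by (rule iffD2[OF mult_unit_dvd_iff' dvd_refl])
  then have "f dvd d" unfolding d(4)[symmetric] .
  moreover have "d dvd r" by (subst d(3)) (rule dvd_triv_right)
  ultimately show ?thesis by (rule dvd_trans)
qed

lemma map_poly_pcompose_eval:
  assumes h: "rhom (h :: 'k::field \<Rightarrow> 'o::field)"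
  shows "poly (map_poly h (pcompose p g)) t = poly (map_poly h p) (poly (map_poly h g) t)"
proof -
  interpret h: rhom h by (rule h)
  interpret H: rhom "\<lambda>p. poly (map_poly h p) t" by (rule rhom_poly_map[OF h])
  show ?thesis
    by (induction p) (auto simp: pcompose_pCons H.hom_add H.hom_mult map_poly_pCons)
qed

text \<open>The degree of \<open>t\<close> over \<open>K\<close> is at least \<open>n\<close> times that of \<open>\<omega> = g(t)\<close>: expand a polynomial \<open>u\<close> with root \<open>t\<close>
  in powers of \<open>g\<close>. If \<open>1, t, \<dots>, t\<^sup>n\<^sup>-\<^sup>1\<close> satisfy no linear relation over \<open>K(\<omega>)\<close>, all coefficients of the
  expansion vanish at \<open>\<omega>\<close> and so are divisible by \<open>f\<close>. Hence no proper factor of \<open>f(g(T))\<close> has the root \<open>t\<close>.\<close>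

lemma irreducible_pcompose:
  fixes h :: "'k::field \<Rightarrow> 'o::field"
  assumes h: "rhom h" and f: "Factorial_Ring.irreducible f" and g: "degree g = n" "n > 0"
    and t: "poly (map_poly h f) (poly (map_poly h g) t) = 0"
    and indep: "\<And>r l. (\<Sum>l<n. poly (map_poly h (r l)) (poly (map_poly h g) t) * t ^ l) = 0 \<Longrightarrow> l < n \<Longrightarrow>
        poly (map_poly h (r l)) (poly (map_poly h g) t) = 0"
  shows "Factorial_Ring.irreducible (pcompose f g)"
proof -
  interpret h: rhom h by (rule h)
  interpret H: rhom "\<lambda>p. poly (map_poly h p) t" by (rule rhom_poly_map[OF h])
  have f0: "f \<noteq> 0" using f by auto
  have df: "degree f > 0"
  proof (rule ccontr)
    assume "\<not> degree f > 0"
    then have "f dvd 1" using f0 is_unit_iff_degree[OF f0] by simp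
    then show False using f by (simp add: Factorial_Ring.irreducible_def)
  qed
  have deg: "degree (pcompose f g) = n * degree f" using g by (simp add: degree_pcompose)
  have claim: "n * degree f \<le> degree u" if u: "u \<noteq> 0" "poly (map_poly h u) t = 0" for u
  proof -
    obtain r where r: "u = (\<Sum>l<n. pcompose (r l) g * monom 1 l)" "\<And>l. l < n \<Longrightarrow> r l \<noteq> 0 \<Longrightarrow> n * degree (r l) + l \<le> degree u"
      using g_adic_expansion[OF g, of u] by blast
    have hm: "map_poly h (monom 1 l) = monom 1 l" for l by (simp add: map_poly_monom h.hom_one)
    have "poly (map_poly h u) t = (\<Sum>l<n. poly (map_poly h (r l)) (poly (map_poly h g) t) * t ^ l)"
      by (subst r(1)) (simp add: H.hom_sum H.hom_mult map_poly_pcompose_eval[OF h] hm poly_monom)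
    then have z: "poly (map_poly h (r l)) (poly (map_poly h g) t) = 0" if "l < n" for l
      using indep that u(2) by simp
    have "\<exists>l<n. r l \<noteq> 0" using r(1) u(1) by (metis (no_types, lifting) lessThan_iff mult_zero_left pcompose_0 sum.neutral)
    then obtain l where l: "l < n" "r l \<noteq> 0" by blast
    have "f dvd r l" by (rule irreducible_dvd_if_common_root[OF h f t z[OF l(1)]])
    then have "degree f \<le> degree (r l)" using l(2) by (rule dvd_imp_degree_le)
    then have "n * degree f \<le> n * degree (r l)" by simp
    then show ?thesis using r(2)[OF l] by linarith
  qed
  have nz: "pcompose f g \<noteq> 0" using deg df g by auto
  show ?thesis
  proof (rule Factorial_Ring.irreducibleI[OF nz])
    show "\<not> pcompose f g dvd 1" using is_unit_iff_degree[OF nz] deg df g by simp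
    fix u v assume uv: "pcompose f g = u * v"
    then have nz': "u \<noteq> 0" "v \<noteq> 0" using nz by auto
    have d: "degree u + degree v = n * degree f" using deg uv nz' by (simp add: degree_mult_eq)
    have "poly (map_poly h u) t * poly (map_poly h v) t = 0"
      using t unfolding map_poly_pcompose_eval[OF h, symmetric] uv H.hom_mult .
    then have "degree u = 0 \<or> degree v = 0" using claim[OF nz'(1)] claim[OF nz'(2)] d by auto
    then show "u dvd 1 \<or> v dvd 1" using nz' is_unit_iff_degree by blast
  qed
qed

lemma sep_poly_map_separable:
  assumes h: "rhom (h :: 'k::field \<Rightarrow> 'o::field)" and f: "Factorial_Ring.irreducible f" "separable_poly f"
  shows "sep_poly (map_poly h f)"
  unfolding sep_poly_def
proof (intro allI impI notI)
  fix y assume y: "poly (map_poly h f) y = 0" "poly (pderiv (map_poly h f)) y = 0"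
  have "poly (map_poly h (pderiv f)) y = 0" using y(2) by (simp add: pderiv_map_poly[OF h])
  then have "f dvd pderiv f" by (rule irreducible_dvd_if_common_root[OF h f(1) y(1)])
  then have "f dvd 1" using f(2) unfolding separable_poly_def by (meson coprime_common_divisor dvd_refl)
  then show False using f(1) by (simp add: Factorial_Ring.irreducible_def)
qed

section \<open>The theorem\<close>

lemma PAC_extension_rhom: "PAC_extension \<iota> \<Longrightarrow> rhom \<iota>"
  unfolding PAC_extension_def field_extension_def ring_hom_def by (simp add: ring_of_type_algebra_def rhom_def)

text \<open>Apply \<open>prescribed_fibres\<close> to \<open>n = 1\<close> and the algebra \<open>M\<close>: it provides elements of \<open>K\<close> outside the zeros of
  any nonzero polynomial, in particular of \<open>\<Prod>c. X - c\<close>.\<close>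

lemma PAC_extension_infinite:
  fixes \<iota> :: "'k::field \<Rightarrow> 'm::field"
  assumes PAC: "PAC_extension \<iota>" shows "infinite (UNIV :: 'k set)"
proof
  assume fin: "finite (UNIV :: 'k set)"
  interpret S: subring_set "polys_in {..<1::nat} :: 'k mpoly set" by (rule polys_in_subring)
  interpret i: rhom "id :: 'k \<Rightarrow> 'k" by (rule rhom_id)
  interpret E: rhom "mpoly_eval (id :: 'k \<Rightarrow> 'k) x" for x by (rule i.mpoly_eval_rhom)
  define Q where "Q = (\<Prod>c\<in>(UNIV :: 'k set). mpoly_var 0 - mpoly_const c)"
  have ev: "mpoly_eval id x (mpoly_var 0 - mpoly_const c) = x 0 - c" for x and c :: 'k
    unfolding i.mpoly_eval_diff i.mpoly_eval_var i.mpoly_eval_const by simp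
  have "mpoly_var 0 - mpoly_const c \<noteq> 0" for c :: 'k
  proof
    assume z: "mpoly_var 0 - mpoly_const c = 0"
    have "mpoly_eval id (\<lambda>_. c + 1) (mpoly_var 0 - mpoly_const c) = 0" unfolding z by (rule E.hom_zero)
    then show False unfolding ev by simp
  qed
  then have Q0: "Q \<noteq> 0" unfolding Q_def using fin by simp
  have QP: "Q \<in> polys_in {..<1}" unfolding Q_def by (intro S.prod S.diff) auto
  have fib: "card {\<theta>' \<in> {0}. poly (map_poly to_ac (0 :: 'm poly)) \<theta>' = poly (map_poly to_ac (0 :: 'm poly)) \<theta>} = 1" for \<theta>
  proof -
    have "{\<theta>' \<in> {0}. poly (map_poly to_ac (0 :: 'm poly)) \<theta>' = poly (map_poly to_ac (0 :: 'm poly)) \<theta>} = {0}" by auto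
    then show ?thesis by simp
  qed
  have "\<exists>a xp zp. mpoly_eval id a Q \<noteq> 0 \<and>
    (\<forall>\<theta>\<in>{0}. poly (gen_monic 1 (\<lambda>j. to_ac (\<iota> (a j)))) (poly (map_poly to_ac xp) \<theta>) = poly (map_poly to_ac (0 :: 'm poly)) \<theta> \<and>
      poly (map_poly to_ac zp) (poly (map_poly to_ac xp) \<theta>) = \<theta>)"
    by (rule prescribed_fibres[OF PAC, where \<mu> = "[:0, 1:]"]) (use QP Q0 fib in \<open>simp_all add: map_poly_pCons\<close>)
  then obtain a where "mpoly_eval id a Q \<noteq> 0" by blast
  moreover have "mpoly_eval id a Q = (\<Prod>c\<in>UNIV. a 0 - c)" unfolding Q_def E.hom_prod ev ..
  moreover have "(\<Prod>c\<in>UNIV. a 0 - c) = 0" by (rule prod_zero[OF fin]) (auto intro: bexI[of _ "a 0"])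
  ultimately show False by simp
qed

theorem theorem1p7:
  fixes \<iota> :: "'k::field \<Rightarrow> 'm::field"
    and n s :: nat
    and f :: "nat \<Rightarrow> 'k poly"
    and \<omega> :: "nat \<Rightarrow> 'm alg_closure"
  assumes "n > 0"
    and "CHAR('k) = 2 \<Longrightarrow> odd n"
    and "\<And>i. i < s \<Longrightarrow> Factorial_Ring.irreducible (f i)"
    and "\<And>i. i < s \<Longrightarrow> separable_poly (f i)"
    and "\<And>i j. i < s \<Longrightarrow> j < s \<Longrightarrow> i \<noteq> j \<Longrightarrow> \<not> (\<exists>c. c \<noteq> 0 \<and> f i = smult c (f j))"
    and "\<And>i. i < s \<Longrightarrow> poly (map_poly (\<lambda>c. to_ac (\<iota> c)) (f i)) (\<omega> i) = 0"
    and "PAC_extension \<iota>"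
    and "\<And>i. i < s \<Longrightarrow> \<exists>E. separable_ext_of_degree n closure_ring (adjoin (\<omega> i)) E"
  shows "\<exists>S. zariski_dense n S \<and>
           (\<forall>a\<in>S. \<forall>i<s. Factorial_Ring.irreducible (pcompose (f i) (monic_poly n a)))"
proof -
  note irr = assms(3) and nonassoc = assms(5) and root = assms(6) and PAC = assms(7)
  have \<iota>: "rhom \<iota>" by (rule PAC_extension_rhom[OF PAC])
  define h where "h = (\<lambda>c. to_ac (\<iota> c))"
  have h: "rhom h" using rhom_comp[OF \<iota> rhom_to_ac] by (simp add: h_def o_def)
  interpret h: rhom h by (rule h)
  let ?M = "range (to_ac :: 'm \<Rightarrow> 'm alg_closure)"
  interpret M: ac_subfield ?M by (rule range_to_ac_subfield)
  have hM: "map_poly h p \<in> polys_over ?M" for p unfolding polys_over_def by (simp add: coeff_map_poly) (simp add: h_def)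
  have infK: "infinite (UNIV :: 'k set)" by (rule PAC_extension_infinite[OF PAC])
  have infM: "infinite ?M"
  proof -
    have "inj h" using rhom_inj[OF h] by (auto intro: injI)
    then have "infinite (range h)" using infK finite_imageD by blast
    moreover have "range h \<subseteq> ?M" by (auto simp: h_def)
    ultimately show ?thesis using finite_subset by blast
  qed
  have two: "n = 2 \<longrightarrow> (2::'m) \<noteq> 0"
  proof (intro impI notI)
    assume n2: "n = 2" and "(2::'m) = 0"
    then have "\<iota> (of_nat 2) = 0" unfolding rhom.hom_of_nat[OF \<iota>] by simp
    then have "of_nat 2 = (0::'k)" using rhom_eq_0_iff[OF \<iota>] by blast
    then have "CHAR('k) dvd 2" unfolding of_nat_eq_0_iff_char_dvd .
    then have "CHAR('k) = 2" using CHAR_not_1[where 'a='k] two_is_prime_nat unfolding prime_nat_iff by auto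
    then show False using assms(2) n2 by simp
  qed
  define Good where "Good = {a. \<forall>i<s. Factorial_Ring.irreducible (pcompose (f i) (monic_poly n a))}"
  have "\<exists>a\<in>Good. mpoly_eval id a q \<noteq> 0" if q: "q \<in> polys_in {..<n}" "q \<noteq> 0" for q
  proof (cases "s = 0")
    case True
    obtain a where "mpoly_eval id a q \<noteq> 0" using mpoly_nonvanishing_point[OF infK q] by blast
    then show ?thesis using True by (auto simp: Good_def)
  next
    case False
    have sepf: "sep_poly (map_poly h (f i))" if "i < s" for i
      using sep_poly_map_separable[OF h irr[OF that] assms(4)[OF that]] .
    have rooth: "poly (map_poly h (f i)) (\<omega> i) = 0" if "i < s" for i using root[OF that] by (simp add: h_def)
    have ex: "\<exists>\<mu> w \<theta>. M.covering_class n (\<omega> i) \<mu> w \<theta>" if i: "i < s" for i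
    proof -
      have om: "sep_elt ?M (\<omega> i)" unfolding sep_elt_def using sepf[OF i] rooth[OF i] hM by blast
      obtain E where E: "separable_ext_of_degree n closure_ring (adjoin (\<omega> i)) E" using assms(8)[OF i] by blast
      obtain \<theta> w where th: "sep_elt ?M \<theta>" "w \<in> polys_over ?M" "poly w \<theta> = \<omega> i" "degree (min_poly (simple_ext ?M (\<omega> i)) \<theta>) = n"
        using sep_ext_primitive[OF infM om E] by metis
      show ?thesis
        using M.covering_class_min_poly[OF th(1,2), of n] alg_closure_algebraic_elt th(3,4) by auto
    qed
    have dist: "\<exists>F\<in>polys_over ?M. poly F (\<omega> i) = 0 \<and> (\<exists>G\<in>polys_over ?M. poly G (\<omega> j) = 0 \<and> (\<forall>y. poly F y = 0 \<longrightarrow> poly G y \<noteq> 0))"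
      if ij: "i < s" "j < s" "i \<noteq> j" for i j
    proof -
      have "poly (map_poly h (f j)) y \<noteq> 0" if y: "poly (map_poly h (f i)) y = 0" for y
      proof
        assume y': "poly (map_poly h (f j)) y = 0"
        have "f i dvd f j" by (rule irreducible_dvd_if_common_root[OF h irr[OF ij(1)] y y'])
        then obtain c where c: "f j = f i * c" by (elim dvdE)
        have "\<not> f i dvd 1" using irr[OF ij(1)] by (simp add: Factorial_Ring.irreducible_def)
        then have "c dvd 1" using irr[OF ij(2)] c unfolding Factorial_Ring.irreducible_def by blast
        moreover have c0: "c \<noteq> 0" using c irr[OF ij(2)] by auto
        ultimately have "degree c = 0" using is_unit_iff_degree[OF c0] by simp
        then obtain k where k: "c = [:k:]" by (rule degree_eq_zeroE)
        have k0: "k \<noteq> 0" using k c0 by simp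
        then have "f j = smult k (f i)" using c k by (simp add: mult.commute)
        then show False using nonassoc[OF ij(2,1)] ij(3) k0 by blast
      qed
      then show ?thesis using hM rooth ij by blast
    qed
    obtain Th w \<theta> where Th: "finite Th" "(\<Prod>t\<in>Th. [:- t, 1:]) \<in> polys_over ?M" "w \<in> polys_over ?M"
      and fib: "\<And>t. t \<in> Th \<Longrightarrow> card {t' \<in> Th. poly w t' = poly w t} = n"
      and th: "\<And>i. i < s \<Longrightarrow> \<theta> i \<in> Th \<and> poly w (\<theta> i) = \<omega> i"
      and gal: "\<And>i r t. i < s \<Longrightarrow> r \<in> polys_over ?M \<Longrightarrow> poly r (\<theta> i) = 0 \<Longrightarrow> t \<in> Th \<Longrightarrow> poly w t = \<omega> i \<Longrightarrow> poly r t = 0"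
      by (rule M.common_covering[where s = s and n = n and \<omega> = \<omega>, OF infM ex dist]) (assumption | rule that)+
    obtain \<mu>' where mu': "map_poly to_ac \<mu>' = (\<Prod>t\<in>Th. [:- t, 1:])" by (rule polys_over_range_to_ac[OF Th(2)])
    obtain w' where w': "map_poly to_ac w' = w" by (rule polys_over_range_to_ac[OF Th(3)])
    have Th0: "Th \<noteq> {}" using th[of 0] False by auto
    have "\<exists>a xp zp. mpoly_eval id a q \<noteq> 0 \<and>
      (\<forall>t\<in>Th. poly (gen_monic n (\<lambda>j. to_ac (\<iota> (a j)))) (poly (map_poly to_ac xp) t) = poly (map_poly to_ac w') t \<and>
        poly (map_poly to_ac zp) (poly (map_poly to_ac xp) t) = t)"
      by (rule prescribed_fibres[OF PAC assms(1) two Th(1) Th0 mu' _ q]) (use fib in \<open>simp add: w'\<close>)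
    then obtain a xp zp where a: "mpoly_eval id a q \<noteq> 0"
      and ax: "\<And>t. t \<in> Th \<Longrightarrow> poly (gen_monic n (\<lambda>j. to_ac (\<iota> (a j)))) (poly (map_poly to_ac xp) t) = poly w t"
        "\<And>t. t \<in> Th \<Longrightarrow> poly (map_poly to_ac zp) (poly (map_poly to_ac xp) t) = t"
      unfolding w' by blast
    define Xp where "Xp = map_poly to_ac xp"
    have XM: "Xp \<in> polys_over ?M" by (auto simp: Xp_def polys_over_def coeff_map_poly)
    have "Factorial_Ring.irreducible (pcompose (f i) (monic_poly n a))" if i: "i < s" for i
    proof -
      define t where "t = poly Xp (\<theta> i)"
      have gt: "poly (map_poly h (gen_monic n a)) t = \<omega> i"
        unfolding map_poly_gen_monic[OF h] t_def Xp_def using ax(1)[of "\<theta> i"] th[OF i] by (simp add: h_def)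
      show ?thesis unfolding monic_poly_eq
      proof (rule irreducible_pcompose[OF h irr[OF i] degree_gen_monic assms(1)])
        show "poly (map_poly h (f i)) (poly (map_poly h (gen_monic n a)) t) = 0" unfolding gt by (rule rooth[OF i])
        fix r l assume r: "(\<Sum>l<n. poly (map_poly h (r l)) (poly (map_poly h (gen_monic n a)) t) * t ^ l) = 0" and l: "l < n"
        define c where "c = (\<lambda>l. poly (map_poly h (r l)) (\<omega> i))"
        define D where "D = (\<Sum>l<n. monom (c l) l)"
        have polyD: "poly D y = (\<Sum>l<n. c l * y ^ l)" for y unfolding D_def by (simp add: poly_sum poly_monom)
        have cD: "coeff D l = (if l < n then c l else 0)" for l by (simp add: D_def coeff_sum)
        \<comment> \<open>the relation between the powers of \<open>t\<close> holds at the whole fibre over \<open>\<omega> i\<close>, where \<open>Xp\<close> takes \<open>n\<close> different values\<close>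
        define Rp where "Rp = (\<Sum>l<n. pcompose (map_poly h (r l)) w * Xp ^ l)"
        have RM: "Rp \<in> polys_over ?M" unfolding Rp_def
          by (intro M.P.sum M.P.mult M.P.power M.pcompose_polys_over hM Th(3) XM)
        have Rev: "poly Rp y = poly D (poly Xp y)" if "poly w y = \<omega> i" for y
          unfolding Rp_def polyD c_def by (simp add: poly_sum poly_pcompose that)
        have "poly D t = 0" using r unfolding gt polyD c_def .
        then have "poly Rp (\<theta> i) = 0" using Rev[of "\<theta> i"] th[OF i] by (simp add: t_def)
        then have van: "poly D (poly Xp y) = 0" if "y \<in> Th" "poly w y = \<omega> i" for y
          using gal[OF i RM _ that] Rev[OF that(2)] by simp
        define A where "A = {y \<in> Th. poly w y = \<omega> i}"
        have "card A = n" using fib[of "\<theta> i"] th[OF i] by (simp add: A_def)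
        moreover have "inj_on (poly Xp) A"
        proof (rule inj_onI)
          fix x y assume xy: "x \<in> A" "y \<in> A" "poly Xp x = poly Xp y"
          have "x = poly (map_poly to_ac zp) (poly Xp x)" using ax(2)[of x] xy(1) by (simp add: A_def Xp_def)
          also have "\<dots> = poly (map_poly to_ac zp) (poly Xp y)" by (simp only: xy(3))
          also have "\<dots> = y" using ax(2)[of y] xy(2) by (simp add: A_def Xp_def)
          finally show "x = y" .
        qed
        ultimately have cX: "card (poly Xp ` A) = n" by (simp add: card_image)
        have "D = 0"
        proof (rule ccontr)
          assume D0: "D \<noteq> 0"
          have "card (poly Xp ` A) \<le> card {y. poly D y = 0}"
            using van by (intro card_mono poly_roots_finite[OF D0]) (auto simp: A_def)
          also have "\<dots> \<le> degree D" by (rule card_poly_roots_bound[OF D0])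
          finally have "coeff D (degree D) = 0" using cX cD by simp
          then show False using D0 leading_coeff_0_iff by blast
        qed
        then show "poly (map_poly h (r l)) (poly (map_poly h (gen_monic n a)) t) = 0"
          using cD[of l] l unfolding gt c_def by simp
      qed
    qed
    then have "a \<in> Good" unfolding Good_def by blast
    with a show ?thesis by (rule rev_bexI[rotated])
  qed
  then have "zariski_dense n Good" unfolding zariski_dense_def mpoly_ring_simps by blast
  moreover have "\<forall>a\<in>Good. \<forall>i<s. Factorial_Ring.irreducible (pcompose (f i) (monic_poly n a))" unfolding Good_def by blast
  ultimately show ?thesis by blast
qed

end
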